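(* Let $C$ be a compact Riemann surface of genus $g\ge 2$, uniformised by a Fuchsian surface group $\Gamma<PSL_2(\mathbb{R})$, let $\mathcal{H}_\Gamma$ be the associated solenoid and $\overline{\mathrm{Comm}(\Gamma)}$ the Belyaev completion of the commensurator of $\Gamma$. Regarding both $\overline{\mathrm{Comm}(\Gamma)}$ and $\mathrm{Aut}(\mathcal{H}_\Gamma)$ as subgroups of $\mathrm{Symm}(\mathcal{B}^* )$ (the latter through the faithful permutation representation $j$ described in the context), one has $$\overline{\mathrm{Comm}(\Gamma)}=\mathrm{Aut}(\mathcal{H}_\Gamma).$$
   Context: A Fuchsian surface group is a torsion-free cocompact discrete subgroup $\Gamma<PSL_2(\mathbb{R})$; it uniformises $C$ if $C\cong\mathbb{H}/\Gamma$, where $\mathbb{H}$ is the upper half plane. Two subgroups are commensurable if their intersection has finite index in both. $\mathrm{Comm}(\Gamma)=\{\alpha\in PSL_2(\mathbb{R}): \alpha\Gamma\alpha^{-1}\text{ and }\Gamma\text{ are commensurable}\}$. $\Gamma_n$ denotes the intersection of all subgroups of $\Gamma$ of index $\le n$; $\widehat\Gamma=\varprojlim_n \Gamma/\Gamma_n$ is the profinite completion and $\widehat\Gamma_n$ is the closure of $\Gamma_n$ in $\widehat\Gamma$ (the profinite completion of $\Gamma_n$). Solenoid: $\mathcal{H}_\Gamma=\varprojlim_n \mathbb{H}/\Gamma_n$ with the inverse limit topology. It is identified with the quotient $\mathbb{H}\times_\Gamma\widehat\Gamma$ of $\mathbb{H}\times\widehat\Gamma$ by the action $\gamma(z,\tau)=(\gamma(z),\tau\gamma^{-1})$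 of $\Gamma$, via $[z,\tau]\leftrightarrow(\tau_n(z)\in\mathbb{H}/\Gamma_n)_n$. Locally it is a product $D\times T$ with $D\subset\mathbb{H}$ a disc and $T$ a coset of some $\widehat\Gamma_m$; continuous functions or maps are holomorphic if they are holomorphic in the variable $z$. $\mathrm{Aut}(\mathcal{H}_\Gamma)$ is the group of holomorphic bijections of $\mathcal{H}_\Gamma$. It contains $\widehat\Gamma$, acting by $\tau([z,\tau'])=[z,\tau\tau']$, and $\mathrm{Comm}(\Gamma)$, where $\alpha\in\mathrm{Comm}(\Gamma)$ acts as follows: choose a finite index subgroup $K<\Gamma$ with $\alpha K\alpha^{-1}<\Gamma$, write $\tau=\tau'\gamma$ with $\tau'\in\widehat K$, $\gamma\in\Gamma$, so $[z,\tau]=[\gamma z,\tau']$, and set $\alpha[z,\tau]=[\alpha\gamma z,\alpha\tau'\alpha^{-1}]$. Belyaev completion: let $\mathcal{B}$ be the set of cosets $xK$ with $x\in\mathrm{Comm}(\Gamma)$ and $K<\mathrm{Comm}(\Gamma)$ commensurable with $\Gamma$. $\mathrm{Symm}(\mathcal{B})$ is the group of permutations of $\mathcal{B}$ with the topology of pointwise convergence ($\mathcal{B}$ discrete). Left multiplication gives an embedding $\mathrm{Comm}(\Gamma)\hookrightarrow\mathrm{Symm}(\mathcal{B})$, and $\overline{\mathrm{Comm}(\Gamma)}$ is the closure of its image. Let $\mathcal{B}^*=\{x\Gamma_n: x\in\mathrm{Comm}(\Gamma),n\in\mathbb{N}\}\subset\mathcal{B}$. Through its action on $\mathcal{B}^*$,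 $\overline{\mathrm{Comm}(\Gamma)}$ is regarded as a subgroup of $\mathrm{Symm}(\mathcal{B}^* )$, namely the closure of $\mathrm{Comm}(\Gamma)$ (acting by left multiplication) in $\mathrm{Symm}(\mathcal{B}^* )$. The representation $j$: the maps $x\Gamma_n\mapsto x\widehat\Gamma_n$ give bijections $\mathrm{Comm}(\Gamma)/\Gamma_n\to\mathrm{Aut}(\mathcal{H}_\Gamma)/\widehat\Gamma_n$, hence a bijection of $\mathcal{B}^*$ with $\{F\widehat\Gamma_n: F\in\mathrm{Aut}(\mathcal{H}_\Gamma),n\in\mathbb{N}\}$; transferring the left multiplication action of $\mathrm{Aut}(\mathcal{H}_\Gamma)$ on the latter set to $\mathcal{B}^*$ gives the injective homomorphism $j:\mathrm{Aut}(\mathcal{H}_\Gamma)\hookrightarrow\mathrm{Symm}(\mathcal{B}^* )$. *)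

theory Defs
  imports
    "HOL-Analysis.Analysis"
    "HOL-Algebra.Group_Action"
    "HOL-Homology.Homology"
begin

definition quotient_topology :: "'a topology \<Rightarrow> ('a \<Rightarrow> 'b) \<Rightarrow> 'b topology" where
  "quotient_topology X f =
     topology (\<lambda>U. U \<subseteq> f ` topspace X \<and> openin X {x \<in> topspace X. f x \<in> U})"

lemma openin_quotient_topology:
  "openin (quotient_topology X f) U \<longleftrightarrow>
     U \<subseteq> f ` topspace X \<and> openin X {x \<in> topspace X. f x \<in> U}"
proof -
  have "istopology (\<lambda>U. U \<subseteq> f ` topspace X \<and> openin X {x \<in> topspace X. f x \<in> U})"
    unfolding istopology_def
  proof (intro conjI allI impI)
    fix S T
    assume S: "S \<subseteq> f ` topspace X \<and> openin X {x \<in> topspace X. f x \<in> S}"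
      and T: "T \<subseteq> f ` topspace X \<and> openin X {x \<in> topspace X. f x \<in> T}"
    have "{x \<in> topspace X. f x \<in> S \<inter> T} =
        {x \<in> topspace X. f x \<in> S} \<inter> {x \<in> topspace X. f x \<in> T}" by auto
    then show "openin X {x \<in> topspace X. f x \<in> S \<inter> T}" using S T by auto
    show "S \<inter> T \<subseteq> f ` topspace X" using S by auto
  next
    fix K
    assume K: "\<forall>S\<in>K. S \<subseteq> f ` topspace X \<and> openin X {x \<in> topspace X. f x \<in> S}"
    have "{x \<in> topspace X. f x \<in> \<Union>K} = (\<Union>S\<in>K. {x \<in> topspace X. f x \<in> S})" by auto
    then show "openin X {x \<in> topspace X. f x \<in> \<Union>K}" using K by auto
    show "\<Union>K \<subseteq> f ` topspace X" using K by auto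
  qed
  then show ?thesis by (simp add: quotient_topology_def)
qed

lemma topspace_quotient_topology [simp]:
  "topspace (quotient_topology X f) = f ` topspace X"
proof
  show "topspace (quotient_topology X f) \<subseteq> f ` topspace X"
    using openin_topspace[of "quotient_topology X f"] unfolding openin_quotient_topology by simp
  have "{x \<in> topspace X. f x \<in> f ` topspace X} = topspace X" by auto
  then have "openin (quotient_topology X f) (f ` topspace X)"
    unfolding openin_quotient_topology by simp
  then show "f ` topspace X \<subseteq> topspace (quotient_topology X f)"
    by (rule openin_subset)
qed

lemma quotient_map_quotient_topology: "quotient_map X (quotient_topology X f) f"
  unfolding quotient_map_def openin_quotient_topology topspace_quotient_topology by blast

type_synonym 'a atlas = "('a set \<times> ('a \<Rightarrow> complex)) set"

definition riemann_surface :: "'a topology \<Rightarrow> 'a atlas \<Rightarrow> bool" where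
  "riemann_surface X A \<longleftrightarrow>
     Hausdorff_space X \<and> connected_space X \<and> second_countable X \<and>
     (\<Union>(U, \<phi>) \<in> A. U) = topspace X \<and>
     (\<forall>(U, \<phi>) \<in> A. openin X U \<and> open (\<phi> ` U) \<and>
        homeomorphic_map (subtopology X U) (top_of_set (\<phi> ` U)) \<phi>) \<and>
     (\<forall>(U, \<phi>) \<in> A. \<forall>(V, \<psi>) \<in> A. (\<psi> \<circ> inv_into U \<phi>) holomorphic_on \<phi> ` (U \<inter> V))"

definition holomorphic_map_between ::
    "'a topology \<Rightarrow> 'a atlas \<Rightarrow> 'b topology \<Rightarrow> 'b atlas \<Rightarrow> ('a \<Rightarrow> 'b) \<Rightarrow> bool" where
  "holomorphic_map_between X A Y B f \<longleftrightarrow>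
     continuous_map X Y f \<and>
     (\<forall>(U, \<phi>) \<in> A. \<forall>(V, \<psi>) \<in> B.
        (\<psi> \<circ> f \<circ> inv_into U \<phi>) holomorphic_on \<phi> ` {x \<in> U. f x \<in> V})"

definition biholomorphic ::
    "'a topology \<Rightarrow> 'a atlas \<Rightarrow> 'b topology \<Rightarrow> 'b atlas \<Rightarrow> bool" where
  "biholomorphic X A Y B \<longleftrightarrow>
     (\<exists>f f'. holomorphic_map_between X A Y B f \<and> holomorphic_map_between Y B X A f' \<and>
        (\<forall>x \<in> topspace X. f' (f x) = x) \<and> (\<forall>y \<in> topspace Y. f (f' y) = y))"

text \<open>The genus of a compact surface is half the rank of its first integral homology group.\<close>

definition has_genus :: "'a topology \<Rightarrow> nat \<Rightarrow> bool" where
  "has_genus X g \<longleftrightarrow> homology_group 1 X \<cong> free_Abelian_group {..<2 * g}"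

definition SL2R :: "(real^2^2) monoid" where
  "SL2R = \<lparr>carrier = {A. det A = 1}, mult = (**), one = mat 1\<rparr>"

definition PSL2R :: "(real^2^2) set monoid" where
  "PSL2R = SL2R Mod {mat 1, - mat 1}"

definition PSL2R_topology :: "(real^2^2) set topology" where
  "PSL2R_topology =
     quotient_topology (top_of_set (carrier SL2R)) (\<lambda>A. {mat 1, - mat 1} #>\<^bsub>SL2R\<^esub> A)"

definition upper_half_plane :: "complex set" where
  "upper_half_plane = {z. 0 < Im z}"

definition SL2_moebius :: "real^2^2 \<Rightarrow> complex \<Rightarrow> complex" where
  "SL2_moebius A =
     moebius (of_real (A$1$1)) (of_real (A$1$2)) (of_real (A$2$1)) (of_real (A$2$2))"

text \<open>The value does not depend on the representative; see \<open>PSL2R_act_eq\<close> below.\<close>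

definition PSL2R_act :: "(real^2^2) set \<Rightarrow> complex \<Rightarrow> complex" where
  "PSL2R_act \<alpha> = (\<lambda>z \<in> upper_half_plane. SL2_moebius (SOME A. A \<in> \<alpha>) z)"

lemma group_SL2R: "group SL2R"
proof (rule groupI)
  fix A assume A: "A \<in> carrier SL2R"
  then have "invertible A" by (simp add: SL2R_def invertible_det_nz)
  then obtain B where B: "B ** A = mat 1" unfolding invertible_def by blast
  have "det B * det A = det (B ** A)" by (rule det_mul[symmetric])
  then have "det B = 1" using A by (simp add: B SL2R_def)
  then have "B \<in> carrier SL2R" by (simp add: SL2R_def)
  moreover have "B \<otimes>\<^bsub>SL2R\<^esub> A = \<one>\<^bsub>SL2R\<^esub>" by (simp add: B SL2R_def)
  ultimately show "\<exists>B\<in>carrier SL2R. B \<otimes>\<^bsub>SL2R\<^esub> A = \<one>\<^bsub>SL2R\<^esub>" by blast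
qed (simp_all add: SL2R_def det_mul matrix_mul_assoc)

lemma uminus_matrix_mult:
  fixes A B :: "real^2^2"
  shows "(- A) ** B = - (A ** B)" "A ** (- B) = - (A ** B)"
  by (simp_all add: matrix_matrix_mult_def vec_eq_iff sum_negf)

lemma det_uminus_2: "det (- A :: real^2^2) = det A"
  by (simp add: det_2)

lemma normal_SL2R: "{mat 1, - mat 1} \<lhd> SL2R"
proof -
  interpret group SL2R by (rule group_SL2R)
  have inv: "inv\<^bsub>SL2R\<^esub> (- mat 1) = - mat 1"
    by (rule inv_equality) (auto simp: SL2R_def uminus_matrix_mult det_uminus_2)
  have inv1: "inv\<^bsub>SL2R\<^esub> (mat 1) = mat 1"
    using inv_one by (simp add: SL2R_def)
  have sub: "subgroup {mat 1, - mat 1} SL2R"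
  proof (rule subgroupI)
    fix a :: "real^2^2" assume "a \<in> {mat 1, - mat 1}"
    then show "inv\<^bsub>SL2R\<^esub> a \<in> {mat 1, - mat 1}" using inv inv1 by auto
  qed (auto simp: SL2R_def det_uminus_2 uminus_matrix_mult)
  show ?thesis
    by (rule normalI[OF sub]) (auto simp: r_coset_def l_coset_def SL2R_def uminus_matrix_mult)
qed

lemma group_PSL2R: "group PSL2R"
  unfolding PSL2R_def by (rule normal.factorgroup_is_group[OF normal_SL2R])

lemma carrier_PSL2R: "carrier PSL2R = {{A, - A} | A. det A = 1}"
  by (auto simp: PSL2R_def carrier_FactGroup r_coset_def SL2R_def uminus_matrix_mult)

lemma SL2_moebius_uminus: "SL2_moebius (- A) z = SL2_moebius A z"
proof -
  have "(- a * z + - b) / (- c * z + - d) = (a * z + b) / (c * z + d)" for a b c d :: complex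
    by (metis add_uminus_conv_diff minus_add_distrib minus_divide_divide mult_minus_left)
  then show ?thesis by (simp add: SL2_moebius_def moebius_def)
qed

lemma PSL2R_act_eq:
  assumes "\<alpha> \<in> carrier PSL2R" "A \<in> \<alpha>" "z \<in> upper_half_plane"
  shows "PSL2R_act \<alpha> z = SL2_moebius A z"
proof -
  obtain B where B: "\<alpha> = {B, - B}" using assms(1) by (auto simp: carrier_PSL2R)
  have "(SOME A. A \<in> \<alpha>) \<in> \<alpha>" using assms(2) by (rule someI)
  then show ?thesis
    using assms(2,3) B by (auto simp: PSL2R_act_def SL2_moebius_uminus)
qed

lemma SL2_denominator_nonzero:
  fixes A :: "real^2^2"
  assumes "det A = 1" "z \<in> upper_half_plane"
  shows "of_real (A$2$1) * z + of_real (A$2$2) \<noteq> (0::complex)"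
proof
  assume 0: "of_real (A$2$1) * z + of_real (A$2$2) = (0::complex)"
  then have "Im (of_real (A$2$1) * z + of_real (A$2$2)) = 0" by simp
  with assms(2) have "A$2$1 = 0" by (auto simp: upper_half_plane_def)
  with 0 have "A$2$2 = 0" by simp
  with \<open>A$2$1 = 0\<close> assms(1) show False by (simp add: det_2)
qed

lemma SL2_moebius_upper_half_plane:
  assumes "det A = 1" "z \<in> upper_half_plane"
  shows "SL2_moebius A z \<in> upper_half_plane"
proof -
  let ?d = "of_real (A$2$1) * z + of_real (A$2$2) :: complex"
  have "Im (SL2_moebius A z) = (A$1$1 * A$2$2 - A$1$2 * A$2$1) * Im z / (cmod ?d)\<^sup>2"
    unfolding SL2_moebius_def moebius_def
    by (simp add: Im_divide cmod_power2 divide_simps) (simp add: algebra_simps)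
  also have "\<dots> > 0"
    using assms SL2_denominator_nonzero[OF assms] by (simp add: det_2 upper_half_plane_def)
  finally show ?thesis by (simp add: upper_half_plane_def)
qed

lemma SL2_moebius_mult:
  assumes "det A = 1" "det B = 1" "z \<in> upper_half_plane"
  shows "SL2_moebius (A ** B) z = SL2_moebius A (SL2_moebius B z)"
proof -
  let ?w = "SL2_moebius B z"
  have comp: "(a * ((p * z + q) / (r * z + s)) + b) / (c * ((p * z + q) / (r * z + s)) + d) =
      ((a * p + b * r) * z + (a * q + b * s)) / ((c * p + d * r) * z + (c * q + d * s))"
    if "r * z + s \<noteq> 0" for a b c d p q r s :: complex
  proof -
    have "a * ((p * z + q) / (r * z + s)) + b = ((a * p + b * r) * z + (a * q + b * s)) / (r * z + s)"
      "c * ((p * z + q) / (r * z + s)) + d = ((c * p + d * r) * z + (c * q + d * s)) / (r * z + s)"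
      using that by (simp_all add: field_simps)
    then show ?thesis using that by simp
  qed
  show ?thesis
    using comp[OF SL2_denominator_nonzero[OF assms(2,3)]]
    by (simp add: SL2_moebius_def moebius_def matrix_matrix_mult_def sum_2)
qed

lemma group_action_PSL2R: "group_action PSL2R upper_half_plane PSL2R_act"
proof -
  have closed: "PSL2R_act \<alpha> z \<in> upper_half_plane"
    if "\<alpha> \<in> carrier PSL2R" "z \<in> upper_half_plane" for \<alpha> z
  proof -
    obtain A where "A \<in> \<alpha>" "det A = 1" using \<open>\<alpha> \<in> carrier PSL2R\<close> by (auto simp: carrier_PSL2R)
    with that show ?thesis by (simp add: PSL2R_act_eq SL2_moebius_upper_half_plane)
  qed
  have mult: "PSL2R_act (\<alpha> \<otimes>\<^bsub>PSL2R\<^esub> \<beta>) z = PSL2R_act \<alpha> (PSL2R_act \<beta> z)"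
    if ab: "\<alpha> \<in> carrier PSL2R" "\<beta> \<in> carrier PSL2R" and z: "z \<in> upper_half_plane" for \<alpha> \<beta> z
  proof -
    obtain A B where A: "A \<in> \<alpha>" "det A = 1" and B: "B \<in> \<beta>" "det B = 1"
      using ab by (fastforce simp: carrier_PSL2R)
    have "A ** B \<in> \<alpha> \<otimes>\<^bsub>PSL2R\<^esub> \<beta>" using A B by (auto simp: PSL2R_def set_mult_def SL2R_def)
    moreover have "\<alpha> \<otimes>\<^bsub>PSL2R\<^esub> \<beta> \<in> carrier PSL2R"
      using ab group_PSL2R by (simp add: group.is_monoid monoid.m_closed)
    ultimately show ?thesis
      using A B ab z closed
      by (simp add: PSL2R_act_eq SL2_moebius_mult SL2_moebius_upper_half_plane)
  qed
  have one: "PSL2R_act \<one>\<^bsub>PSL2R\<^esub> z = z" if "z \<in> upper_half_plane" for z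
  proof -
    have "mat 1 \<in> \<one>\<^bsub>PSL2R\<^esub>" by (simp add: PSL2R_def)
    moreover have "\<one>\<^bsub>PSL2R\<^esub> \<in> carrier PSL2R"
      using group_PSL2R by (simp add: group.is_monoid)
    ultimately show ?thesis
      using that by (simp add: PSL2R_act_eq SL2_moebius_def moebius_def mat_def)
  qed
  have Bij: "PSL2R_act \<alpha> \<in> Bij upper_half_plane" if a: "\<alpha> \<in> carrier PSL2R" for \<alpha>
  proof -
    have inv: "inv\<^bsub>PSL2R\<^esub> \<alpha> \<in> carrier PSL2R" using a group_PSL2R by simp
    have "bij_betw (PSL2R_act \<alpha>) upper_half_plane upper_half_plane"
    proof (rule bij_betwI[where g = "PSL2R_act (inv\<^bsub>PSL2R\<^esub> \<alpha>)"])
      fix z assume z: "z \<in> upper_half_plane"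
      show "PSL2R_act (inv\<^bsub>PSL2R\<^esub> \<alpha>) (PSL2R_act \<alpha> z) = z"
        using mult[OF inv a z] one[OF z] group.l_inv[OF group_PSL2R a] by simp
      show "PSL2R_act \<alpha> (PSL2R_act (inv\<^bsub>PSL2R\<^esub> \<alpha>) z) = z"
        using mult[OF a inv z] one[OF z] group.r_inv[OF group_PSL2R a] by simp
    qed (use closed a inv in auto)
    then show ?thesis by (simp add: Bij_def PSL2R_act_def)
  qed
  have "PSL2R_act (\<alpha> \<otimes>\<^bsub>PSL2R\<^esub> \<beta>) = PSL2R_act \<alpha> \<otimes>\<^bsub>BijGroup upper_half_plane\<^esub> PSL2R_act \<beta>"
    if ab: "\<alpha> \<in> carrier PSL2R" "\<beta> \<in> carrier PSL2R" for \<alpha> \<beta>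
  proof
    fix z
    show "PSL2R_act (\<alpha> \<otimes>\<^bsub>PSL2R\<^esub> \<beta>) z =
        (PSL2R_act \<alpha> \<otimes>\<^bsub>BijGroup upper_half_plane\<^esub> PSL2R_act \<beta>) z"
    proof (cases "z \<in> upper_half_plane")
      case True
      then show ?thesis using mult[OF ab] Bij ab by (simp add: BijGroup_def compose_def)
    next
      case False
      then show ?thesis using Bij ab by (simp add: BijGroup_def compose_def PSL2R_act_def)
    qed
  qed
  then have "PSL2R_act \<in> hom PSL2R (BijGroup upper_half_plane)"
    using Bij by (intro homI) (auto simp: BijGroup_def)
  then show ?thesis
    by (simp add: group_action_def group_hom_def group_hom_axioms_def group_PSL2R group_BijGroup)
qed

abbreviation PSL2R_sub :: "(real^2^2) set set \<Rightarrow> (real^2^2) set monoid" where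
  "PSL2R_sub \<Gamma> \<equiv> PSL2R\<lparr>carrier := \<Gamma>\<rparr>"

definition PSL2R_orbit :: "(real^2^2) set set \<Rightarrow> complex \<Rightarrow> complex set" where
  "PSL2R_orbit \<Gamma> z = orbit (PSL2R_sub \<Gamma>) PSL2R_act z"

definition orbit_space :: "(real^2^2) set set \<Rightarrow> complex set topology" where
  "orbit_space \<Gamma> = quotient_topology (top_of_set upper_half_plane) (PSL2R_orbit \<Gamma>)"

text \<open>The charts are the local inverses of the projection from the upper half plane.\<close>

definition orbit_space_atlas :: "(real^2^2) set set \<Rightarrow> complex set atlas" where
  "orbit_space_atlas \<Gamma> =
     {(PSL2R_orbit \<Gamma> ` D, inv_into D (PSL2R_orbit \<Gamma>)) | D.
        open D \<and> D \<subseteq> upper_half_plane \<and> inj_on (PSL2R_orbit \<Gamma>) D}"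

definition fuchsian_surface_group :: "(real^2^2) set set \<Rightarrow> bool" where
  "fuchsian_surface_group \<Gamma> \<longleftrightarrow>
     subgroup \<Gamma> PSL2R \<and>
     (\<forall>\<gamma>\<in>\<Gamma>. \<gamma> \<noteq> \<one>\<^bsub>PSL2R\<^esub> \<longrightarrow> (\<forall>n::nat. 0 < n \<longrightarrow> \<gamma> [^]\<^bsub>PSL2R\<^esub> n \<noteq> \<one>\<^bsub>PSL2R\<^esub>)) \<and>
     subtopology PSL2R_topology \<Gamma> = discrete_topology \<Gamma> \<and>
     compact_space (orbit_space \<Gamma>)"

definition uniformises :: "(real^2^2) set set \<Rightarrow> 'c topology \<Rightarrow> 'c atlas \<Rightarrow> bool" where
  "uniformises \<Gamma> X A \<longleftrightarrow> biholomorphic X A (orbit_space \<Gamma>) (orbit_space_atlas \<Gamma>)"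

definition finite_index :: "('a, 'b) monoid_scheme \<Rightarrow> 'a set \<Rightarrow> 'a set \<Rightarrow> bool" where
  "finite_index G H K \<longleftrightarrow> finite (rcosets\<^bsub>G\<lparr>carrier := H\<rparr>\<^esub> K)"

definition commensurable :: "('a, 'b) monoid_scheme \<Rightarrow> 'a set \<Rightarrow> 'a set \<Rightarrow> bool" where
  "commensurable G H K \<longleftrightarrow> finite_index G H (H \<inter> K) \<and> finite_index G K (H \<inter> K)"

definition conj_subgroup :: "('a, 'b) monoid_scheme \<Rightarrow> 'a \<Rightarrow> 'a set \<Rightarrow> 'a set" where
  "conj_subgroup G x H = (\<lambda>h. x \<otimes>\<^bsub>G\<^esub> h \<otimes>\<^bsub>G\<^esub> inv\<^bsub>G\<^esub> x) ` H"

definition Comm :: "(real^2^2) set set \<Rightarrow> (real^2^2) set set" where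
  "Comm \<Gamma> = {\<alpha> \<in> carrier PSL2R. commensurable PSL2R (conj_subgroup PSL2R \<alpha> \<Gamma>) \<Gamma>}"

text \<open>
  \<open>low_index_core G n\<close> is the intersection of all subgroups of index at most \<open>n\<close>; the profinite
  completion is the inverse limit of the quotients by these subgroups, realised as a set
  of compatible sequences of cosets.
\<close>

definition low_index_core :: "('a, 'b) monoid_scheme \<Rightarrow> nat \<Rightarrow> 'a set" where
  "low_index_core G n =
     carrier G \<inter> \<Inter>{H. subgroup H G \<and> finite (rcosets\<^bsub>G\<^esub> H) \<and> card (rcosets\<^bsub>G\<^esub> H) \<le> n}"

definition profinite :: "('a, 'b) monoid_scheme \<Rightarrow> (nat \<Rightarrow> 'a set) monoid" where
  "profinite G =
     \<lparr>carrier = {\<tau>. (\<forall>n. \<tau> n \<in> carrier (G Mod low_index_core G n)) \<and>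
                   (\<forall>n m. m \<le> n \<longrightarrow> \<tau> m = \<tau> n <#>\<^bsub>G\<^esub> low_index_core G m)},
      mult = (\<lambda>\<sigma> \<tau> n. \<sigma> n \<otimes>\<^bsub>G Mod low_index_core G n\<^esub> \<tau> n),
      one = (\<lambda>n. \<one>\<^bsub>G Mod low_index_core G n\<^esub>)\<rparr>"

definition profinite_topology :: "('a, 'b) monoid_scheme \<Rightarrow> (nat \<Rightarrow> 'a set) topology" where
  "profinite_topology G =
     subtopology
       (product_topology (\<lambda>n. discrete_topology (carrier (G Mod low_index_core G n))) UNIV)
       (carrier (profinite G))"

definition profinite_embed :: "('a, 'b) monoid_scheme \<Rightarrow> 'a \<Rightarrow> nat \<Rightarrow> 'a set" where
  "profinite_embed G x = (\<lambda>n. low_index_core G n #>\<^bsub>G\<^esub> x)"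

definition profinite_closure :: "('a, 'b) monoid_scheme \<Rightarrow> 'a set \<Rightarrow> (nat \<Rightarrow> 'a set) set" where
  "profinite_closure G K = profinite_topology G closure_of (profinite_embed G ` K)"

abbreviation Gamma_n :: "(real^2^2) set set \<Rightarrow> nat \<Rightarrow> (real^2^2) set set" where
  "Gamma_n \<Gamma> n \<equiv> low_index_core (PSL2R_sub \<Gamma>) n"

abbreviation Gamma_hat :: "(real^2^2) set set \<Rightarrow> (nat \<Rightarrow> (real^2^2) set set) monoid" where
  "Gamma_hat \<Gamma> \<equiv> profinite (PSL2R_sub \<Gamma>)"

abbreviation hat :: "(real^2^2) set set \<Rightarrow> (real^2^2) set set \<Rightarrow> (nat \<Rightarrow> (real^2^2) set set) set"
  where "hat \<Gamma> K \<equiv> profinite_closure (PSL2R_sub \<Gamma>) K"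

type_synonym solenoid_point = "nat \<Rightarrow> complex set"

text \<open>The covering map from the orbit space of a subgroup of \<open>\<Gamma>\<close> to that of \<open>\<Gamma>\<close>, on orbits.\<close>

definition orbit_projection :: "(real^2^2) set set \<Rightarrow> complex set \<Rightarrow> complex set" where
  "orbit_projection \<Gamma> p = (\<Union>z\<in>p. PSL2R_orbit \<Gamma> z)"

definition solenoid :: "(real^2^2) set set \<Rightarrow> solenoid_point set" where
  "solenoid \<Gamma> =
     {p. (\<forall>n. p n \<in> topspace (orbit_space (Gamma_n \<Gamma> n))) \<and>
         (\<forall>n m. m \<le> n \<longrightarrow> p m = orbit_projection (Gamma_n \<Gamma> m) (p n))}"

definition solenoid_topology :: "(real^2^2) set set \<Rightarrow> solenoid_point topology" where
  "solenoid_topology \<Gamma> =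
     subtopology (product_topology (\<lambda>n. orbit_space (Gamma_n \<Gamma> n)) UNIV) (solenoid \<Gamma>)"

text \<open>
  The point \<open>[z, \<tau>]\<close>. Since \<open>\<tau> n\<close> is a coset of the normal subgroup \<open>Gamma_n \<Gamma> n\<close>, the set of all
  \<open>\<delta> z\<close> with \<open>\<delta>\<close> in \<open>\<tau> n\<close> is precisely one orbit of that subgroup.
\<close>

definition sol_point :: "complex \<Rightarrow> (nat \<Rightarrow> (real^2^2) set set) \<Rightarrow> solenoid_point" where
  "sol_point z \<tau> = (\<lambda>n. (\<lambda>\<delta>. PSL2R_act \<delta> z) ` \<tau> n)"

text \<open>A local product structure \<open>D \<times> T\<close>, with \<open>D\<close> a disc and \<open>T\<close> a coset of some \<open>hat \<Gamma> (Gamma_n \<Gamma> m)\<close>.\<close>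

definition sol_chart ::
    "(real^2^2) set set \<Rightarrow> complex set \<Rightarrow> (nat \<Rightarrow> (real^2^2) set set) set \<Rightarrow> bool" where
  "sol_chart \<Gamma> D T \<longleftrightarrow>
     (\<exists>c r. 0 < r \<and> D = ball c r) \<and> D \<subseteq> upper_half_plane \<and>
     (\<exists>\<tau> \<in> carrier (Gamma_hat \<Gamma>). \<exists>m. T = \<tau> <#\<^bsub>Gamma_hat \<Gamma>\<^esub> hat \<Gamma> (Gamma_n \<Gamma> m)) \<and>
     openin (solenoid_topology \<Gamma>) (case_prod sol_point ` (D \<times> T)) \<and>
     homeomorphic_map
       (prod_topology (top_of_set D) (subtopology (profinite_topology (PSL2R_sub \<Gamma>)) T))
       (subtopology (solenoid_topology \<Gamma>) (case_prod sol_point ` (D \<times> T)))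
       (case_prod sol_point)"

text \<open>Holomorphy in the variable \<open>z\<close>: read in product charts, the disc component of \<open>F [z, \<tau>]\<close> is a
  holomorphic function of \<open>z\<close> for each fixed \<open>\<tau>\<close>.\<close>

definition sol_holomorphic ::
    "(real^2^2) set set \<Rightarrow> (solenoid_point \<Rightarrow> solenoid_point) \<Rightarrow> bool" where
  "sol_holomorphic \<Gamma> F \<longleftrightarrow>
     continuous_map (solenoid_topology \<Gamma>) (solenoid_topology \<Gamma>) F \<and>
     (\<forall>D T D' T'. sol_chart \<Gamma> D T \<and> sol_chart \<Gamma> D' T' \<longrightarrow>
        (\<forall>\<tau>\<in>T. (\<lambda>z. fst (inv_into (D' \<times> T') (case_prod sol_point) (F (sol_point z \<tau>))))
           holomorphic_on {z \<in> D. F (sol_point z \<tau>) \<in> case_prod sol_point ` (D' \<times> T')}))"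

definition Aut_solenoid ::
    "(real^2^2) set set \<Rightarrow> (solenoid_point \<Rightarrow> solenoid_point) monoid" where
  "Aut_solenoid \<Gamma> =
     (BijGroup (solenoid \<Gamma>))\<lparr>carrier := {F \<in> Bij (solenoid \<Gamma>). sol_holomorphic \<Gamma> F}\<rparr>"

definition hat_act ::
    "(real^2^2) set set \<Rightarrow> (nat \<Rightarrow> (real^2^2) set set) \<Rightarrow> solenoid_point \<Rightarrow> solenoid_point" where
  "hat_act \<Gamma> \<tau> = (\<lambda>p \<in> solenoid \<Gamma>. THE q. \<exists>z \<tau>'. z \<in> upper_half_plane \<and>
     \<tau>' \<in> carrier (Gamma_hat \<Gamma>) \<and> p = sol_point z \<tau>' \<and>
     q = sol_point z (\<tau> \<otimes>\<^bsub>Gamma_hat \<Gamma>\<^esub> \<tau>'))"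

text \<open>
  For \<open>\<alpha> K \<alpha>\<^sup>-\<^sup>1 \<subseteq> \<Gamma>\<close> and \<open>\<tau>\<close> in \<open>hat \<Gamma> K\<close>, the element \<open>\<alpha> \<tau> \<alpha>\<^sup>-\<^sup>1\<close> is the value at \<open>\<tau>\<close> of the continuous
  extension of \<open>k \<mapsto> \<alpha> k \<alpha>\<^sup>-\<^sup>1\<close> from \<open>K\<close> to \<open>hat \<Gamma> K\<close>.
\<close>

definition hat_conj ::
    "(real^2^2) set set \<Rightarrow> (real^2^2) set set \<Rightarrow> (real^2^2) set \<Rightarrow>
     (nat \<Rightarrow> (real^2^2) set set) \<Rightarrow> (nat \<Rightarrow> (real^2^2) set set)" where
  "hat_conj \<Gamma> K \<alpha> \<tau> = (THE \<sigma>. \<exists>c.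
     continuous_map (subtopology (profinite_topology (PSL2R_sub \<Gamma>)) (hat \<Gamma> K))
       (profinite_topology (PSL2R_sub \<Gamma>)) c \<and>
     (\<forall>k\<in>K. c (profinite_embed (PSL2R_sub \<Gamma>) k) =
        profinite_embed (PSL2R_sub \<Gamma>) (\<alpha> \<otimes>\<^bsub>PSL2R\<^esub> k \<otimes>\<^bsub>PSL2R\<^esub> inv\<^bsub>PSL2R\<^esub> \<alpha>)) \<and>
     \<sigma> = c \<tau>)"

text \<open>The image of a point does not depend on the choice of \<open>K\<close> or of the representation
  \<open>[z, \<tau>' \<gamma>]\<close>, so all choices are admitted.\<close>

definition Comm_act ::
    "(real^2^2) set set \<Rightarrow> (real^2^2) set \<Rightarrow> solenoid_point \<Rightarrow> solenoid_point" where
  "Comm_act \<Gamma> \<alpha> = (\<lambda>p \<in> solenoid \<Gamma>. THE q. \<exists>K z \<tau>' \<gamma>.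
     subgroup K PSL2R \<and> K \<subseteq> \<Gamma> \<and> finite_index PSL2R \<Gamma> K \<and> conj_subgroup PSL2R \<alpha> K \<subseteq> \<Gamma> \<and>
     z \<in> upper_half_plane \<and> \<tau>' \<in> hat \<Gamma> K \<and> \<gamma> \<in> \<Gamma> \<and>
     p = sol_point z (\<tau>' \<otimes>\<^bsub>Gamma_hat \<Gamma>\<^esub> profinite_embed (PSL2R_sub \<Gamma>) \<gamma>) \<and>
     q = sol_point (PSL2R_act \<alpha> (PSL2R_act \<gamma> z)) (hat_conj \<Gamma> K \<alpha> \<tau>'))"

definition Symm_topology :: "'a set \<Rightarrow> ('a \<Rightarrow> 'a) topology" where
  "Symm_topology S =
     subtopology (product_topology (\<lambda>_. discrete_topology S) S) (carrier (BijGroup S))"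

definition Belyaev_cosets :: "(real^2^2) set set \<Rightarrow> (real^2^2) set set set" where
  "Belyaev_cosets \<Gamma> =
     {x <#\<^bsub>PSL2R\<^esub> K | x K. x \<in> Comm \<Gamma> \<and> subgroup K PSL2R \<and> K \<subseteq> Comm \<Gamma> \<and> commensurable PSL2R K \<Gamma>}"

definition Belyaev_completion ::
    "(real^2^2) set set \<Rightarrow> ((real^2^2) set set \<Rightarrow> (real^2^2) set set) set" where
  "Belyaev_completion \<Gamma> =
     Symm_topology (Belyaev_cosets \<Gamma>) closure_of
       ((\<lambda>x. \<lambda>b \<in> Belyaev_cosets \<Gamma>. x <#\<^bsub>PSL2R\<^esub> b) ` Comm \<Gamma>)"

definition Belyaev_star :: "(real^2^2) set set \<Rightarrow> (real^2^2) set set set" where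
  "Belyaev_star \<Gamma> = {x <#\<^bsub>PSL2R\<^esub> Gamma_n \<Gamma> n | x n. x \<in> Comm \<Gamma>}"

text \<open>The completion acts on the invariant subset \<open>Belyaev_star \<Gamma>\<close>; restricted to it, the completion is a
  set of permutations of that subset.\<close>

definition completion_on_star ::
    "(real^2^2) set set \<Rightarrow> ((real^2^2) set set \<Rightarrow> (real^2^2) set set) set" where
  "completion_on_star \<Gamma> = (\<lambda>f. restrict f (Belyaev_star \<Gamma>)) ` Belyaev_completion \<Gamma>"

definition star_coset_map ::
    "(real^2^2) set set \<Rightarrow> (real^2^2) set set \<Rightarrow> (solenoid_point \<Rightarrow> solenoid_point) set" where
  "star_coset_map \<Gamma> b = (THE c. \<exists>x n. x \<in> Comm \<Gamma> \<and> b = x <#\<^bsub>PSL2R\<^esub> Gamma_n \<Gamma> n \<and>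
     c = Comm_act \<Gamma> x <#\<^bsub>Aut_solenoid \<Gamma>\<^esub> (hat_act \<Gamma> ` hat \<Gamma> (Gamma_n \<Gamma> n)))"

definition j_rep ::
    "(real^2^2) set set \<Rightarrow> (solenoid_point \<Rightarrow> solenoid_point) \<Rightarrow>
     (real^2^2) set set \<Rightarrow> (real^2^2) set set" where
  "j_rep \<Gamma> F = (\<lambda>b \<in> Belyaev_star \<Gamma>.
     inv_into (Belyaev_star \<Gamma>) (star_coset_map \<Gamma>) (F <#\<^bsub>Aut_solenoid \<Gamma>\<^esub> star_coset_map \<Gamma> b))"

end

theory Submission
  imports Defs "HOL-Complex_Analysis.Conformal_Mappings"
begin

text \<open>
  Both sides turn out to be the set of the permutations
  \<open>x \<Gamma>\<^sub>n \<mapsto> a g x \<Gamma>\<^sub>n\<close>, where \<open>a\<close> is in the commensurator, \<open>\<tau>\<close> is in the profinite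
  completion, and \<open>g \<in> \<Gamma>\<close> is in a level \<open>\<tau>\<^sub>m\<close> that is deep enough for the coset at hand.

  For the Belyaev completion this is formal. A limit \<open>f\<close> of left multiplications is determined by
  elements \<open>a\<^sub>n\<close> with \<open>f \<Gamma>\<^sub>n = a\<^sub>n \<Gamma>\<^sub>n\<close>, and the quotients of the \<open>a\<^sub>n\<close> by \<open>a\<^sub>0\<close> form a coherent
  sequence in \<open>\<Gamma>\<close>, that is, an element of \<open>\<Gamma>hat\<close> (\<open>Belyaev_completion_eq\<close>). For the solenoid it
  amounts to the decomposition of every automorphism as a commensurator element times an element
  of \<open>\<Gamma>hat\<close> (\<open>Aut_solenoid_decompose\<close>). The commutation rule \<open>hat_act_Comm_act\<close>, by which elements of
  \<open>\<Gamma>hat\<close> near \<open>1\<close> pass across an element of the commensurator, then computes \<open>j\<close>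
  (\<open>j_rep_sol_aut\<close>).

  The decomposition is the geometric part. An automorphism \<open>F\<close> maps the leaf of the points
  \<open>[z, 1]\<close> to a leaf: lifting through the covering \<open>\<H> \<rightarrow> \<H> / \<Gamma>\<close> gives
  \<open>F [z, 1] = [\<alpha> z, \<sigma>]\<close>, with \<open>\<sigma>\<close> constant because \<open>\<H>\<close> is connected and \<open>\<Gamma>hat\<close> is totally
  disconnected (\<open>lift_to_HH\<close>). After composition with \<open>\<sigma>\<^sup>-\<^sup>1\<close> the base leaf is preserved. The inverse
  of \<open>F\<close> is continuous since the solenoid is compact and Hausdorff, and the same lifting
  applied to it shows that \<open>\<alpha>\<close> is a bijection. So \<open>\<alpha>\<close> is a holomorphic automorphism of \<open>\<H>\<close>, and by
  the Schwarz lemma it is given by some \<open>A\<close> in \<open>PSL\<^sub>2(\<real>)\<close>.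

  It remains to see that \<open>A\<close> is in the commensurator (\<open>rigidity\<close>). For \<open>s\<close> deep in \<open>\<Gamma>\<close> the points
  \<open>[z, 1]\<close> and \<open>[s z, 1]\<close> are uniformly close in the solenoid, hence so are their images, and
  \<open>h = A s A\<^sup>-\<^sup>1\<close> moves every point of \<open>\<H>\<close> by a small amount modulo \<open>\<Gamma>\<close>. The element \<open>\<gamma>\<close> of \<open>\<Gamma>\<close> for
  which \<open>\<gamma> h\<close> moves a given point by little is unique below the injectivity radius of \<open>\<H> / \<Gamma>\<close>, so it
  is locally constant, and by connectedness it is constant. Then \<open>\<gamma> h\<close> has bounded displacement on
  \<open>\<H>\<close>, which forces \<open>\<gamma> h = 1\<close> and \<open>h \<in> \<Gamma>\<close>. On the dense base leaf the corrected automorphism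
  now agrees with \<open>A\<close>, and so it agrees everywhere.

  The topological input is that \<open>\<Gamma>\<close> acts freely and properly discontinuously with compact quotient.
  This makes \<open>\<Gamma>\<close> finitely generated, so that each \<open>\<Gamma>\<^sub>n\<close> has finite index and the completion and the
  solenoid are compact.
\<close>


section \<open>Cosets and subgroups of low index\<close>

context group
begin

lemma l_inv_cancel: "x \<in> carrier G \<Longrightarrow> y \<in> carrier G \<Longrightarrow> inv x \<otimes> (x \<otimes> y) = y"
  by (simp add: m_assoc[symmetric])

lemma r_inv_cancel: "x \<in> carrier G \<Longrightarrow> y \<in> carrier G \<Longrightarrow> x \<otimes> (inv x \<otimes> y) = y"
  by (simp add: m_assoc[symmetric])

lemma mem_rcos_iff:
  assumes "subgroup H G" "a \<in> carrier G"
  shows "x \<in> H #> a \<longleftrightarrow> x \<in> carrier G \<and> x \<otimes> inv a \<in> H"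
proof -
  interpret H: subgroup H G by fact
  show ?thesis
  proof
    assume "x \<in> H #> a"
    then obtain h where h: "h \<in> H" "x = h \<otimes> a" by (auto simp: r_coset_def)
    then show "x \<in> carrier G \<and> x \<otimes> inv a \<in> H" using assms(2) by (simp add: m_assoc)
  next
    assume *: "x \<in> carrier G \<and> x \<otimes> inv a \<in> H"
    then have "x = (x \<otimes> inv a) \<otimes> a" using assms(2) by (simp add: m_assoc)
    then show "x \<in> H #> a" using * unfolding r_coset_def by blast
  qed
qed

lemma rcos_eq_iff:
  assumes "subgroup H G" "a \<in> carrier G" "b \<in> carrier G"
  shows "H #> a = H #> b \<longleftrightarrow> a \<otimes> inv b \<in> H"
proof
  assume "H #> a = H #> b"
  then show "a \<otimes> inv b \<in> H" using rcos_self[OF assms(2,1)] mem_rcos_iff[OF assms(1,3)] by blast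
next
  assume "a \<otimes> inv b \<in> H"
  then have "a \<in> H #> b" using mem_rcos_iff[OF assms(1,3)] assms(2) by blast
  then show "H #> a = H #> b" using repr_independence[OF _ assms(3,1)] by blast
qed

lemma rcosets_image: "rcosets H = (\<lambda>a. H #> a) ` carrier G"
  by (auto simp: RCOSETS_def)

text \<open>A function that separates the cosets of \<open>K\<close> and takes few values bounds the index. Allowing
  any function treats intersections, preimages under conjugation and towers of subgroups alike:
  each comes with a natural choice of \<open>f\<close>.\<close>

lemma low_index_criterion:
  assumes K: "subgroup K G" and fin: "finite (f ` carrier G)"
    and sep: "\<And>g h. g \<in> carrier G \<Longrightarrow> h \<in> carrier G \<Longrightarrow> f g = f h \<Longrightarrow> g \<otimes> inv h \<in> K"
  shows "finite (rcosets K) \<and> card (rcosets K) \<le> card (f ` carrier G)"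
proof -
  let ?r = "\<lambda>v. K #> inv_into (carrier G) f v"
  have "rcosets K \<subseteq> ?r ` f ` carrier G"
  proof
    fix C assume "C \<in> rcosets K"
    then obtain g where g: "g \<in> carrier G" "C = K #> g" by (auto simp: rcosets_image)
    let ?h = "inv_into (carrier G) f (f g)"
    have h: "?h \<in> carrier G" "f ?h = f g"
      using g by (auto intro: inv_into_into f_inv_into_f)
    then have "K #> g = ?r (f g)" using rcos_eq_iff[OF K g(1) h(1)] sep g by simp
    then show "C \<in> ?r ` f ` carrier G" using g by blast
  qed
  then show ?thesis using surj_card_le[OF fin] finite_surj[OF fin] by blast
qed

lemma low_index_core_eq: "low_index_core G n =
  \<Inter> (insert (carrier G) {H. subgroup H G \<and> finite (rcosets H) \<and> card (rcosets H) \<le> n})"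
  by (simp add: low_index_core_def)

lemma subgroup_low_index_core: "subgroup (low_index_core G n) G"
  unfolding low_index_core_eq by (rule subgroups_Inter) (auto simp: subgroup_self)

lemma low_index_core_le:
  "subgroup H G \<Longrightarrow> finite (rcosets H) \<Longrightarrow> card (rcosets H) \<le> n \<Longrightarrow> low_index_core G n \<subseteq> H"
  unfolding low_index_core_def by blast

lemma low_index_core_antimono: "m \<le> n \<Longrightarrow> low_index_core G n \<subseteq> low_index_core G m"
  unfolding low_index_core_def by fastforce

text \<open>No subgroup has index \<open>0\<close>, so the family that is intersected is empty.\<close>

lemma low_index_core_0: "low_index_core G 0 = carrier G"
proof -
  have "rcosets H \<noteq> {}" for H by (auto simp: rcosets_image)
  then show ?thesis unfolding low_index_core_def by (auto simp: card_eq_0_iff)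
qed

text \<open>Conjugating a subgroup does not raise its index, so the family that is intersected is stable
  under conjugation.\<close>

lemma normal_low_index_core: "low_index_core G n \<lhd> G"
proof (rule normal_invI[OF subgroup_low_index_core])
  fix x h assume x: "x \<in> carrier G" and h: "h \<in> low_index_core G n"
  have hc: "h \<in> carrier G" using h by (simp add: low_index_core_def)
  have "x \<otimes> h \<otimes> inv x \<in> H"
    if H: "subgroup H G" "finite (rcosets H)" "card (rcosets H) \<le> n" for H
  proof -
    interpret H: subgroup H G by fact
    let ?K = "{g \<in> carrier G. x \<otimes> g \<otimes> inv x \<in> H}"
    have comb: "x \<otimes> (g \<otimes> k) \<otimes> inv x = (x \<otimes> g \<otimes> inv x) \<otimes> (x \<otimes> k \<otimes> inv x)"
      if "g \<in> carrier G" "k \<in> carrier G" for g k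
      using x that by (simp add: m_assoc l_inv_cancel)
    have cinv: "x \<otimes> inv g \<otimes> inv x = inv (x \<otimes> g \<otimes> inv x)" if "g \<in> carrier G" for g
      using x that by (simp add: inv_mult_group m_assoc)
    have K: "subgroup ?K G"
      by (rule subgroupI) (use x in \<open>auto simp: comb cinv\<close>)
    let ?f = "\<lambda>g. H #> (x \<otimes> g)"
    have sub: "?f ` carrier G \<subseteq> rcosets H" using x by (auto simp: rcosets_image)
    have "finite (rcosets ?K) \<and> card (rcosets ?K) \<le> card (?f ` carrier G)"
    proof (rule low_index_criterion[OF K])
      show "finite (?f ` carrier G)" using sub H(2) finite_subset by blast
      fix g k assume gk: "g \<in> carrier G" "k \<in> carrier G" "?f g = ?f k"
      then have "x \<otimes> g \<otimes> inv (x \<otimes> k) \<in> H" using rcos_eq_iff[OF H(1)] x by simp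
      then show "g \<otimes> inv k \<in> ?K" using gk x by (simp add: inv_mult_group m_assoc)
    qed
    then have "finite (rcosets ?K)" "card (rcosets ?K) \<le> n"
      using card_mono[OF H(2) sub] H(3) by auto
    then show ?thesis using low_index_core_le[OF K] h by blast
  qed
  then show "x \<otimes> h \<otimes> inv x \<in> low_index_core G n"
    unfolding low_index_core_def using x hc by blast
qed

text \<open>A subgroup of index at most \<open>n\<close> is the stabiliser of a point in a permutation representation
  on \<open>n\<close> points, and such a representation is determined by the images of the generators.\<close>

lemma finite_low_index_subgroups:
  assumes S: "finite S" "S \<subseteq> carrier G" and gen: "carrier G = generate G S"
  shows "finite {H. subgroup H G \<and> finite (rcosets H) \<and> card (rcosets H) \<le> n}"
    (is "finite ?F")
proof -
  have "\<exists>e. inj_on e (rcosets H) \<and> e ` (rcosets H) \<subseteq> {..<n}" if H: "H \<in> ?F" for H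
  proof -
    obtain e where "bij_betw e (rcosets H) {..<card (rcosets H)}"
      using ex_bij_betw_finite_nat[of "rcosets H"] H by (auto simp: atLeast0LessThan)
    then have "inj_on e (rcosets H)" "e ` (rcosets H) = {..<card (rcosets H)}"
      by (auto simp: bij_betw_def)
    then show ?thesis using H by (intro exI[of _ e]) auto
  qed
  then have "\<exists>e. \<forall>H\<in>?F. inj_on (e H) (rcosets H) \<and> e H ` (rcosets H) \<subseteq> {..<n}"
    by (intro bchoice ballI)
  then obtain e where e: "\<And>H. H \<in> ?F \<Longrightarrow> inj_on (e H) (rcosets H)"
      "\<And>H. H \<in> ?F \<Longrightarrow> e H ` (rcosets H) \<subseteq> {..<n}" by blast
  define S' where "S' = S \<union> (\<lambda>s. inv s) ` S"
  \<comment> \<open>The label of the coset \<open>H\<close> and the transition graph of the generators on the labels. These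
    data have finitely many values and determine \<open>H\<close>, as the stabiliser of its own label.\<close>
  define d where "d H = (e H H, {(e H C, s, e H (C #> s)) | C s. C \<in> rcosets H \<and> s \<in> S'})" for H
  have S': "S' \<subseteq> carrier G" "finite S'" using S by (auto simp: S'_def)
  have Hin: "H \<in> rcosets H" if "H \<in> ?F" for H
  proof -
    have "H #> \<one> = H" using that by (auto intro!: coset_mult_one dest: subgroup.subset)
    then show ?thesis by (metis one_closed rcosets_image image_eqI)
  qed
  have tr: "C #> s \<in> rcosets H" if "H \<in> ?F" "C \<in> rcosets H" "s \<in> carrier G" for H C s
  proof -
    from that(2) obtain a where "a \<in> carrier G" "C = H #> a" by (auto simp: rcosets_image)
    moreover have "H \<subseteq> carrier G" using that(1) by (auto dest: subgroup.subset)
    ultimately show ?thesis using that(3) by (auto simp: coset_mult_assoc rcosets_image)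
  qed
  have Csub: "C \<subseteq> carrier G" if "H \<in> ?F" "C \<in> rcosets H" for H C
  proof -
    from that(2) obtain a where "a \<in> carrier G" "C = H #> a" by (auto simp: rcosets_image)
    moreover have "H \<subseteq> carrier G" using that(1) by (auto dest: subgroup.subset)
    ultimately show ?thesis using r_coset_subset_G by simp
  qed
  have "d ` ?F \<subseteq> {..<n} \<times> Pow ({..<n} \<times> S' \<times> {..<n})"
  proof
    fix y assume "y \<in> d ` ?F"
    then obtain H where H: "H \<in> ?F" "y = d H" by blast
    have "e H C < n" if "C \<in> rcosets H" for C using e(2)[OF H(1)] that by blast
    then show "y \<in> {..<n} \<times> Pow ({..<n} \<times> S' \<times> {..<n})"
      using Hin[OF H(1)] tr[OF H(1)] S' unfolding H(2) d_def by auto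
  qed
  then have fin: "finite (d ` ?F)" by (rule finite_subset) (use S' in auto)
  have "inj_on d ?F"
  proof (rule inj_onI)
    fix H H' assume H: "H \<in> ?F" "H' \<in> ?F" and eq: "d H = d H'"
    have step: "e H (C #> s) = e H' (C' #> s)"
      if "C \<in> rcosets H" "C' \<in> rcosets H'" "e H C = e H' C'" "s \<in> S'" for C C' s
    proof -
      have "(e H C, s, e H (C #> s)) \<in> snd (d H)"
        unfolding d_def snd_conv using that by blast
      then have "(e H C, s, e H (C #> s)) \<in> snd (d H')" by (simp add: eq)
      then obtain C'' where C'': "C'' \<in> rcosets H'" "e H C = e H' C''" "e H (C #> s) = e H' (C'' #> s)"
        by (auto simp: d_def)
      then have "C'' = C'" using e(1)[OF H(2)] that unfolding inj_on_def by metis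
      then show ?thesis using C'' by simp
    qed
    have "\<forall>C C'. C \<in> rcosets H \<longrightarrow> C' \<in> rcosets H' \<longrightarrow> e H C = e H' C' \<longrightarrow> e H (C #> g) = e H' (C' #> g)"
      if "g \<in> generate G S" for g
      using that
    proof (induction rule: generate.induct)
      case one
      then show ?case using Csub[OF H(1)] Csub[OF H(2)] by (simp add: coset_mult_one)
    next
      case (incl h) then show ?case using step by (auto simp: S'_def)
    next
      case (inv h) then show ?case using step by (auto simp: S'_def)
    next
      case (eng h1 h2)
      have h: "h1 \<in> carrier G" "h2 \<in> carrier G" using eng gen by auto
      show ?case
      proof (intro allI impI)
        fix C C' assume C: "C \<in> rcosets H" "C' \<in> rcosets H'" "e H C = e H' C'"
        have "C #> (h1 \<otimes> h2) = (C #> h1) #> h2" "C' #> (h1 \<otimes> h2) = (C' #> h1) #> h2"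
          using coset_mult_assoc Csub[OF H(1) C(1)] Csub[OF H(2) C(2)] h by auto
        then show "e H (C #> (h1 \<otimes> h2)) = e H' (C' #> (h1 \<otimes> h2))"
          using eng.IH C tr[OF H(1)] tr[OF H(2)] h by simp
      qed
    qed
    then have lab: "e H (H #> g) = e H' (H' #> g)" if "g \<in> carrier G" for g
      using that Hin H eq gen by (simp add: d_def)
    \<comment> \<open>An element is in \<open>H\<close> just when it fixes the label of \<open>H\<close>.\<close>
    have stab: "(g \<in> K) = (e K (K #> g) = e K K)" if "K \<in> ?F" "g \<in> carrier G" for K g
    proof -
      have K: "subgroup K G" using that(1) by simp
      have "K #> \<one> = K" by (rule coset_mult_one[OF subgroup.subset[OF K]])
      then have "(g \<in> K) = (K #> g = K)" using rcos_eq_iff[OF K that(2) one_closed] that(2) by simp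
      then show ?thesis
        using inj_on_eq_iff[OF e(1)[OF that(1)] tr[OF that(1) Hin[OF that(1)] that(2)] Hin[OF that(1)]]
        by simp
    qed
    have "e H H = e H' H'" using eq by (simp add: d_def)
    then have *: "(g \<in> H) = (g \<in> H')" if "g \<in> carrier G" for g
      using stab[OF H(1) that] stab[OF H(2) that] lab[OF that] by simp
    moreover have "H \<subseteq> carrier G" "H' \<subseteq> carrier G" using H by (auto dest: subgroup.subset)
    ultimately show "H = H'" by blast
  qed
  with fin show ?thesis by (rule finite_imageD)
qed

lemma finite_index_low_index_core:
  assumes S: "finite S" "S \<subseteq> carrier G" "carrier G = generate G S"
  shows "finite (rcosets (low_index_core G n))"
proof -
  define F where "F = {H. subgroup H G \<and> finite (rcosets H) \<and> card (rcosets H) \<le> n}"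
  have F: "finite F" unfolding F_def by (rule finite_low_index_subgroups[OF S])
  define f where "f g = (\<lambda>H\<in>F. H #> g)" for g
  have "f ` carrier G \<subseteq> Pi\<^sub>E F (\<lambda>H. rcosets H)" by (auto simp: f_def rcosets_image)
  moreover have "finite (Pi\<^sub>E F (\<lambda>H. rcosets H))" by (rule finite_PiE[OF F]) (simp add: F_def)
  ultimately have fin: "finite (f ` carrier G)" using finite_subset by blast
  have "g \<otimes> inv h \<in> low_index_core G n"
    if gh: "g \<in> carrier G" "h \<in> carrier G" "f g = f h" for g h
  proof -
    have "g \<otimes> inv h \<in> H" if "H \<in> F" for H
    proof -
      have "H #> g = H #> h" using gh(3) that unfolding f_def by (metis restrict_apply')
      then show ?thesis using rcos_eq_iff gh that by (simp add: F_def)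
    qed
    then show ?thesis using gh by (auto simp: low_index_core_def F_def)
  qed
  then show ?thesis using low_index_criterion[OF subgroup_low_index_core fin] by blast
qed

end

section \<open>The profinite completion and commensurating elements\<close>

text \<open>A subgroup \<open>\<Gamma>\<close> is kept inside a larger group \<open>G\<close>, because elements of \<open>G\<close> act by conjugation
  on the topology that the subgroups of finite index define on \<open>\<Gamma>\<close>. The finiteness assumption
  makes the sets \<open>core n\<close> cofinal among these subgroups and the completion compact.\<close>

locale finite_core_subgroup = group G for G (structure) +
  fixes \<Gamma> :: "'a set"
  assumes sub: "subgroup \<Gamma> G"
    and fin: "\<And>n. finite (rcosets\<^bsub>G\<lparr>carrier := \<Gamma>\<rparr>\<^esub> (low_index_core (G\<lparr>carrier := \<Gamma>\<rparr>) n))"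
begin

abbreviation "\<Delta> \<equiv> G\<lparr>carrier := \<Gamma>\<rparr>"
abbreviation "core n \<equiv> low_index_core \<Delta> n"
abbreviation "\<Gamma>hat \<equiv> carrier (profinite \<Delta>)"
abbreviation pmult (infixl "\<star>" 70) where "\<sigma> \<star> \<tau> \<equiv> \<sigma> \<otimes>\<^bsub>profinite \<Delta>\<^esub> \<tau>"
abbreviation "emb \<equiv> profinite_embed \<Delta>"
abbreviation "PT \<equiv> profinite_topology \<Delta>"

lemma group_sub: "group \<Delta>"
  by (rule subgroup_imp_group[OF sub])

lemma r_coset_sub [simp]: "H #>\<^bsub>\<Delta>\<^esub> a = H #> a"
  by (simp add: r_coset_def)

lemma set_mult_sub [simp]: "A <#>\<^bsub>\<Delta>\<^esub> B = A <#> B"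
  by (simp add: set_mult_def)

lemma inv_sub [simp]: "x \<in> \<Gamma> \<Longrightarrow> inv\<^bsub>\<Delta>\<^esub> x = inv x"
  by (rule m_inv_consistent[OF sub])

lemma sub_carrier [simp]: "x \<in> \<Gamma> \<Longrightarrow> x \<in> carrier G"
  using subgroup.mem_carrier[OF sub] .

lemma sub_closed [simp]: "\<one> \<in> \<Gamma>" "x \<in> \<Gamma> \<Longrightarrow> inv x \<in> \<Gamma>" "x \<in> \<Gamma> \<Longrightarrow> y \<in> \<Gamma> \<Longrightarrow> x \<otimes> y \<in> \<Gamma>"
  using sub by (auto simp: subgroup.one_closed subgroup.m_inv_closed subgroup.m_closed)

lemma core_sub: "subgroup (core n) \<Delta>"
  by (rule group.subgroup_low_index_core[OF group_sub])

lemma core_subgroup: "subgroup (core n) G"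
  by (rule incl_subgroup[OF sub core_sub])

lemma core_subset: "core n \<subseteq> \<Gamma>"
  using subgroup.subset[OF core_sub] by simp

lemma core_mem [simp]: "x \<in> core n \<Longrightarrow> x \<in> \<Gamma>"
  using core_subset by blast

lemma core_closed [simp]: "\<one> \<in> core n" "x \<in> core n \<Longrightarrow> inv x \<in> core n"
    "x \<in> core n \<Longrightarrow> y \<in> core n \<Longrightarrow> x \<otimes> y \<in> core n"
  using core_subgroup[of n] by (auto simp: subgroup.one_closed subgroup.m_inv_closed subgroup.m_closed)

lemma core_0 [simp]: "core 0 = \<Gamma>"
  using group.low_index_core_0[OF group_sub] by simp

lemma core_antimono: "m \<le> n \<Longrightarrow> core n \<subseteq> core m"
  by (rule group.low_index_core_antimono[OF group_sub])

lemma core_normal: "core n \<lhd> \<Delta>"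
  by (rule group.normal_low_index_core[OF group_sub])

lemma core_conj: "x \<in> \<Gamma> \<Longrightarrow> h \<in> core n \<Longrightarrow> x \<otimes> h \<otimes> inv x \<in> core n"
  using normal.inv_op_closed2[OF core_normal, of x h] by simp

lemma core_conj': "x \<in> \<Gamma> \<Longrightarrow> h \<in> core n \<Longrightarrow> inv x \<otimes> h \<otimes> x \<in> core n"
  using normal.inv_op_closed1[OF core_normal, of x h] by simp

subsection \<open>Finite index\<close>

lemma rcosets_sub: "subgroup H G \<Longrightarrow> rcosets\<^bsub>G\<lparr>carrier := H\<rparr>\<^esub> K = (\<lambda>a. K #> a) ` H"
  by (auto simp: RCOSETS_def r_coset_def)

lemma finite_indexI:
  assumes H: "subgroup H G" and K: "subgroup K G" and KH: "K \<subseteq> H" and fin: "finite (f ` H)"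
    and sep: "\<And>g h. g \<in> H \<Longrightarrow> h \<in> H \<Longrightarrow> f g = f h \<Longrightarrow> g \<otimes> inv h \<in> K"
  shows "finite_index G H K"
proof -
  interpret H: group "G\<lparr>carrier := H\<rparr>" by (rule subgroup_imp_group[OF H])
  have "subgroup K (G\<lparr>carrier := H\<rparr>)" by (rule subgroup_incl[OF K H KH])
  then show ?thesis unfolding finite_index_def
    using H.low_index_criterion[of K f] fin sep m_inv_consistent[OF H] by simp
qed

lemma finite_indexD:
  assumes "finite_index G H K" "subgroup H G"
  shows "finite ((\<lambda>a. K #> a) ` H)"
  using assms by (simp add: finite_index_def rcosets_sub)

lemma finite_index_core: "finite_index G \<Gamma> (core n)"
  using fin by (simp add: finite_index_def)

lemma finite_core_cosets: "finite ((\<lambda>a. core n #> a) ` \<Gamma>)"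
  using finite_indexD[OF finite_index_core sub] .

lemma finite_index_imp_core:
  assumes "subgroup K G" "K \<subseteq> \<Gamma>" "finite_index G \<Gamma> K"
  shows "\<exists>n. core n \<subseteq> K"
proof -
  have "subgroup K \<Delta>" by (rule subgroup_incl[OF assms(1) sub assms(2)])
  then show ?thesis
    using group.low_index_core_le[OF group_sub] assms(3) unfolding finite_index_def by blast
qed

lemma core_coset_eq_iff: "a \<in> \<Gamma> \<Longrightarrow> b \<in> \<Gamma> \<Longrightarrow> core n #> a = core n #> b \<longleftrightarrow> a \<otimes> inv b \<in> core n"
  by (rule rcos_eq_iff[OF core_subgroup]) auto

lemma mem_core_coset: "a \<in> \<Gamma> \<Longrightarrow> x \<in> core n #> a \<longleftrightarrow> x \<in> \<Gamma> \<and> x \<otimes> inv a \<in> core n"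
proof -
  assume a: "a \<in> \<Gamma>"
  have "x \<in> \<Gamma>" if "x \<in> carrier G" "x \<otimes> inv a \<in> core n"
  proof -
    have "x = (x \<otimes> inv a) \<otimes> a" using that a by (simp add: m_assoc)
    then show ?thesis using that a by (metis core_mem sub_closed(3))
  qed
  then show ?thesis using mem_rcos_iff[OF core_subgroup, of a x n] a by auto
qed

text \<open>The form in which finite index is used: a separating function with finitely many values puts
  some \<open>core n\<close> inside \<open>K\<close>.\<close>

lemma core_le_if_separated:
  assumes K: "subgroup K G" "K \<subseteq> \<Gamma>" and fin: "finite (f ` \<Gamma>)"
    and sep: "\<And>g h. g \<in> \<Gamma> \<Longrightarrow> h \<in> \<Gamma> \<Longrightarrow> f g = f h \<Longrightarrow> g \<otimes> inv h \<in> K"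
  shows "\<exists>n. core n \<subseteq> K"
  by (rule finite_index_imp_core[OF K finite_indexI[OF sub K fin sep]])

subsection \<open>Commensurating elements\<close>

text \<open>Continuity of conjugation by \<open>a\<close> at the identity, made explicit by a pair of levels.\<close>

definition conj_core :: "'a \<Rightarrow> nat \<Rightarrow> nat \<Rightarrow> bool" where
  "conj_core a m n \<longleftrightarrow> (\<forall>g\<in>core m. a \<otimes> g \<otimes> inv a \<in> core n)"

lemma conj_core_mono: "conj_core a m n \<Longrightarrow> m \<le> m' \<Longrightarrow> n' \<le> n \<Longrightarrow> conj_core a m' n'"
  unfolding conj_core_def using core_antimono by blast

lemma conj_mult:
  "a \<in> carrier G \<Longrightarrow> g \<in> carrier G \<Longrightarrow> h \<in> carrier G \<Longrightarrow>
   a \<otimes> (g \<otimes> h) \<otimes> inv a = (a \<otimes> g \<otimes> inv a) \<otimes> (a \<otimes> h \<otimes> inv a)"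
  by (simp add: m_assoc l_inv_cancel)

lemma conj_inv:
  "a \<in> carrier G \<Longrightarrow> g \<in> carrier G \<Longrightarrow> a \<otimes> inv g \<otimes> inv a = inv (a \<otimes> g \<otimes> inv a)"
  by (simp add: inv_mult_group m_assoc)

lemma conj_prod:
  "a \<in> carrier G \<Longrightarrow> b \<in> carrier G \<Longrightarrow> g \<in> carrier G \<Longrightarrow>
   (a \<otimes> b) \<otimes> g \<otimes> inv (a \<otimes> b) = a \<otimes> (b \<otimes> g \<otimes> inv b) \<otimes> inv a"
  by (simp add: inv_mult_group m_assoc)

lemma conj_core_mult:
  assumes "a \<in> carrier G" "b \<in> carrier G" "conj_core a m n" "conj_core b k m"
  shows "conj_core (a \<otimes> b) k n"
  using assms unfolding conj_core_def by (simp add: conj_prod)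

lemma conj_core_sub: "a \<in> \<Gamma> \<Longrightarrow> conj_core a n n"
  unfolding conj_core_def by (simp add: core_conj)

text \<open>The elements of \<open>core m\<close> that conjugation by \<open>a\<close> sends into \<open>core n\<close> form a subgroup of
  finite index in \<open>\<Gamma>\<close>, so the target can be shrunk at the expense of the source. To separate its
  cosets, \<open>f\<close> records the coset of \<open>core m\<close> and, relative to a chosen representative of that
  coset, the coset of \<open>core n\<close> of the conjugate.\<close>

lemma conj_core_refine:
  assumes a: "a \<in> carrier G" and m: "conj_core a m 0"
  shows "\<exists>k\<ge>N. conj_core a k n"
proof -
  let ?c = "\<lambda>g. a \<otimes> g \<otimes> inv a"
  let ?K = "{g \<in> core m. ?c g \<in> core n}"
  let ?r = "\<lambda>g. SOME x. x \<in> core m #> g"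
  let ?f = "\<lambda>g. (core m #> g, core n #> ?c (g \<otimes> inv (?r g)))"
  have K: "subgroup ?K G"
    by (rule subgroupI) (use a in \<open>auto simp: conj_mult conj_inv intro: exI[of _ \<one>]\<close>)
  have r: "?r g \<in> \<Gamma>" "g \<otimes> inv (?r g) \<in> core m" if g: "g \<in> \<Gamma>" for g
  proof -
    have "g \<in> core m #> g" using rcos_self[OF _ core_subgroup] g by simp
    then have "?r g \<in> core m #> g" by (rule someI)
    then have *: "?r g \<in> \<Gamma>" "?r g \<otimes> inv g \<in> core m" using mem_core_coset g by auto
    then have "inv (?r g \<otimes> inv g) \<in> core m" by simp
    with * g show "?r g \<in> \<Gamma>" "g \<otimes> inv (?r g) \<in> core m" by (simp_all add: inv_mult_group)
  qed
  have c: "?c h \<in> \<Gamma>" if "h \<in> core m" for h using m that unfolding conj_core_def by simp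
  have "?f ` \<Gamma> \<subseteq> ((\<lambda>a. core m #> a) ` \<Gamma>) \<times> ((\<lambda>a. core n #> a) ` \<Gamma>)"
    using c[OF r(2)] by blast
  then have fin: "finite (?f ` \<Gamma>)"
    by (rule finite_subset) (intro finite_cartesian_product finite_core_cosets)
  have "\<exists>k. core k \<subseteq> ?K"
  proof (rule core_le_if_separated[OF K _ fin])
    show "?K \<subseteq> \<Gamma>" by auto
    fix g h assume gh: "g \<in> \<Gamma>" "h \<in> \<Gamma>" "?f g = ?f h"
    then have eq: "core m #> g = core m #> h" "core n #> ?c (g \<otimes> inv (?r g)) = core n #> ?c (h \<otimes> inv (?r g))"
      by auto
    have rh: "h \<otimes> inv (?r g) \<in> core m" using r(2)[OF gh(2)] eq(1) by simp
    define x where "x = ?r g"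
    have x: "x \<in> \<Gamma>" "g \<otimes> inv x \<in> core m" "h \<otimes> inv x \<in> core m" using r[OF gh(1)] rh by (auto simp: x_def)
    have "?c (g \<otimes> inv x) \<otimes> inv (?c (h \<otimes> inv x)) \<in> core n"
      using eq(2) core_coset_eq_iff[OF c[OF x(2)] c[OF x(3)]] by (simp add: x_def)
    moreover have "?c (g \<otimes> inv x) \<otimes> inv (?c (h \<otimes> inv x)) = ?c (g \<otimes> inv h)"
      using gh x(1) a by (simp add: inv_mult_group m_assoc l_inv_cancel)
    moreover have "g \<otimes> inv h \<in> core m" using eq(1) core_coset_eq_iff gh by simp
    ultimately show "g \<otimes> inv h \<in> ?K" by simp
  qed
  then obtain k where "core k \<subseteq> ?K" by blast
  then have "conj_core a k n" unfolding conj_core_def by blast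
  then show ?thesis using conj_core_mono[of a k n "max N k" n] by (intro exI[of _ "max N k"]) auto
qed

definition comm :: "'a set" where
  "comm = {a \<in> carrier G. commensurable G (conj_subgroup G a \<Gamma>) \<Gamma>}"

lemma conj_subgroup_subgroup:
  assumes a: "a \<in> carrier G" and H: "subgroup H G"
  shows "subgroup (conj_subgroup G a H) G"
proof -
  interpret H: subgroup H G by fact
  show ?thesis unfolding conj_subgroup_def
  proof (rule subgroupI)
    fix x assume "x \<in> (\<lambda>h. a \<otimes> h \<otimes> inv a) ` H"
    then obtain h where h: "h \<in> H" "x = a \<otimes> h \<otimes> inv a" by blast
    then have "inv x = a \<otimes> inv h \<otimes> inv a" using a by (simp add: conj_inv)
    then show "inv x \<in> (\<lambda>h. a \<otimes> h \<otimes> inv a) ` H" using h by blast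
    fix y assume "y \<in> (\<lambda>h. a \<otimes> h \<otimes> inv a) ` H"
    then obtain k where k: "k \<in> H" "y = a \<otimes> k \<otimes> inv a" by blast
    then have "x \<otimes> y = a \<otimes> (h \<otimes> k) \<otimes> inv a" using a h by (simp only: conj_mult H.mem_carrier)
    then show "x \<otimes> y \<in> (\<lambda>h. a \<otimes> h \<otimes> inv a) ` H" using h k by blast
  next
    show "(\<lambda>h. a \<otimes> h \<otimes> inv a) ` H \<noteq> {}" using H.one_closed by blast
  qed (use a in auto)
qed

lemma mem_conj_subgroup:
  assumes a: "a \<in> carrier G" and H: "H \<subseteq> carrier G"
  shows "x \<in> conj_subgroup G a H \<longleftrightarrow> x \<in> carrier G \<and> inv a \<otimes> x \<otimes> a \<in> H"
proof
  assume "x \<in> conj_subgroup G a H"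
  then obtain h where h: "h \<in> H" "x = a \<otimes> h \<otimes> inv a" by (auto simp: conj_subgroup_def)
  then have hc: "h \<in> carrier G" using H by blast
  then have "inv a \<otimes> x \<otimes> a = h" using h a by (simp add: m_assoc l_inv_cancel)
  then show "x \<in> carrier G \<and> inv a \<otimes> x \<otimes> a \<in> H" using h hc a by simp
next
  assume x: "x \<in> carrier G \<and> inv a \<otimes> x \<otimes> a \<in> H"
  then have "x = a \<otimes> (inv a \<otimes> x \<otimes> a) \<otimes> inv a" using a by (simp add: m_assoc r_inv_cancel)
  then show "x \<in> conj_subgroup G a H" using x unfolding conj_subgroup_def by blast
qed

text \<open>Commensurability means that \<open>\<Gamma>\<close> and its conjugate contain each other up to finite index, and
  finite index in \<open>\<Gamma>\<close> is detected by the groups \<open>core m\<close>. So membership in the commensurator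
  becomes continuity of conjugation by \<open>a\<close> and by its inverse.\<close>

lemma comm_iff:
  "a \<in> comm \<longleftrightarrow> a \<in> carrier G \<and> (\<exists>m. conj_core a m 0 \<and> conj_core (inv a) m 0)"
proof (cases "a \<in> carrier G")
  case a: True
  let ?L = "conj_subgroup G a \<Gamma>"
  have G: "\<Gamma> \<subseteq> carrier G" by auto
  have L: "subgroup ?L G" by (rule conj_subgroup_subgroup[OF a sub])
  have I: "subgroup (?L \<inter> \<Gamma>) G" by (rule subgroups_Inter_pair[OF L sub])
  have memL: "x \<in> ?L \<longleftrightarrow> x \<in> carrier G \<and> inv a \<otimes> x \<otimes> a \<in> \<Gamma>" for x
    by (rule mem_conj_subgroup[OF a G])
  have inL: "a \<otimes> g \<otimes> inv a \<in> ?L" if "g \<in> \<Gamma>" for g using that by (auto simp: conj_subgroup_def)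
  show ?thesis
  proof
    assume "a \<in> comm"
    then have 1: "finite_index G ?L (?L \<inter> \<Gamma>)" and 2: "finite_index G \<Gamma> (?L \<inter> \<Gamma>)"
      by (auto simp: comm_def commensurable_def)
    obtain m1 where "core m1 \<subseteq> ?L \<inter> \<Gamma>" using finite_index_imp_core[OF I _ 2] by blast
    then have m1: "conj_core (inv a) m1 0" unfolding conj_core_def using memL a by auto
    let ?K = "{g \<in> \<Gamma>. a \<otimes> g \<otimes> inv a \<in> \<Gamma>}"
    let ?f = "\<lambda>g. (?L \<inter> \<Gamma>) #> (a \<otimes> g \<otimes> inv a)"
    have K: "subgroup ?K G"
      by (rule subgroupI) (use a in \<open>auto simp: conj_mult conj_inv intro: exI[of _ \<one>]\<close>)
    have "?f ` \<Gamma> \<subseteq> (\<lambda>x. (?L \<inter> \<Gamma>) #> x) ` ?L" using inL by blast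
    then have fin: "finite (?f ` \<Gamma>)" by (rule finite_subset[OF _ finite_indexD[OF 1 L]])
    have "\<exists>k. core k \<subseteq> ?K"
    proof (rule core_le_if_separated[OF K _ fin])
      fix g h assume gh: "g \<in> \<Gamma>" "h \<in> \<Gamma>" "?f g = ?f h"
      then have "(a \<otimes> g \<otimes> inv a) \<otimes> inv (a \<otimes> h \<otimes> inv a) \<in> ?L \<inter> \<Gamma>"
        using rcos_eq_iff[OF I, of "a \<otimes> g \<otimes> inv a" "a \<otimes> h \<otimes> inv a"] a by simp
      moreover have "(a \<otimes> g \<otimes> inv a) \<otimes> inv (a \<otimes> h \<otimes> inv a) = a \<otimes> (g \<otimes> inv h) \<otimes> inv a"
        using gh a by (simp add: inv_mult_group m_assoc l_inv_cancel)
      ultimately show "g \<otimes> inv h \<in> ?K" using gh by simp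
    qed auto
    then obtain m2 where "conj_core a m2 0" unfolding conj_core_def by auto
    then show "a \<in> carrier G \<and> (\<exists>m. conj_core a m 0 \<and> conj_core (inv a) m 0)"
      using m1 a conj_core_mono[of a m2 0 "max m1 m2" 0] conj_core_mono[of "inv a" m1 0 "max m1 m2" 0]
      by auto
  next
    assume "a \<in> carrier G \<and> (\<exists>m. conj_core a m 0 \<and> conj_core (inv a) m 0)"
    then obtain m where m: "conj_core a m 0" "conj_core (inv a) m 0" by blast
    have m1: "core m \<subseteq> ?L" using m(2) a memL unfolding conj_core_def by auto
    have "finite_index G \<Gamma> (?L \<inter> \<Gamma>)"
    proof (rule finite_indexI[OF sub I _ finite_core_cosets[of m]])
      fix g h assume "g \<in> \<Gamma>" "h \<in> \<Gamma>" "core m #> g = core m #> h"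
      then have "g \<otimes> inv h \<in> core m" using core_coset_eq_iff by simp
      then show "g \<otimes> inv h \<in> ?L \<inter> \<Gamma>" using m1 by auto
    qed auto
    moreover have "finite_index G ?L (?L \<inter> \<Gamma>)"
    proof (rule finite_indexI[OF L I])
      let ?f = "\<lambda>x. core m #> (inv a \<otimes> x \<otimes> a)"
      have "?f ` ?L \<subseteq> (\<lambda>a. core m #> a) ` \<Gamma>" using memL by blast
      then show "finite (?f ` ?L)" by (rule finite_subset[OF _ finite_core_cosets])
      fix g h assume gh: "g \<in> ?L" "h \<in> ?L" "?f g = ?f h"
      then have c: "g \<in> carrier G" "h \<in> carrier G" using memL by auto
      have "inv a \<otimes> g \<otimes> a \<otimes> inv (inv a \<otimes> h \<otimes> a) \<in> core m"
        using core_coset_eq_iff gh memL by simp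
      moreover have "inv a \<otimes> g \<otimes> a \<otimes> inv (inv a \<otimes> h \<otimes> a) = inv a \<otimes> (g \<otimes> inv h) \<otimes> a"
        using c a by (simp add: inv_mult_group m_assoc r_inv_cancel)
      ultimately have k: "inv a \<otimes> (g \<otimes> inv h) \<otimes> a \<in> core m" by simp
      then have "a \<otimes> (inv a \<otimes> (g \<otimes> inv h) \<otimes> a) \<otimes> inv a \<in> core 0"
        using m(1) unfolding conj_core_def by blast
      moreover have "a \<otimes> (inv a \<otimes> (g \<otimes> inv h) \<otimes> a) \<otimes> inv a = g \<otimes> inv h"
        using c a by (simp add: m_assoc r_inv_cancel)
      ultimately show "g \<otimes> inv h \<in> ?L \<inter> \<Gamma>" using k c memL by simp
    qed auto
    ultimately show "a \<in> comm" using a by (simp add: comm_def commensurable_def)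
  qed
qed (simp add: comm_def)

lemma comm_carrier [simp]: "a \<in> comm \<Longrightarrow> a \<in> carrier G"
  by (simp add: comm_def)

lemma comm_conj_core: "a \<in> comm \<Longrightarrow> \<exists>k\<ge>N. conj_core a k n"
  using comm_iff conj_core_refine by blast

lemma commI:
  "a \<in> carrier G \<Longrightarrow> conj_core a m 0 \<Longrightarrow> conj_core (inv a) k 0 \<Longrightarrow> a \<in> comm"
  unfolding comm_iff
  using conj_core_mono[of a m 0 "max m k" 0] conj_core_mono[of "inv a" k 0 "max m k" 0] by auto

lemma comm_inv [simp]: "a \<in> comm \<Longrightarrow> inv a \<in> comm"
  unfolding comm_iff by auto

lemma comm_mult [simp]:
  assumes "a \<in> comm" "b \<in> comm"
  shows "a \<otimes> b \<in> comm"
proof -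
  obtain m where m: "conj_core a m 0" using comm_conj_core assms by blast
  obtain k where k: "conj_core b k m" using comm_conj_core assms by blast
  obtain m' where m': "conj_core (inv b) m' 0" using comm_conj_core assms comm_inv by blast
  obtain k' where k': "conj_core (inv a) k' m'" using comm_conj_core assms comm_inv by blast
  have "conj_core (a \<otimes> b) k 0" using conj_core_mult m k assms by simp
  moreover have "conj_core (inv (a \<otimes> b)) k' 0"
    using conj_core_mult[OF _ _ m' k'] assms by (simp add: inv_mult_group)
  ultimately show ?thesis using commI assms by simp
qed

lemma sub_comm [simp]: "a \<in> \<Gamma> \<Longrightarrow> a \<in> comm"
  by (rule commI[of _ 0 0]) (auto intro!: conj_core_sub)

subsection \<open>The profinite completion as nested coset sequences\<close>

lemma carrier_Mod_core: "carrier (\<Delta> Mod core n) = (\<lambda>a. core n #> a) ` \<Gamma>"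
  by (auto simp: carrier_FactGroup)

text \<open>This turns the compatibility condition of the inverse limit into an inclusion of cosets.\<close>

lemma core_coset_expand:
  assumes "m \<le> n" "t \<in> \<Gamma>"
  shows "(core n #> t) <#> core m = core m #> t"
proof (rule Set.set_eqI)
  fix x
  have "x \<in> (core n #> t) <#> core m \<longleftrightarrow> (\<exists>s\<in>core n #> t. \<exists>h\<in>core m. x = s \<otimes> h)"
    by (auto simp: set_mult_def)
  also have "\<dots> \<longleftrightarrow> x \<in> core m #> t"
  proof
    assume "\<exists>s\<in>core n #> t. \<exists>h\<in>core m. x = s \<otimes> h"
    then obtain s h where s: "s \<in> core n #> t" "h \<in> core m" "x = s \<otimes> h" by blast
    then have st: "s \<in> \<Gamma>" "s \<otimes> inv t \<in> core m" using mem_core_coset assms core_antimono[OF assms(1)] by auto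
    have "x \<otimes> inv t = (s \<otimes> h \<otimes> inv s) \<otimes> (s \<otimes> inv t)"
      using s st assms by (simp add: m_assoc l_inv_cancel)
    then have "x \<otimes> inv t \<in> core m" using core_conj[OF st(1) s(2)] st(2) by simp
    then show "x \<in> core m #> t" using s st assms mem_core_coset by simp
  next
    assume "x \<in> core m #> t"
    then have x: "x \<in> \<Gamma>" "x \<otimes> inv t \<in> core m" using mem_core_coset assms by auto
    have "inv t \<otimes> (x \<otimes> inv t) \<otimes> t \<in> core m" by (rule core_conj'[OF assms(2) x(2)])
    moreover have "x = t \<otimes> (inv t \<otimes> (x \<otimes> inv t) \<otimes> t)"
      using x assms by (simp add: m_assoc r_inv_cancel)
    moreover have "t \<in> core n #> t" using rcos_self[OF _ core_subgroup] assms by simp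
    ultimately show "\<exists>s\<in>core n #> t. \<exists>h\<in>core m. x = s \<otimes> h" by blast
  qed
  finally show "x \<in> (core n #> t) <#> core m \<longleftrightarrow> x \<in> core m #> t" .
qed

lemma self_in_core_coset [simp]: "t \<in> \<Gamma> \<Longrightarrow> t \<in> core n #> t"
  using rcos_self[OF _ core_subgroup] by simp

lemma core_coset_self_eq: "t \<in> \<Gamma> \<Longrightarrow> s \<in> core n #> t \<Longrightarrow> core n #> t = core n #> s"
  by (rule repr_independence[OF _ sub_carrier core_subgroup])

lemma core_coset_subset_iff:
  assumes "m \<le> n" "s \<in> \<Gamma>" "t \<in> \<Gamma>"
  shows "core n #> t \<subseteq> core m #> s \<longleftrightarrow> core m #> s = core m #> t"
proof
  assume "core n #> t \<subseteq> core m #> s"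
  then have "t \<in> core m #> s" using assms by auto
  with assms(2) show "core m #> s = core m #> t" by (rule core_coset_self_eq)
next
  assume "core m #> s = core m #> t"
  then show "core n #> t \<subseteq> core m #> s"
    using core_antimono[OF assms(1)] mem_core_coset[OF assms(3)] by auto
qed

text \<open>With elements of the completion as nested sequences of cosets, an equation between two of
  them is checked by exhibiting at each level one element of \<open>\<Gamma>\<close> that lies in both cosets.\<close>

lemma hat_iff:
  "\<tau> \<in> \<Gamma>hat \<longleftrightarrow> (\<forall>n. \<exists>t\<in>\<Gamma>. \<tau> n = core n #> t) \<and> (\<forall>n m. m \<le> n \<longrightarrow> \<tau> n \<subseteq> \<tau> m)"
proof -
  have "(\<forall>n m. m \<le> n \<longrightarrow> \<tau> m = \<tau> n <#> core m) \<longleftrightarrow> (\<forall>n m. m \<le> n \<longrightarrow> \<tau> n \<subseteq> \<tau> m)"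
    if *: "\<forall>n. \<exists>t\<in>\<Gamma>. \<tau> n = core n #> t"
  proof -
    have "\<tau> m = \<tau> n <#> core m \<longleftrightarrow> \<tau> n \<subseteq> \<tau> m" if mn: "m \<le> n" for m n
    proof -
      obtain s where s: "s \<in> \<Gamma>" "\<tau> m = core m #> s" using * by blast
      obtain t where t: "t \<in> \<Gamma>" "\<tau> n = core n #> t" using * by blast
      show ?thesis unfolding s(2) t(2) core_coset_expand[OF mn t(1)]
        using core_coset_subset_iff[OF mn s(1) t(1)] by simp
    qed
    then show ?thesis by blast
  qed
  note nested = this
  have cosets: "(\<forall>n. \<tau> n \<in> carrier (\<Delta> Mod core n)) \<longleftrightarrow> (\<forall>n. \<exists>t\<in>\<Gamma>. \<tau> n = core n #> t)"
    by (simp add: carrier_Mod_core image_iff)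
  have hat: "\<tau> \<in> \<Gamma>hat \<longleftrightarrow> (\<forall>n. \<tau> n \<in> carrier (\<Delta> Mod core n)) \<and> (\<forall>n m. m \<le> n \<longrightarrow> \<tau> m = \<tau> n <#> core m)"
    by (simp add: profinite_def)
  show ?thesis unfolding hat cosets by (rule conj_cong[OF refl nested])
qed

lemma hat_ex:
  assumes "\<tau> \<in> \<Gamma>hat"
  shows "\<exists>t. t \<in> \<tau> n"
proof -
  obtain t where "t \<in> \<Gamma>" "\<tau> n = core n #> t" using assms unfolding hat_iff by blast
  then have "t \<in> \<tau> n" by simp
  then show ?thesis ..
qed

lemma hat_seq: "\<tau> \<in> \<Gamma>hat \<Longrightarrow> \<exists>t. \<forall>n. t n \<in> \<tau> n"
  by (intro choice allI hat_ex)

lemma hat_mem: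
  assumes "\<tau> \<in> \<Gamma>hat" "t \<in> \<tau> n"
  shows "t \<in> \<Gamma>" "\<tau> n = core n #> t"
proof -
  obtain s where s: "s \<in> \<Gamma>" "\<tau> n = core n #> s" using assms(1) unfolding hat_iff by blast
  then show "t \<in> \<Gamma>" using assms(2) mem_core_coset by simp
  show "\<tau> n = core n #> t" using core_coset_self_eq[OF s(1), of t n] s assms(2) by metis
qed

lemma hat_nested: "\<tau> \<in> \<Gamma>hat \<Longrightarrow> m \<le> n \<Longrightarrow> t \<in> \<tau> n \<Longrightarrow> t \<in> \<tau> m"
  unfolding hat_iff by blast

lemma hat_mem_iff: "\<tau> \<in> \<Gamma>hat \<Longrightarrow> t \<in> \<tau> n \<Longrightarrow> s \<in> \<tau> n \<longleftrightarrow> s \<in> \<Gamma> \<and> s \<otimes> inv t \<in> core n"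
proof -
  assume "\<tau> \<in> \<Gamma>hat" "t \<in> \<tau> n"
  note t = hat_mem[OF this]
  show ?thesis unfolding t(2) by (rule mem_core_coset[OF t(1)])
qed

lemma hat_level_eqI:
  assumes "\<sigma> \<in> \<Gamma>hat" "\<tau> \<in> \<Gamma>hat" "x \<in> \<sigma> n" "x \<in> \<tau> n"
  shows "\<sigma> n = \<tau> n"
  using hat_mem(2)[OF assms(1,3)] hat_mem(2)[OF assms(2,4)] by simp

lemma hat_level_eq_le:
  assumes "\<sigma> \<in> \<Gamma>hat" "\<tau> \<in> \<Gamma>hat" "\<sigma> n = \<tau> n" "m \<le> n"
  shows "\<sigma> m = \<tau> m"
proof -
  obtain t where "t \<in> \<sigma> n" using hat_ex assms by blast
  then have "t \<in> \<sigma> m" "t \<in> \<tau> m" using hat_nested assms by auto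
  then show ?thesis by (rule hat_level_eqI[OF assms(1,2)])
qed

lemma hat_eqI:
  assumes "\<sigma> \<in> \<Gamma>hat" "\<tau> \<in> \<Gamma>hat" "\<And>n. \<exists>x. x \<in> \<sigma> n \<and> x \<in> \<tau> n"
  shows "\<sigma> = \<tau>"
  using hat_level_eqI[OF assms(1,2)] assms(3) by blast

lemma hat_of_seq:
  assumes "\<And>n. t n \<in> \<Gamma>" "\<And>m n. m \<le> n \<Longrightarrow> t n \<otimes> inv (t m) \<in> core m"
  shows "(\<lambda>n. core n #> t n) \<in> \<Gamma>hat"
proof -
  have "core n #> t n \<subseteq> core m #> t m" if "m \<le> n" for m n
    using core_coset_subset_iff[OF that] core_coset_eq_iff[of "t n" "t m" m] assms that by auto
  then show ?thesis using assms(1) unfolding hat_iff by blast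
qed

lemma pmult_level: "\<sigma> \<in> \<Gamma>hat \<Longrightarrow> \<tau> \<in> \<Gamma>hat \<Longrightarrow> s \<in> \<sigma> n \<Longrightarrow> t \<in> \<tau> n \<Longrightarrow> (\<sigma> \<star> \<tau>) n = core n #> (s \<otimes> t)"
  using hat_mem[of \<sigma> s n] hat_mem[of \<tau> t n] normal.rcos_sum[OF core_normal, of s t n]
  by (simp add: profinite_def FactGroup_def)

lemma pmult_closed [simp]:
  assumes "\<sigma> \<in> \<Gamma>hat" "\<tau> \<in> \<Gamma>hat"
  shows "\<sigma> \<star> \<tau> \<in> \<Gamma>hat"
proof -
  obtain s t where "\<forall>n. s n \<in> \<sigma> n" "\<forall>n. t n \<in> \<tau> n" using hat_seq[OF assms(1)] hat_seq[OF assms(2)] by blast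
  then have st: "s n \<in> \<sigma> n" "t n \<in> \<tau> n" for n by auto
  have G: "s n \<in> \<Gamma>" "t n \<in> \<Gamma>" for n using hat_mem(1)[OF assms(1) st(1)] hat_mem(1)[OF assms(2) st(2)] .
  have "\<sigma> \<star> \<tau> = (\<lambda>n. core n #> (s n \<otimes> t n))" using pmult_level[OF assms st] by blast
  moreover have "(\<lambda>n. core n #> (s n \<otimes> t n)) \<in> \<Gamma>hat"
  proof (rule hat_of_seq)
    fix m n :: nat assume mn: "m \<le> n"
    have "s n \<in> \<sigma> m" "t n \<in> \<tau> m" using hat_nested[OF assms(1) mn st(1)] hat_nested[OF assms(2) mn st(2)] .
    then have "core m #> (s n \<otimes> t n) = core m #> (s m \<otimes> t m)"
      using pmult_level[OF assms st, of m] pmult_level[OF assms, of "s n" m "t n"] by simp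
    then show "s n \<otimes> t n \<otimes> inv (s m \<otimes> t m) \<in> core m"
      using core_coset_eq_iff G by simp
  qed (use G in simp)
  ultimately show ?thesis by simp
qed

lemma pmult_mem:
  assumes "\<sigma> \<in> \<Gamma>hat" "\<tau> \<in> \<Gamma>hat" "s \<in> \<sigma> n" "t \<in> \<tau> n"
  shows "s \<otimes> t \<in> (\<sigma> \<star> \<tau>) n"
  using pmult_level[OF assms] hat_mem(1)[OF assms(1,3)] hat_mem(1)[OF assms(2,4)] by simp

lemma emb_level: "emb x n = core n #> x"
  by (simp add: profinite_embed_def)

lemma emb_hat [simp]: "x \<in> \<Gamma> \<Longrightarrow> emb x \<in> \<Gamma>hat"
  unfolding profinite_embed_def r_coset_sub by (rule hat_of_seq) auto

lemma emb_mem: "x \<in> \<Gamma> \<Longrightarrow> x \<in> emb x n"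
  by (simp add: emb_level)

lemma emb_mem_iff: "x \<in> \<Gamma> \<Longrightarrow> y \<in> emb x n \<longleftrightarrow> y \<in> \<Gamma> \<and> y \<otimes> inv x \<in> core n"
  by (simp add: emb_level mem_core_coset)

lemma emb_mult: "x \<in> \<Gamma> \<Longrightarrow> y \<in> \<Gamma> \<Longrightarrow> emb (x \<otimes> y) = emb x \<star> emb y"
proof (rule hat_eqI)
  fix n assume xy: "x \<in> \<Gamma>" "y \<in> \<Gamma>"
  then have "x \<otimes> y \<in> emb (x \<otimes> y) n" "x \<otimes> y \<in> (emb x \<star> emb y) n"
    by (auto intro: emb_mem pmult_mem)
  then show "\<exists>z. z \<in> emb (x \<otimes> y) n \<and> z \<in> (emb x \<star> emb y) n" by blast
qed auto

lemma core_coset_one [simp]: "core n #> \<one> = core n"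
  by (rule coset_mult_one[OF subgroup.subset[OF core_subgroup]])

lemma pmult_assoc:
  assumes "\<rho> \<in> \<Gamma>hat" "\<sigma> \<in> \<Gamma>hat" "\<tau> \<in> \<Gamma>hat"
  shows "\<rho> \<star> \<sigma> \<star> \<tau> = \<rho> \<star> (\<sigma> \<star> \<tau>)"
proof (rule hat_eqI)
  fix n
  obtain r s t where *: "r \<in> \<rho> n" "s \<in> \<sigma> n" "t \<in> \<tau> n" using hat_ex[OF assms(1)] hat_ex[OF assms(2)] hat_ex[OF assms(3)] by blast
  then have "r \<in> \<Gamma>" "s \<in> \<Gamma>" "t \<in> \<Gamma>"
    using hat_mem(1)[OF assms(1)] hat_mem(1)[OF assms(2)] hat_mem(1)[OF assms(3)] by auto
  then have "r \<otimes> s \<otimes> t = r \<otimes> (s \<otimes> t)" by (simp add: m_assoc)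
  moreover have "r \<otimes> s \<otimes> t \<in> (\<rho> \<star> \<sigma> \<star> \<tau>) n" "r \<otimes> (s \<otimes> t) \<in> (\<rho> \<star> (\<sigma> \<star> \<tau>)) n"
    using * assms by (auto intro!: pmult_mem)
  ultimately show "\<exists>x. x \<in> (\<rho> \<star> \<sigma> \<star> \<tau>) n \<and> x \<in> (\<rho> \<star> (\<sigma> \<star> \<tau>)) n" by auto
qed (use assms in auto)

lemma one_pmult:
  assumes "\<tau> \<in> \<Gamma>hat"
  shows "emb \<one> \<star> \<tau> = \<tau>" "\<tau> \<star> emb \<one> = \<tau>"
proof -
  have "\<exists>t. t \<in> \<tau> n \<and> \<one> \<otimes> t \<in> (emb \<one> \<star> \<tau>) n \<and> t \<otimes> \<one> \<in> (\<tau> \<star> emb \<one>) n \<and> t \<in> \<Gamma>" for n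
    using hat_ex[OF assms, of n] assms hat_mem(1) by (auto intro!: pmult_mem emb_mem)
  then have *: "\<exists>t. t \<in> \<tau> n \<and> t \<in> (emb \<one> \<star> \<tau>) n \<and> t \<in> (\<tau> \<star> emb \<one>) n" for n
    by (metis l_one r_one sub_carrier)
  show "emb \<one> \<star> \<tau> = \<tau>" "\<tau> \<star> emb \<one> = \<tau>"
    by (rule hat_eqI; use assms * in \<open>auto; blast\<close>)+
qed

text \<open>The inverse in the completion; at each level any representative of the coset can be
  inverted, since \<open>core n\<close> is normal.\<close>

definition hinv :: "(nat \<Rightarrow> 'a set) \<Rightarrow> nat \<Rightarrow> 'a set" where
  "hinv \<tau> = (\<lambda>n. core n #> inv (SOME t. t \<in> \<tau> n))"

lemma hinv_hat [simp]:
  assumes "\<tau> \<in> \<Gamma>hat"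
  shows "hinv \<tau> \<in> \<Gamma>hat"
proof -
  let ?t = "\<lambda>n. SOME t. t \<in> \<tau> n"
  have t: "?t n \<in> \<tau> n" for n using hat_ex[OF assms] by (rule someI_ex)
  have G: "?t n \<in> \<Gamma>" for n using hat_mem(1)[OF assms t] .
  show ?thesis unfolding hinv_def
  proof (rule hat_of_seq)
    show "inv (?t n) \<in> \<Gamma>" for n using G by simp
    fix m n :: nat assume "m \<le> n"
    then have "?t n \<in> \<tau> m" using hat_nested[OF assms _ t] by simp
    then have "?t m \<otimes> inv (?t n) \<in> core m" using hat_mem_iff[OF assms _, of "?t n" m "?t m"] t by blast
    from core_conj'[OF G[of n] this] G
    have "inv (?t n) \<otimes> ?t m \<in> core m" by (simp add: m_assoc)
    then show "inv (?t n) \<otimes> inv (inv (?t m)) \<in> core m" using G by simp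
  qed
qed

lemma hinv_mem:
  assumes "\<tau> \<in> \<Gamma>hat" "t \<in> \<tau> n"
  shows "inv t \<in> hinv \<tau> n"
proof -
  let ?t = "SOME t. t \<in> \<tau> n"
  have t: "?t \<in> \<tau> n" using assms(2) by (rule someI)
  have G: "?t \<in> \<Gamma>" "t \<in> \<Gamma>" using hat_mem(1)[OF assms(1)] t assms(2) by auto
  have "?t \<otimes> inv t \<in> core n" using hat_mem_iff[OF assms] t by blast
  from core_conj'[OF G(2) this] G have "inv t \<otimes> ?t \<in> core n" by (simp add: m_assoc)
  then show ?thesis using G mem_core_coset[of "inv ?t" "inv t" n] by (simp add: hinv_def)
qed

lemma hinv_pmult:
  assumes "\<tau> \<in> \<Gamma>hat"
  shows "hinv \<tau> \<star> \<tau> = emb \<one>" "\<tau> \<star> hinv \<tau> = emb \<one>"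
proof -
  have *: "\<one> \<in> (hinv \<tau> \<star> \<tau>) n \<and> \<one> \<in> (\<tau> \<star> hinv \<tau>) n" for n
  proof -
    obtain t where t: "t \<in> \<tau> n" using hat_ex[OF assms] by blast
    have "inv t \<otimes> t \<in> (hinv \<tau> \<star> \<tau>) n" "t \<otimes> inv t \<in> (\<tau> \<star> hinv \<tau>) n"
      using assms t hinv_mem by (auto intro!: pmult_mem)
    then show ?thesis using hat_mem(1)[OF assms t] by simp
  qed
  show "hinv \<tau> \<star> \<tau> = emb \<one>" "\<tau> \<star> hinv \<tau> = emb \<one>"
    by (rule hat_eqI; use assms * emb_mem[OF sub_closed(1)] in auto)+
qed

subsection \<open>Topology of the profinite completion\<close>

lemma topspace_PT [simp]: "topspace PT = \<Gamma>hat"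
  by (auto simp: profinite_topology_def profinite_def)

text \<open>Each level determines the lower ones, so a basic neighbourhood, which constrains finitely
  many levels, is described by the highest of them.\<close>

lemma openin_PT:
  "openin PT U \<longleftrightarrow> U \<subseteq> \<Gamma>hat \<and> (\<forall>\<tau>\<in>U. \<exists>k. \<forall>\<sigma>\<in>\<Gamma>hat. \<sigma> k = \<tau> k \<longrightarrow> \<sigma> \<in> U)"
proof
  let ?P = "product_topology (\<lambda>n. discrete_topology (carrier (\<Delta> Mod core n))) UNIV"
  assume U: "openin PT U"
  then obtain V where V: "openin ?P V" "U = V \<inter> \<Gamma>hat"
    unfolding profinite_topology_def openin_subtopology by blast
  have "\<exists>k. \<forall>\<sigma>\<in>\<Gamma>hat. \<sigma> k = \<tau> k \<longrightarrow> \<sigma> \<in> U" if "\<tau> \<in> U" for \<tau>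
  proof -
    have "\<tau> \<in> V" using V that by simp
    obtain W :: "nat \<Rightarrow> 'a set set" where W: "finite {i. W i \<noteq> carrier (\<Delta> Mod core i)}" "\<tau> \<in> Pi\<^sub>E UNIV W" "Pi\<^sub>E UNIV W \<subseteq> V"
    proof -
      from \<open>\<tau> \<in> V\<close> have "\<exists>W. finite {i \<in> UNIV. W i \<noteq> topspace (discrete_topology (carrier (\<Delta> Mod core i)))} \<and>
          (\<forall>i\<in>UNIV. openin (discrete_topology (carrier (\<Delta> Mod core i))) (W i)) \<and>
          \<tau> \<in> Pi\<^sub>E UNIV W \<and> Pi\<^sub>E UNIV W \<subseteq> V"
        using V(1) unfolding openin_product_topology_alt by (elim bspec)
      then show ?thesis using that by auto
    qed
    define k where "k = Max (insert 0 {i. W i \<noteq> carrier (\<Delta> Mod core i)})"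
    have "\<sigma> \<in> U" if s: "\<sigma> \<in> \<Gamma>hat" "\<sigma> k = \<tau> k" for \<sigma>
    proof -
      have "\<sigma> i \<in> W i" for i
      proof (cases "W i = carrier (\<Delta> Mod core i)")
        case True
        then show ?thesis using s(1) by (simp add: profinite_def)
      next
        case False
        then have "i \<le> k" unfolding k_def using W(1) by (intro Max_ge) auto
        then have "\<sigma> i = \<tau> i" using hat_level_eq_le s \<open>\<tau> \<in> U\<close> V(2) by blast
        then show ?thesis using W(2) by auto
      qed
      then show ?thesis using W(3) V(2) s(1) by auto
    qed
    then show ?thesis by blast
  qed
  then show "U \<subseteq> \<Gamma>hat \<and> (\<forall>\<tau>\<in>U. \<exists>k. \<forall>\<sigma>\<in>\<Gamma>hat. \<sigma> k = \<tau> k \<longrightarrow> \<sigma> \<in> U)" using V(2) by blast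
next
  let ?P = "product_topology (\<lambda>n. discrete_topology (carrier (\<Delta> Mod core n))) UNIV"
  assume *: "U \<subseteq> \<Gamma>hat \<and> (\<forall>\<tau>\<in>U. \<exists>k. \<forall>\<sigma>\<in>\<Gamma>hat. \<sigma> k = \<tau> k \<longrightarrow> \<sigma> \<in> U)"
  have lev: "openin PT {\<sigma> \<in> \<Gamma>hat. \<sigma> k = C}" for k C
  proof -
    have "openin ?P {\<sigma> \<in> topspace ?P. \<sigma> k \<in> {C} \<inter> carrier (\<Delta> Mod core k)}"
      by (rule openin_continuous_map_preimage[OF continuous_map_product_projection]) auto
    moreover have "{\<sigma> \<in> \<Gamma>hat. \<sigma> k = C} = {\<sigma> \<in> topspace ?P. \<sigma> k \<in> {C} \<inter> carrier (\<Delta> Mod core k)} \<inter> \<Gamma>hat"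
      by (auto simp: profinite_def)
    ultimately show ?thesis unfolding profinite_topology_def openin_subtopology by blast
  qed
  show "openin PT U"
    unfolding openin_subopen[of PT U]
  proof
    fix \<tau> assume t: "\<tau> \<in> U"
    then obtain k where "\<forall>\<sigma>\<in>\<Gamma>hat. \<sigma> k = \<tau> k \<longrightarrow> \<sigma> \<in> U" using * by blast
    then show "\<exists>T. openin PT T \<and> \<tau> \<in> T \<and> T \<subseteq> U"
      using lev[of k "\<tau> k"] t * by (intro exI[of _ "{\<sigma> \<in> \<Gamma>hat. \<sigma> k = \<tau> k}"]) auto
  qed
qed

lemma openin_level: "openin PT {\<sigma> \<in> \<Gamma>hat. P (\<sigma> k)}"
  unfolding openin_PT by (auto intro!: exI[of _ k])

lemma Hausdorff_PT: "Hausdorff_space PT"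
  unfolding profinite_topology_def
  by (intro Hausdorff_space_subtopology) (simp add: Hausdorff_space_product_topology)

text \<open>The nested sequences form a closed subset of a product of finite discrete spaces.\<close>

lemma compact_PT: "compact_space PT"
proof -
  let ?P = "product_topology (\<lambda>n. discrete_topology (carrier (\<Delta> Mod core n))) UNIV"
  have "compact_space ?P"
    by (simp add: compact_space_product_topology compact_space_discrete_topology carrier_Mod_core finite_core_cosets)
  moreover have "closedin ?P \<Gamma>hat"
  proof -
    have "closedin ?P {\<tau> \<in> topspace ?P. \<tau> n \<subseteq> \<tau> m}" for n m
    proof -
      have "openin ?P {\<tau> \<in> topspace ?P. \<tau> n \<in> {A} \<inter> carrier (\<Delta> Mod core n)}" for n A
        by (rule openin_continuous_map_preimage[OF continuous_map_product_projection]) auto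
      then have "openin ?P {\<tau> \<in> topspace ?P. \<tau> n = A}" for n A
        by (rule back_subst[where P = "openin ?P"]) auto
      then have "openin ?P (\<Union>A B. if A \<subseteq> B then {} else {\<tau> \<in> topspace ?P. \<tau> n = A} \<inter> {\<tau> \<in> topspace ?P. \<tau> m = B})"
        by (intro openin_Union) auto
      moreover have "topspace ?P - {\<tau> \<in> topspace ?P. \<tau> n \<subseteq> \<tau> m} =
        (\<Union>A B. if A \<subseteq> B then {} else {\<tau> \<in> topspace ?P. \<tau> n = A} \<inter> {\<tau> \<in> topspace ?P. \<tau> m = B})"
        by (auto split: if_splits)
      ultimately show ?thesis by (simp add: closedin_def)
    qed
    then have "closedin ?P (\<Inter>p\<in>{(n, m). m \<le> n}. {\<tau> \<in> topspace ?P. \<tau> (fst p) \<subseteq> \<tau> (snd p)})"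
      by (intro closedin_Inter) auto
    moreover have "\<Gamma>hat = (\<Inter>p\<in>{(n, m). m \<le> n}. {\<tau> \<in> topspace ?P. \<tau> (fst p) \<subseteq> \<tau> (snd p)})"
    proof (rule Set.set_eqI)
      fix \<tau>
      have "\<tau> \<in> topspace ?P \<longleftrightarrow> (\<forall>n. \<exists>t\<in>\<Gamma>. \<tau> n = core n #> t)"
        by (simp add: carrier_Mod_core PiE_iff image_iff)
      then show "\<tau> \<in> \<Gamma>hat \<longleftrightarrow> \<tau> \<in> (\<Inter>p\<in>{(n, m). m \<le> n}. {\<tau> \<in> topspace ?P. \<tau> (fst p) \<subseteq> \<tau> (snd p)})"
        unfolding hat_iff by (simp add: split_paired_all) blast
    qed
    ultimately show ?thesis by simp
  qed
  ultimately show ?thesis unfolding profinite_topology_def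
    using closedin_compact_space compact_space_subtopology by blast
qed

lemma closure_iff:
  assumes "K \<subseteq> \<Gamma>"
  shows "\<tau> \<in> profinite_closure \<Delta> K \<longleftrightarrow> \<tau> \<in> \<Gamma>hat \<and> (\<forall>k. \<exists>x\<in>K. x \<in> \<tau> k)"
proof -
  have mem: "x \<in> \<tau> k \<longleftrightarrow> emb x k = \<tau> k" if "x \<in> \<Gamma>" "\<tau> \<in> \<Gamma>hat" for x \<tau> k
    using hat_level_eqI[OF emb_hat that(2) emb_mem, of x k] emb_mem[of x k] that by auto
  show ?thesis
  proof
    assume *: "\<tau> \<in> profinite_closure \<Delta> K"
    then have t: "\<tau> \<in> \<Gamma>hat" by (auto simp: profinite_closure_def in_closure_of)
    have "\<exists>x\<in>K. x \<in> \<tau> k" for k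
    proof -
      have "\<exists>y. y \<in> emb ` K \<and> y \<in> {\<sigma> \<in> \<Gamma>hat. \<sigma> k = \<tau> k}"
      proof -
        have "\<tau> \<in> PT closure_of (emb ` K)" using * by (simp add: profinite_closure_def)
        then have "\<forall>T. \<tau> \<in> T \<and> openin PT T \<longrightarrow> (\<exists>y. y \<in> emb ` K \<and> y \<in> T)"
          by (simp add: in_closure_of)
        then show ?thesis using openin_level[of "\<lambda>C. C = \<tau> k" k] t
            by (auto dest: spec[of _ "{\<sigma> \<in> \<Gamma>hat. \<sigma> k = \<tau> k}"])
      qed
      then obtain x where "x \<in> K" "emb x k = \<tau> k" by auto
      then show ?thesis using mem[OF _ t, of x k] assms by auto
    qed
    then show "\<tau> \<in> \<Gamma>hat \<and> (\<forall>k. \<exists>x\<in>K. x \<in> \<tau> k)" using t by blast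
  next
    assume *: "\<tau> \<in> \<Gamma>hat \<and> (\<forall>k. \<exists>x\<in>K. x \<in> \<tau> k)"
    show "\<tau> \<in> profinite_closure \<Delta> K"
      unfolding profinite_closure_def in_closure_of
    proof (intro conjI allI impI)
      fix T assume "\<tau> \<in> T \<and> openin PT T"
      then obtain k where k: "\<forall>\<sigma>\<in>\<Gamma>hat. \<sigma> k = \<tau> k \<longrightarrow> \<sigma> \<in> T" unfolding openin_PT by blast
      obtain x where x: "x \<in> K" "x \<in> \<tau> k" using * by blast
      then have "emb x \<in> T" using k mem[of x \<tau> k] assms * emb_hat by blast
      then show "\<exists>y. y \<in> emb ` K \<and> y \<in> T" using x by blast
    qed (use * in simp)
  qed
qed

lemma closure_core: "profinite_closure \<Delta> (core n) = {\<tau> \<in> \<Gamma>hat. \<tau> n = core n}"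
proof (rule Set.set_eqI)
  fix \<tau>
  have "(\<forall>k. \<exists>x\<in>core n. x \<in> \<tau> k) \<longleftrightarrow> \<tau> n = core n" if t: "\<tau> \<in> \<Gamma>hat"
  proof
    assume "\<forall>k. \<exists>x\<in>core n. x \<in> \<tau> k"
    then obtain x where x: "x \<in> core n" "x \<in> \<tau> n" by metis
    then show "\<tau> n = core n"
      using hat_mem(2)[OF t, of x n] coset_join2[OF _ core_subgroup, of x n] by simp
  next
    assume n: "\<tau> n = core n"
    show "\<forall>k. \<exists>x\<in>core n. x \<in> \<tau> k"
    proof
      fix k
      obtain x where "x \<in> \<tau> (max n k)" using hat_ex[OF t] by blast
      then have "x \<in> \<tau> n" "x \<in> \<tau> k"
        using hat_nested[OF t, of n "max n k" x] hat_nested[OF t, of k "max n k" x] by auto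
      then show "\<exists>x\<in>core n. x \<in> \<tau> k" using n by blast
    qed
  qed
  then show "\<tau> \<in> profinite_closure \<Delta> (core n) \<longleftrightarrow> \<tau> \<in> {\<tau> \<in> \<Gamma>hat. \<tau> n = core n}"
    using closure_iff[OF core_subset] by blast
qed

text \<open>As a union of cosets of \<open>core m\<close>, the subgroup \<open>K\<close> contains every coset of \<open>core m\<close> that it
  meets.\<close>

lemma closure_mem_level:
  assumes K: "subgroup K G" "K \<subseteq> \<Gamma>" "core m \<subseteq> K" and t: "\<tau> \<in> profinite_closure \<Delta> K" "x \<in> \<tau> m"
  shows "x \<in> K"
proof -
  have t': "\<tau> \<in> \<Gamma>hat" using t closure_iff[OF K(2)] by blast
  obtain y where y: "y \<in> K" "y \<in> \<tau> m" using t closure_iff[OF K(2)] by metis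
  then have "x \<otimes> inv y \<in> K" "x \<in> \<Gamma>" using hat_mem_iff[OF t' y(2)] t(2) K(3) by auto
  then have "(x \<otimes> inv y) \<otimes> y \<in> K" using subgroup.m_closed[OF K(1) _ y(1)] by simp
  then show ?thesis using \<open>x \<in> \<Gamma>\<close> y K(2) by (simp add: m_assoc subset_iff)
qed

end

section \<open>The upper half plane\<close>

interpretation PSL: group PSL2R
  by (rule group_PSL2R)

abbreviation "act \<equiv> PSL2R_act"
abbreviation "HH \<equiv> upper_half_plane"

lemma open_HH: "open HH"
  unfolding upper_half_plane_def by (rule open_halfspace_Im_gt)

lemma convex_HH: "convex HH"
  unfolding upper_half_plane_def by (rule convex_halfspace_Im_gt)

lemma connected_HH: "connected HH"
  by (rule convex_connected[OF convex_HH])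

lemma ii_HH [simp]: "\<i> \<in> HH"
  by (simp add: upper_half_plane_def)

lemma act_closed [simp]: "\<alpha> \<in> carrier PSL2R \<Longrightarrow> z \<in> HH \<Longrightarrow> act \<alpha> z \<in> HH"
  using group_action.element_image[OF group_action_PSL2R] by blast

lemma act_mult: "\<alpha> \<in> carrier PSL2R \<Longrightarrow> \<beta> \<in> carrier PSL2R \<Longrightarrow> z \<in> HH \<Longrightarrow>
    act (\<alpha> \<otimes>\<^bsub>PSL2R\<^esub> \<beta>) z = act \<alpha> (act \<beta> z)"
  using group_action.composition_rule[OF group_action_PSL2R] by blast

lemma act_one [simp]: "z \<in> HH \<Longrightarrow> act \<one>\<^bsub>PSL2R\<^esub> z = z"
  using group_action.id_eq_one[OF group_action_PSL2R] by (metis restrict_apply')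

lemma act_inv [simp]:
  "\<alpha> \<in> carrier PSL2R \<Longrightarrow> z \<in> HH \<Longrightarrow> act (inv\<^bsub>PSL2R\<^esub> \<alpha>) (act \<alpha> z) = z"
  "\<alpha> \<in> carrier PSL2R \<Longrightarrow> z \<in> HH \<Longrightarrow> act \<alpha> (act (inv\<^bsub>PSL2R\<^esub> \<alpha>) z) = z"
  using act_mult[of "inv\<^bsub>PSL2R\<^esub> \<alpha>" \<alpha> z] act_mult[of \<alpha> "inv\<^bsub>PSL2R\<^esub> \<alpha>" z] by simp_all

lemma act_matrix:
  assumes "a * d - b * c = 1"
  shows "\<exists>\<alpha>\<in>carrier PSL2R. \<forall>z\<in>HH. act \<alpha> z =
    (of_real a * z + of_real b) / (of_real c * z + of_real d)"
proof -
  define A :: "real^2^2" where "A = vector [vector [a, b], vector [c, d]]"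
  have e: "A$1$1 = a" "A$1$2 = b" "A$2$1 = c" "A$2$2 = d" by (simp_all add: A_def)
  have "det A = 1" using assms by (simp add: det_2 e)
  then have *: "{A, - A} \<in> carrier PSL2R" by (auto simp: carrier_PSL2R)
  then show ?thesis
    by (intro bexI[of _ "{A, - A}"] ballI) (auto simp: PSL2R_act_eq[of _ A] SL2_moebius_def moebius_def e)
qed

lemma act_cases:
  assumes "\<alpha> \<in> carrier PSL2R"
  shows "\<exists>A. \<alpha> = {A, - A} \<and>
    (\<forall>z\<in>HH. act \<alpha> z = (of_real (A$1$1) * z + of_real (A$1$2)) / (of_real (A$2$1) * z + of_real (A$2$2))) \<and>
    (\<forall>z\<in>HH. of_real (A$2$1) * z + of_real (A$2$2) \<noteq> (0::complex)) \<and>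
    A$1$1 * A$2$2 - A$1$2 * A$2$1 = 1 \<and>
    (\<forall>z\<in>HH. Im (act \<alpha> z) = Im z / (cmod (of_real (A$2$1) * z + of_real (A$2$2)))\<^sup>2)"
proof -
  obtain A where A: "\<alpha> = {A, - A}" "det A = 1" using assms by (auto simp: carrier_PSL2R)
  have d: "A$1$1 * A$2$2 - A$1$2 * A$2$1 = 1" using A(2) by (simp add: det_2)
  have 1: "act \<alpha> z = (of_real (A$1$1) * z + of_real (A$1$2)) / (of_real (A$2$1) * z + of_real (A$2$2))"
    if "z \<in> HH" for z
    using PSL2R_act_eq[OF assms _ that, of A] A by (simp add: SL2_moebius_def moebius_def)
  have 2: "Im (act \<alpha> z) = Im z / (cmod (of_real (A$2$1) * z + of_real (A$2$2)))\<^sup>2" if "z \<in> HH" for z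
  proof -
    have "Im (act \<alpha> z) = (A$1$1 * A$2$2 - A$1$2 * A$2$1) * Im z / (cmod (of_real (A$2$1) * z + of_real (A$2$2)))\<^sup>2"
      unfolding 1[OF that]
      by (simp add: Im_divide cmod_power2 divide_simps) (simp add: algebra_simps)
    then show ?thesis by (simp add: d)
  qed
  show ?thesis using A(1) 1 SL2_denominator_nonzero[OF A(2)] d 2 by (intro exI[of _ A]) simp
qed

lemma holomorphic_act:
  assumes "\<alpha> \<in> carrier PSL2R"
  shows "act \<alpha> holomorphic_on HH"
proof -
  obtain A :: "real^2^2" where A: "\<forall>z\<in>HH. act \<alpha> z = (of_real (A$1$1) * z + of_real (A$1$2)) / (of_real (A$2$1) * z + of_real (A$2$2))"
    "\<forall>z\<in>HH. of_real (A$2$1) * z + of_real (A$2$2) \<noteq> (0::complex)"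
    using act_cases[OF assms] by blast
  have "(\<lambda>z. (of_real (A$1$1) * z + of_real (A$1$2)) / (of_real (A$2$1) * z + of_real (A$2$2))) holomorphic_on HH"
    by (intro holomorphic_intros) (use A(2) in auto)
  then show ?thesis by (rule holomorphic_transform) (simp add: A(1))
qed

lemma continuous_on_act: "\<alpha> \<in> carrier PSL2R \<Longrightarrow> S \<subseteq> HH \<Longrightarrow> continuous_on S (act \<alpha>)"
  using holomorphic_act holomorphic_on_imp_continuous_on continuous_on_subset by blast

lemma act_image_eq:
  assumes "\<alpha> \<in> carrier PSL2R" "U \<subseteq> HH"
  shows "act \<alpha> ` U = {z \<in> HH. act (inv\<^bsub>PSL2R\<^esub> \<alpha>) z \<in> U}"
proof
  show "act \<alpha> ` U \<subseteq> {z \<in> HH. act (inv\<^bsub>PSL2R\<^esub> \<alpha>) z \<in> U}" using assms by auto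
  show "{z \<in> HH. act (inv\<^bsub>PSL2R\<^esub> \<alpha>) z \<in> U} \<subseteq> act \<alpha> ` U"
  proof
    fix z assume z: "z \<in> {z \<in> HH. act (inv\<^bsub>PSL2R\<^esub> \<alpha>) z \<in> U}"
    then have "z = act \<alpha> (act (inv\<^bsub>PSL2R\<^esub> \<alpha>) z)" using assms by simp
    then show "z \<in> act \<alpha> ` U" using z by blast
  qed
qed

lemma open_preimage_HH:
  assumes "continuous_on HH f" "open U"
  shows "open {z \<in> HH. f z \<in> U}"
  using continuous_open_preimage[OF assms(1) open_HH assms(2)] by (simp add: vimage_def Int_def)

lemma open_act_image:
  assumes "\<alpha> \<in> carrier PSL2R" "U \<subseteq> HH" "open U"
  shows "open (act \<alpha> ` U)"
  unfolding act_image_eq[OF assms(1,2)]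
  by (rule open_preimage_HH[OF continuous_on_act]) (use assms in auto)

subsection \<open>An invariant measure of displacement\<close>

text \<open>This is \<open>4 sinh\<^sup>2 (d / 2)\<close> for the hyperbolic distance \<open>d\<close>, and so invariant under \<open>PSL2R\<close>.\<close>

definition hyp :: "complex \<Rightarrow> complex \<Rightarrow> real" where
  "hyp z w = (cmod (z - w))\<^sup>2 / (Im z * Im w)"

lemma hyp_commute: "hyp z w = hyp w z"
  by (simp add: hyp_def norm_minus_commute mult.commute)

lemma hyp_act:
  assumes "\<alpha> \<in> carrier PSL2R" "z \<in> HH" "w \<in> HH"
  shows "hyp (act \<alpha> z) (act \<alpha> w) = hyp z w"
proof -
  obtain A :: "real^2^2" where A: "\<forall>z\<in>HH. act \<alpha> z = (of_real (A$1$1) * z + of_real (A$1$2)) / (of_real (A$2$1) * z + of_real (A$2$2))"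
    "\<forall>z\<in>HH. of_real (A$2$1) * z + of_real (A$2$2) \<noteq> (0::complex)"
    "A$1$1 * A$2$2 - A$1$2 * A$2$1 = 1"
    "\<forall>z\<in>HH. Im (act \<alpha> z) = Im z / (cmod (of_real (A$2$1) * z + of_real (A$2$2)))\<^sup>2"
    using act_cases[OF assms(1)] by blast
  note A = A[rule_format]
  define p where "p = of_real (A$2$1) * z + (of_real (A$2$2) :: complex)"
  define q where "q = of_real (A$2$1) * w + (of_real (A$2$2) :: complex)"
  have pq: "p \<noteq> 0" "q \<noteq> 0" using A(2) assms by (auto simp: p_def q_def)
  have "act \<alpha> z - act \<alpha> w = ((of_real (A$1$1) * z + of_real (A$1$2)) * q - (of_real (A$1$1) * w + of_real (A$1$2)) * p) / (p * q)"
    using A(1)[OF assms(2)] A(1)[OF assms(3)] pq by (simp add: p_def[symmetric] q_def[symmetric] diff_frac_eq)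
  also have "(of_real (A$1$1) * z + of_real (A$1$2)) * q - (of_real (A$1$1) * w + of_real (A$1$2)) * p
     = of_real (A$1$1 * A$2$2 - A$1$2 * A$2$1) * (z - w)"
    by (simp add: p_def q_def algebra_simps)
  finally have "act \<alpha> z - act \<alpha> w = (z - w) / (p * q)" using A(3) by simp
  then show ?thesis unfolding hyp_def A(4)[OF assms(2)] A(4)[OF assms(3)] p_def[symmetric] q_def[symmetric]
    using pq by (simp add: norm_divide norm_mult power_divide power_mult_distrib)
qed

text \<open>Near the diagonal the imaginary parts are comparable, so \<open>hyp\<close> controls the Euclidean
  distance.\<close>

lemma hyp_small:
  assumes "z \<in> HH" "w \<in> HH" "hyp z w < e" "e \<le> 1"
  shows "Im z < 3 * Im w" "Im w < 3 * Im z" "(cmod (z - w))\<^sup>2 \<le> 3 * e * (Im w)\<^sup>2"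
proof -
  have pos: "0 < Im z" "0 < Im w" using assms by (auto simp: upper_half_plane_def)
  have e: "(cmod (z - w))\<^sup>2 < e * (Im z * Im w)"
    using assms(3) pos by (simp add: hyp_def divide_simps)
  have e0: "0 < e"
  proof -
    have "0 \<le> hyp z w" using pos by (simp add: hyp_def)
    then show ?thesis using assms(3) by linarith
  qed
  have "(Im z - Im w)\<^sup>2 \<le> (cmod (z - w))\<^sup>2" by (simp add: cmod_power2)
  also have "\<dots> < e * (Im z * Im w)" by (rule e)
  also have "\<dots> \<le> Im z * Im w" using assms(4) pos by (simp add: mult_left_le_one_le)
  finally have *: "(Im z - Im w)\<^sup>2 < Im z * Im w" .
  have le: "a < 3 * b" if "0 < a" "0 < b" "(a - b)\<^sup>2 < a * b" for a b :: real
  proof (rule ccontr)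
    assume "\<not> a < 3 * b"
    then have ab: "3 * b \<le> a" by simp
    then have "a * b \<le> a * (a - 2 * b)" using that by (intro mult_left_mono) auto
    also have "\<dots> \<le> (a - b)\<^sup>2" by (simp add: power2_eq_square algebra_simps)
    finally show False using that by simp
  qed
  show 1: "Im z < 3 * Im w" using le[OF pos *] .
  show "Im w < 3 * Im z" using le[OF pos(2,1)] * by (simp add: power2_commute mult.commute)
  have "e * (Im z * Im w) \<le> e * ((3 * Im w) * Im w)"
    using e0 1 pos by (intro mult_left_mono mult_right_mono) auto
  then show "(cmod (z - w))\<^sup>2 \<le> 3 * e * (Im w)\<^sup>2" using e by (simp add: power2_eq_square)
qed

text \<open>A substitute for the triangle inequality, obtained from the one for the Euclidean distance.
  All imaginary parts are within a factor \<open>3\<close> of each other, which gives the constant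
  \<open>108 = 12 * 9\<close>.\<close>

lemma hyp_triangle:
  assumes "a \<in> HH" "b \<in> HH" "w \<in> HH" "hyp a w < e" "hyp b w < e" "e \<le> 1"
  shows "hyp a b \<le> 108 * e"
proof -
  have pos: "0 < Im a" "0 < Im b" "0 < Im w" using assms by (auto simp: upper_half_plane_def)
  note a = hyp_small[OF assms(1,3,4,6)] and b = hyp_small[OF assms(2,3,5,6)]
  have e0: "0 \<le> e" using assms(4) pos by (smt (verit) hyp_def divide_nonneg_nonneg mult_nonneg_nonneg zero_le_power2)
  have "cmod (a - b) \<le> cmod (a - w) + cmod (b - w)"
    by (metis norm_triangle_ineq4 diff_diff_eq2 diff_add_cancel)
  then have "(cmod (a - b))\<^sup>2 \<le> (cmod (a - w) + cmod (b - w))\<^sup>2" by (rule power_mono) simp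
  also have "\<dots> \<le> 2 * (cmod (a - w))\<^sup>2 + 2 * (cmod (b - w))\<^sup>2"
    using zero_le_power2[of "cmod (a - w) - cmod (b - w)"] by (simp add: power2_eq_square algebra_simps)
  also have "\<dots> \<le> 12 * e * (Im w)\<^sup>2" using a(3) b(3) by simp
  finally have n: "(cmod (a - b))\<^sup>2 \<le> 12 * e * (Im w)\<^sup>2" .
  have "Im w * Im w \<le> (3 * Im a) * (3 * Im b)" using a(2) b(2) pos by (intro mult_mono) auto
  then have "12 * e * (Im w)\<^sup>2 \<le> 12 * e * (9 * (Im a * Im b))"
    using e0 by (intro mult_left_mono) (auto simp: power2_eq_square)
  with n have "(cmod (a - b))\<^sup>2 \<le> 108 * e * (Im a * Im b)" by simp
  then show ?thesis using pos by (simp add: hyp_def divide_simps)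
qed

lemma null_of_linear_bound:
  fixes p c K :: real
  assumes "\<And>y. 0 < y \<Longrightarrow> \<bar>p - c * y\<^sup>2\<bar> \<le> K * y"
  shows "p = 0"
proof -
  have "((\<lambda>y. p - c * y\<^sup>2) \<longlongrightarrow> p - c * 0\<^sup>2) (at_right 0)" by (intro tendsto_intros)
  moreover have "((\<lambda>y. p - c * y\<^sup>2) \<longlongrightarrow> 0) (at_right 0)"
  proof (rule Lim_null_comparison)
    show "\<forall>\<^sub>F y in at_right 0. norm (p - c * y\<^sup>2) \<le> K * y"
      using assms by (auto simp: eventually_at_right_field intro!: exI[of _ 1])
    have "((\<lambda>y. K * y) \<longlongrightarrow> K * 0) (at_right 0)" by (intro tendsto_intros)
    then show "((\<lambda>y. K * y) \<longlongrightarrow> 0) (at_right 0)" by simp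
  qed
  ultimately show ?thesis using tendsto_unique[of "at_right (0::real)"] by fastforce
qed

text \<open>An isometry of bounded displacement fixes every boundary point. For a real \<open>x\<close> on the
  boundary, letting \<open>z\<close> tend to \<open>x\<close> in the bound forces the fixed point equation at \<open>x\<close>.\<close>

lemma bounded_displacement_trivial:
  assumes \<alpha>: "\<alpha> \<in> carrier PSL2R" and bd: "\<And>z. z \<in> HH \<Longrightarrow> hyp (act \<alpha> z) z \<le> B"
  shows "\<alpha> = \<one>\<^bsub>PSL2R\<^esub>"
proof -
  obtain A where A: "\<alpha> = {A, - A}" "\<forall>z\<in>HH. act \<alpha> z = (of_real (A$1$1) * z + of_real (A$1$2)) / (of_real (A$2$1) * z + of_real (A$2$2))"
    "\<forall>z\<in>HH. of_real (A$2$1) * z + of_real (A$2$2) \<noteq> (0::complex)"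
    "A$1$1 * A$2$2 - A$1$2 * A$2$1 = 1"
    "\<forall>z\<in>HH. Im (act \<alpha> z) = Im z / (cmod (of_real (A$2$1) * z + of_real (A$2$2)))\<^sup>2"
    using act_cases[OF \<alpha>] by blast
  note A = A[rule_format]
  define a b c d where abcd: "a = A$1$1" "b = A$1$2" "c = A$2$1" "d = A$2$2"
  \<comment> \<open>Multiplied by \<open>c x + d\<close>, the equation \<open>(a x + b) / (c x + d) = x\<close> covers the boundary point
    at infinity, too.\<close>
  have fix0: "c * x\<^sup>2 + (d - a) * x - b = 0" for x :: real
  proof (rule null_of_linear_bound)
    fix y :: real assume y: "0 < y"
    define z where "z = Complex x y"
    have z: "z \<in> HH" "Im z = y" using y by (auto simp: z_def upper_half_plane_def)
    define p where "p = of_real c * z + (of_real d :: complex)"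
    have p0: "p \<noteq> 0" using A(3)[OF z(1)] by (simp add: p_def abcd)
    define q where "q = of_real a * z + of_real b - z * p"
    have "act \<alpha> z = (of_real a * z + of_real b) / p"
      using A(2)[OF z(1)] by (simp add: p_def abcd)
    then have "act \<alpha> z - z = q / p" using p0 by (simp add: q_def diff_divide_distrib)
    then have "(cmod (act \<alpha> z - z))\<^sup>2 = (cmod q)\<^sup>2 / (cmod p)\<^sup>2" by (simp add: norm_divide power_divide)
    moreover have "Im (act \<alpha> z) = y / (cmod p)\<^sup>2" using A(5)[OF z(1)] z(2) by (simp add: p_def abcd)
    ultimately have "hyp (act \<alpha> z) z = (cmod q)\<^sup>2 / y\<^sup>2"
      using z(2) p0 y by (simp add: hyp_def power2_eq_square)
    then have "(cmod q)\<^sup>2 = hyp (act \<alpha> z) z * y\<^sup>2" using y by simp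
    also have "\<dots> \<le> B * y\<^sup>2" using bd[OF z(1)] by (rule mult_right_mono) simp
    also have "\<dots> \<le> (sqrt \<bar>B\<bar> * y)\<^sup>2" by (simp add: power_mult_distrib mult_right_mono)
    finally have q: "cmod q \<le> sqrt \<bar>B\<bar> * y" by (rule power2_le_imp_le) (use y in simp)
    have "\<bar>Re q\<bar> \<le> sqrt \<bar>B\<bar> * y" using abs_Re_le_cmod[of q] q by linarith
    moreover have "Re q = - (c * x\<^sup>2 + (d - a) * x - b - c * y\<^sup>2)"
      by (simp add: q_def p_def z_def power2_eq_square algebra_simps)
    ultimately show "\<bar>c * x\<^sup>2 + (d - a) * x - b - c * y\<^sup>2\<bar> \<le> sqrt \<bar>B\<bar> * y" by simp
  qed
  have "b = 0" using fix0[of 0] by simp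
  moreover have "c = 0" "d = a" using fix0[of 1] fix0[of "-1"] \<open>b = 0\<close> by auto
  moreover from this have "a * a = 1" using A(4) \<open>b = 0\<close> by (simp add: abcd[symmetric])
  ultimately have "A = mat 1 \<or> A = - mat 1"
    unfolding abcd by (auto simp: vec_eq_iff forall_2 mat_def square_eq_1_iff)
  then show ?thesis using A(1) by (auto simp: PSL2R_def)
qed

lemma hyp_self [simp]: "hyp z z = 0"
  by (simp add: hyp_def)

text \<open>An element with trivial action has displacement \<open>0\<close>.\<close>

lemma act_faithful:
  assumes "\<alpha> \<in> carrier PSL2R" "\<beta> \<in> carrier PSL2R" "\<And>z. z \<in> HH \<Longrightarrow> act \<alpha> z = act \<beta> z"
  shows "\<alpha> = \<beta>"
proof -
  have "inv\<^bsub>PSL2R\<^esub> \<beta> \<otimes>\<^bsub>PSL2R\<^esub> \<alpha> = \<one>\<^bsub>PSL2R\<^esub>"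
    by (rule bounded_displacement_trivial[where B = 0]) (use assms in \<open>auto simp: act_mult\<close>)
  then show ?thesis using assms(1,2) by (metis PSL.inv_closed PSL.inv_equality PSL.inv_inv)
qed

subsection \<open>Holomorphic automorphisms\<close>

lemma act_transitive:
  assumes "w \<in> HH"
  shows "\<exists>\<alpha>\<in>carrier PSL2R. act \<alpha> \<i> = w"
proof -
  define s where "s = sqrt (Im w)"
  have s: "0 < s" "s * s = Im w" using assms by (auto simp: s_def upper_half_plane_def)
  obtain \<alpha> where a: "\<alpha> \<in> carrier PSL2R" "\<forall>z\<in>HH. act \<alpha> z =
      (of_real s * z + of_real (Re w / s)) / (of_real 0 * z + of_real (1 / s))"
    using act_matrix[of s "1 / s" "Re w / s" 0] s by auto
  have "act \<alpha> \<i> = of_real (s * s) * \<i> + of_real (Re w)"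
    using bspec[OF a(2) ii_HH] s(1) by (simp add: distrib_right) 
  also have "\<dots> = w" by (simp add: s(2) complex_eq_iff)
  finally show ?thesis using a(1) by blast
qed

lemma cayley_inverse:
  assumes "w \<noteq> (1::complex)"
  shows "(\<i> * (1 + w) / (1 - w) - \<i>) / (\<i> * (1 + w) / (1 - w) + \<i>) = w"
proof -
  have "\<i> * (1 + w) / (1 - w) - \<i> = 2 * \<i> * w / (1 - w)" "\<i> * (1 + w) / (1 - w) + \<i> = 2 * \<i> / (1 - w)"
    using assms by (simp_all add: field_simps)
  then show ?thesis using assms by simp
qed

lemma cayley_HH: "z \<in> HH \<Longrightarrow> cmod ((z - \<i>) / (z + \<i>)) < 1" "z \<in> HH \<Longrightarrow> z + \<i> \<noteq> 0"
proof -
  assume z: "z \<in> HH"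
  have "(cmod (z - \<i>))\<^sup>2 < (cmod (z + \<i>))\<^sup>2"
    using z unfolding cmod_power2 by (simp add: upper_half_plane_def power2_eq_square algebra_simps)
  then have "cmod (z - \<i>) < cmod (z + \<i>)" using power_less_imp_less_base by fastforce
  moreover show "z + \<i> \<noteq> 0" using z by (auto simp: complex_eq_iff upper_half_plane_def)
  ultimately show "cmod ((z - \<i>) / (z + \<i>)) < 1" by (simp add: norm_divide divide_simps)
qed

lemma cayley_disc:
  assumes "cmod w < 1"
  shows "\<i> * (1 + w) / (1 - w) \<in> HH" "w \<noteq> 1"
proof -
  show w: "w \<noteq> 1" using assms by auto
  have "Im (\<i> * (1 + w) / (1 - w)) = (1 - (cmod w)\<^sup>2) / (cmod (1 - w))\<^sup>2"
    unfolding Im_divide cmod_power2 by (simp add: power2_eq_square algebra_simps)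
  also have "\<dots> > 0" using assms w by (simp add: power_less_one_iff abs_square_less_1)
  finally show "\<i> * (1 + w) / (1 - w) \<in> HH" by (simp add: upper_half_plane_def)
qed

lemma cayley_inverse':
  assumes "z \<in> HH"
  shows "\<i> * (1 + (z - \<i>) / (z + \<i>)) / (1 - (z - \<i>) / (z + \<i>)) = z"
proof -
  have z: "z + \<i> \<noteq> 0" using cayley_HH(2)[OF assms] .
  have "1 + (z - \<i>) / (z + \<i>) = 2 * z / (z + \<i>)" "1 - (z - \<i>) / (z + \<i>) = 2 * \<i> / (z + \<i>)"
    using z by (simp_all add: field_simps)
  then show ?thesis using z by simp
qed

text \<open>By the Schwarz lemma, applied to the map and to its inverse after a Cayley transform, an
  automorphism that fixes \<open>\<i>\<close> is a rotation about \<open>\<i>\<close>.\<close>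

lemma automorphism_fixing_ii:
  assumes hol: "h holomorphic_on HH" and bij: "bij_betw h HH HH" and fix_ii: "h \<i> = \<i>"
  shows "\<exists>\<alpha>\<in>carrier PSL2R. \<forall>z\<in>HH. h z = act \<alpha> z"
proof -
  \<comment> \<open>The Cayley transform to the unit disc, and its inverse.\<close>
  define c where "c z = (z - \<i>) / (z + \<i>)" for z :: complex
  define c' where "c' w = \<i> * (1 + w) / (1 - w)" for w :: complex
  have c: "c z \<in> ball 0 1" if "z \<in> HH" for z using cayley_HH(1)[OF that] by (simp add: c_def)
  have c': "c' w \<in> HH" if "w \<in> ball 0 1" for w using cayley_disc(1)[of w] that by (simp add: c'_def)
  have cc': "c (c' w) = w" if "w \<in> ball 0 1" for w
    using cayley_inverse[of w] cayley_disc(2)[of w] that by (simp add: c_def c'_def)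
  have c'c: "c' (c z) = z" if "z \<in> HH" for z using cayley_inverse'[OF that] by (simp add: c_def c'_def)
  have holc: "c holomorphic_on HH" unfolding c_def
    by (intro holomorphic_intros) (use cayley_HH(2) in auto)
  have holc': "c' holomorphic_on ball 0 1" unfolding c'_def
    by (intro holomorphic_intros) (use cayley_disc(2) in auto)
  have schwarz: "cmod (c (k (c' w))) \<le> cmod w"
      "cmod (c (k (c' w))) = cmod w \<Longrightarrow> w \<noteq> 0 \<Longrightarrow> \<exists>l. (\<forall>z. cmod z < 1 \<longrightarrow> c (k (c' z)) = l * z) \<and> cmod l = 1"
    if k: "k holomorphic_on HH" "\<And>z. z \<in> HH \<Longrightarrow> k z \<in> HH" "k \<i> = \<i>" and w: "cmod w < 1" for k w
  proof -
    have "(k \<circ> c') holomorphic_on ball 0 1"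
      by (rule holomorphic_on_compose_gen[OF holc' k(1)]) (use c' in auto)
    then have "(c \<circ> (k \<circ> c')) holomorphic_on ball 0 1"
      by (rule holomorphic_on_compose_gen[OF _ holc]) (use c' k(2) in auto)
    then have h: "(\<lambda>w. c (k (c' w))) holomorphic_on ball 0 1" by (simp add: o_def)
    have 0: "c (k (c' 0)) = 0" by (simp add: c'_def k(3) c_def)
    have n: "cmod (c (k (c' z))) < 1" if "cmod z < 1" for z using c[OF k(2)[OF c']] that by simp
    show "cmod (c (k (c' w))) \<le> cmod w" by (rule Schwarz_Lemma(1)[OF h 0 n w])
    show "\<exists>l. (\<forall>z. cmod z < 1 \<longrightarrow> c (k (c' z)) = l * z) \<and> cmod l = 1"
      if "cmod (c (k (c' w))) = cmod w" "w \<noteq> 0"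
      using Schwarz_Lemma(3)[OF h 0 n w] that w by blast
  qed
  have inj: "inj_on h HH" and im: "h ` HH = HH" using bij by (auto simp: bij_betw_def)
  obtain k where k: "k holomorphic_on h ` HH" "\<And>z. z \<in> HH \<Longrightarrow> k (h z) = z"
    using holomorphic_has_inverse[OF hol open_HH inj] by metis
  have kH: "k z \<in> HH" "h (k z) = z" if "z \<in> HH" for z
  proof -
    from that im obtain x where "x \<in> HH" "z = h x" by (metis imageE)
    then show "k z \<in> HH" "h (k z) = z" using k(2) by auto
  qed
  have k_ii: "k \<i> = \<i>" using k(2)[of \<i>] fix_ii by simp
  have hH: "h z \<in> HH" if "z \<in> HH" for z using im that by blast
  \<comment> \<open>Any nonzero point of the disc serves: the Schwarz lemma for the map and for its inverse gives
    equality at this point, hence a rotation.\<close>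
  define w :: complex where "w = 1/2"
  have w: "cmod w < 1" "w \<noteq> 0" by (auto simp: w_def)
  have "cmod (c (h (c' w))) \<le> cmod w" by (rule schwarz(1)[OF hol hH fix_ii w(1)])
  moreover have "cmod w \<le> cmod (c (h (c' w)))"
  proof -
    define v where "v = c (h (c' w))"
    have v: "v \<in> ball 0 1" unfolding v_def by (intro c hH c') (use w in simp)
    have "c' v = h (c' w)" unfolding v_def by (rule c'c[OF hH[OF c']]) (use w in simp)
    then have "c (k (c' v)) = w" using k(2)[OF c'] cc' w by simp
    moreover have "cmod (c (k (c' v))) \<le> cmod v"
      using schwarz(1)[of k v] k(1) im v kH(1) k_ii by simp
    ultimately show ?thesis by (simp add: v_def)
  qed
  ultimately have "cmod (c (h (c' w))) = cmod w" by simp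
  then obtain l where l: "\<And>z. cmod z < 1 \<Longrightarrow> c (h (c' z)) = l * z" "cmod l = 1"
    using schwarz(2)[OF hol hH fix_ii w(1) _ w(2)] by blast
  have chz: "c (h z) = l * c z" if "z \<in> HH" for z
    using l(1)[of "c z"] c[OF that] c'c[OF that] by simp
  \<comment> \<open>A rotation of the disc by the angle \<open>2 t\<close> is induced by the rotation matrix of the angle
    \<open>t\<close>.\<close>
  define t where "t = Arg l / 2"
  have "l = cis t * cis t"
    using l(2) rcis_cmod_Arg[of l] by (simp add: t_def cis_mult rcis_def)
  then have lt: "l = (of_real (cos t) + \<i> * of_real (sin t)) * (of_real (cos t) + \<i> * of_real (sin t))"
    by (simp add: cis_conv_exp exp_Euler cos_of_real sin_of_real)
  obtain \<alpha> where \<alpha>: "\<alpha> \<in> carrier PSL2R" "\<forall>z\<in>HH. act \<alpha> z =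
      (of_real (cos t) * z + of_real (sin t)) / (of_real (- sin t) * z + of_real (cos t))"
    using act_matrix[of "cos t" "cos t" "sin t" "- sin t"] by (auto simp: power2_eq_square[symmetric])
  have "h z = act \<alpha> z" if z: "z \<in> HH" for z
  proof -
    define C S where CS: "C = (of_real (cos t) :: complex)" "S = (of_real (sin t) :: complex)"
    have CS1: "C * C + S * S = 1"
      unfolding CS by (metis of_real_add of_real_mult of_real_1 power2_eq_square sin_cos_squared_add2)
    define m where "m = act \<alpha> z"
    define q where "q = - S * z + C"
    have m: "m \<in> HH" using \<alpha>(1) z by (simp add: m_def)
    have unit: "(C + \<i> * S) * (C - \<i> * S) = 1" using CS1 by (simp add: algebra_simps)
    have q0: "q \<noteq> 0"
    proof
      assume "q = 0"
      then have "m = 0" using \<alpha>(2) z by (simp add: m_def q_def CS)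
      then show False using m by (simp add: upper_half_plane_def)
    qed
    have "m = (C * z + S) / q" using \<alpha>(2) z by (simp add: m_def q_def CS)
    then have "m - \<i> = (C * z + S - \<i> * q) / q" "m + \<i> = (C * z + S + \<i> * q) / q"
      using q0 by (simp_all add: field_simps)
    then have "c m = (C * z + S - \<i> * q) / (C * z + S + \<i> * q)"
      using q0 by (simp add: c_def)
    also have "C * z + S - \<i> * q = (C + \<i> * S) * (z - \<i>)" by (simp add: q_def algebra_simps)
    also have "C * z + S + \<i> * q = (C - \<i> * S) * (z + \<i>)" by (simp add: q_def algebra_simps)
    also have "(C + \<i> * S) * (z - \<i>) / ((C - \<i> * S) * (z + \<i>)) = (C + \<i> * S) * (C + \<i> * S) * c z"
    proof -
      have "C - \<i> * S \<noteq> 0" using unit by auto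
      then have "1 / (C - \<i> * S) = C + \<i> * S" using unit by (simp add: field_simps)
      then show ?thesis unfolding c_def by (metis (no_types, opaque_lifting) mult.assoc mult.commute times_divide_eq_left times_divide_times_eq mult.left_commute div_by_1 mult_1)
    qed
    also have "\<dots> = c (h z)" using chz[OF z] lt by (simp add: CS)
    finally have "c m = c (h z)" .
    then have "m = h z" using c'c[OF m] c'c[OF hH[OF z]] by metis
    then show ?thesis by (simp add: m_def)
  qed
  then show ?thesis using \<alpha>(1) by blast
qed

text \<open>Composition with an element of \<open>PSL2R\<close> that moves \<open>f \<i>\<close> back to \<open>\<i>\<close> reduces this to the case
  of a fixed point.\<close>

lemma automorphism_HH:
  assumes hol: "f holomorphic_on HH" and bij: "bij_betw f HH HH"
  shows "\<exists>\<alpha>\<in>carrier PSL2R. \<forall>z\<in>HH. f z = act \<alpha> z"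
proof -
  have fH: "f z \<in> HH" if "z \<in> HH" for z using bij that by (auto simp: bij_betw_def)
  obtain \<beta> where b: "\<beta> \<in> carrier PSL2R" "act \<beta> \<i> = f \<i>" using act_transitive[OF fH[OF ii_HH]] by auto
  let ?b' = "inv\<^bsub>PSL2R\<^esub> \<beta>"
  have b': "?b' \<in> carrier PSL2R" using b by simp
  have "bij_betw (act ?b') HH HH"
    by (rule bij_betwI[where g = "act \<beta>"]) (use b in auto)
  then have "bij_betw (act ?b' \<circ> f) HH HH" using bij bij_betw_trans by blast
  moreover have "(act ?b' \<circ> f) holomorphic_on HH"
    by (rule holomorphic_on_compose_gen[OF hol holomorphic_act[OF b']]) (use fH in auto)
  moreover have "(act ?b' \<circ> f) \<i> = \<i>" using b by (simp flip: b(2))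
  ultimately obtain \<alpha> where a: "\<alpha> \<in> carrier PSL2R" "\<forall>z\<in>HH. (act ?b' \<circ> f) z = act \<alpha> z"
    using automorphism_fixing_ii by blast
  have "f z = act (\<beta> \<otimes>\<^bsub>PSL2R\<^esub> \<alpha>) z" if "z \<in> HH" for z
  proof -
    have "act ?b' (f z) = act \<alpha> z" using a(2) that by simp
    then have "act \<beta> (act \<alpha> z) = f z" using act_inv(2)[OF b(1) fH[OF that]] by simp
    then show ?thesis using a(1) b(1) that by (simp add: act_mult)
  qed
  then show ?thesis using a(1) b(1) by blast
qed

section \<open>Discrete cocompact groups\<close>

lemma norm_le_entries:
  fixes A :: "real^2^2"
  shows "norm A \<le> \<bar>A$1$1\<bar> + \<bar>A$1$2\<bar> + \<bar>A$2$1\<bar> + \<bar>A$2$2\<bar>"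
proof -
  have "norm A \<le> norm (A$1) + norm (A$2)"
    using L2_set_le_sum[of UNIV "\<lambda>i. norm (A$i)"] by (simp add: norm_vec_def sum_2)
  moreover have "norm (A$i) \<le> \<bar>A$i$1\<bar> + \<bar>A$i$2\<bar>" for i
    using norm_le_l1_cart[of "A$i"] by (simp add: sum_2)
  ultimately show ?thesis using add_mono by (smt (verit))
qed

lemma entry_le_norm: "\<bar>(A :: real^2^2)$i$j\<bar> \<le> norm A"
  using component_le_norm_cart[of "A$i" j] Finite_Cartesian_Product.norm_nth_le[of A i] by linarith

text \<open>Discreteness is given for the quotient \<open>PSL2R\<close>. An open set that isolates the identity there
  pulls back to a neighbourhood of both matrices that represent it, and a ball of radius at most
  \<open>1\<close> about one excludes the other.\<close>

lemma discrete_isolated: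
  assumes sub: "subgroup \<Gamma> PSL2R"
    and disc: "subtopology PSL2R_topology \<Gamma> = discrete_topology \<Gamma>"
  shows "\<exists>e>0. \<forall>A. det A = 1 \<and> {A, - A} \<in> \<Gamma> \<and> norm (A - mat 1) < e \<longrightarrow> A = mat 1"
proof -
  let ?cls = "\<lambda>A. {mat 1, - mat 1} #>\<^bsub>SL2R\<^esub> A"
  have cls: "?cls A = {A, - A}" for A
    by (auto simp: r_coset_def SL2R_def uminus_matrix_mult)
  have one: "\<one>\<^bsub>PSL2R\<^esub> = {mat 1, - mat 1}" by (simp add: PSL2R_def)
  have "openin (subtopology PSL2R_topology \<Gamma>) {\<one>\<^bsub>PSL2R\<^esub>}"
    using disc subgroup.one_closed[OF sub] by simp
  then obtain U where U: "openin PSL2R_topology U" "{\<one>\<^bsub>PSL2R\<^esub>} = U \<inter> \<Gamma>"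
    by (auto simp: openin_subtopology)
  have "openin (top_of_set (carrier SL2R)) {A \<in> carrier SL2R. ?cls A \<in> U}"
    using U(1) unfolding PSL2R_topology_def openin_quotient_topology by simp
  moreover have "mat 1 \<in> {A \<in> carrier SL2R. ?cls A \<in> U}"
  proof -
    have "?cls (mat 1) = \<one>\<^bsub>PSL2R\<^esub>" unfolding cls one ..
    moreover have "\<one>\<^bsub>PSL2R\<^esub> \<in> U" using U(2) by blast
    moreover have "mat 1 \<in> carrier SL2R" by (simp add: SL2R_def)
    ultimately show ?thesis by simp
  qed
  ultimately obtain e where e: "0 < e" "\<forall>A\<in>carrier SL2R. dist A (mat 1) < e \<longrightarrow> A \<in> {A \<in> carrier SL2R. ?cls A \<in> U}"
    unfolding openin_euclidean_subtopology_iff by blast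
  have "A = mat 1" if A: "det A = 1" "{A, - A} \<in> \<Gamma>" "norm (A - mat 1) < min e 1" for A :: "real^2^2"
  proof -
    have "A \<in> carrier SL2R" using A(1) by (simp add: SL2R_def)
    then have "?cls A \<in> U" using e(2) A(3) by (auto simp: dist_norm)
    then have "{A, - A} \<in> U" unfolding cls .
    then have "{A, - A} \<in> {\<one>\<^bsub>PSL2R\<^esub>}" unfolding U(2) using A(2) by simp
    then have "{A, - A} = {mat 1, - mat 1}" unfolding one by simp
    moreover have "A \<noteq> - mat 1"
    proof
      assume "A = - mat 1"
      then have "(A - mat 1)$1$1 = - 2" by (simp add: mat_def)
      then show False using entry_le_norm[of "A - mat 1" 1 1] A(3) by simp
    qed
    ultimately show ?thesis by blast
  qed
  then show ?thesis using e(1) by (intro exI[of _ "min e 1"]) auto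
qed

text \<open>From \<open>Im (A z) = Im z / \<bar>c z + d\<bar>\<^sup>2\<close> one bounds \<open>c z + d\<close>, hence the lower row of \<open>A\<close>. Then
  \<open>a z + b = (A z) (c z + d)\<close> bounds the upper row.\<close>

lemma bounded_of_meets_compact:
  assumes K: "compact K" "K \<subseteq> HH"
  shows "\<exists>B. \<forall>A z. det A = 1 \<and> z \<in> K \<and> SL2_moebius A z \<in> K \<longrightarrow> (\<forall>i j. \<bar>A$i$j\<bar> \<le> B)"
proof (cases "K = {}")
  case False
  obtain M where M: "\<And>z. z \<in> K \<Longrightarrow> cmod z \<le> M"
    using compact_imp_bounded[OF K(1)] unfolding bounded_iff by blast
  have "continuous_on K Im" by (intro continuous_intros)
  then obtain z0 where z0: "z0 \<in> K" "\<And>z. z \<in> K \<Longrightarrow> Im z0 \<le> Im z"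
    using continuous_attains_inf[OF K(1) False] by blast
  define m where "m = Im z0"
  have m: "0 < m" "\<And>z. z \<in> K \<Longrightarrow> m \<le> Im z" using z0 K(2) by (auto simp: m_def upper_half_plane_def)
  have M0: "0 < M" using M[OF z0(1)] m(1) abs_Im_le_cmod[of z0] by (simp add: m_def)
  define R where "R = sqrt (M / m)"
  have R0: "0 \<le> R" using M0 m by (simp add: R_def)
  have lin: "\<bar>p\<bar> \<le> T / m \<and> \<bar>q\<bar> \<le> T + T / m * M"
    if z: "z \<in> K" and T: "cmod (of_real p * z + of_real q) \<le> T" for p q T z
  proof -
    have "\<bar>p\<bar> * Im z \<le> T"
      using abs_Im_le_cmod[of "of_real p * z + of_real q"] T m(2)[OF z] m(1) by (simp add: abs_mult)
    moreover have "\<bar>p\<bar> * m \<le> \<bar>p\<bar> * Im z" using m(2)[OF z] by (simp add: mult_left_mono)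
    ultimately have p: "\<bar>p\<bar> \<le> T / m" using m(1) by (simp add: pos_le_divide_eq)
    have "\<bar>q\<bar> = cmod ((of_real p * z + of_real q) - of_real p * z)" by simp
    also have "\<dots> \<le> T + \<bar>p\<bar> * cmod z" using norm_triangle_ineq4 T by (smt (verit) norm_mult norm_of_real)
    also have "\<dots> \<le> T + T / m * M" using p M[OF z] by (intro add_left_mono mult_mono) auto
    finally show ?thesis using p by simp
  qed
  define B where "B = Max {R / m, R + R / m * M, M * R / m, M * R + M * R / m * M}"
  have "\<bar>A$i$j\<bar> \<le> B" if A: "det A = 1" "z \<in> K" "SL2_moebius A z \<in> K" for A :: "real^2^2" and z i j
  proof -
    have zH: "z \<in> HH" using A(2) K(2) by blast
    define p where "p = of_real (A$2$1) * z + (of_real (A$2$2) :: complex)"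
    have p0: "p \<noteq> 0" using SL2_denominator_nonzero[OF A(1) zH] by (simp add: p_def)
    define w where "w = SL2_moebius A z"
    have w: "w * p = of_real (A$1$1) * z + of_real (A$1$2)"
      using p0 by (simp add: w_def SL2_moebius_def moebius_def p_def)
    have "Im w = (A$1$1 * A$2$2 - A$1$2 * A$2$1) * Im z / (cmod p)\<^sup>2"
      unfolding w_def SL2_moebius_def moebius_def p_def
      by (simp add: Im_divide cmod_power2 divide_simps) (simp add: algebra_simps)
    then have "Im w * (cmod p)\<^sup>2 = Im z" using A(1) p0 by (simp add: det_2)
    then have "m * (cmod p)\<^sup>2 \<le> M"
      using m(2)[OF A(3)] M[OF A(2)] abs_Im_le_cmod[of z]
      by (smt (verit) mult_right_mono w_def zero_le_power2)
    then have "(cmod p)\<^sup>2 \<le> M / m" using m(1) by (simp add: pos_le_divide_eq mult.commute)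
    then have pR: "cmod p \<le> R" unfolding R_def by (rule real_le_rsqrt)
    have "cmod (w * p) \<le> M * R"
      unfolding norm_mult using M[OF A(3)] pR M0 by (intro mult_mono) (auto simp: w_def)
    then have 1: "\<bar>A$1$1\<bar> \<le> M * R / m \<and> \<bar>A$1$2\<bar> \<le> M * R + M * R / m * M"
      using lin[OF A(2)] unfolding w by blast
    have 2: "\<bar>A$2$1\<bar> \<le> R / m \<and> \<bar>A$2$2\<bar> \<le> R + R / m * M"
      using lin[OF A(2)] pR unfolding p_def by blast
    have B: "R / m \<le> B" "R + R / m * M \<le> B" "M * R / m \<le> B" "M * R + M * R / m * M \<le> B"
      by (auto simp: B_def)
    have "\<forall>i j. \<bar>A$i$j\<bar> \<le> B" unfolding forall_2 using 1 2 B by linarith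
    then show ?thesis by blast
  qed
  then show ?thesis by blast
qed auto

text \<open>Two nearby matrices \<open>A\<close>, \<open>A'\<close> in a bounded set have \<open>A\<^sup>-\<^sup>1 A'\<close> near the identity. Hence the
  matrices that represent a discrete group have no accumulation point.\<close>

lemma properly_discontinuous:
  assumes sub: "subgroup \<Gamma> PSL2R"
    and disc: "subtopology PSL2R_topology \<Gamma> = discrete_topology \<Gamma>"
    and K: "compact K" "K \<subseteq> HH"
  shows "finite {\<gamma> \<in> \<Gamma>. \<exists>z\<in>K. act \<gamma> z \<in> K}"
proof -
  interpret sub: subgroup \<Gamma> PSL2R by fact
  define S where "S = {A. det A = 1 \<and> {A, - A} \<in> \<Gamma> \<and> (\<exists>z\<in>K. SL2_moebius A z \<in> K)}"
  obtain B0 where B0: "\<forall>A z. det A = 1 \<and> z \<in> K \<and> SL2_moebius A z \<in> K \<longrightarrow> (\<forall>i j. \<bar>A$i$j\<bar> \<le> B0)"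
    using bounded_of_meets_compact[OF K] by blast
  define B where "B = max B0 1"
  have B: "\<bar>A$i$j\<bar> \<le> B" if "A \<in> S" for A i j
  proof -
    have "\<bar>A$i$j\<bar> \<le> B0" using that B0 unfolding S_def by blast
    then show ?thesis by (simp add: B_def)
  qed
  have B1: "1 \<le> B" by (simp add: B_def)
  obtain e where e: "0 < e" "\<forall>A. det A = 1 \<and> {A, - A} \<in> \<Gamma> \<and> norm (A - mat 1) < e \<longrightarrow> A = mat 1"
    using discrete_isolated[OF sub disc] by blast
  have near: "A = A'" if A: "A \<in> S" "A' \<in> S" "norm (A' - A) < e / (8 * B)" for A A'
  proof -
    \<comment> \<open>The inverse of \<open>A\<close>; its entries are those of \<open>A\<close> up to sign, so they obey the same bound.\<close>
    define D :: "real^2^2" where "D = vector [vector [A$2$2, - A$1$2], vector [- A$2$1, A$1$1]]"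
    have D: "D$1$1 = A$2$2" "D$1$2 = - A$1$2" "D$2$1 = - A$2$1" "D$2$2 = A$1$1"
      by (simp_all add: D_def)
    have dA: "A$1$1 * A$2$2 - A$1$2 * A$2$1 = 1" "det A = 1" "det A' = 1" "{A, - A} \<in> \<Gamma>" "{A', - A'} \<in> \<Gamma>"
      using A by (auto simp: S_def det_2)
    have detD: "det D = 1" using dA(1) by (simp add: det_2 D algebra_simps)
    have AD: "A ** D = mat 1" "D ** A = mat 1"
      using dA(1) by (auto simp: vec_eq_iff forall_2 matrix_matrix_mult_def sum_2 D mat_def algebra_simps)
    have in_PSL: "{X, - X} \<otimes>\<^bsub>PSL2R\<^esub> {Y, - Y} = {X ** Y, - (X ** Y)}" for X Y :: "real^2^2"
      by (auto simp: PSL2R_def set_mult_def SL2R_def uminus_matrix_mult)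
    have "{D, - D} \<otimes>\<^bsub>PSL2R\<^esub> {A, - A} = \<one>\<^bsub>PSL2R\<^esub>" unfolding in_PSL AD by (simp add: PSL2R_def)
    then have "{D, - D} = inv\<^bsub>PSL2R\<^esub> {A, - A}"
      using PSL.inv_equality[of "{D, - D}" "{A, - A}"] dA detD sub.mem_carrier
      by (auto simp: carrier_PSL2R)
    then have DG: "{D, - D} \<in> \<Gamma>" using dA(4) by simp
    have "{D ** A', - (D ** A')} \<in> \<Gamma>" unfolding in_PSL[symmetric] using DG dA(5) by (rule sub.m_closed)
    moreover have "det (D ** A') = 1" using detD dA by (simp add: det_mul)
    moreover have "norm (D ** A' - mat 1) < e"
    proof -
      define E where "E = A' - A"
      have "D ** A' - mat 1 = D ** E"
        unfolding E_def AD(2)[symmetric]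
        by (simp add: vec_eq_iff matrix_matrix_mult_def sum_2 algebra_simps)
      moreover have "\<bar>(D ** E)$i$j\<bar> \<le> 2 * B * norm E" for i j
      proof -
        have "\<bar>D$i$k * E$k$j\<bar> \<le> B * norm E" for k
        proof -
          have "\<forall>i k. \<bar>D$i$k\<bar> \<le> B" unfolding forall_2 using B[OF A(1)] by (simp add: D)
          then show ?thesis unfolding abs_mult using entry_le_norm[of E k j] B1 by (intro mult_mono) auto
        qed
        from this[of 1] this[of 2] show ?thesis by (simp add: matrix_matrix_mult_def sum_2)
      qed
      from this[of 1 1] this[of 1 2] this[of 2 1] this[of 2 2]
      have "norm (D ** E) \<le> 8 * B * norm E" using norm_le_entries[of "D ** E"] by linarith
      moreover have "8 * B * norm E < e" using A(3) B1 by (simp add: E_def pos_less_divide_eq mult.commute)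
      ultimately show ?thesis by simp
    qed
    ultimately have "D ** A' = mat 1" using e(2) by blast
    then have "A ** (D ** A') = A" by simp
    then show "A = A'" by (simp add: matrix_mul_assoc AD(1))
  qed
  have "finite S"
  proof (rule ccontr)
    assume inf: "infinite S"
    have "norm A \<le> 4 * B" if "A \<in> S" for A
      using norm_le_entries[of A] B[OF that, of 1 1] B[OF that, of 1 2] B[OF that, of 2 1] B[OF that, of 2 2]
      by linarith
    then have "bounded S" unfolding bounded_iff by blast
    then obtain L where "L islimpt S" using inf bounded_infinite_imp_islimpt[of S S] by auto
    define r where "r = e / (16 * B)"
    have r: "0 < r" using e(1) B1 by (simp add: r_def)
    have "infinite (S \<inter> ball L r)" using \<open>L islimpt S\<close> r by (simp add: islimpt_eq_infinite_ball)
    then obtain A where A: "A \<in> S \<inter> ball L r" by (metis all_not_in_conv finite.emptyI)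
    have "S \<inter> ball L r \<subseteq> {A}"
    proof
      fix A' assume A': "A' \<in> S \<inter> ball L r"
      have "dist A' A \<le> dist L A' + dist L A" using dist_triangle2[of A' A L] by (simp add: dist_commute)
      moreover have "dist L A' < r" "dist L A < r" using A A' by auto
      ultimately have "dist A' A < 2 * r" by linarith
      then have "norm (A' - A) < e / (8 * B)" by (simp add: dist_norm r_def)
      then show "A' \<in> {A}" using near A A' by auto
    qed
    then show False using \<open>infinite (S \<inter> ball L r)\<close> finite_subset by blast
  qed
  moreover have "{\<gamma> \<in> \<Gamma>. \<exists>z\<in>K. act \<gamma> z \<in> K} \<subseteq> (\<lambda>A. {A, - A}) ` S"
  proof
    fix \<gamma> assume *: "\<gamma> \<in> {\<gamma> \<in> \<Gamma>. \<exists>z\<in>K. act \<gamma> z \<in> K}"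
    then obtain z where z: "z \<in> K" "act \<gamma> z \<in> K" by blast
    have g: "\<gamma> \<in> carrier PSL2R" using * by auto
    then obtain A where A: "det A = 1" "\<gamma> = {A, - A}" by (auto simp: carrier_PSL2R)
    then have "act \<gamma> z = SL2_moebius A z" using PSL2R_act_eq[OF g] z K(2) by auto
    then show "\<gamma> \<in> (\<lambda>A. {A, - A}) ` S" using A z * by (auto simp: S_def)
  qed
  ultimately show ?thesis using finite_subset by blast
qed

lemma PSL2R_orbit_eq: "PSL2R_orbit L z = (\<lambda>g. act g z) ` L"
  by (auto simp: PSL2R_orbit_def orbit_def)

lemma orbit_self:
  assumes "subgroup L PSL2R" "z \<in> HH"
  shows "z \<in> PSL2R_orbit L z"
  unfolding PSL2R_orbit_eq using act_one[OF assms(2)] subgroup.one_closed[OF assms(1)] by (metis image_eqI)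

lemma mem_orbit_iff:
  assumes L: "subgroup L PSL2R" and z: "z \<in> HH" and w: "w \<in> HH"
  shows "w \<in> PSL2R_orbit L z \<longleftrightarrow> PSL2R_orbit L w = PSL2R_orbit L z"
proof
  interpret L: subgroup L PSL2R by fact
  assume "w \<in> PSL2R_orbit L z"
  then obtain g where g: "g \<in> L" "w = act g z" by (auto simp: PSL2R_orbit_eq)
  show "PSL2R_orbit L w = PSL2R_orbit L z" unfolding PSL2R_orbit_eq
  proof
    show "(\<lambda>h. act h w) ` L \<subseteq> (\<lambda>h. act h z) ` L"
    proof clarify
      fix h assume h: "h \<in> L"
      then have "act h w = act (h \<otimes>\<^bsub>PSL2R\<^esub> g) z" using g z by (simp add: act_mult)
      then show "act h w \<in> (\<lambda>h. act h z) ` L"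
        using h g(1) by (intro image_eqI[of _ _ "h \<otimes>\<^bsub>PSL2R\<^esub> g"]) simp_all
    qed
    show "(\<lambda>h. act h z) ` L \<subseteq> (\<lambda>h. act h w) ` L"
    proof clarify
      fix h assume h: "h \<in> L"
      then have "act h z = act (h \<otimes>\<^bsub>PSL2R\<^esub> inv\<^bsub>PSL2R\<^esub> g) w" using g z by (simp add: act_mult)
      then show "act h z \<in> (\<lambda>h. act h w) ` L"
        using h g(1) by (intro image_eqI[of _ _ "h \<otimes>\<^bsub>PSL2R\<^esub> inv\<^bsub>PSL2R\<^esub> g"]) simp_all
    qed
  qed
next
  assume "PSL2R_orbit L w = PSL2R_orbit L z"
  then show "w \<in> PSL2R_orbit L z" using orbit_self[OF L w] by simp
qed

lemma orbit_subset_HH: "L \<subseteq> carrier PSL2R \<Longrightarrow> z \<in> HH \<Longrightarrow> PSL2R_orbit L z \<subseteq> HH"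
  by (auto simp: PSL2R_orbit_eq)

lemma topspace_orbit_space: "topspace (orbit_space L) = PSL2R_orbit L ` HH"
  by (simp add: orbit_space_def)

lemma quotient_map_orbit: "quotient_map (top_of_set HH) (orbit_space L) (PSL2R_orbit L)"
  unfolding orbit_space_def by (rule quotient_map_quotient_topology)

lemma continuous_map_orbit: "continuous_map (top_of_set HH) (orbit_space L) (PSL2R_orbit L)"
  by (rule quotient_imp_continuous_map[OF quotient_map_orbit])

text \<open>The preimage of the image of \<open>U\<close> is the union of the translates of \<open>U\<close>.\<close>

lemma openin_orbit_image:
  assumes L: "subgroup L PSL2R" and U: "open U" "U \<subseteq> HH"
  shows "openin (orbit_space L) (PSL2R_orbit L ` U)"
proof -
  interpret L: subgroup L PSL2R by fact
  have "{x \<in> HH. PSL2R_orbit L x \<in> PSL2R_orbit L ` U} = (\<Union>g\<in>L. act g ` U)"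
  proof (rule Set.set_eqI)
    fix x
    have "x \<in> HH \<and> PSL2R_orbit L x = PSL2R_orbit L u \<longleftrightarrow> (\<exists>g\<in>L. x = act g u)" if "u \<in> U" for u
      using mem_orbit_iff[OF L, of u x] orbit_subset_HH[OF L.subset, of u] that U(2)
      by (auto simp: PSL2R_orbit_eq)
    then show "x \<in> {x \<in> HH. PSL2R_orbit L x \<in> PSL2R_orbit L ` U} \<longleftrightarrow> x \<in> (\<Union>g\<in>L. act g ` U)"
      by blast
  qed
  moreover have "open (\<Union>g\<in>L. act g ` U)" using open_act_image[OF _ U(2,1)] by auto
  ultimately show ?thesis
    unfolding orbit_space_def openin_quotient_topology
    using U(2) open_HH by (auto simp: openin_open_eq)
qed

text \<open>An index that is locally constant on \<open>HH\<close> is constant. This applies whenever an element of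
  \<open>\<Gamma>\<close>, or a level of an element of the completion, is determined near each point.\<close>

lemma connected_HH_selects:
  assumes op: "\<And>i. i \<in> I \<Longrightarrow> open (S i)" and cov: "HH \<subseteq> (\<Union>i\<in>I. S i)"
    and disj: "\<And>i j z. i \<in> I \<Longrightarrow> j \<in> I \<Longrightarrow> z \<in> HH \<Longrightarrow> z \<in> S i \<Longrightarrow> z \<in> S j \<Longrightarrow> i = j"
  shows "\<exists>i\<in>I. HH \<subseteq> S i"
proof -
  obtain i where i: "i \<in> I" "\<i> \<in> S i" using cov ii_HH by blast
  define T where "T = (\<Union>j\<in>I - {i}. S j)"
  have "open T" unfolding T_def using op by blast
  moreover have "S i \<inter> T \<inter> HH = {}" using disj i(1) unfolding T_def by blast
  moreover have "HH \<subseteq> S i \<union> T" using cov unfolding T_def by blast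
  moreover have "S i \<inter> HH \<noteq> {}" using i by auto
  ultimately have "T \<inter> HH = {}" using connectedD[OF connected_HH op[OF i(1)]] by blast
  then show ?thesis using \<open>HH \<subseteq> S i \<union> T\<close> i(1) by blast
qed

locale fuchsian =
  fixes \<Gamma> :: "(real^2^2) set set"
  assumes fuchsian: "fuchsian_surface_group \<Gamma>"
begin

lemma sub_PSL: "subgroup \<Gamma> PSL2R"
  using fuchsian by (simp add: fuchsian_surface_group_def)

sublocale \<Gamma>: subgroup \<Gamma> PSL2R
  by (rule sub_PSL)

lemma finite_returns: "compact K \<Longrightarrow> K \<subseteq> HH \<Longrightarrow> finite {\<gamma> \<in> \<Gamma>. \<exists>z\<in>K. act \<gamma> z \<in> K}"
  by (rule properly_discontinuous[OF sub_PSL]) (use fuchsian in \<open>simp_all add: fuchsian_surface_group_def\<close>)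

text \<open>Point stabilisers are finite, and a torsion-free finite group is trivial.\<close>

lemma free:
  assumes g: "\<gamma> \<in> \<Gamma>" and z: "z \<in> HH" and fix_z: "act \<gamma> z = z"
  shows "\<gamma> = \<one>\<^bsub>PSL2R\<^esub>"
proof (rule ccontr)
  assume ne: "\<gamma> \<noteq> \<one>\<^bsub>PSL2R\<^esub>"
  have gc: "\<gamma> \<in> carrier PSL2R" using g by simp
  have pow: "\<gamma> [^]\<^bsub>PSL2R\<^esub> n \<in> \<Gamma> \<and> act (\<gamma> [^]\<^bsub>PSL2R\<^esub> n) z = z" for n :: nat
    by (induction n) (use g gc z fix_z in \<open>auto simp: act_mult\<close>)
  have "finite {\<gamma> \<in> \<Gamma>. \<exists>x\<in>{z}. act \<gamma> x \<in> {z}}" by (rule finite_returns) (use z in auto)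
  then have "finite (range (\<lambda>n::nat. \<gamma> [^]\<^bsub>PSL2R\<^esub> n))" by (rule rev_finite_subset) (use pow in auto)
  then have "\<not> inj (\<lambda>n::nat. \<gamma> [^]\<^bsub>PSL2R\<^esub> n)" using finite_imageD by fastforce
  then obtain i j :: nat where ij: "i < j" "\<gamma> [^]\<^bsub>PSL2R\<^esub> j = \<gamma> [^]\<^bsub>PSL2R\<^esub> i"
    unfolding inj_def by (metis linorder_neqE_nat)
  then have "\<gamma> [^]\<^bsub>PSL2R\<^esub> (j - i) = \<one>\<^bsub>PSL2R\<^esub>" using PSL.pow_eq_div2[OF gc] by simp
  moreover have "0 < j - i" using ij by simp
  ultimately show False using fuchsian g ne unfolding fuchsian_surface_group_def by blast
qed

lemma free_eq:
  assumes "\<gamma> \<in> \<Gamma>" "\<delta> \<in> \<Gamma>" "z \<in> HH" "act \<gamma> z = act \<delta> z"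
  shows "\<gamma> = \<delta>"
proof -
  have "inv\<^bsub>PSL2R\<^esub> \<delta> \<otimes>\<^bsub>PSL2R\<^esub> \<gamma> = \<one>\<^bsub>PSL2R\<^esub>"
    by (rule free[of _ z]) (use assms in \<open>auto simp: act_mult\<close>)
  then show ?thesis using assms(1,2) by (metis PSL.inv_closed PSL.inv_equality PSL.inv_inv \<Gamma>.mem_carrier)
qed

text \<open>Only finitely many elements of \<open>\<Gamma>\<close> move a compact neighbourhood of the two points to meet
  itself, and the radius can be shrunk to exclude each of those that do not map \<open>z\<close> to \<open>w\<close>.\<close>

lemma separation:
  assumes z: "z \<in> HH" and w: "w \<in> HH"
  shows "\<exists>r>0. ball z r \<subseteq> HH \<and> ball w r \<subseteq> HH \<and>
    (\<forall>\<gamma>\<in>\<Gamma>. \<forall>x\<in>ball z r. act \<gamma> x \<in> ball w r \<longrightarrow> act \<gamma> z = w)"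
proof -
  obtain r1 where r1: "0 < r1" "cball z r1 \<subseteq> HH" using open_HH z open_contains_cball by blast
  obtain r2 where r2: "0 < r2" "cball w r2 \<subseteq> HH" using open_HH w open_contains_cball by blast
  define K where "K = cball z r1 \<union> cball w r2"
  have K: "compact K" "K \<subseteq> HH" using r1 r2 by (auto simp: K_def)
  define F where "F = {\<gamma> \<in> \<Gamma>. \<exists>z\<in>K. act \<gamma> z \<in> K}"
  have F: "finite F" "F \<subseteq> \<Gamma>" unfolding F_def using finite_returns[OF K] by auto
  have ev: "\<forall>\<^sub>F r in at_right 0. act \<gamma> z \<noteq> w \<longrightarrow> (\<forall>x\<in>ball z r. act \<gamma> x \<notin> ball w r)" if "\<gamma> \<in> F" for \<gamma>
  proof (cases "act \<gamma> z = w")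
    case False
    define e where "e = dist (act \<gamma> z) w / 2"
    have e: "0 < e" using False by (simp add: e_def)
    have gc: "\<gamma> \<in> carrier PSL2R" using that F(2) \<Gamma>.mem_carrier by blast
    have "continuous (at z) (act \<gamma>)"
      using continuous_on_act[OF gc order.refl] open_HH z by (simp add: continuous_on_eq_continuous_at)
    then obtain d where d: "0 < d" "\<And>x. dist x z < d \<Longrightarrow> dist (act \<gamma> x) (act \<gamma> z) < e"
      unfolding continuous_at_eps_delta using e by blast
    have "\<forall>x\<in>ball z r. act \<gamma> x \<notin> ball w r" if r: "0 < r" "r < min d e" for r
    proof
      fix x assume "x \<in> ball z r"
      then have "dist (act \<gamma> x) (act \<gamma> z) < e" using d(2) r by (simp add: dist_commute)
      moreover have "dist (act \<gamma> z) w \<le> dist (act \<gamma> x) (act \<gamma> z) + dist (act \<gamma> x) w"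
        using dist_triangle[of "act \<gamma> z" w "act \<gamma> x"] by (simp add: dist_commute)
      ultimately have "e < dist (act \<gamma> x) w" unfolding e_def by linarith
      then show "act \<gamma> x \<notin> ball w r" using r by (simp add: dist_commute)
    qed
    then show ?thesis using d(1) e by (auto simp: eventually_at_right_field intro!: exI[of _ "min d e"])
  qed simp
  have "\<forall>\<^sub>F r in at_right 0. \<forall>\<gamma>\<in>F. act \<gamma> z \<noteq> w \<longrightarrow> (\<forall>x\<in>ball z r. act \<gamma> x \<notin> ball w r)"
    using F(1) ev by (intro eventually_ball_finite ballI)
  moreover have "\<forall>\<^sub>F r in at_right 0. 0 < r \<and> r < min r1 r2"
    using r1(1) r2(1) by (auto simp: eventually_at_right_field intro!: exI[of _ "min r1 r2"])
  ultimately have "\<forall>\<^sub>F r in at_right 0. (\<forall>\<gamma>\<in>F. act \<gamma> z \<noteq> w \<longrightarrow> (\<forall>x\<in>ball z r. act \<gamma> x \<notin> ball w r)) \<and> 0 < r \<and> r < min r1 r2"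
    by (rule eventually_conj)
  then obtain r where r: "\<forall>\<gamma>\<in>F. act \<gamma> z \<noteq> w \<longrightarrow> (\<forall>x\<in>ball z r. act \<gamma> x \<notin> ball w r)" "0 < r" "r < min r1 r2"
    using eventually_happens'[OF trivial_limit_at_right_real] by blast
  have sub: "ball z r \<subseteq> cball z r1" "ball w r \<subseteq> cball w r2" using r(3) by auto
  have "act \<gamma> z = w" if "\<gamma> \<in> \<Gamma>" "x \<in> ball z r" "act \<gamma> x \<in> ball w r" for \<gamma> x
  proof -
    have "x \<in> K" "act \<gamma> x \<in> K" using that(2,3) sub unfolding K_def by blast+
    then have "\<gamma> \<in> F" unfolding F_def using that(1) by blast
    then show ?thesis using r(1) that by blast
  qed
  then show ?thesis using r(2) sub r1(2) r2(2) by blast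
qed

text \<open>The discs that the projection to \<open>HH / \<Gamma>\<close> maps injectively; they are the first factors of
  the product charts.\<close>

definition good_disc :: "complex set \<Rightarrow> bool" where
  "good_disc D \<longleftrightarrow> (\<exists>c r. 0 < r \<and> D = ball c r) \<and> D \<subseteq> HH \<and>
     (\<forall>\<gamma>\<in>\<Gamma>. \<forall>x\<in>D. act \<gamma> x \<in> D \<longrightarrow> \<gamma> = \<one>\<^bsub>PSL2R\<^esub>)"

lemma good_discD:
  assumes "good_disc D"
  shows "open D" "D \<subseteq> HH" "\<gamma> \<in> \<Gamma> \<Longrightarrow> x \<in> D \<Longrightarrow> act \<gamma> x \<in> D \<Longrightarrow> \<gamma> = \<one>\<^bsub>PSL2R\<^esub>"
  using assms by (auto simp: good_disc_def)

lemma ex_good_ball: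
  assumes "z \<in> HH"
  shows "\<exists>r>0. good_disc (ball z r)"
proof -
  obtain r where r: "0 < r" "ball z r \<subseteq> HH"
      "\<forall>\<gamma>\<in>\<Gamma>. \<forall>x\<in>ball z r. act \<gamma> x \<in> ball z r \<longrightarrow> act \<gamma> z = z"
    using separation[OF assms assms] by blast
  have "\<gamma> = \<one>\<^bsub>PSL2R\<^esub>" if "\<gamma> \<in> \<Gamma>" "x \<in> ball z r" "act \<gamma> x \<in> ball z r" for \<gamma> x
    using r(3) that free[OF that(1) assms] by blast
  then show ?thesis unfolding good_disc_def using r by blast
qed

lemma ex_good_disc: "z \<in> HH \<Longrightarrow> \<exists>D. good_disc D \<and> z \<in> D"
  using ex_good_ball centre_in_ball by blast

lemma good_disc_eq:
  assumes "good_disc D" "\<gamma> \<in> \<Gamma>" "\<delta> \<in> \<Gamma>" "z \<in> HH" "act \<gamma> z \<in> D" "act \<delta> z \<in> D"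
  shows "\<gamma> = \<delta>"
proof -
  have "act (\<gamma> \<otimes>\<^bsub>PSL2R\<^esub> inv\<^bsub>PSL2R\<^esub> \<delta>) (act \<delta> z) = act \<gamma> z"
    using assms by (simp add: act_mult)
  then have "\<gamma> \<otimes>\<^bsub>PSL2R\<^esub> inv\<^bsub>PSL2R\<^esub> \<delta> = \<one>\<^bsub>PSL2R\<^esub>"
    using good_discD(3)[OF assms(1)] assms by simp
  then show ?thesis using assms(2,3) by (metis PSL.inv_closed PSL.inv_equality PSL.inv_inv \<Gamma>.mem_carrier)
qed

lemma Hausdorff_orbit_space:
  assumes L: "subgroup L PSL2R" "L \<subseteq> \<Gamma>"
  shows "Hausdorff_space (orbit_space L)"
  unfolding Hausdorff_space_def
proof (intro allI impI)
  fix p q assume pq: "p \<in> topspace (orbit_space L) \<and> q \<in> topspace (orbit_space L) \<and> p \<noteq> q"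
  then obtain z w where zw: "z \<in> HH" "w \<in> HH" "p = PSL2R_orbit L z" "q = PSL2R_orbit L w"
    by (auto simp: topspace_orbit_space)
  obtain r where r: "0 < r" "ball z r \<subseteq> HH" "ball w r \<subseteq> HH"
      "\<forall>\<gamma>\<in>\<Gamma>. \<forall>x\<in>ball z r. act \<gamma> x \<in> ball w r \<longrightarrow> act \<gamma> z = w"
    using separation[OF zw(1,2)] by blast
  have "disjnt (PSL2R_orbit L ` ball z r) (PSL2R_orbit L ` ball w r)"
  proof (rule ccontr)
    assume "\<not> disjnt (PSL2R_orbit L ` ball z r) (PSL2R_orbit L ` ball w r)"
    then obtain x y where xy: "x \<in> ball z r" "y \<in> ball w r" "PSL2R_orbit L x = PSL2R_orbit L y"
      by (auto simp: disjnt_iff)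
    have "y \<in> PSL2R_orbit L x"
      unfolding xy(3) by (rule orbit_self[OF L(1)]) (use xy(2) r(3) in blast)
    then obtain g where g: "g \<in> L" "y = act g x" by (auto simp: PSL2R_orbit_eq)
    then have "act g z = w" using r(4) xy L(2) by blast
    then have "w \<in> PSL2R_orbit L z" using g(1) by (auto simp: PSL2R_orbit_eq)
    then show False using mem_orbit_iff[OF L(1) zw(1,2)] pq zw by simp
  qed
  moreover have "p \<in> PSL2R_orbit L ` ball z r" "q \<in> PSL2R_orbit L ` ball w r"
    using zw r(1) by auto
  ultimately show "\<exists>U V. openin (orbit_space L) U \<and> openin (orbit_space L) V \<and> p \<in> U \<and> q \<in> V \<and> disjnt U V"
    using openin_orbit_image[OF L(1) open_ball r(2)] openin_orbit_image[OF L(1) open_ball r(3)] by blast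
qed

text \<open>Discs whose closure is in \<open>HH\<close> project to an open cover of the compact quotient; finitely
  many of them suffice.\<close>

lemma ex_fundamental_set:
  "\<exists>U K. open U \<and> U \<subseteq> K \<and> compact K \<and> K \<subseteq> HH \<and> (\<forall>z\<in>HH. \<exists>\<gamma>\<in>\<Gamma>. act \<gamma> z \<in> U)"
proof -
  let ?P = "{(z, r). 0 < r \<and> cball z r \<subseteq> HH}"
  let ?f = "\<lambda>(z, r). PSL2R_orbit \<Gamma> ` ball z r"
  have "compactin (orbit_space \<Gamma>) (topspace (orbit_space \<Gamma>))"
    using fuchsian by (simp add: fuchsian_surface_group_def compact_space_def)
  moreover have "openin (orbit_space \<Gamma>) V" if V: "V \<in> ?f ` ?P" for V
  proof -
    from V obtain z r where zr: "0 < r" "cball z r \<subseteq> HH" "V = PSL2R_orbit \<Gamma> ` ball z r" by auto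
    have "ball z r \<subseteq> HH" using zr(2) ball_subset_cball by blast
    then show ?thesis unfolding zr(3) by (rule openin_orbit_image[OF sub_PSL open_ball])
  qed
  moreover have "topspace (orbit_space \<Gamma>) \<subseteq> \<Union> (?f ` ?P)"
  proof
    fix p assume "p \<in> topspace (orbit_space \<Gamma>)"
    then obtain z where z: "z \<in> HH" "p = PSL2R_orbit \<Gamma> z" by (auto simp: topspace_orbit_space)
    then obtain r where "0 < r" "cball z r \<subseteq> HH" using open_HH open_contains_cball by blast
    then have "(z, r) \<in> ?P" "p \<in> ?f (z, r)" using z(2) by auto
    then show "p \<in> \<Union> (?f ` ?P)" by blast
  qed
  ultimately obtain \<F> where F: "finite \<F>" "\<F> \<subseteq> ?f ` ?P" "topspace (orbit_space \<Gamma>) \<subseteq> \<Union>\<F>"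
    unfolding compactin_def by meson
  obtain C where C: "C \<subseteq> ?P" "finite C" "\<F> = ?f ` C" using finite_subset_image[OF F(1,2)] by blast
  define U where "U = (\<Union>(z, r)\<in>C. ball z r)"
  define K where "K = (\<Union>(z, r)\<in>C. cball z r)"
  have "open U" "U \<subseteq> K" "K \<subseteq> HH" using C(1) by (auto simp: U_def K_def)
  moreover have "compact K" unfolding K_def using C(2) by (intro compact_UN) auto
  moreover have "\<exists>\<gamma>\<in>\<Gamma>. act \<gamma> z \<in> U" if z: "z \<in> HH" for z
  proof -
    have "PSL2R_orbit \<Gamma> z \<in> \<Union> (?f ` C)"
      using F(3) z unfolding C(3) topspace_orbit_space by blast
    then obtain x where x: "x \<in> U" "PSL2R_orbit \<Gamma> z = PSL2R_orbit \<Gamma> x" by (auto simp: U_def)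
    have "x \<in> PSL2R_orbit \<Gamma> z"
      unfolding x(2) by (rule orbit_self[OF sub_PSL]) (use x(1) \<open>U \<subseteq> K\<close> \<open>K \<subseteq> HH\<close> in blast)
    then show ?thesis using x(1) by (auto simp: PSL2R_orbit_eq)
  qed
  ultimately show ?thesis by blast
qed

text \<open>Let the translates of an open set \<open>U\<close> cover the connected space \<open>HH\<close>. The union of the
  translates by the subgroup generated by the elements that move \<open>U\<close> to meet itself is disjoint
  from the union of the remaining translates.\<close>

lemma finitely_generated:
  "\<exists>S. finite S \<and> S \<subseteq> \<Gamma> \<and> \<Gamma> = generate (PSL2R_sub \<Gamma>) S"
proof -
  obtain U K where UK: "open U" "U \<subseteq> K" "compact K" "K \<subseteq> HH" "\<forall>z\<in>HH. \<exists>\<gamma>\<in>\<Gamma>. act \<gamma> z \<in> U"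
    using ex_fundamental_set by blast
  have UH: "U \<subseteq> HH" using UK by blast
  \<comment> \<open>The group is generated by the elements that move \<open>K\<close> to meet itself.\<close>
  define S where "S = {\<gamma> \<in> \<Gamma>. \<exists>z\<in>K. act \<gamma> z \<in> K}"
  have S: "finite S" "S \<subseteq> \<Gamma>" using finite_returns[OF UK(3,4)] by (auto simp: S_def)
  let ?D = "PSL2R_sub \<Gamma>"
  interpret D: group ?D by (rule PSL.subgroup_imp_group[OF sub_PSL])
  define G where "G = generate ?D S"
  have G: "G \<subseteq> \<Gamma>" "subgroup G ?D"
    using D.generate_incl[of S] D.generate_is_subgroup[of S] S(2) by (auto simp: G_def)
  define A where "A = (\<Union>\<gamma>\<in>G. act \<gamma> ` U)"
  define B where "B = (\<Union>\<gamma>\<in>\<Gamma> - G. act \<gamma> ` U)"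
  have op: "open A" "open B"
    unfolding A_def B_def using open_act_image[OF _ UH UK(1)] G(1) \<Gamma>.mem_carrier by blast+
  have cov: "HH \<subseteq> A \<union> B"
  proof
    fix z assume z: "z \<in> HH"
    obtain \<gamma> where g: "\<gamma> \<in> \<Gamma>" "act \<gamma> z \<in> U" using UK(5) z by blast
    have "z = act (inv\<^bsub>PSL2R\<^esub> \<gamma>) (act \<gamma> z)" using g z by simp
    moreover have "inv\<^bsub>PSL2R\<^esub> \<gamma> \<in> \<Gamma>" using g by simp
    ultimately show "z \<in> A \<union> B" unfolding A_def B_def using g(2) by blast
  qed
  have disj: "A \<inter> B = {}"
  proof (rule ccontr)
    assume "A \<inter> B \<noteq> {}"
    then obtain g d u v where gd: "g \<in> G" "d \<in> \<Gamma>" "d \<notin> G" "u \<in> U" "v \<in> U" "act g u = act d v"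
      by (auto simp: A_def B_def)
    have g': "g \<in> \<Gamma>" using gd G by blast
    define s where "s = inv\<^bsub>PSL2R\<^esub> g \<otimes>\<^bsub>PSL2R\<^esub> d"
    have uv: "u \<in> HH" "v \<in> HH" using gd UH by auto
    have s\<Gamma>: "s \<in> \<Gamma>" using g' gd(2) by (simp add: s_def)
    have "act s v = act (inv\<^bsub>PSL2R\<^esub> g) (act d v)" using g' gd(2) uv by (simp add: s_def act_mult)
    also have "\<dots> = u" using gd(6)[symmetric] g' uv by simp
    finally have "s \<in> S" unfolding S_def using s\<Gamma> gd(4,5) UK(2) by blast
    then have "s \<in> G" by (simp add: G_def generate.incl)
    then have "g \<otimes>\<^bsub>?D\<^esub> s \<in> G" using gd(1) G(2) subgroup.m_closed by metis
    moreover have "g \<otimes>\<^bsub>?D\<^esub> s = d" using g' gd(2) by (simp add: s_def PSL.r_inv_cancel)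
    ultimately show False using gd(3) by simp
  qed
  obtain u where u: "u \<in> U" using UK(5) ii_HH by blast
  have "\<one>\<^bsub>PSL2R\<^esub> \<in> G" using subgroup.one_closed[OF G(2)] by simp
  then have "u \<in> A" unfolding A_def using u UH act_one by (metis UN_I image_eqI subsetD)
  then have "A \<inter> HH \<noteq> {}" using u UH by blast
  then have BH: "B \<inter> HH = {}" using connectedD[OF connected_HH op _ cov] disj by blast
  have "\<Gamma> \<subseteq> G"
  proof
    fix d assume d: "d \<in> \<Gamma>"
    show "d \<in> G"
    proof (rule ccontr)
      assume "d \<notin> G"
      then have "act d u \<in> B \<inter> HH" using d u UH by (auto simp: B_def)
      then show False using BH by blast
    qed
  qed
  then show ?thesis using S G(1) unfolding G_def by blast
qed

text \<open>The injectivity radius of the compact surface is positive: near each point a disc with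
  disjoint translates gives a lower bound, compactness makes it uniform on a fundamental set, and
  invariance of \<open>hyp\<close> carries it to \<open>HH\<close>.\<close>

lemma displacement_bound:
  "\<exists>e>0. \<forall>z\<in>HH. \<forall>\<gamma>\<in>\<Gamma>. hyp (act \<gamma> z) z < e \<longrightarrow> \<gamma> = \<one>\<^bsub>PSL2R\<^esub>"
proof -
  obtain U K where UK: "U \<subseteq> K" "compact K" "K \<subseteq> HH" "\<forall>z\<in>HH. \<exists>\<gamma>\<in>\<Gamma>. act \<gamma> z \<in> U"
    using ex_fundamental_set by blast
  have "\<exists>p. 0 < fst p \<and> 0 < snd p \<and>
      (\<forall>x\<in>ball z (fst p) \<inter> HH. \<forall>\<gamma>\<in>\<Gamma>. hyp (act \<gamma> x) x < snd p \<longrightarrow> \<gamma> = \<one>\<^bsub>PSL2R\<^esub>)" if z: "z \<in> K" for z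
  proof -
    obtain r where r: "0 < r" "good_disc (ball z r)" using ex_good_ball z UK(3) by blast
    \<comment> \<open>\<open>M\<close> bounds \<open>Im x\<close> for \<open>x\<close> in the disc of radius \<open>r / 2\<close>. By \<open>hyp_small\<close> a displacement
      below \<open>e\<close> moves \<open>x\<close> by less than \<open>r / 2\<close>, since \<open>3 e M\<^sup>2 < r\<^sup>2 / 4\<close> when \<open>13 e M\<^sup>2 \<le> r\<^sup>2\<close>.
      So \<open>x\<close> and its image are both in \<open>ball z r\<close>.\<close>
    define M where "M = Im z + r / 2"
    have M: "0 < M" using z UK(3) r(1) by (auto simp: M_def upper_half_plane_def add_pos_pos)
    define e where "e = min 1 (r\<^sup>2 / (13 * M\<^sup>2))"
    have e: "0 < e" "e \<le> 1" using r(1) M by (auto simp: e_def)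
    have "e \<le> r\<^sup>2 / (13 * M\<^sup>2)" by (simp add: e_def)
    then have e2: "e * (13 * M\<^sup>2) \<le> r\<^sup>2" using M by (simp add: pos_le_divide_eq)
    have "\<gamma> = \<one>\<^bsub>PSL2R\<^esub>"
      if x: "x \<in> ball z (r / 2)" "x \<in> HH" and g: "\<gamma> \<in> \<Gamma>" "hyp (act \<gamma> x) x < e" for x \<gamma>
    proof -
      have xz: "cmod (x - z) < r / 2" using x(1) by (simp add: dist_norm norm_minus_commute)
      have "Im x \<le> M" using abs_Im_le_cmod[of "x - z"] xz by (simp add: M_def)
      moreover have "0 < Im x" using x(2) by (simp add: upper_half_plane_def)
      ultimately have "(Im x)\<^sup>2 \<le> M\<^sup>2" by (simp add: power_mono)
      then have "3 * e * (Im x)\<^sup>2 \<le> 3 * e * M\<^sup>2" using e(1) by simp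
      moreover have "(cmod (act \<gamma> x - x))\<^sup>2 \<le> 3 * e * (Im x)\<^sup>2"
        by (rule hyp_small(3)[OF act_closed x(2) g(2) e(2)]) (use g x in auto)
      moreover have "0 < e * M\<^sup>2" using e(1) M by simp
      moreover have "(r / 2)\<^sup>2 = r\<^sup>2 / 4" "3 * e * M\<^sup>2 = 3 * (e * M\<^sup>2)" "e * (13 * M\<^sup>2) = 13 * (e * M\<^sup>2)"
        by (simp_all add: power_divide)
      ultimately have "(cmod (act \<gamma> x - x))\<^sup>2 < (r / 2)\<^sup>2" using e2 by linarith
      then have "cmod (act \<gamma> x - x) < r / 2" by (rule power_less_imp_less_base) (use r(1) in simp)
      then have "cmod (act \<gamma> x - z) < r"
        using norm_triangle_ineq[of "act \<gamma> x - x" "x - z"] xz by simp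
      then have "act \<gamma> x \<in> ball z r" by (simp add: dist_norm norm_minus_commute)
      moreover have "x \<in> ball z r" using x(1) r(1) by simp
      ultimately show ?thesis using good_discD(3)[OF r(2) g(1)] by blast
    qed
    then show ?thesis using r(1) e(1) by (intro exI[of _ "(r / 2, e)"]) auto
  qed
  then have "\<exists>p. \<forall>z\<in>K. 0 < fst (p z) \<and> 0 < snd (p z) \<and>
      (\<forall>x\<in>ball z (fst (p z)) \<inter> HH. \<forall>\<gamma>\<in>\<Gamma>. hyp (act \<gamma> x) x < snd (p z) \<longrightarrow> \<gamma> = \<one>\<^bsub>PSL2R\<^esub>)"
    by (intro bchoice ballI)
  then obtain p where p: "\<forall>z\<in>K. 0 < fst (p z) \<and> 0 < snd (p z) \<and>
      (\<forall>x\<in>ball z (fst (p z)) \<inter> HH. \<forall>\<gamma>\<in>\<Gamma>. hyp (act \<gamma> x) x < snd (p z) \<longrightarrow> \<gamma> = \<one>\<^bsub>PSL2R\<^esub>)"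
    by blast
  have "K \<subseteq> (\<Union>z\<in>K. ball z (fst (p z)))" using p by fastforce
  then obtain C where C: "C \<subseteq> K" "finite C" "K \<subseteq> (\<Union>z\<in>C. ball z (fst (p z)))"
    using compactE_image[OF UK(2), of K "\<lambda>z. ball z (fst (p z))"] by auto
  define e where "e = Min (insert 1 ((\<lambda>z. snd (p z)) ` C))"
  have e: "0 < e" "\<And>z. z \<in> C \<Longrightarrow> e \<le> snd (p z)"
    using C p unfolding e_def by (auto simp: Min_gr_iff)
  have "\<gamma> = \<one>\<^bsub>PSL2R\<^esub>" if z: "z \<in> HH" and g: "\<gamma> \<in> \<Gamma>" "hyp (act \<gamma> z) z < e" for z \<gamma>
  proof -
    obtain d where d: "d \<in> \<Gamma>" "act d z \<in> U" using UK(4) z by blast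
    have dz: "act d z \<in> K" using d(2) UK(1) by blast
    obtain c where c: "c \<in> C" "act d z \<in> ball c (fst (p c))" using C(3) dz by blast
    define k where "k = d \<otimes>\<^bsub>PSL2R\<^esub> \<gamma> \<otimes>\<^bsub>PSL2R\<^esub> inv\<^bsub>PSL2R\<^esub> d"
    have k: "k \<in> \<Gamma>" using d g by (simp add: k_def)
    have "act k (act d z) = act d (act \<gamma> z)" using d g z by (simp add: k_def act_mult)
    then have "hyp (act k (act d z)) (act d z) = hyp (act \<gamma> z) z" using hyp_act[of d "act \<gamma> z" z] d g z by simp
    then have "hyp (act k (act d z)) (act d z) < snd (p c)" using g(2) e(2)[OF c(1)] by simp
    moreover have "act d z \<in> ball c (fst (p c)) \<inter> HH" using c(2) dz UK(3) by blast
    ultimately have "k = \<one>\<^bsub>PSL2R\<^esub>" using p c(1) C(1) k by blast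
    then have "act d (act \<gamma> z) = act d z" using \<open>act k (act d z) = act d (act \<gamma> z)\<close> d z by simp
    then have "act \<gamma> z = z" using act_inv(1)[of d] d g z by (metis \<Gamma>.mem_carrier act_closed)
    then show ?thesis using free g(1) z by blast
  qed
  then show ?thesis using e(1) by blast
qed

end

section \<open>The solenoid\<close>

abbreviation psl_mult (infixl "\<cdot>" 70) where "x \<cdot> y \<equiv> x \<otimes>\<^bsub>PSL2R\<^esub> y"
abbreviation psl_inv where "psl_inv x \<equiv> inv\<^bsub>PSL2R\<^esub> x"

context fuchsian
begin

sublocale finite_core_subgroup PSL2R \<Gamma>
proof
  fix n
  obtain S where S: "finite S" "S \<subseteq> \<Gamma>" "\<Gamma> = generate (PSL2R_sub \<Gamma>) S" using finitely_generated by blast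
  interpret D: group "PSL2R_sub \<Gamma>" by (rule PSL.subgroup_imp_group[OF sub_PSL])
  show "finite (rcosets\<^bsub>PSL2R_sub \<Gamma>\<^esub> low_index_core (PSL2R_sub \<Gamma>) n)"
    by (rule D.finite_index_low_index_core[of S]) (use S in auto)
qed

abbreviation hat_mult (infixl "\<star>" 70) where "\<sigma> \<star> \<tau> \<equiv> \<sigma> \<otimes>\<^bsub>profinite \<Delta>\<^esub> \<tau>"
abbreviation "orb n z \<equiv> PSL2R_orbit (core n) z"
abbreviation "sol \<equiv> solenoid \<Gamma>"
abbreviation "ST \<equiv> solenoid_topology \<Gamma>"
abbreviation "sp \<equiv> sol_point"
abbreviation "PR \<equiv> prod_topology (top_of_set HH) PT"

lemma orb_self: "z \<in> HH \<Longrightarrow> z \<in> orb n z"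
  by (rule orbit_self[OF core_subgroup])

lemma orb_mem:
  assumes "w \<in> orb n z" "z \<in> HH"
  shows "w \<in> HH" "orb n w = orb n z"
proof -
  show "w \<in> HH" using assms by (auto simp: PSL2R_orbit_eq)
  then show "orb n w = orb n z" using assms mem_orbit_iff[OF core_subgroup] by blast
qed

lemma orb_mono: "m \<le> n \<Longrightarrow> orb n z \<subseteq> orb m z"
  unfolding PSL2R_orbit_eq using core_antimono by blast

lemma act_orb: "h \<in> core n \<Longrightarrow> act h z \<in> orb n z"
  by (auto simp: PSL2R_orbit_eq)

lemma orb_act: "h \<in> core n \<Longrightarrow> z \<in> HH \<Longrightarrow> orb n (act h z) = orb n z"
  using orb_mem(2) act_orb by blast

text \<open>As for the completion, compatibility of a sequence of orbits means that the orbits are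
  nested.\<close>

lemma sol_iff:
  "p \<in> sol \<longleftrightarrow> (\<forall>n. \<exists>z\<in>HH. p n = orb n z) \<and> (\<forall>n m. m \<le> n \<longrightarrow> p n \<subseteq> p m)"
proof -
  have "(\<forall>n m. m \<le> n \<longrightarrow> p m = orbit_projection (core m) (p n)) \<longleftrightarrow> (\<forall>n m. m \<le> n \<longrightarrow> p n \<subseteq> p m)"
    if *: "\<forall>n. \<exists>z\<in>HH. p n = orb n z"
  proof -
    have "p m = orbit_projection (core m) (p n) \<longleftrightarrow> p n \<subseteq> p m" if mn: "m \<le> n" for m n
    proof -
      obtain z where z: "z \<in> HH" "p n = orb n z" using * by blast
      obtain w where w: "w \<in> HH" "p m = orb m w" using * by blast
      have "orb m v = orb m z" if "v \<in> orb n z" for v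
        using orb_mem(2)[OF _ z(1)] orb_mono[OF mn] that by blast
      then have "orbit_projection (core m) (p n) = orb m z"
        unfolding orbit_projection_def z(2) using orb_self[OF z(1)] by blast
      moreover have "orb n z \<subseteq> orb m w \<longleftrightarrow> orb m w = orb m z"
        using orb_mem(2)[OF _ w(1)] orb_self[OF z(1)] orb_mono[OF mn] by blast
      ultimately show ?thesis unfolding z(2) w(2) by simp
    qed
    then show ?thesis by blast
  qed
  note nested = this
  have orbits: "(\<forall>n. p n \<in> topspace (orbit_space (core n))) \<longleftrightarrow> (\<forall>n. \<exists>z\<in>HH. p n = orb n z)"
    by (auto simp: topspace_orbit_space)
  have sol: "p \<in> sol \<longleftrightarrow> (\<forall>n. p n \<in> topspace (orbit_space (core n))) \<and> (\<forall>n m. m \<le> n \<longrightarrow> p m = orbit_projection (core m) (p n))"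
    by (simp add: solenoid_def)
  show ?thesis unfolding sol orbits by (rule conj_cong[OF refl nested])
qed

lemma sol_ex:
  assumes "p \<in> sol"
  shows "\<exists>z. z \<in> p n"
proof -
  obtain z where "z \<in> HH" "p n = orb n z" using assms unfolding sol_iff by blast
  then show ?thesis using orb_self by blast
qed

lemma sol_mem:
  assumes "p \<in> sol" "z \<in> p n"
  shows "z \<in> HH" "p n = orb n z"
proof -
  obtain w where w: "w \<in> HH" "p n = orb n w" using assms(1) unfolding sol_iff by blast
  then show "z \<in> HH" "p n = orb n z" using orb_mem[of z n w] assms(2) by auto
qed

lemma sol_nested: "p \<in> sol \<Longrightarrow> m \<le> n \<Longrightarrow> z \<in> p n \<Longrightarrow> z \<in> p m"
  unfolding sol_iff by blast

lemma sol_level_eqI: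
  assumes "p \<in> sol" "q \<in> sol" "z \<in> p n" "z \<in> q n"
  shows "p n = q n"
  using sol_mem(2)[OF assms(1,3)] sol_mem(2)[OF assms(2,4)] by simp

lemma sp_level:
  assumes z: "z \<in> HH" and \<tau>: "\<tau> \<in> \<Gamma>hat" and t: "t \<in> \<tau> n"
  shows "sp z \<tau> n = orb n (act t z)"
proof -
  have t\<Gamma>: "t \<in> \<Gamma>" using hat_mem(1)[OF \<tau> t] .
  have "act (h \<cdot> t) z = act h (act t z)" if "h \<in> core n" for h
    using that t\<Gamma> z by (simp add: act_mult)
  then have "(\<lambda>\<delta>. act \<delta> z) ` ((\<lambda>h. h \<cdot> t) ` core n) = (\<lambda>h. act h (act t z)) ` core n"
    unfolding image_image by (intro image_cong) auto
  moreover have "core n #>\<^bsub>PSL2R\<^esub> t = (\<lambda>h. h \<cdot> t) ` core n" by (auto simp: r_coset_def)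
  ultimately show ?thesis
    unfolding sol_point_def PSL2R_orbit_eq hat_mem(2)[OF \<tau> t] by simp
qed

lemma sp_mem: "t \<in> \<tau> n \<Longrightarrow> act t z \<in> sp z \<tau> n"
  by (simp add: sol_point_def)

lemma sp_sol [simp]:
  assumes z: "z \<in> HH" and \<tau>: "\<tau> \<in> \<Gamma>hat"
  shows "sp z \<tau> \<in> sol"
  unfolding sol_iff
proof (intro conjI allI impI)
  fix n
  obtain t where t: "t \<in> \<tau> n" using hat_ex[OF \<tau>] by blast
  have "act t z \<in> HH" using hat_mem(1)[OF \<tau> t] z by simp
  then show "\<exists>w\<in>HH. sp z \<tau> n = orb n w" using sp_level[OF z \<tau> t] by blast
next
  fix m n :: nat assume "m \<le> n"
  then show "sp z \<tau> n \<subseteq> sp z \<tau> m" using hat_nested[OF \<tau>] by (auto simp: sol_point_def)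
qed

text \<open>The identification of \<open>[\<gamma> z, \<tau>]\<close> with \<open>[z, \<tau> \<gamma>]\<close>.\<close>

lemma sp_shift:
  assumes z: "z \<in> HH" and \<tau>: "\<tau> \<in> \<Gamma>hat" and g: "\<gamma> \<in> \<Gamma>"
  shows "sp (act \<gamma> z) \<tau> = sp z (\<tau> \<star> emb \<gamma>)"
proof
  fix n
  obtain t where t: "t \<in> \<tau> n" using hat_ex[OF \<tau>] by blast
  have t\<Gamma>: "t \<in> \<Gamma>" using hat_mem(1)[OF \<tau> t] .
  have "t \<cdot> \<gamma> \<in> (\<tau> \<star> emb \<gamma>) n" using pmult_mem[OF \<tau> emb_hat[OF g] t emb_mem[OF g]] .
  then have "sp z (\<tau> \<star> emb \<gamma>) n = orb n (act (t \<cdot> \<gamma>) z)" using sp_level[OF z _ _] \<tau> g by simp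
  also have "\<dots> = sp (act \<gamma> z) \<tau> n" using sp_level[OF _ \<tau> t] z g t\<Gamma> by (simp add: act_mult)
  finally show "sp (act \<gamma> z) \<tau> n = sp z (\<tau> \<star> emb \<gamma>) n" ..
qed

lemma sp_inj:
  assumes z: "z \<in> HH" and st: "\<sigma> \<in> \<Gamma>hat" "\<tau> \<in> \<Gamma>hat" and eq: "sp z \<sigma> = sp z \<tau>"
  shows "\<sigma> = \<tau>"
proof (rule hat_eqI[OF st])
  fix n
  obtain s where s: "s \<in> \<sigma> n" using hat_ex[OF st(1)] by blast
  have "act s z \<in> sp z \<tau> n" using sp_mem[of s \<sigma> n z] s eq by simp
  then obtain t where t: "t \<in> \<tau> n" "act s z = act t z" by (auto simp: sol_point_def)
  have "s = t" using free_eq[OF hat_mem(1)[OF st(1) s] hat_mem(1)[OF st(2) t(1)] z t(2)] .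
  then show "\<exists>x. x \<in> \<sigma> n \<and> x \<in> \<tau> n" using s t by blast
qed

text \<open>Over a point of the solenoid the representatives \<open>(z, \<tau>)\<close> form one orbit of \<open>\<Gamma>\<close>: freeness of
  the action makes the element of \<open>\<Gamma>\<close> that is found at level \<open>0\<close> work at every level.\<close>

lemma sp_eqD:
  assumes z: "z \<in> HH" and w: "w \<in> HH" and st: "\<sigma> \<in> \<Gamma>hat" "\<tau> \<in> \<Gamma>hat" and eq: "sp z \<sigma> = sp w \<tau>"
  shows "\<exists>\<gamma>\<in>\<Gamma>. w = act \<gamma> z \<and> \<sigma> = \<tau> \<star> emb \<gamma>"
proof -
  obtain s where s: "s \<in> \<sigma> 0" using hat_ex[OF st(1)] by blast
  have s\<Gamma>: "s \<in> \<Gamma>" using hat_mem(1)[OF st(1) s] .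
  have "act s z \<in> sp w \<tau> 0" using sp_mem[of s \<sigma> 0 z] s eq by simp
  then obtain t where t: "t \<in> \<tau> 0" "act s z = act t w" by (auto simp: sol_point_def)
  have t\<Gamma>: "t \<in> \<Gamma>" using hat_mem(1)[OF st(2) t(1)] .
  define \<gamma> where "\<gamma> = psl_inv t \<cdot> s"
  have g: "\<gamma> \<in> \<Gamma>" using s\<Gamma> t\<Gamma> by (simp add: \<gamma>_def)
  have w': "w = act \<gamma> z" using s\<Gamma> t\<Gamma> z w t(2) by (simp add: \<gamma>_def act_mult)
  have "sp z \<sigma> = sp z (\<tau> \<star> emb \<gamma>)" unfolding eq w' by (rule sp_shift[OF z st(2) g])
  then have "\<sigma> = \<tau> \<star> emb \<gamma>" using sp_inj[OF z st(1)] st(2) g by simp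
  then show ?thesis using g w' by blast
qed

text \<open>Each level of \<open>p\<close> is the orbit of \<open>t z\<close> for some \<open>t\<close> in \<open>\<Gamma>\<close>. By freeness the coset of \<open>t\<close> is
  determined, and the nesting of the orbits becomes the nesting of these cosets.\<close>

lemma sp_surj:
  assumes p: "p \<in> sol" and z: "z \<in> p 0"
  shows "\<exists>\<tau>\<in>\<Gamma>hat. p = sp z \<tau>"
proof -
  have zH: "z \<in> HH" and p0: "p 0 = orb 0 z" using sol_mem[OF p z] by auto
  have "\<exists>t. t \<in> \<Gamma> \<and> act t z \<in> p n" for n
  proof -
    obtain w where w: "w \<in> p n" using sol_ex[OF p] by blast
    then have "w \<in> orb 0 z" using sol_nested[OF p, of 0 n] p0 by simp
    then obtain t where "t \<in> \<Gamma>" "w = act t z" by (auto simp: PSL2R_orbit_eq)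
    then show ?thesis using w by blast
  qed
  then have "\<exists>t. \<forall>n. t n \<in> \<Gamma> \<and> act (t n) z \<in> p n" by (intro choice allI)
  then obtain t where t: "\<And>n. t n \<in> \<Gamma>" "\<And>n. act (t n) z \<in> p n" by blast
  have hat: "(\<lambda>n. core n #>\<^bsub>PSL2R\<^esub> t n) \<in> \<Gamma>hat"
  proof (rule hat_of_seq)
    fix m n :: nat assume mn: "m \<le> n"
    have "act (t n) z \<in> p m" by (rule sol_nested[OF p mn t(2)])
    then have "act (t n) z \<in> orb m (act (t m) z)" using sol_mem(2)[OF p t(2)[of m]] by simp
    then obtain h where h: "h \<in> core m" "act (t n) z = act h (act (t m) z)" by (auto simp: PSL2R_orbit_eq)
    then have "act (t n) z = act (h \<cdot> t m) z" using t(1) zH by (simp add: act_mult)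
    then have "t n = h \<cdot> t m" using free_eq[OF t(1) _ zH] h(1) t(1) by simp
    then show "t n \<cdot> psl_inv (t m) \<in> core m" using h(1) t(1)[of m] by (simp add: PSL.m_assoc)
  qed (rule t(1))
  moreover have "p = sp z (\<lambda>n. core n #>\<^bsub>PSL2R\<^esub> t n)"
  proof
    fix n
    have "t n \<in> core n #>\<^bsub>PSL2R\<^esub> t n" using t(1) by simp
    then have "sp z (\<lambda>n. core n #>\<^bsub>PSL2R\<^esub> t n) n = orb n (act (t n) z)"
      by (rule sp_level[OF zH hat])
    then show "p n = sp z (\<lambda>n. core n #>\<^bsub>PSL2R\<^esub> t n) n"
      using sol_mem(2)[OF p t(2)[of n]] by simp
  qed
  ultimately show ?thesis by blast
qed

lemma sp_cases:
  assumes "p \<in> sol"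
  obtains z \<tau> where "z \<in> HH" "\<tau> \<in> \<Gamma>hat" "p = sp z \<tau>"
  using sol_ex[OF assms, of 0] sp_surj[OF assms] sol_mem(1)[OF assms] by metis

text \<open>The freedom in the choice of a representative is used to prescribe both its first coordinate
  and one level of the second.\<close>

lemma sp_level_cases:
  assumes p: "p \<in> sol" and u: "u \<in> HH" and c: "c \<in> \<Gamma>" "act c u \<in> p n"
  shows "\<exists>\<tau>\<in>\<Gamma>hat. p = sp u \<tau> \<and> c \<in> \<tau> n"
proof -
  have "act c u \<in> p 0" using sol_nested[OF p _ c(2)] by simp
  moreover have "act (psl_inv c) (act c u) \<in> orb 0 (act c u)" using c(1) by (intro act_orb) simp
  ultimately have "u \<in> p 0" using sol_mem(2)[OF p, of "act c u" 0] c(1) u by simp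
  then obtain \<tau> where \<tau>: "\<tau> \<in> \<Gamma>hat" "p = sp u \<tau>" using sp_surj[OF p] by blast
  then obtain t where t: "t \<in> \<tau> n" "act c u = act t u" using c(2) by (auto simp: sol_point_def)
  have "c = t" by (rule free_eq[OF c(1) hat_mem(1)[OF \<tau>(1) t(1)] u t(2)])
  then show ?thesis using \<tau> t(1) by blast
qed

subsection \<open>Topology of the solenoid\<close>

lemma topspace_ST [simp]: "topspace ST = sol"
  by (auto simp: solenoid_topology_def solenoid_def)

lemma topspace_PR [simp]: "topspace PR = HH \<times> \<Gamma>hat"
  by simp

lemma continuous_map_level: "continuous_map ST (orbit_space (core n)) (\<lambda>p. p n)"
  unfolding solenoid_topology_def
  by (intro continuous_map_from_subtopology continuous_map_product_projection) auto

lemma openin_sol_level: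
  assumes "openin (orbit_space (core n)) W"
  shows "openin ST {p \<in> sol. p n \<in> W}"
  using openin_continuous_map_preimage[OF continuous_map_level assms] by simp

text \<open>The image of a box is visible at a single level, because \<open>sp_level_cases\<close> moves
  representatives into the box.\<close>

lemma openin_box:
  assumes U: "open U" "U \<subseteq> HH" and c: "c \<in> \<Gamma>"
  shows "openin ST (case_prod sp ` (U \<times> {\<sigma> \<in> \<Gamma>hat. c \<in> \<sigma> n}))"
proof -
  let ?W = "PSL2R_orbit (core n) ` (act c ` U)"
  have cU: "open (act c ` U)" "act c ` U \<subseteq> HH" using open_act_image[OF _ U(2,1)] c U(2) by auto
  have "case_prod sp ` (U \<times> {\<sigma> \<in> \<Gamma>hat. c \<in> \<sigma> n}) = {p \<in> sol. p n \<in> ?W}"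
  proof (intro equalityI subsetI)
    fix p assume "p \<in> case_prod sp ` (U \<times> {\<sigma> \<in> \<Gamma>hat. c \<in> \<sigma> n})"
    then obtain u \<sigma> where u: "u \<in> U" "\<sigma> \<in> \<Gamma>hat" "c \<in> \<sigma> n" "p = sp u \<sigma>" by auto
    then have "u \<in> HH" using U(2) by blast
    then show "p \<in> {p \<in> sol. p n \<in> ?W}" using u sp_level[of u \<sigma> c n] by auto
  next
    fix p assume "p \<in> {p \<in> sol. p n \<in> ?W}"
    then obtain u where u: "p \<in> sol" "u \<in> U" "p n = orb n (act c u)" by auto
    have uH: "u \<in> HH" using u(2) U(2) by blast
    have "act c u \<in> p n" unfolding u(3) using uH c by (intro orb_self) simp
    then show "p \<in> case_prod sp ` (U \<times> {\<sigma> \<in> \<Gamma>hat. c \<in> \<sigma> n})"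
      using sp_level_cases[OF u(1) uH c] u(2) by auto
  qed
  then show ?thesis using openin_sol_level[OF openin_orbit_image[OF core_subgroup cU]] by simp
qed

lemma open_map_sp: "open_map PR ST (case_prod sp)"
  unfolding open_map_def
proof (intro allI impI)
  fix V assume V: "openin PR V"
  show "openin ST (case_prod sp ` V)"
    unfolding openin_subopen[of ST "case_prod sp ` V"]
  proof
    fix p assume "p \<in> case_prod sp ` V"
    then obtain z \<tau> where z: "(z, \<tau>) \<in> V" "p = sp z \<tau>" by auto
    then obtain U W where UW: "openin (top_of_set HH) U" "openin PT W" "z \<in> U" "\<tau> \<in> W" "U \<times> W \<subseteq> V"
      using openin_prod_topology_alt[THEN iffD1, OF V, rule_format, OF z(1)] by blast
    have U: "open U" "U \<subseteq> HH" using UW(1) open_HH by (auto simp: openin_open_eq)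
    have \<tau>: "\<tau> \<in> \<Gamma>hat" using UW(2,4) openin_PT by blast
    obtain k where k: "\<forall>\<sigma>\<in>\<Gamma>hat. \<sigma> k = \<tau> k \<longrightarrow> \<sigma> \<in> W" using UW(2,4) openin_PT by blast
    obtain c where c: "c \<in> \<tau> k" using hat_ex[OF \<tau>] by blast
    have "\<sigma> \<in> W" if "\<sigma> \<in> \<Gamma>hat" "c \<in> \<sigma> k" for \<sigma>
      using k that hat_level_eqI[OF that(1) \<tau> that(2) c] by blast
    then have "case_prod sp ` (U \<times> {\<sigma> \<in> \<Gamma>hat. c \<in> \<sigma> k}) \<subseteq> case_prod sp ` V" using UW(5) by blast
    moreover have "p \<in> case_prod sp ` (U \<times> {\<sigma> \<in> \<Gamma>hat. c \<in> \<sigma> k})" using z(2) UW(3) c \<tau> by auto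
    ultimately show "\<exists>T. openin ST T \<and> p \<in> T \<and> T \<subseteq> case_prod sp ` V"
      using openin_box[OF U hat_mem(1)[OF \<tau> c]] by blast
  qed
qed

lemma continuous_map_sp: "continuous_map PR ST (case_prod sp)"
proof -
  have "continuous_map PR (orbit_space (core n)) (\<lambda>x. case_prod sp x n)" for n
    unfolding continuous_map_def
  proof (intro conjI allI impI)
    have "sp z \<tau> n \<in> topspace (orbit_space (core n))" if "z \<in> HH" "\<tau> \<in> \<Gamma>hat" for z \<tau>
      using sp_sol[OF that] by (simp add: solenoid_def)
    then show "(\<lambda>x. case_prod sp x n) \<in> topspace PR \<rightarrow> topspace (orbit_space (core n))" by auto
    fix W assume W: "openin (orbit_space (core n)) W"
    show "openin PR {x \<in> topspace PR. case_prod sp x n \<in> W}"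
      unfolding openin_subopen[of PR "{x \<in> topspace PR. case_prod sp x n \<in> W}"]
    proof
      fix x assume "x \<in> {x \<in> topspace PR. case_prod sp x n \<in> W}"
      then obtain z \<tau> where z: "x = (z, \<tau>)" "z \<in> HH" "\<tau> \<in> \<Gamma>hat" "sp z \<tau> n \<in> W" by auto
      obtain c where c: "c \<in> \<tau> n" using hat_ex[OF z(3)] by blast
      have c\<Gamma>: "c \<in> \<Gamma>" using hat_mem(1)[OF z(3) c] .
      have cl: "sp v \<sigma> n = orb n (act c v)" if "v \<in> HH" "\<sigma> \<in> \<Gamma>hat" "c \<in> \<sigma> n" for v \<sigma>
        using sp_level that by blast
      define U where "U = {v \<in> HH. orb n (act c v) \<in> W}"
      have "continuous_map (top_of_set HH) (orbit_space (core n)) (PSL2R_orbit (core n) \<circ> act c)"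
        by (rule continuous_map_compose[OF _ continuous_map_orbit])
          (use continuous_on_act[of c HH] c\<Gamma> in auto)
      from openin_continuous_map_preimage[OF this W] have "openin (top_of_set HH) U"
        by (simp add: U_def)
      then have "openin PR (U \<times> {\<sigma> \<in> \<Gamma>hat. c \<in> \<sigma> n})"
        using openin_level[of "\<lambda>C. c \<in> C" n] by (simp add: openin_prod_Times_iff)
      moreover have "x \<in> U \<times> {\<sigma> \<in> \<Gamma>hat. c \<in> \<sigma> n}" using z c cl by (simp add: U_def)
      moreover have "U \<times> {\<sigma> \<in> \<Gamma>hat. c \<in> \<sigma> n} \<subseteq> {x \<in> topspace PR. case_prod sp x n \<in> W}"
        using cl by (auto simp: U_def)
      ultimately show "\<exists>T. openin PR T \<and> x \<in> T \<and> T \<subseteq> {x \<in> topspace PR. case_prod sp x n \<in> W}"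
        by blast
    qed
  qed
  then have "continuous_map PR (product_topology (\<lambda>n. orbit_space (core n)) UNIV) (case_prod sp)"
    by (simp add: continuous_map_componentwise_UNIV)
  then show ?thesis unfolding solenoid_topology_def
    by (rule continuous_map_into_subtopology) auto
qed

lemma sp_image: "case_prod sp ` (HH \<times> \<Gamma>hat) = sol"
proof (intro equalityI subsetI)
  fix p assume "p \<in> sol"
  then show "p \<in> case_prod sp ` (HH \<times> \<Gamma>hat)" by (rule sp_cases) auto
qed auto

lemma Hausdorff_ST: "Hausdorff_space ST"
  unfolding solenoid_topology_def
  by (intro Hausdorff_space_subtopology)
    (simp add: Hausdorff_space_product_topology Hausdorff_orbit_space core_subgroup core_subset)

text \<open>The points \<open>[z, \<tau>]\<close> with \<open>z\<close> in a compact fundamental set exhaust the solenoid.\<close>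

lemma compact_ST: "compact_space ST"
proof -
  obtain U K where UK: "U \<subseteq> K" "compact K" "K \<subseteq> HH" "\<forall>z\<in>HH. \<exists>\<gamma>\<in>\<Gamma>. act \<gamma> z \<in> U"
    using ex_fundamental_set by blast
  have "compactin PR (K \<times> \<Gamma>hat)"
    using UK(2,3) compact_PT by (simp add: compactin_Times compactin_subtopology compact_space_def)
  then have "compactin ST (case_prod sp ` (K \<times> \<Gamma>hat))"
    by (rule image_compactin[OF _ continuous_map_sp])
  moreover have "case_prod sp ` (K \<times> \<Gamma>hat) = sol"
  proof (intro equalityI subsetI)
    fix p assume "p \<in> case_prod sp ` (K \<times> \<Gamma>hat)"
    then show "p \<in> sol" using UK(3) by auto
  next
    fix p assume p: "p \<in> sol"
    obtain z where z: "z \<in> p 0" using sol_ex[OF p] by blast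
    have zH: "z \<in> HH" "p 0 = orb 0 z" using sol_mem[OF p z] by auto
    obtain g where g: "g \<in> \<Gamma>" "act g z \<in> U" using UK(4) zH(1) by blast
    have "act g z \<in> p 0" unfolding zH(2) by (rule act_orb) (use g in simp)
    then obtain \<tau> where "\<tau> \<in> \<Gamma>hat" "p = sp (act g z) \<tau>" using sp_surj[OF p] by blast
    then show "p \<in> case_prod sp ` (K \<times> \<Gamma>hat)" using g(2) UK(1) by auto
  qed
  ultimately show ?thesis by (simp add: compact_space_def)
qed

subsection \<open>Product charts\<close>

lemma sp_inj_on_good_disc:
  assumes D: "good_disc D"
  shows "inj_on (case_prod sp) (D \<times> \<Gamma>hat)"
proof (rule inj_onI)
  fix x y assume xy: "x \<in> D \<times> \<Gamma>hat" "y \<in> D \<times> \<Gamma>hat" "case_prod sp x = case_prod sp y"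
  obtain z \<sigma> w \<tau> where e: "x = (z, \<sigma>)" "y = (w, \<tau>)" by fastforce
  have zw: "z \<in> D" "w \<in> D" "\<sigma> \<in> \<Gamma>hat" "\<tau> \<in> \<Gamma>hat" "sp z \<sigma> = sp w \<tau>" using xy e by auto
  have H: "z \<in> HH" "w \<in> HH" using zw good_discD(2)[OF D] by auto
  obtain g where g: "g \<in> \<Gamma>" "w = act g z" "\<sigma> = \<tau> \<star> emb g" using sp_eqD[OF H zw(3-5)] by blast
  then have "g = \<one>\<^bsub>PSL2R\<^esub>" using good_discD(3)[OF D g(1) zw(1)] zw(2) by simp
  then show "x = y" using e g H zw(4) by (simp add: one_pmult)
qed

text \<open>The whole completion is the closure of \<open>core 0 = \<Gamma>\<close>, and so it is admitted as the second
  factor of a chart.\<close>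

lemma sol_chart_good_disc:
  assumes D: "good_disc D"
  shows "sol_chart \<Gamma> D \<Gamma>hat"
proof -
  have Dop: "open D" "D \<subseteq> HH" using good_discD[OF D] by auto
  have opD: "openin (top_of_set HH) D" using Dop open_HH by (simp add: openin_open_eq)
  have op: "openin PR (D \<times> \<Gamma>hat)" using opD by (simp add: openin_prod_Times_iff openin_PT)
  then have img: "openin ST (case_prod sp ` (D \<times> \<Gamma>hat))" using open_map_sp by (simp add: open_map_def)
  have sub: "subtopology PR (D \<times> \<Gamma>hat) =
      prod_topology (top_of_set D) (subtopology PT \<Gamma>hat)"
    using Dop(2) by (simp add: subtopology_Times subtopology_subtopology Int_absorb1)
  have "homeomorphic_map (prod_topology (top_of_set D) (subtopology PT \<Gamma>hat))
       (subtopology ST (case_prod sp ` (D \<times> \<Gamma>hat))) (case_prod sp)"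
    unfolding sub[symmetric]
  proof (rule bijective_open_imp_homeomorphic_map)
    have ts: "topspace (subtopology PR (D \<times> \<Gamma>hat)) = D \<times> \<Gamma>hat" using Dop(2) by auto
    show "continuous_map (subtopology PR (D \<times> \<Gamma>hat)) (subtopology ST (case_prod sp ` (D \<times> \<Gamma>hat))) (case_prod sp)"
      by (intro continuous_map_into_subtopology continuous_map_from_subtopology continuous_map_sp) auto
    show "open_map (subtopology PR (D \<times> \<Gamma>hat)) (subtopology ST (case_prod sp ` (D \<times> \<Gamma>hat))) (case_prod sp)"
      by (intro open_map_into_subtopology open_map_from_subtopology open_map_sp op) auto
    show "case_prod sp ` topspace (subtopology PR (D \<times> \<Gamma>hat)) = topspace (subtopology ST (case_prod sp ` (D \<times> \<Gamma>hat)))"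
      unfolding ts using openin_subset[OF img] by auto
    show "inj_on (case_prod sp) (topspace (subtopology PR (D \<times> \<Gamma>hat)))"
      unfolding ts by (rule sp_inj_on_good_disc[OF D])
  qed
  moreover have "\<Gamma>hat = emb \<one>\<^bsub>PSL2R\<^esub> <#\<^bsub>profinite \<Delta>\<^esub> profinite_closure \<Delta> (core 0)"
  proof -
    have "\<tau> 0 = \<Gamma>" if t: "\<tau> \<in> \<Gamma>hat" for \<tau>
    proof -
      obtain x where x: "x \<in> \<tau> 0" using hat_ex[OF t] by blast
      then show ?thesis using hat_mem[OF t x] PSL.coset_join2[OF _ core_subgroup[of 0], of x] by simp
    qed
    then have "profinite_closure \<Delta> (core 0) = \<Gamma>hat" unfolding closure_core by auto
    then show ?thesis using one_pmult(1) by (auto simp: l_coset_def)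
  qed
  ultimately show ?thesis
    unfolding sol_chart_def using D img Dop(2) unfolding good_disc_def
    by (metis emb_hat sub_closed(1))
qed

end

section \<open>The two groups that act on the solenoid\<close>

context finite_core_subgroup
begin

text \<open>Conjugation by \<open>a\<close> is uniformly continuous on \<open>K\<close> for the topologies that the \<open>core n\<close>
  define, so it extends to the closure: the level \<open>n\<close> of the image depends only on a sufficiently
  high level of the argument.\<close>

lemma conj_extension:
  assumes K: "subgroup K G" "K \<subseteq> \<Gamma>" "core l \<subseteq> K" and a: "a \<in> carrier G"
    and aK: "\<And>k. k \<in> K \<Longrightarrow> a \<otimes> k \<otimes> inv a \<in> \<Gamma>"
  shows "\<exists>c. continuous_map (subtopology PT (profinite_closure \<Delta> K)) PT c \<and>
    (\<forall>k\<in>K. c (emb k) = emb (a \<otimes> k \<otimes> inv a)) \<and>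
    (\<forall>\<tau>\<in>profinite_closure \<Delta> K. \<forall>n k t. l \<le> k \<longrightarrow> conj_core a k n \<longrightarrow> t \<in> \<tau> k \<longrightarrow> a \<otimes> t \<otimes> inv a \<in> c \<tau> n)"
proof -
  let ?c = "\<lambda>x. a \<otimes> x \<otimes> inv a"
  have l0: "conj_core a l 0" unfolding conj_core_def using aK K(3) by auto
  have "\<forall>n. \<exists>k. l \<le> k \<and> conj_core a k n" using conj_core_refine[OF a l0] by blast
  then obtain \<kappa> where \<kappa>: "\<forall>n. l \<le> \<kappa> n \<and> conj_core a (\<kappa> n) n" using choice by metis
  \<comment> \<open>The level \<open>n\<close> of the image is read off at the level \<open>\<kappa> n\<close> of the argument; the choice of \<open>t\<close>
    there does not matter.\<close>
  define c where "c \<tau> = (\<lambda>n. core n #> ?c (SOME t. t \<in> \<tau> (\<kappa> n)))" for \<tau>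
  have hat: "\<tau> \<in> \<Gamma>hat" if "\<tau> \<in> profinite_closure \<Delta> K" for \<tau>
    using that closure_iff[OF K(2)] by simp
  have inK: "t \<in> K" if \<tau>: "\<tau> \<in> profinite_closure \<Delta> K" and t: "l \<le> k" "t \<in> \<tau> k" for \<tau> t k
    using closure_mem_level[OF K \<tau>] hat_nested[OF hat[OF \<tau>] t] by blast
  have some: "(SOME t. t \<in> \<tau> k) \<in> \<tau> k" if \<tau>: "\<tau> \<in> profinite_closure \<Delta> K" for \<tau> k
    using hat_ex[OF hat[OF \<tau>], of k] by (rule someI_ex)
  have close: "?c t \<otimes> inv (?c t') \<in> core n"
    if \<tau>: "\<tau> \<in> profinite_closure \<Delta> K" and k: "k \<le> k'" and t: "t' \<in> \<tau> k" "t \<in> \<tau> k'" "conj_core a k n"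
    for \<tau> k k' t t' n
  proof -
    have tk: "t \<in> \<tau> k" using hat_nested[OF hat[OF \<tau>] k t(2)] .
    have G: "t \<in> \<Gamma>" "t' \<in> \<Gamma>" using hat_mem(1)[OF hat[OF \<tau>]] tk t(1) by auto
    have "t \<otimes> inv t' \<in> core k" using hat_mem_iff[OF hat[OF \<tau>] t(1)] tk by blast
    then have "?c (t \<otimes> inv t') \<in> core n" using t(3) unfolding conj_core_def by blast
    then show ?thesis using a G by (simp add: conj_mult conj_inv)
  qed
  have lev: "?c t \<in> c \<tau> n"
    if \<tau>: "\<tau> \<in> profinite_closure \<Delta> K" and t: "l \<le> k" "conj_core a k n" "t \<in> \<tau> k" for \<tau> n k t
  proof -
    let ?s = "SOME t. t \<in> \<tau> (\<kappa> n)"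
    obtain r where r: "r \<in> \<tau> (max k (\<kappa> n))" using hat_ex[OF hat[OF \<tau>]] by blast
    have "?c r \<otimes> inv (?c t) \<in> core n" by (rule close[OF \<tau> _ t(3) r t(2)]) simp
    moreover have "?c r \<otimes> inv (?c ?s) \<in> core n"
      by (rule close[OF \<tau> _ some[OF \<tau>] r]) (use \<kappa> in auto)
    moreover have G: "?c r \<in> \<Gamma>" "?c t \<in> \<Gamma>" "?c ?s \<in> \<Gamma>"
      using aK inK[OF \<tau> _ r] inK[OF \<tau> t(1,3)] inK[OF \<tau> _ some[OF \<tau>], of "\<kappa> n"] \<kappa> t(1) by auto
    ultimately have "core n #> ?c t = core n #> ?c ?s" by (metis core_coset_eq_iff)
    then show ?thesis unfolding c_def using self_in_core_coset[OF G(2), of n] by simp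
  qed
  have chat: "c \<tau> \<in> \<Gamma>hat" if \<tau>: "\<tau> \<in> profinite_closure \<Delta> K" for \<tau>
    unfolding c_def
  proof (rule hat_of_seq)
    fix n
    show "?c (SOME t. t \<in> \<tau> (\<kappa> n)) \<in> \<Gamma>" using aK inK[OF \<tau> _ some[OF \<tau>]] \<kappa> by blast
  next
    fix m n :: nat assume mn: "m \<le> n"
    let ?s = "\<lambda>n. SOME t. t \<in> \<tau> (\<kappa> n)"
    have "conj_core a (\<kappa> n) m" using \<kappa> conj_core_mono[of a "\<kappa> n" n "\<kappa> n" m] mn by simp
    then have "?c (?s n) \<in> c \<tau> m" using lev[OF \<tau> _ _ some[OF \<tau>]] \<kappa> by blast
    moreover have "?c (?s m) \<in> \<Gamma>" using aK inK[OF \<tau> _ some[OF \<tau>]] \<kappa> by blast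
    ultimately show "?c (?s n) \<otimes> inv (?c (?s m)) \<in> core m" unfolding c_def using mem_core_coset by simp
  qed
  have "c (emb k) = emb (?c k)" if k: "k \<in> K" for k
  proof -
    have k\<Gamma>: "k \<in> \<Gamma>" using k K(2) by blast
    have cl: "emb k \<in> profinite_closure \<Delta> K"
      unfolding closure_iff[OF K(2)] using k k\<Gamma> emb_mem[OF k\<Gamma>] by auto
    show ?thesis
    proof (rule hat_eqI[OF chat[OF cl] emb_hat[OF aK[OF k]]])
      fix n
      have "?c k \<in> c (emb k) n" using lev[OF cl _ _ emb_mem[OF k\<Gamma>]] \<kappa> by blast
      then show "\<exists>x. x \<in> c (emb k) n \<and> x \<in> emb (?c k) n" using emb_mem[OF aK[OF k]] by blast
    qed
  qed
  moreover have "continuous_map (subtopology PT (profinite_closure \<Delta> K)) PT c"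
    unfolding continuous_map_def
  proof (intro conjI allI impI)
    show "c \<in> topspace (subtopology PT (profinite_closure \<Delta> K)) \<rightarrow> topspace PT"
      using chat by auto
    fix U assume U: "openin PT U"
    let ?S = "{\<tau> \<in> \<Gamma>hat. \<exists>\<sigma>\<in>profinite_closure \<Delta> K. c \<sigma> \<in> U \<and> (\<exists>k. \<tau> k = \<sigma> k \<and> (\<forall>\<rho>\<in>profinite_closure \<Delta> K. \<rho> k = \<sigma> k \<longrightarrow> c \<rho> \<in> U))}"
    have "openin PT ?S" unfolding openin_PT by blast
    moreover have "{\<tau> \<in> topspace (subtopology PT (profinite_closure \<Delta> K)). c \<tau> \<in> U} = ?S \<inter> profinite_closure \<Delta> K"
    proof (intro equalityI subsetI)
      fix \<tau> assume "\<tau> \<in> {\<tau> \<in> topspace (subtopology PT (profinite_closure \<Delta> K)). c \<tau> \<in> U}"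
      then have \<tau>: "\<tau> \<in> profinite_closure \<Delta> K" "c \<tau> \<in> U" by auto
      obtain n where n: "\<forall>\<sigma>\<in>\<Gamma>hat. \<sigma> n = c \<tau> n \<longrightarrow> \<sigma> \<in> U" using U \<tau>(2) openin_PT by blast
      have "c \<rho> \<in> U" if \<rho>: "\<rho> \<in> profinite_closure \<Delta> K" "\<rho> (\<kappa> n) = \<tau> (\<kappa> n)" for \<rho>
      proof -
        have "c \<rho> n = c \<tau> n" using \<rho>(2) by (simp add: c_def)
        then show ?thesis using n chat[OF \<rho>(1)] by blast
      qed
      then show "\<tau> \<in> ?S \<inter> profinite_closure \<Delta> K" using \<tau> hat[OF \<tau>(1)] by blast
    qed (use hat in auto)
    ultimately show "openin (subtopology PT (profinite_closure \<Delta> K)) {\<tau> \<in> topspace (subtopology PT (profinite_closure \<Delta> K)). c \<tau> \<in> U}"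
      unfolding openin_subtopology by blast
  qed
  ultimately show ?thesis using lev by blast
qed

text \<open>The image of \<open>K\<close> is dense in its closure, and the completion is Hausdorff.\<close>

lemma conj_extension_unique:
  assumes K: "K \<subseteq> \<Gamma>"
    and c: "continuous_map (subtopology PT (profinite_closure \<Delta> K)) PT c"
    and d: "continuous_map (subtopology PT (profinite_closure \<Delta> K)) PT d"
    and eq: "\<And>k. k \<in> K \<Longrightarrow> c (emb k) = d (emb k)" and \<tau>: "\<tau> \<in> profinite_closure \<Delta> K"
  shows "c \<tau> = d \<tau>"
proof (rule forall_in_closure_of_eq[OF _ Hausdorff_PT c d])
  have "emb ` K \<subseteq> profinite_closure \<Delta> K"
  proof clarify
    fix k assume k: "k \<in> K"
    then have "k \<in> \<Gamma>" using K by blast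
    then show "emb k \<in> profinite_closure \<Delta> K"
      unfolding closure_iff[OF K] using k emb_mem[of k] by auto
  qed
  then have "profinite_closure \<Delta> K \<inter> emb ` K = emb ` K" by blast
  then show "\<tau> \<in> subtopology PT (profinite_closure \<Delta> K) closure_of (emb ` K)"
    using \<tau> unfolding closure_of_subtopology by (simp add: profinite_closure_def)
qed (use eq in auto)

end

context fuchsian
begin

lemma Comm_eq: "Comm \<Gamma> = comm"
  unfolding Comm_def comm_def ..

lemma comm_PSL [simp]: "a \<in> comm \<Longrightarrow> a \<in> carrier PSL2R"
  by (rule comm_carrier)

lemma hat_act_sp:
  assumes \<tau>: "\<tau> \<in> \<Gamma>hat" and z: "z \<in> HH" and \<sigma>: "\<sigma> \<in> \<Gamma>hat"
  shows "hat_act \<Gamma> \<tau> (sp z \<sigma>) = sp z (\<tau> \<star> \<sigma>)"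
proof -
  have "(THE q. \<exists>w \<tau>'. w \<in> HH \<and> \<tau>' \<in> \<Gamma>hat \<and> sp z \<sigma> = sp w \<tau>' \<and> q = sp w (\<tau> \<star> \<tau>')) = sp z (\<tau> \<star> \<sigma>)"
  proof (rule the_equality)
    show "\<exists>w \<tau>'. w \<in> HH \<and> \<tau>' \<in> \<Gamma>hat \<and> sp z \<sigma> = sp w \<tau>' \<and> sp z (\<tau> \<star> \<sigma>) = sp w (\<tau> \<star> \<tau>')"
      using z \<sigma> by blast
    fix q assume "\<exists>w \<tau>'. w \<in> HH \<and> \<tau>' \<in> \<Gamma>hat \<and> sp z \<sigma> = sp w \<tau>' \<and> q = sp w (\<tau> \<star> \<tau>')"
    then obtain w \<tau>' where w: "w \<in> HH" "\<tau>' \<in> \<Gamma>hat" "sp z \<sigma> = sp w \<tau>'" "q = sp w (\<tau> \<star> \<tau>')" by blast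
    obtain g where g: "g \<in> \<Gamma>" "w = act g z" "\<sigma> = \<tau>' \<star> emb g"
      using sp_eqD[OF z w(1) \<sigma> w(2,3)] by blast
    show "q = sp z (\<tau> \<star> \<sigma>)"
      unfolding w(4) g(2,3) using sp_shift[OF z _ g(1), of "\<tau> \<star> \<tau>'"] \<tau> w(2) g(1) by (simp add: pmult_assoc)
  qed
  then show ?thesis using z \<sigma> by (simp add: hat_act_def)
qed

lemma hat_act_sol [simp]: "\<tau> \<in> \<Gamma>hat \<Longrightarrow> p \<in> sol \<Longrightarrow> hat_act \<Gamma> \<tau> p \<in> sol"
  by (erule sp_cases[of p]) (simp add: hat_act_sp)

lemma hat_act_mult: "\<sigma> \<in> \<Gamma>hat \<Longrightarrow> \<tau> \<in> \<Gamma>hat \<Longrightarrow> p \<in> sol \<Longrightarrow> hat_act \<Gamma> (\<sigma> \<star> \<tau>) p = hat_act \<Gamma> \<sigma> (hat_act \<Gamma> \<tau> p)"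
  by (erule sp_cases[of p]) (simp add: hat_act_sp pmult_assoc)

lemma hat_act_one: "p \<in> sol \<Longrightarrow> hat_act \<Gamma> (emb \<one>\<^bsub>PSL2R\<^esub>) p = p"
  by (erule sp_cases[of p]) (simp add: hat_act_sp one_pmult)

lemma hat_act_level:
  assumes "\<tau> \<in> \<Gamma>hat" "p \<in> sol" "t \<in> \<tau> n" "w \<in> p n"
  shows "hat_act \<Gamma> \<tau> p n = orb n (act t w)"
proof -
  obtain z \<sigma> where z: "z \<in> HH" "\<sigma> \<in> \<Gamma>hat" "p = sp z \<sigma>" using sp_cases[OF assms(2)] .
  obtain s where s: "s \<in> \<sigma> n" "w = act s z" using assms(4) z(3) by (auto simp: sol_point_def)
  have "t \<cdot> s \<in> (\<tau> \<star> \<sigma>) n" by (rule pmult_mem[OF assms(1) z(2) assms(3) s(1)])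
  then have "sp z (\<tau> \<star> \<sigma>) n = orb n (act (t \<cdot> s) z)" using sp_level[OF z(1)] assms(1) z(2) by simp
  moreover have "act (t \<cdot> s) z = act t w"
    using hat_mem(1)[OF assms(1,3)] hat_mem(1)[OF z(2) s(1)] z(1) s(2) by (simp add: act_mult)
  ultimately show ?thesis using hat_act_sp[OF assms(1) z(1,2)] z(3) by simp
qed

lemma orb_conj_core:
  assumes "a \<in> carrier PSL2R" "conj_core a k n" "w \<in> HH" "v \<in> orb k w"
  shows "orb n (act a v) = orb n (act a w)"
proof -
  obtain h where h: "h \<in> core k" "v = act h w" using assms(4) by (auto simp: PSL2R_orbit_eq)
  have "act a v = act (a \<cdot> h \<cdot> psl_inv a) (act a w)"
    using h assms(1,3) by (simp add: act_mult)
  moreover have "a \<cdot> h \<cdot> psl_inv a \<in> core n" using assms(2) h(1) unfolding conj_core_def by blast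
  ultimately show ?thesis using orb_act assms(1,3) by simp
qed

text \<open>All choices admitted in the definition of \<^const>\<open>Comm_act\<close> give the same point: at level \<open>n\<close> it
  is the \<open>core n\<close>-orbit of \<open>\<alpha> w\<close>, for any \<open>w\<close> in a sufficiently high level of \<open>p\<close>.\<close>

definition comm_rep :: "(real^2^2) set \<Rightarrow> solenoid_point \<Rightarrow> solenoid_point \<Rightarrow> bool" where
  "comm_rep a p q \<longleftrightarrow> (\<exists>K z \<tau>' \<gamma>.
     subgroup K PSL2R \<and> K \<subseteq> \<Gamma> \<and> finite_index PSL2R \<Gamma> K \<and> conj_subgroup PSL2R a K \<subseteq> \<Gamma> \<and>
     z \<in> HH \<and> \<tau>' \<in> hat \<Gamma> K \<and> \<gamma> \<in> \<Gamma> \<and> p = sp z (\<tau>' \<star> emb \<gamma>) \<and>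
     q = sp (act a (act \<gamma> z)) (hat_conj \<Gamma> K a \<tau>'))"

text \<open>The existence and uniqueness of the extension give a meaning to the description in the
  definition of \<open>hat_conj\<close>.\<close>

lemma hat_conj_level:
  assumes a: "a \<in> carrier PSL2R"
    and K: "subgroup K PSL2R" "K \<subseteq> \<Gamma>" "core l \<subseteq> K" "conj_subgroup PSL2R a K \<subseteq> \<Gamma>"
    and \<tau>: "\<tau> \<in> hat \<Gamma> K"
  shows "hat_conj \<Gamma> K a \<tau> \<in> \<Gamma>hat"
    and "\<And>k n t. l \<le> k \<Longrightarrow> conj_core a k n \<Longrightarrow> t \<in> \<tau> k \<Longrightarrow> a \<cdot> t \<cdot> psl_inv a \<in> hat_conj \<Gamma> K a \<tau> n"
proof -
  have aK: "a \<cdot> k \<cdot> psl_inv a \<in> \<Gamma>" if "k \<in> K" for k using K(4) that by (auto simp: conj_subgroup_def)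
  obtain c where c: "continuous_map (subtopology PT (hat \<Gamma> K)) PT c"
    "\<forall>k\<in>K. c (emb k) = emb (a \<cdot> k \<cdot> psl_inv a)"
    "\<forall>\<tau>\<in>hat \<Gamma> K. \<forall>n k t. l \<le> k \<longrightarrow> conj_core a k n \<longrightarrow> t \<in> \<tau> k \<longrightarrow> a \<cdot> t \<cdot> psl_inv a \<in> c \<tau> n"
    using conj_extension[OF K(1-3) a aK] by blast
  have "hat_conj \<Gamma> K a \<tau> = c \<tau>"
    unfolding hat_conj_def
  proof (rule the_equality)
    fix \<sigma> assume "\<exists>d. continuous_map (subtopology PT (hat \<Gamma> K)) PT d \<and>
       (\<forall>k\<in>K. d (emb k) = emb (a \<cdot> k \<cdot> psl_inv a)) \<and> \<sigma> = d \<tau>"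
    then obtain d where d: "continuous_map (subtopology PT (hat \<Gamma> K)) PT d"
       "\<forall>k\<in>K. d (emb k) = emb (a \<cdot> k \<cdot> psl_inv a)" "\<sigma> = d \<tau>" by blast
    show "\<sigma> = c \<tau>"
      unfolding d(3) by (rule conj_extension_unique[OF K(2) d(1) c(1) _ \<tau>]) (use c(2) d(2) in simp)
  qed (use c in blast)
  moreover have "c \<tau> \<in> \<Gamma>hat"
    using continuous_map_funspace[OF c(1)] \<tau> closure_iff[OF K(2), of \<tau>] by auto
  ultimately show "hat_conj \<Gamma> K a \<tau> \<in> \<Gamma>hat"
    and "\<And>k n t. l \<le> k \<Longrightarrow> conj_core a k n \<Longrightarrow> t \<in> \<tau> k \<Longrightarrow> a \<cdot> t \<cdot> psl_inv a \<in> hat_conj \<Gamma> K a \<tau> n"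
    using c(3) \<tau> by auto
qed

lemma comm_rep_level:
  assumes a: "a \<in> carrier PSL2R" and r: "comm_rep a p q" and k: "conj_core a k n" and w: "w \<in> p k"
  shows "q n = orb n (act a w)" "q \<in> sol"
proof -
  obtain K z \<tau> \<gamma> where *: "subgroup K PSL2R" "K \<subseteq> \<Gamma>" "finite_index PSL2R \<Gamma> K" "conj_subgroup PSL2R a K \<subseteq> \<Gamma>"
     "z \<in> HH" "\<tau> \<in> hat \<Gamma> K" "\<gamma> \<in> \<Gamma>" "p = sp z (\<tau> \<star> emb \<gamma>)"
     "q = sp (act a (act \<gamma> z)) (hat_conj \<Gamma> K a \<tau>)"
    using r unfolding comm_rep_def by blast
  obtain l where l: "core l \<subseteq> K" using finite_index_imp_core[OF *(1-3)] by blast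
  note hc = hat_conj_level[OF a *(1,2) l *(4,6)]
  have \<tau>: "\<tau> \<in> \<Gamma>hat" using *(6) closure_iff[OF *(2)] by simp
  define k' where "k' = max k l"
  have k': "conj_core a k' n" using conj_core_mono[OF k, of k' n] by (simp add: k'_def)
  obtain t where t: "t \<in> \<tau> k'" using hat_ex[OF \<tau>] by blast
  have t\<Gamma>: "t \<in> \<Gamma>" using hat_mem(1)[OF \<tau> t] .
  have lev: "a \<cdot> t \<cdot> psl_inv a \<in> hat_conj \<Gamma> K a \<tau> n" by (rule hc(2)[OF _ k' t]) (simp add: k'_def)
  have "q n = orb n (act (a \<cdot> t \<cdot> psl_inv a) (act a (act \<gamma> z)))"
    using sp_level[OF _ hc(1) lev, of "act a (act \<gamma> z)"] a *(5,7) unfolding *(9) by simp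
  also have "act (a \<cdot> t \<cdot> psl_inv a) (act a (act \<gamma> z)) = act a (act (t \<cdot> \<gamma>) z)"
    using a t\<Gamma> *(5,7) by (simp add: act_mult)
  also have "orb n (act a (act (t \<cdot> \<gamma>) z)) = orb n (act a w)"
  proof (rule orb_conj_core[OF a k])
    have p: "p \<in> sol" unfolding *(8) using *(5,7) \<tau> by simp
    then show "w \<in> HH" using sol_mem(1) w by blast
    have "t \<cdot> \<gamma> \<in> (\<tau> \<star> emb \<gamma>) k'" by (rule pmult_mem[OF \<tau> _ t emb_mem]) (use *(7) in auto)
    then have "act (t \<cdot> \<gamma>) z \<in> p k'" unfolding *(8) by (rule sp_mem)
    then have "act (t \<cdot> \<gamma>) z \<in> p k" using sol_nested[OF p, of k k'] by (simp add: k'_def)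
    then show "act (t \<cdot> \<gamma>) z \<in> orb k w" using sol_mem(2)[OF p w] by simp
  qed
  finally show "q n = orb n (act a w)" .
  show "q \<in> sol" unfolding *(9) using hc(1) a *(5,7) by simp
qed

text \<open>The element \<open>\<gamma>\<close> in the definition of the action can be chosen from \<open>\<sigma>\<close> alone. So on the leaf
  of the points \<open>[z, \<sigma>]\<close> the action is \<open>z \<mapsto> \<beta> z\<close> in the first coordinate and constant in the
  second.\<close>

lemma comm_rep_ex:
  assumes a: "a \<in> comm" and \<sigma>: "\<sigma> \<in> \<Gamma>hat"
  shows "\<exists>\<beta>\<in>carrier PSL2R. \<exists>\<rho>\<in>\<Gamma>hat. \<forall>z\<in>HH. comm_rep a (sp z \<sigma>) (sp (act \<beta> z) \<rho>)"
proof -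
  have ac: "a \<in> carrier PSL2R" using a by simp
  obtain m where m: "conj_core a m 0" using comm_conj_core[OF a] by blast
  obtain t where t: "t \<in> \<sigma> m" using hat_ex[OF \<sigma>] by blast
  have t\<Gamma>: "t \<in> \<Gamma>" using hat_mem(1)[OF \<sigma> t] .
  \<comment> \<open>Dividing by a representative of level \<open>m\<close> moves \<open>\<sigma>\<close> into the closure of \<open>core m\<close>, to which
    conjugation by \<open>a\<close> extends.\<close>
  define \<tau> where "\<tau> = \<sigma> \<star> emb (psl_inv t)"
  have \<tau>: "\<tau> \<in> \<Gamma>hat" using \<sigma> t\<Gamma> by (simp add: \<tau>_def)
  have "t \<cdot> psl_inv t \<in> \<tau> m"
    unfolding \<tau>_def by (rule pmult_mem[OF \<sigma> _ t emb_mem]) (use t\<Gamma> in auto)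
  then have "\<tau> m = core m" using hat_mem(2)[OF \<tau>, of "\<one>\<^bsub>PSL2R\<^esub>" m] t\<Gamma> by simp
  then have \<tau>m: "\<tau> \<in> hat \<Gamma> (core m)" using \<tau> by (simp add: closure_core)
  have conj: "conj_subgroup PSL2R a (core m) \<subseteq> \<Gamma>"
    using m unfolding conj_core_def conj_subgroup_def by auto
  have \<sigma>eq: "\<sigma> = \<tau> \<star> emb t"
    using \<sigma> t\<Gamma> by (simp add: \<tau>_def pmult_assoc emb_mult[symmetric] one_pmult)
  have "comm_rep a (sp z \<sigma>) (sp (act (a \<cdot> t) z) (hat_conj \<Gamma> (core m) a \<tau>))" if z: "z \<in> HH" for z
    unfolding comm_rep_def
    using core_subgroup[of m] core_subset[of m] finite_index_core[of m] conj z \<tau>m t\<Gamma> \<sigma>eq act_mult[OF ac _ z, of t]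
    by (intro exI[of _ "core m"] exI[of _ z] exI[of _ \<tau>] exI[of _ t]) simp
  moreover have "hat_conj \<Gamma> (core m) a \<tau> \<in> \<Gamma>hat"
    by (rule hat_conj_level(1)[OF ac core_subgroup core_subset order.refl conj \<tau>m])
  ultimately show ?thesis using ac t\<Gamma> by (intro bexI[of _ "a \<cdot> t"] bexI[of _ "hat_conj \<Gamma> (core m) a \<tau>"]) auto
qed

lemma comm_rep_unique:
  assumes a: "a \<in> comm" and p: "p \<in> sol" and q: "comm_rep a p q" "comm_rep a p q'"
  shows "q = q'"
proof
  fix n
  obtain k where k: "conj_core a k n" using comm_conj_core[OF a] by blast
  obtain w where w: "w \<in> p k" using sol_ex[OF p] by blast
  show "q n = q' n"
    using comm_rep_level(1)[OF comm_PSL[OF a] q(1) k w] comm_rep_level(1)[OF comm_PSL[OF a] q(2) k w] by simp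
qed

lemma Comm_act_eq:
  assumes a: "a \<in> comm" and p: "p \<in> sol" and q: "comm_rep a p q"
  shows "Comm_act \<Gamma> a p = q"
proof -
  have "Comm_act \<Gamma> a p = (THE q. comm_rep a p q)" using p by (simp add: Comm_act_def comm_rep_def)
  also have "\<dots> = q"
  proof (rule the_equality)
    show "r = q" if "comm_rep a p r" for r by (rule comm_rep_unique[OF a p that q])
  qed (rule q)
  finally show ?thesis .
qed

lemma Comm_act_affine:
  assumes "a \<in> comm" "\<sigma> \<in> \<Gamma>hat"
  shows "\<exists>\<beta>\<in>carrier PSL2R. \<exists>\<rho>\<in>\<Gamma>hat. \<forall>z\<in>HH. Comm_act \<Gamma> a (sp z \<sigma>) = sp (act \<beta> z) \<rho>"
proof -
  obtain \<beta> \<rho> where b: "\<beta> \<in> carrier PSL2R" "\<rho> \<in> \<Gamma>hat"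
      "\<forall>z\<in>HH. comm_rep a (sp z \<sigma>) (sp (act \<beta> z) \<rho>)"
    using comm_rep_ex[OF assms] by blast
  then have "\<forall>z\<in>HH. Comm_act \<Gamma> a (sp z \<sigma>) = sp (act \<beta> z) \<rho>"
    using Comm_act_eq[OF assms(1) sp_sol[OF _ assms(2)]] by blast
  then show ?thesis using b(1,2) by blast
qed

lemma Comm_act_level:
  assumes a: "a \<in> comm" and p: "p \<in> sol" and k: "conj_core a k n" and w: "w \<in> p k"
  shows "Comm_act \<Gamma> a p n = orb n (act a w)"
proof -
  obtain z \<sigma> where z: "z \<in> HH" "\<sigma> \<in> \<Gamma>hat" "p = sp z \<sigma>" using sp_cases[OF p] .
  obtain q where q: "comm_rep a p q" using comm_rep_ex[OF a z(2)] z by blast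
  show ?thesis unfolding Comm_act_eq[OF a p q] by (rule comm_rep_level(1)[OF comm_PSL[OF a] q k w])
qed

lemma Comm_act_sol [simp]:
  assumes a: "a \<in> comm" and p: "p \<in> sol"
  shows "Comm_act \<Gamma> a p \<in> sol"
proof -
  obtain z \<sigma> where z: "z \<in> HH" "\<sigma> \<in> \<Gamma>hat" "p = sp z \<sigma>" using sp_cases[OF p] .
  obtain \<beta> \<rho> where "\<beta> \<in> carrier PSL2R" "\<rho> \<in> \<Gamma>hat" "Comm_act \<Gamma> a p = sp (act \<beta> z) \<rho>"
    using Comm_act_affine[OF a z(2)] z by blast
  then show ?thesis using z(1) by simp
qed

lemma Comm_act_mem:
  assumes a: "a \<in> comm" and p: "p \<in> sol" and k: "conj_core a k n" and w: "w \<in> p k"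
  shows "act a w \<in> Comm_act \<Gamma> a p n"
  unfolding Comm_act_level[OF assms] using sol_mem(1)[OF p w] a by (intro orb_self) simp

lemma hat_act_mem:
  assumes "\<tau> \<in> \<Gamma>hat" "p \<in> sol" "t \<in> \<tau> n" "w \<in> p n"
  shows "act t w \<in> hat_act \<Gamma> \<tau> p n"
  unfolding hat_act_level[OF assms]
  using sol_mem(1)[OF assms(2,4)] hat_mem(1)[OF assms(1,3)] by (intro orb_self) simp

lemma sol_eqI:
  assumes "p \<in> sol" "q \<in> sol" "\<And>n. \<exists>z. z \<in> p n \<and> z \<in> q n"
  shows "p = q"
  using sol_level_eqI[OF assms(1,2)] assms(3) by blast

text \<open>At each level both sides contain the image of the same point of a sufficiently high level of
  \<open>p\<close>.\<close>

lemma Comm_act_mult: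
  assumes a: "a \<in> comm" and b: "b \<in> comm" and p: "p \<in> sol"
  shows "Comm_act \<Gamma> (a \<cdot> b) p = Comm_act \<Gamma> a (Comm_act \<Gamma> b p)"
proof (rule sol_eqI)
  fix n
  obtain k where k: "conj_core a k n" using comm_conj_core[OF a] by blast
  obtain l where l: "conj_core b l k" using comm_conj_core[OF b] by blast
  obtain w where w: "w \<in> p l" using sol_ex[OF p] by blast
  have wH: "w \<in> HH" using sol_mem(1)[OF p w] .
  have "act (a \<cdot> b) w \<in> Comm_act \<Gamma> (a \<cdot> b) p n"
    by (rule Comm_act_mem[OF _ p conj_core_mult[OF _ _ k l] w]) (use a b in auto)
  moreover have "act a (act b w) \<in> Comm_act \<Gamma> a (Comm_act \<Gamma> b p) n"
    by (rule Comm_act_mem[where p = "Comm_act \<Gamma> b p" and w = "act b w", OF a _ k Comm_act_mem[OF b p l w]])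
      (use b p in simp)
  ultimately show "\<exists>z. z \<in> Comm_act \<Gamma> (a \<cdot> b) p n \<and> z \<in> Comm_act \<Gamma> a (Comm_act \<Gamma> b p) n"
    using act_mult[OF _ _ wH, of a b] a b by auto
qed (use assms in auto)

lemma Comm_act_sub:
  assumes g: "\<gamma> \<in> \<Gamma>" and p: "p \<in> sol"
  shows "Comm_act \<Gamma> \<gamma> p = hat_act \<Gamma> (emb \<gamma>) p"
proof (rule sol_eqI)
  fix n
  obtain w where w: "w \<in> p n" using sol_ex[OF p] by blast
  show "\<exists>z. z \<in> Comm_act \<Gamma> \<gamma> p n \<and> z \<in> hat_act \<Gamma> (emb \<gamma>) p n"
    using Comm_act_mem[OF sub_comm[OF g] p conj_core_sub[OF g] w]
      hat_act_mem[OF emb_hat[OF g] p emb_mem[OF g] w] by blast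
qed (use assms in auto)

lemma Comm_act_one: "p \<in> sol \<Longrightarrow> Comm_act \<Gamma> \<one>\<^bsub>PSL2R\<^esub> p = p"
  using Comm_act_sub[of "\<one>\<^bsub>PSL2R\<^esub>"] hat_act_one by simp

lemma Comm_act_inv [simp]:
  assumes "a \<in> comm" "p \<in> sol"
  shows "Comm_act \<Gamma> a (Comm_act \<Gamma> (psl_inv a) p) = p" "Comm_act \<Gamma> (psl_inv a) (Comm_act \<Gamma> a p) = p"
  using assms Comm_act_mult[of a "psl_inv a" p] Comm_act_mult[of "psl_inv a" a p] Comm_act_one by simp_all

lemma hat_act_inv [simp]:
  assumes "\<tau> \<in> \<Gamma>hat" "p \<in> sol"
  shows "hat_act \<Gamma> \<tau> (hat_act \<Gamma> (hinv \<tau>) p) = p" "hat_act \<Gamma> (hinv \<tau>) (hat_act \<Gamma> \<tau> p) = p"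
  using assms hat_act_mult[of \<tau> "hinv \<tau>" p] hat_act_mult[of "hinv \<tau>" \<tau> p]
  by (simp_all add: hinv_pmult hat_act_one)

lemma Comm_act_base:
  assumes a: "a \<in> comm" and z: "z \<in> HH"
  shows "Comm_act \<Gamma> a (sp z (emb \<one>\<^bsub>PSL2R\<^esub>)) = sp (act a z) (emb \<one>\<^bsub>PSL2R\<^esub>)"
proof (rule sol_eqI)
  fix n
  obtain k where k: "conj_core a k n" using comm_conj_core[OF a] by blast
  have base: "w \<in> sp w (emb \<one>\<^bsub>PSL2R\<^esub>) k" if "w \<in> HH" for w k
    using sp_mem[of "\<one>\<^bsub>PSL2R\<^esub>" "emb \<one>\<^bsub>PSL2R\<^esub>" k w] emb_mem[of "\<one>\<^bsub>PSL2R\<^esub>" k] that by simp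
  have "act a z \<in> Comm_act \<Gamma> a (sp z (emb \<one>\<^bsub>PSL2R\<^esub>)) n"
    by (rule Comm_act_mem[OF a _ k base[OF z]]) (use z in simp)
  then show "\<exists>w. w \<in> Comm_act \<Gamma> a (sp z (emb \<one>\<^bsub>PSL2R\<^esub>)) n \<and> w \<in> sp (act a z) (emb \<one>\<^bsub>PSL2R\<^esub>) n"
    using base[of "act a z"] a z by auto
qed (use assms in auto)

text \<open>An element \<open>\<tau>\<close> of the completion near \<open>1\<close> passes across \<open>x\<close>: the element \<open>\<tau>'\<close> is the value
  at \<open>\<tau>\<close> of the continuous extension of conjugation by the inverse of \<open>x\<close>, and continuity puts it
  into the closure of \<open>core n\<close>.\<close>

lemma hat_act_Comm_act:
  assumes x: "x \<in> comm"
  shows "\<exists>m. \<forall>\<tau>\<in>\<Gamma>hat. \<tau> m = core m \<longrightarrow> (\<exists>\<tau>'\<in>\<Gamma>hat. \<tau>' n = core n \<and>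
    (\<forall>p\<in>sol. hat_act \<Gamma> \<tau> (Comm_act \<Gamma> x p) = Comm_act \<Gamma> x (hat_act \<Gamma> \<tau>' p)))"
proof -
  have xc: "x \<in> carrier PSL2R" using x by simp
  let ?y = "psl_inv x"
  have y: "?y \<in> comm" "?y \<in> carrier PSL2R" using x by auto
  obtain m where m: "conj_core ?y m n" using comm_conj_core[OF y(1)] by blast
  have yK: "?y \<cdot> k \<cdot> psl_inv ?y \<in> \<Gamma>" if "k \<in> core m" for k
    using m that core_mem unfolding conj_core_def by blast
  have ex: "\<exists>c. continuous_map (subtopology PT (hat \<Gamma> (core m))) PT c \<and>
    (\<forall>k\<in>core m. c (emb k) = emb (?y \<cdot> k \<cdot> psl_inv ?y)) \<and>
    (\<forall>\<tau>\<in>hat \<Gamma> (core m). \<forall>n k t. m \<le> k \<longrightarrow> conj_core ?y k n \<longrightarrow> t \<in> \<tau> k \<longrightarrow> ?y \<cdot> t \<cdot> psl_inv ?y \<in> c \<tau> n)"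
    by (rule conj_extension[OF core_subgroup core_subset order.refl y(2)]) (rule yK)
  obtain c where c: "continuous_map (subtopology PT (hat \<Gamma> (core m))) PT c"
    "\<forall>k\<in>core m. c (emb k) = emb (?y \<cdot> k \<cdot> psl_inv ?y)"
    "\<forall>\<tau>\<in>hat \<Gamma> (core m). \<forall>n k t. m \<le> k \<longrightarrow> conj_core ?y k n \<longrightarrow> t \<in> \<tau> k \<longrightarrow> ?y \<cdot> t \<cdot> psl_inv ?y \<in> c \<tau> n"
    using ex by (elim exE conjE) (rule that)
  have "\<exists>\<tau>'\<in>\<Gamma>hat. \<tau>' n = core n \<and>
    (\<forall>p\<in>sol. hat_act \<Gamma> \<tau> (Comm_act \<Gamma> x p) = Comm_act \<Gamma> x (hat_act \<Gamma> \<tau>' p))"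
    if \<tau>: "\<tau> \<in> \<Gamma>hat" "\<tau> m = core m" for \<tau>
  proof (intro bexI[of _ "c \<tau>"] conjI ballI)
    have \<tau>m: "\<tau> \<in> hat \<Gamma> (core m)" using \<tau> by (simp add: closure_core)
    show ch: "c \<tau> \<in> \<Gamma>hat"
      using continuous_map_funspace[OF c(1)] \<tau>m \<tau>(1) by auto
    have "\<one>\<^bsub>PSL2R\<^esub> \<in> \<tau> m" using \<tau>(2) by simp
    then have "?y \<cdot> \<one>\<^bsub>PSL2R\<^esub> \<cdot> psl_inv ?y \<in> c \<tau> n" using c(3) \<tau>m m by blast
    then have "\<one>\<^bsub>PSL2R\<^esub> \<in> c \<tau> n" using xc by simp
    then show "c \<tau> n = core n" using hat_mem(2)[OF ch] by (metis core_coset_one)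
    fix p assume p: "p \<in> sol"
    \<comment> \<open>At level \<open>l\<close> both sides contain \<open>t x w = x (x\<^sup>-\<^sup>1 t x) w\<close>.\<close>
    show "hat_act \<Gamma> \<tau> (Comm_act \<Gamma> x p) = Comm_act \<Gamma> x (hat_act \<Gamma> (c \<tau>) p)"
    proof (rule sol_eqI)
      fix l
      obtain k where k: "conj_core x k l" using comm_conj_core[OF x] by blast
      obtain j where j: "max m l \<le> j" "conj_core ?y j k" using comm_conj_core[OF y(1)] by blast
      obtain t where t: "t \<in> \<tau> j" using hat_ex[OF \<tau>(1)] by blast
      have t\<Gamma>: "t \<in> \<Gamma>" using hat_mem(1)[OF \<tau>(1) t] .
      have tl: "t \<in> \<tau> l" using hat_nested[OF \<tau>(1) _ t] j(1) by simp
      have "?y \<cdot> t \<cdot> psl_inv ?y \<in> c \<tau> k" using c(3) \<tau>m j t by auto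
      then have s: "?y \<cdot> t \<cdot> x \<in> c \<tau> k" using xc by simp
      obtain w where w: "w \<in> p k" using sol_ex[OF p] by blast
      have wH: "w \<in> HH" using sol_mem(1)[OF p w] .
      have "act t (act x w) \<in> hat_act \<Gamma> \<tau> (Comm_act \<Gamma> x p) l"
        by (rule hat_act_mem[where p = "Comm_act \<Gamma> x p" and w = "act x w", OF \<tau>(1) _ tl Comm_act_mem[OF x p k w]])
          (use x p in simp)
      moreover have "act x (act (?y \<cdot> t \<cdot> x) w) \<in> Comm_act \<Gamma> x (hat_act \<Gamma> (c \<tau>) p) l"
        by (rule Comm_act_mem[where p = "hat_act \<Gamma> (c \<tau>) p" and w = "act (?y \<cdot> t \<cdot> x) w", OF x _ k hat_act_mem[OF ch p s w]])
          (use ch p in simp)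
      moreover have "act x (act (?y \<cdot> t \<cdot> x) w) = act t (act x w)"
        using xc t\<Gamma> wH by (simp add: act_mult)
      ultimately show "\<exists>z. z \<in> hat_act \<Gamma> \<tau> (Comm_act \<Gamma> x p) l \<and> z \<in> Comm_act \<Gamma> x (hat_act \<Gamma> (c \<tau>) p) l"
        by auto
    qed (use x p ch \<tau>(1) in auto)
  qed
  then show ?thesis by blast
qed

subsection \<open>Both groups act by holomorphic bijections\<close>

text \<open>At level \<open>n\<close> such a map is induced by a map of orbit spaces from level \<open>k\<close>, which is
  continuous since orbit spaces carry the quotient topology.\<close>

lemma continuous_map_sol_levels:
  assumes Fs: "\<And>p. p \<in> sol \<Longrightarrow> F p \<in> sol"
    and lev: "\<And>n. \<exists>k \<beta>. \<beta> \<in> carrier PSL2R \<and> conj_core \<beta> k n \<and> (\<forall>p\<in>sol. \<forall>w\<in>p k. F p n = orb n (act \<beta> w))"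
  shows "continuous_map ST ST F"
proof -
  have "continuous_map ST (orbit_space (core n)) (\<lambda>p. F p n)" for n
  proof -
    obtain k \<beta> where b: "\<beta> \<in> carrier PSL2R" "conj_core \<beta> k n" "\<forall>p\<in>sol. \<forall>w\<in>p k. F p n = orb n (act \<beta> w)"
      using lev by blast
    define G where "G O' = (\<Union>w\<in>O'. orb n (act \<beta> w))" for O'
    have G: "G (orb k w) = orb n (act \<beta> w)" if "w \<in> HH" for w
      unfolding G_def using orb_conj_core[OF b(1,2) that] orb_self[OF that, of k] by blast
    have "continuous_map (top_of_set HH) (orbit_space (core n)) (PSL2R_orbit (core n) \<circ> act \<beta>)"
      by (rule continuous_map_compose[OF _ continuous_map_orbit]) (use continuous_on_act[OF b(1)] b(1) in auto)
    then have "continuous_map (top_of_set HH) (orbit_space (core n)) (G \<circ> PSL2R_orbit (core k))"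
      by (rule continuous_map_eq) (simp add: G)
    then have "continuous_map (orbit_space (core k)) (orbit_space (core n)) G"
      by (rule continuous_compose_quotient_map[OF quotient_map_orbit])
    then have "continuous_map ST (orbit_space (core n)) (G \<circ> (\<lambda>p. p k))"
      by (rule continuous_map_compose[OF continuous_map_level])
    then show ?thesis
    proof (rule continuous_map_eq)
      fix p assume "p \<in> topspace ST"
      then have p: "p \<in> sol" by simp
      obtain w where w: "w \<in> p k" using sol_ex[OF p] by blast
      show "(G \<circ> (\<lambda>p. p k)) p = F p n" using b(3) p w sol_mem[OF p w] G by simp
    qed
  qed
  then have "continuous_map ST (product_topology (\<lambda>n. orbit_space (core n)) UNIV) F"
    by (simp add: continuous_map_componentwise_UNIV)
  then have "continuous_map ST (subtopology (product_topology (\<lambda>n. orbit_space (core n)) UNIV) sol) F"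
    by (rule continuous_map_into_subtopology) (use Fs in auto)
  then show ?thesis unfolding solenoid_topology_def .
qed

lemma continuous_map_Comm_act: "a \<in> comm \<Longrightarrow> continuous_map ST ST (Comm_act \<Gamma> a)"
proof (rule continuous_map_sol_levels)
  fix n assume a: "a \<in> comm"
  obtain k where k: "conj_core a k n" using comm_conj_core[OF a] by blast
  then show "\<exists>k \<beta>. \<beta> \<in> carrier PSL2R \<and> conj_core \<beta> k n \<and> (\<forall>p\<in>sol. \<forall>w\<in>p k. Comm_act \<Gamma> a p n = orb n (act \<beta> w))"
    using Comm_act_level[OF a] a by (intro exI[of _ k] exI[of _ a]) simp
qed simp

lemma continuous_map_hat_act: "\<tau> \<in> \<Gamma>hat \<Longrightarrow> continuous_map ST ST (hat_act \<Gamma> \<tau>)"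
proof (rule continuous_map_sol_levels)
  fix n assume t: "\<tau> \<in> \<Gamma>hat"
  obtain x where x: "x \<in> \<tau> n" using hat_ex[OF t] by blast
  have x\<Gamma>: "x \<in> \<Gamma>" using hat_mem(1)[OF t x] .
  show "\<exists>k \<beta>. \<beta> \<in> carrier PSL2R \<and> conj_core \<beta> k n \<and> (\<forall>p\<in>sol. \<forall>w\<in>p k. hat_act \<Gamma> \<tau> p n = orb n (act \<beta> w))"
    using hat_act_level[OF t _ x] x\<Gamma> conj_core_sub[OF x\<Gamma>] by (intro exI[of _ n] exI[of _ x]) simp
qed simp

text \<open>In product charts such a map is \<open>z \<mapsto> \<gamma> \<beta> z\<close> with \<open>\<gamma> \<in> \<Gamma>\<close>. Since the chart coordinate is
  continuous, proper discontinuity makes \<open>\<gamma>\<close> locally constant.\<close>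

lemma sol_holomorphic_affine:
  assumes cont: "continuous_map ST ST F"
    and aff: "\<And>\<tau>. \<tau> \<in> \<Gamma>hat \<Longrightarrow> \<exists>\<beta>\<in>carrier PSL2R. \<exists>\<rho>\<in>\<Gamma>hat. \<forall>z\<in>HH. F (sp z \<tau>) = sp (act \<beta> z) \<rho>"
  shows "sol_holomorphic \<Gamma> F"
  unfolding sol_holomorphic_def
proof (intro conjI allI impI ballI cont)
  fix D T D' T' \<tau> assume ch: "sol_chart \<Gamma> D T \<and> sol_chart \<Gamma> D' T'" and \<tau>T: "\<tau> \<in> T"
  let ?I = "case_prod sp ` (D' \<times> T')"
  let ?S = "{z \<in> D. F (sp z \<tau>) \<in> ?I}"
  let ?g = "\<lambda>z. inv_into (D' \<times> T') (case_prod sp) (F (sp z \<tau>))"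
  have Tsub: "T \<subseteq> \<Gamma>hat" if "sol_chart \<Gamma> D T" for D T
  proof -
    from that obtain \<sigma> m where "\<sigma> \<in> \<Gamma>hat" "T = \<sigma> <#\<^bsub>profinite \<Delta>\<^esub> profinite_closure \<Delta> (core m)"
      unfolding sol_chart_def by blast
    then show ?thesis by (auto simp: l_coset_def closure_core)
  qed
  have T: "\<tau> \<in> \<Gamma>hat" "T' \<subseteq> \<Gamma>hat" using Tsub ch \<tau>T by blast+
  have D: "D \<subseteq> HH" "D' \<subseteq> HH" "open D'" using ch by (auto simp: sol_chart_def)
  obtain \<beta> \<rho> where b: "\<beta> \<in> carrier PSL2R" "\<rho> \<in> \<Gamma>hat" "\<forall>z\<in>HH. F (sp z \<tau>) = sp (act \<beta> z) \<rho>"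
    using aff[OF T(1)] by blast
  have hom: "homeomorphic_map (prod_topology (top_of_set D') (subtopology PT T'))
      (subtopology ST ?I) (case_prod sp)"
    using ch by (auto simp: sol_chart_def)
  have ts: "topspace (prod_topology (top_of_set D') (subtopology PT T')) = D' \<times> T'" using T(2) by auto
  have inj: "inj_on (case_prod sp) (D' \<times> T')"
    using homeomorphic_imp_injective_map[OF hom] unfolding ts .
  have ginv: "?g z \<in> D' \<times> T'" "case_prod sp (?g z) = F (sp z \<tau>)" if "z \<in> ?S" for z
  proof -
    from that have "F (sp z \<tau>) \<in> ?I" by blast
    then show "?g z \<in> D' \<times> T'" "case_prod sp (?g z) = F (sp z \<tau>)"
      by (rule inv_into_into, rule f_inv_into_f)
  qed
  have cg: "continuous_on ?S (\<lambda>z. fst (?g z))"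
  proof -
    have cs: "continuous_map (top_of_set ?S) PR (\<lambda>z. (z, \<tau>))"
      using T(1) D(1) by (intro continuous_map_pairedI) auto
    have "continuous_map (top_of_set ?S) ST (\<lambda>z. F (sp z \<tau>))"
      using continuous_map_compose[OF continuous_map_compose[OF cs continuous_map_sp] cont]
      by (simp add: o_def)
    then have c1: "continuous_map (top_of_set ?S) (subtopology ST ?I) (\<lambda>z. F (sp z \<tau>))"
      by (rule continuous_map_into_subtopology) auto
    obtain h where h: "homeomorphic_maps (prod_topology (top_of_set D') (subtopology PT T'))
      (subtopology ST ?I) (case_prod sp) h"
      using hom unfolding homeomorphic_map_maps by blast
    have ch: "continuous_map (subtopology ST ?I) (prod_topology (top_of_set D') (subtopology PT T')) h"
      "\<And>x. x \<in> D' \<times> T' \<Longrightarrow> h (case_prod sp x) = x"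
      using h ts by (auto simp: homeomorphic_maps_def)
    have "continuous_map (top_of_set ?S) (top_of_set D') (fst \<circ> (h \<circ> (\<lambda>z. F (sp z \<tau>))))"
      by (rule continuous_map_compose[OF continuous_map_compose[OF c1 ch(1)] continuous_map_fst])
    then have "continuous_map (top_of_set ?S) (top_of_set D') (\<lambda>z. fst (?g z))"
    proof (rule continuous_map_eq)
      fix z assume "z \<in> topspace (top_of_set ?S)"
      then have z: "z \<in> ?S" by simp
      have "h (F (sp z \<tau>)) = ?g z" using ch(2)[OF ginv(1)[OF z]] unfolding ginv(2)[OF z] .
      then show "(fst \<circ> (h \<circ> (\<lambda>z. F (sp z \<tau>)))) z = fst (?g z)" by simp
    qed
    then show ?thesis by (auto simp: continuous_map_in_subtopology)
  qed
  show "(\<lambda>z. fst (?g z)) holomorphic_on ?S"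
    unfolding holomorphic_on_def
  proof
    fix z0 assume z0: "z0 \<in> ?S"
    have orbit: "\<exists>\<gamma>\<in>\<Gamma>. fst (?g z) = act \<gamma> (act \<beta> z)" if z: "z \<in> ?S" for z
    proof -
      obtain w \<sigma> where w: "?g z = (w, \<sigma>)" by fastforce
      have ws: "w \<in> D'" "\<sigma> \<in> T'" "sp w \<sigma> = F (sp z \<tau>)" using ginv[OF z] unfolding w by auto
      have zH: "z \<in> HH" using z D(1) by blast
      have "sp (act \<beta> z) \<rho> = sp w \<sigma>" using ws(3) b(3) zH by simp
      moreover have "act \<beta> z \<in> HH" "w \<in> HH" "\<sigma> \<in> \<Gamma>hat" using b(1) zH ws(1,2) D(2) T(2) by auto
      ultimately obtain \<gamma> where "\<gamma> \<in> \<Gamma>" "w = act \<gamma> (act \<beta> z)"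
        using sp_eqD[OF _ _ b(2)] by metis
      then show ?thesis using w by auto
    qed
    obtain \<gamma> where g: "\<gamma> \<in> \<Gamma>" "fst (?g z0) = act \<gamma> (act \<beta> z0)" using orbit[OF z0] by blast
    have z0H: "z0 \<in> HH" using z0 D(1) by blast
    have "fst (?g z0) \<in> HH" using g b(1) z0H by simp
    then obtain E where E: "good_disc E" "fst (?g z0) \<in> E" using ex_good_disc by blast
    let ?f = "\<lambda>z. act (\<gamma> \<cdot> \<beta>) z"
    have gb: "\<gamma> \<cdot> \<beta> \<in> carrier PSL2R" using g(1) b(1) by simp
    have 1: "\<forall>\<^sub>F z in at z0 within ?S. fst (?g z) \<in> E"
      by (rule topological_tendstoD[OF bspec[OF cg[unfolded continuous_on_def] z0] good_discD(1)[OF E(1)] E(2)])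
    have cf: "continuous_on ?S ?f" by (rule continuous_on_act[OF gb]) (use D(1) in blast)
    have "?f z0 \<in> E" using E(2) g z0H b(1) by (simp add: act_mult)
    then have 2: "\<forall>\<^sub>F z in at z0 within ?S. ?f z \<in> E"
      by (rule topological_tendstoD[OF bspec[OF cf[unfolded continuous_on_def] z0] good_discD(1)[OF E(1)]])
    have 3: "\<forall>\<^sub>F z in at z0 within ?S. z \<in> ?S" by (simp add: eventually_at_filter)
    \<comment> \<open>Two elements of \<open>\<Gamma>\<close> that move the same point into the good disc \<open>E\<close> coincide, so near \<open>z0\<close>
      the coordinate is given by the single element \<open>\<gamma>\<close>.\<close>
    have eq: "fst (?g z) = ?f z" if "z \<in> ?S" "fst (?g z) \<in> E" "?f z \<in> E" for z
    proof -
      from orbit[OF that(1)] obtain \<delta> where d: "\<delta> \<in> \<Gamma>" "fst (?g z) = act \<delta> (act \<beta> z)" by blast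
      have zH: "z \<in> HH" using that(1) D(1) by blast
      have "?f z = act \<gamma> (act \<beta> z)" using g(1) b(1) zH by (simp add: act_mult)
      then have "\<delta> = \<gamma>" using good_disc_eq[OF E(1) d(1) g(1), of "act \<beta> z"] that(2,3) d(2) b(1) zH by simp
      then show ?thesis using d(2) \<open>?f z = act \<gamma> (act \<beta> z)\<close> by simp
    qed
    have ev: "\<forall>\<^sub>F z in at z0 within ?S. fst (?g z) = ?f z"
      using 1 2 3 by eventually_elim (rule eq)
    have "?f holomorphic_on ?S" by (rule holomorphic_on_subset[OF holomorphic_act[OF gb]]) (use D(1) in blast)
    then obtain u where u: "(?f has_field_derivative u) (at z0 within ?S)"
      using z0 unfolding holomorphic_on_def field_differentiable_def by blast
    have "fst (?g z0) = ?f z0" using g z0H b(1) by (simp add: act_mult)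
    then have "((\<lambda>z. fst (?g z)) has_field_derivative u) (at z0 within ?S)"
      using u has_field_derivative_cong_eventually[OF ev, of u] by simp
    then show "(\<lambda>z. fst (?g z)) field_differentiable (at z0 within ?S)"
      unfolding field_differentiable_def by blast
  qed
qed

end

section \<open>Automorphisms of the solenoid\<close>

context fuchsian
begin

abbreviation "ee \<equiv> emb \<one>\<^bsub>PSL2R\<^esub>"

lemma ee_hat [simp]: "ee \<in> \<Gamma>hat"
  by (rule emb_hat) simp

lemma sp_emb: "z \<in> HH \<Longrightarrow> \<gamma> \<in> \<Gamma> \<Longrightarrow> sp z (emb \<gamma>) = sp (act \<gamma> z) ee"
  using sp_shift[of z ee \<gamma>] by (simp add: one_pmult)

lemma open_preimage_ST:
  assumes "continuous_map (top_of_set HH) Y f" "openin Y W"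
  shows "open {z \<in> HH. f z \<in> W}"
  using openin_continuous_map_preimage[OF assms] open_HH by (simp add: openin_open_eq)

subsection \<open>Lifting maps from the upper half plane\<close>

text \<open>Pulling back the covering \<open>HH \<rightarrow> HH / \<Gamma>\<close> along \<open>f\<close> gives a covering of \<open>HH\<close> inside the plane
  \<open>complex \<times> complex\<close>, which has a section because \<open>HH\<close> is simply connected.\<close>

lemma covering_pullback:
  assumes f: "continuous_map (top_of_set HH) ST f"
  shows "covering_space {(z, w). z \<in> HH \<and> w \<in> f z 0} fst HH"
    (is "covering_space ?E fst HH")
proof
  have fs: "f z \<in> sol" if "z \<in> HH" for z using continuous_map_funspace[OF f] that by auto
  have cf: "continuous_map (top_of_set HH) (orbit_space (core 0)) (\<lambda>z. f z 0)"
    using continuous_map_compose[OF f continuous_map_level[of 0]] by (simp add: o_def)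
  show "continuous_on ?E fst" by (intro continuous_intros)
  show "fst ` ?E = HH" using sol_ex[OF fs, of _ 0] by force
  fix z0 assume z0: "z0 \<in> HH"
  obtain w0 where w0: "w0 \<in> f z0 0" using sol_ex[OF fs[OF z0]] by blast
  have w0H: "w0 \<in> HH" "f z0 0 = orb 0 w0" using sol_mem[OF fs[OF z0] w0] by auto
  obtain D where D: "good_disc D" "w0 \<in> D" using ex_good_disc[OF w0H(1)] by blast
  note DH = good_discD(1,2)[OF D(1)]
  let ?pi = "PSL2R_orbit (core 0)"
  define T where "T = {z \<in> HH. f z 0 \<in> ?pi ` D}"
  have T: "open T" "T \<subseteq> HH" "z0 \<in> T"
    using open_preimage_ST[OF cf openin_orbit_image[OF core_subgroup DH]] z0 w0H(2) D(2)
    by (auto simp: T_def)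
  have ex: "\<exists>x. x \<in> D \<and> x \<in> f z 0" if z: "z \<in> T" for z
  proof -
    obtain x where "x \<in> D" "f z 0 = orb 0 x" using z by (auto simp: T_def)
    then show ?thesis using orb_self[of x 0] DH(2) by blast
  qed
  \<comment> \<open>The local section over \<open>T\<close>: the point of \<open>f z 0\<close> in \<open>D\<close>. The sheets over \<open>T\<close> are its
    translates by the elements of \<open>\<Gamma>\<close>.\<close>
  define w where "w z = (SOME x. x \<in> D \<and> x \<in> f z 0)" for z
  have w: "w z \<in> D" "w z \<in> f z 0" if "z \<in> T" for z
    using someI_ex[OF ex[OF that]] by (auto simp: w_def)
  have wH: "w z \<in> HH" if "z \<in> T" for z using w[OF that] DH by blast
  have fw: "f z 0 = orb 0 (w z)" if "z \<in> T" for z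
    using sol_mem(2)[OF fs w(2)[OF that]] that T(2) by blast
  have uniq: "x = w z" if z: "z \<in> T" "x \<in> D" "x \<in> f z 0" for x z
  proof -
    obtain g where g: "g \<in> \<Gamma>" "x = act g (w z)" using z(3) unfolding fw[OF z(1)] by (auto simp: PSL2R_orbit_eq)
    then have "g = \<one>\<^bsub>PSL2R\<^esub>" using good_discD(3)[OF D(1) g(1) w(1)[OF z(1)]] z(2) by simp
    then show ?thesis using g(2) wH[OF z(1)] by simp
  qed
  have cw: "continuous_on T w"
    unfolding continuous_on_open_vimage[OF T(1)]
  proof (intro allI impI)
    fix B :: "complex set" assume B: "open B"
    have "w -` B \<inter> T = {z \<in> HH. f z 0 \<in> ?pi ` (D \<inter> B)}"
    proof (intro equalityI subsetI)
      fix z assume "z \<in> w -` B \<inter> T"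
      then show "z \<in> {z \<in> HH. f z 0 \<in> ?pi ` (D \<inter> B)}" using T(2) w(1) fw by auto
    next
      fix z assume "z \<in> {z \<in> HH. f z 0 \<in> ?pi ` (D \<inter> B)}"
      then obtain x where x: "z \<in> HH" "x \<in> D" "x \<in> B" "f z 0 = orb 0 x" by auto
      then have zT: "z \<in> T" by (auto simp: T_def)
      have "x \<in> f z 0" unfolding x(4) using x(2) DH(2) by (intro orb_self) blast
      then have "x = w z" using uniq[OF zT x(2)] by blast
      then show "z \<in> w -` B \<inter> T" using x(3) zT by simp
    qed
    moreover have "open {z \<in> HH. f z 0 \<in> ?pi ` (D \<inter> B)}"
      by (rule open_preimage_ST[OF cf openin_orbit_image[OF core_subgroup]]) (use B DH in auto)
    ultimately show "open (w -` B \<inter> T)" by simp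
  qed
  define q where "q g z = (z, act g (w z))" for g z
  have E: "q g z \<in> ?E" if "g \<in> \<Gamma>" "z \<in> T" for g z
  proof -
    have "act g (w z) \<in> f z 0" unfolding fw[OF that(2)] by (rule act_orb) (use that in simp)
    then show ?thesis using T(2) that by (auto simp: q_def)
  qed
  \<comment> \<open>Being cut out by an open box, the sheets are open in the covering space.\<close>
  have sheet: "q g ` T = ?E \<inter> (T \<times> act g ` D)" if g: "g \<in> \<Gamma>" for g
  proof (intro equalityI subsetI)
    fix y assume "y \<in> q g ` T"
    then show "y \<in> ?E \<inter> (T \<times> act g ` D)" using E[OF g] w(1) by (auto simp: q_def)
  next
    fix y assume y: "y \<in> ?E \<inter> (T \<times> act g ` D)"
    then obtain z d where z: "y = (z, act g d)" "z \<in> T" "d \<in> D" "act g d \<in> f z 0" by auto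
    have dH: "d \<in> HH" using z(3) DH(2) by blast
    have "act (psl_inv g) (act g d) \<in> orb 0 (act g d)" by (rule act_orb) (use g in simp)
    also have "orb 0 (act g d) = f z 0" using sol_mem(2)[OF fs z(4)] z(2) T(2) by blast
    finally have "d \<in> f z 0" using g dH by simp
    then have "d = w z" using uniq z by blast
    then show "y \<in> q g ` T" using z by (auto simp: q_def)
  qed
  have "\<Union> ((\<lambda>g. q g ` T) ` \<Gamma>) = ?E \<inter> fst -` T"
  proof (intro equalityI subsetI)
    fix y assume "y \<in> ?E \<inter> fst -` T"
    then obtain z x where zx: "y = (z, x)" "z \<in> T" "x \<in> f z 0" by auto
    then obtain g where "g \<in> \<Gamma>" "x = act g (w z)" using fw by (auto simp: PSL2R_orbit_eq)
    then show "y \<in> \<Union> ((\<lambda>g. q g ` T) ` \<Gamma>)" using zx by (auto simp: q_def)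
  next
    fix y assume "y \<in> \<Union> ((\<lambda>g. q g ` T) ` \<Gamma>)"
    then show "y \<in> ?E \<inter> fst -` T" using E by (auto simp: q_def)
  qed
  moreover have "\<forall>u\<in>(\<lambda>g. q g ` T) ` \<Gamma>. openin (top_of_set ?E) u"
  proof clarify
    fix g assume g: "g \<in> \<Gamma>"
    have "open (T \<times> act g ` D)" using T(1) open_act_image[OF _ DH(2,1)] g by (simp add: open_Times)
    then show "openin (top_of_set ?E) (q g ` T)" unfolding sheet[OF g] by (rule openin_open_Int)
  qed
  moreover have "pairwise disjnt ((\<lambda>g. q g ` T) ` \<Gamma>)"
  proof -
    have "q g ` T = q h ` T" if "g \<in> \<Gamma>" "h \<in> \<Gamma>" "\<not> disjnt (q g ` T) (q h ` T)" for g h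
    proof -
      from that(3) obtain z where "z \<in> T" "act g (w z) = act h (w z)"
        by (auto simp: disjnt_iff q_def)
      then have "g = h" using free_eq that(1,2) wH by blast
      then show ?thesis by simp
    qed
    then show ?thesis unfolding pairwise_def by blast
  qed
  moreover have "\<forall>u\<in>(\<lambda>g. q g ` T) ` \<Gamma>. \<exists>q'. homeomorphism u T fst q'"
  proof clarify
    fix g assume g: "g \<in> \<Gamma>"
    have "continuous_on T (act g \<circ> w)"
      by (rule continuous_on_compose[OF cw continuous_on_act]) (use g wH in auto)
    then have "continuous_on T (q g)" unfolding q_def by (intro continuous_intros) (simp add: o_def)
    then have "homeomorphism (q g ` T) T fst (q g)"
      unfolding homeomorphism_def by (auto simp: q_def intro!: continuous_intros image_eqI)
    then show "\<exists>q'. homeomorphism (q g ` T) T fst q'" by blast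
  qed
  ultimately show "\<exists>T. z0 \<in> T \<and> openin (top_of_set HH) T \<and> (\<exists>v. \<Union> v = ?E \<inter> fst -` T \<and>
      (\<forall>u\<in>v. openin (top_of_set ?E) u) \<and> pairwise disjnt v \<and> (\<forall>u\<in>v. \<exists>q. homeomorphism u T fst q))"
    using T open_HH by (intro exI[of _ T] conjI exI[of _ "(\<lambda>g. q g ` T) ` \<Gamma>"]) (auto simp: openin_open_eq)
qed

text \<open>The second coordinate of the lift lies in a totally disconnected space, and so it is
  constant.\<close>

lemma lift_to_HH:
  assumes f: "continuous_map (top_of_set HH) ST f"
  shows "\<exists>\<alpha> \<sigma>. continuous_on HH \<alpha> \<and> \<alpha> ` HH \<subseteq> HH \<and> \<sigma> \<in> \<Gamma>hat \<and> (\<forall>z\<in>HH. f z = sp (\<alpha> z) \<sigma>)"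
proof -
  have fs: "f z \<in> sol" if "z \<in> HH" for z using continuous_map_funspace[OF f] that by auto
  have "locally path_connected HH" by (rule open_imp_locally_path_connected[OF open_HH])
  moreover have "simply_connected HH" by (rule convex_imp_simply_connected[OF convex_HH])
  ultimately obtain g where g: "continuous_on HH g" "g \<in> HH \<rightarrow> {(z, w). z \<in> HH \<and> w \<in> f z 0}"
      "\<And>y. y \<in> HH \<Longrightarrow> fst (g y) = y"
    using covering_space_lift[OF covering_pullback[OF f], of HH "\<lambda>z. z"] by (auto simp: continuous_on_id)
  define \<alpha> where "\<alpha> z = snd (g z)" for z
  have \<alpha>: "continuous_on HH \<alpha>" unfolding \<alpha>_def by (intro continuous_intros g(1))
  have \<alpha>f: "\<alpha> z \<in> f z 0" if "z \<in> HH" for z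
  proof -
    have "g z \<in> {(z, w). z \<in> HH \<and> w \<in> f z 0}" by (rule funcset_mem[OF g(2) that])
    then show ?thesis using g(3)[OF that] by (auto simp: \<alpha>_def)
  qed
  have \<alpha>H: "\<alpha> z \<in> HH" if "z \<in> HH" for z using sol_mem(1)[OF fs \<alpha>f] that by blast
  have "\<forall>z\<in>HH. \<exists>\<tau>. \<tau> \<in> \<Gamma>hat \<and> f z = sp (\<alpha> z) \<tau>" using sp_surj[OF fs \<alpha>f] by blast
  then obtain \<tau> where \<tau>: "\<forall>z\<in>HH. \<tau> z \<in> \<Gamma>hat \<and> f z = sp (\<alpha> z) (\<tau> z)" using bchoice by metis
  have const: "\<tau> z n = \<tau> \<i> n" if z: "z \<in> HH" for z n
  proof -
    have op: "open {z \<in> HH. \<tau> z n = C}" for C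
      unfolding open_subopen[of "{z \<in> HH. \<tau> z n = C}"]
    proof clarify
      fix z0 assume z0: "z0 \<in> HH" "C = \<tau> z0 n"
      have t0: "\<tau> z0 \<in> \<Gamma>hat" "f z0 = sp (\<alpha> z0) (\<tau> z0)" using \<tau> z0(1) by auto
      obtain c where c: "c \<in> \<tau> z0 n" using hat_ex[OF t0(1)] by blast
      obtain D where D: "good_disc D" "\<alpha> z0 \<in> D" using ex_good_disc[OF \<alpha>H[OF z0(1)]] by blast
      let ?W = "case_prod sp ` (D \<times> {\<sigma> \<in> \<Gamma>hat. c \<in> \<sigma> n})"
      let ?N = "{z \<in> HH. f z \<in> ?W} \<inter> {z \<in> HH. \<alpha> z \<in> D}"
      have oN: "open ?N"
        by (intro open_Int open_preimage_ST[OF f openin_box] open_preimage_HH[OF \<alpha>] good_discD[OF D(1)]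
            hat_mem(1)[OF t0(1) c])
      have "f z0 \<in> ?W" unfolding t0(2) using D(2) t0(1) c by auto
      then have z0N: "z0 \<in> ?N" using z0(1) D(2) by blast
      have "\<tau> z n = \<tau> z0 n" if zN: "z \<in> ?N" for z
      proof -
        have zH: "z \<in> HH" "\<alpha> z \<in> D" using zN by auto
        obtain x \<sigma> where x: "x \<in> D" "\<sigma> \<in> \<Gamma>hat" "c \<in> \<sigma> n" "f z = sp x \<sigma>" using zN by auto
        have tz: "\<tau> z \<in> \<Gamma>hat" "f z = sp (\<alpha> z) (\<tau> z)" using \<tau> zH(1) by auto
        have "(x, \<sigma>) = (\<alpha> z, \<tau> z)"
          by (rule inj_onD[OF sp_inj_on_good_disc[OF D(1)]]) (use x zH tz in auto)
        then show ?thesis using hat_level_eqI[OF x(2) t0(1) x(3) c] by simp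
      qed
      then have "?N \<subseteq> {z \<in> HH. \<tau> z n = \<tau> z0 n}" by blast
      with oN z0N show "\<exists>T. open T \<and> z0 \<in> T \<and> T \<subseteq> {z \<in> HH. \<tau> z n = \<tau> z0 n}"
        by (intro exI[of _ ?N] conjI)
    qed
    have "\<exists>C\<in>UNIV. HH \<subseteq> {z \<in> HH. \<tau> z n = C}"
      by (rule connected_HH_selects) (use op in auto)
    then show ?thesis using z ii_HH by blast
  qed
  have "f z = sp (\<alpha> z) (\<tau> \<i>)" if z: "z \<in> HH" for z
  proof -
    have "\<tau> z = \<tau> \<i>" using const[OF z] by blast
    then show ?thesis using \<tau> z by metis
  qed
  then show ?thesis using \<alpha> \<alpha>H \<tau> ii_HH by (intro exI[of _ \<alpha>] exI[of _ "\<tau> \<i>"]) auto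
qed

lemma continuous_leaf: "\<tau> \<in> \<Gamma>hat \<Longrightarrow> continuous_map (top_of_set HH) ST (\<lambda>z. sp z \<tau>)"
proof -
  assume t: "\<tau> \<in> \<Gamma>hat"
  have "continuous_map (top_of_set HH) PR (\<lambda>z. (z, \<tau>))" using t by (intro continuous_map_pairedI) auto
  from continuous_map_compose[OF this continuous_map_sp] show ?thesis by (simp add: o_def)
qed

lemma continuous_transversal: "z \<in> HH \<Longrightarrow> continuous_map PT ST (sp z)"
proof -
  assume z: "z \<in> HH"
  have "continuous_map PT PR (\<lambda>\<tau>. (z, \<tau>))" using z by (intro continuous_map_pairedI) auto
  from continuous_map_compose[OF this continuous_map_sp] show ?thesis by (simp add: o_def)
qed

text \<open>Near a point the element \<open>\<gamma>\<close> is pinned down by a disc with disjoint translates.\<close>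

lemma deck_constant:
  assumes \<phi>: "continuous_on HH \<phi>" "\<And>z. z \<in> HH \<Longrightarrow> \<exists>\<gamma>\<in>\<Gamma>. \<phi> z = act \<gamma> z"
  shows "\<exists>\<gamma>\<in>\<Gamma>. \<forall>z\<in>HH. \<phi> z = act \<gamma> z"
proof -
  have "\<exists>\<gamma>\<in>\<Gamma>. HH \<subseteq> {z \<in> HH. \<phi> z = act \<gamma> z}"
  proof (rule connected_HH_selects)
    fix g assume g: "g \<in> \<Gamma>"
    show "open {z \<in> HH. \<phi> z = act g z}"
      unfolding open_subopen[of "{z \<in> HH. \<phi> z = act g z}"]
    proof clarify
      fix z0 assume z0: "z0 \<in> HH" "\<phi> z0 = act g z0"
      have "act g z0 \<in> HH" using g z0 by simp
      then obtain D where D: "good_disc D" "act g z0 \<in> D" using ex_good_disc by blast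
      let ?N = "{z \<in> HH. \<phi> z \<in> D} \<inter> {z \<in> HH. act g z \<in> D}"
      have o: "open ?N"
        using open_preimage_HH[OF \<phi>(1) good_discD(1)[OF D(1)]]
          open_preimage_HH[OF continuous_on_act good_discD(1)[OF D(1)], of g] g by auto
      have zN: "z0 \<in> ?N" using z0 D(2) by auto
      have "\<phi> z = act g z" if "z \<in> ?N" for z
      proof -
        from that have "z \<in> HH" by blast
        from \<phi>(2)[OF this] obtain d where d: "d \<in> \<Gamma>" "\<phi> z = act d z" by blast
        then have "d = g" using good_disc_eq[OF D(1) d(1) g, of z] that by simp
        then show ?thesis using d by simp
      qed
      then have "?N \<subseteq> {z \<in> HH. \<phi> z = act g z}" by blast
      with o zN show "\<exists>T. open T \<and> z0 \<in> T \<and> T \<subseteq> {z \<in> HH. \<phi> z = act g z}"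
        by (intro exI[of _ ?N] conjI)
    qed
  qed (use \<phi>(2) free_eq in auto)
  then show ?thesis by blast
qed

text \<open>In a product chart around \<open>[\<alpha> z\<^sub>0, \<sigma>]\<close> the disc coordinate of \<open>F [z, 1]\<close> is \<open>\<alpha> z\<close>.\<close>

lemma sol_holomorphic_leaf:
  assumes F: "sol_holomorphic \<Gamma> F" and \<alpha>: "continuous_on HH \<alpha>" "\<alpha> ` HH \<subseteq> HH"
    and \<sigma>: "\<sigma> \<in> \<Gamma>hat" and eq: "\<And>z. z \<in> HH \<Longrightarrow> F (sp z ee) = sp (\<alpha> z) \<sigma>"
  shows "\<alpha> holomorphic_on HH"
  unfolding holomorphic_on_def
proof
  fix z0 assume z0: "z0 \<in> HH"
  have "\<alpha> z0 \<in> HH" using z0 \<alpha>(2) by blast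
  then obtain D' where D': "good_disc D'" "\<alpha> z0 \<in> D'" using ex_good_disc by blast
  obtain D where D: "good_disc D" "z0 \<in> D" using ex_good_disc[OF z0] by blast
  let ?h = "\<lambda>z. fst (inv_into (D' \<times> \<Gamma>hat) (case_prod sp) (F (sp z ee)))"
  let ?S = "{z \<in> D. F (sp z ee) \<in> case_prod sp ` (D' \<times> \<Gamma>hat)}"
  let ?N = "D \<inter> {z \<in> HH. \<alpha> z \<in> D'}"
  have "?h holomorphic_on ?S"
    using F sol_chart_good_disc[OF D(1)] sol_chart_good_disc[OF D'(1)] ee_hat
    unfolding sol_holomorphic_def by blast
  moreover have NS: "?N \<subseteq> ?S" using eq \<sigma> by auto
  ultimately have "?h holomorphic_on ?N" using holomorphic_on_subset by blast
  moreover have "?h z = \<alpha> z" if z: "z \<in> ?N" for z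
  proof -
    have "F (sp z ee) = case_prod sp (\<alpha> z, \<sigma>)" using eq z by simp
    then show ?thesis
      using inv_into_f_f[OF sp_inj_on_good_disc[OF D'(1)], of "(\<alpha> z, \<sigma>)"] z \<sigma> by auto
  qed
  ultimately have "\<alpha> holomorphic_on ?N" by (rule holomorphic_transform)
  moreover have "open ?N" using good_discD(1)[OF D(1)] open_preimage_HH[OF \<alpha>(1) good_discD(1)[OF D'(1)]] by auto
  moreover have "z0 \<in> ?N" using z0 D(2) D'(2) by simp
  ultimately have "\<alpha> field_differentiable at z0" using holomorphic_on_imp_differentiable_at by blast
  then show "\<alpha> field_differentiable at z0 within HH" by (rule field_differentiable_at_within)
qed

subsection \<open>Rigidity\<close>

lemma continuous_on_hyp:
  assumes "continuous_on S f" "continuous_on S g" "\<And>x. x \<in> S \<Longrightarrow> f x \<in> HH" "\<And>x. x \<in> S \<Longrightarrow> g x \<in> HH"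
  shows "continuous_on S (\<lambda>x. hyp (f x) (g x))"
  unfolding hyp_def
  by (intro continuous_intros assms(1,2)) (use assms(3,4) in \<open>fastforce simp: upper_half_plane_def\<close>)

text \<open>Uniform continuity of \<open>G\<close> on the compact solenoid. With \<open>z = g\<^sup>-\<^sup>1 k\<close> and \<open>k\<close> in a
  fundamental set, the points \<open>[z, 1]\<close> and \<open>[s z, 1]\<close> are \<open>[k, g\<^sup>-\<^sup>1]\<close> and \<open>[k, s g\<^sup>-\<^sup>1]\<close>, whose
  second coordinates agree at level \<open>m\<close>. So a bound for \<open>k\<close> in a compact set serves for all \<open>z\<close>.\<close>

lemma uniformly_close_levels:
  assumes G: "continuous_map ST ST G" and e: "0 < e" "e \<le> 1"
  shows "\<exists>m. \<forall>z\<in>HH. \<forall>s\<in>core m. \<exists>x\<in>G (sp z ee) 0. \<exists>y\<in>G (sp (act s z) ee) 0. hyp x y < e"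
proof -
  define small where "small p q \<longleftrightarrow> (\<exists>x\<in>p 0. \<exists>y\<in>q 0. hyp x y < e)" for p q :: solenoid_point
  \<comment> \<open>Each point of the solenoid has a neighbourhood whose points are pairwise close. The constant
    \<open>109\<close> exceeds the \<open>108\<close> of \<open>hyp_triangle\<close>, which makes the final bound strict.\<close>
  have loc: "\<exists>N. openin ST N \<and> p0 \<in> N \<and> (\<forall>p\<in>N. \<forall>q\<in>N. small p q)" if p0: "p0 \<in> sol" for p0
  proof -
    obtain w0 where w0: "w0 \<in> p0 0" using sol_ex[OF p0] by blast
    have w0H: "w0 \<in> HH" "p0 0 = orb 0 w0" using sol_mem[OF p0 w0] by auto
    define B where "B = {x \<in> HH. hyp x w0 < e / 109}"
    have "continuous_on HH (\<lambda>x. hyp x w0)"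
      by (rule continuous_on_hyp) (use w0H in \<open>auto intro: continuous_intros\<close>)
    from open_preimage_HH[OF this, of "{..<e/109}"] have B: "open B" "B \<subseteq> HH" by (auto simp: B_def)
    let ?N = "{p \<in> sol. p 0 \<in> PSL2R_orbit (core 0) ` B}"
    have oN: "openin ST ?N" by (rule openin_sol_level[OF openin_orbit_image[OF core_subgroup B]])
    have pN: "p0 \<in> ?N" using p0 w0H e by (auto simp: B_def)
    have "small p q" if "p \<in> ?N" "q \<in> ?N" for p q
    proof -
      obtain a b where ab: "a \<in> B" "p 0 = orb 0 a" "b \<in> B" "q 0 = orb 0 b" using \<open>p \<in> ?N\<close> \<open>q \<in> ?N\<close> by auto
      have "hyp a b \<le> 108 * (e / 109)"
        by (rule hyp_triangle[of a b w0]) (use ab w0H e in \<open>auto simp: B_def\<close>)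
      then have "hyp a b < e" using e by simp
      moreover have "a \<in> p 0" "b \<in> q 0" unfolding ab(2,4) by (rule orb_self, use ab(1,3) B(2) in blast)+
      ultimately show ?thesis unfolding small_def by blast
    qed
    then have "\<forall>p\<in>?N. \<forall>q\<in>?N. small p q" by (intro ballI)
    with oN pN show ?thesis by (intro exI[of _ ?N] conjI)
  qed
  obtain U K where UK: "U \<subseteq> K" "compact K" "K \<subseteq> HH" "\<forall>z\<in>HH. \<exists>\<gamma>\<in>\<Gamma>. act \<gamma> z \<in> U"
    using ex_fundamental_set by blast
  \<comment> \<open>Boxes of level \<open>k\<close> on which \<open>G\<close> varies little; \<open>m\<close> will be the highest level in a finite
    cover by such boxes.\<close>
  define P where "P B k \<longleftrightarrow> (\<exists>U C. B = U \<times> {\<sigma> \<in> \<Gamma>hat. \<sigma> k = C} \<and> openin (top_of_set HH) U \<and>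
     (\<forall>x\<in>B. \<forall>y\<in>B. small (G (case_prod sp x)) (G (case_prod sp y))))" for B k
  have "compactin PR (K \<times> \<Gamma>hat)"
    using UK(2,3) compact_PT by (simp add: compactin_Times compactin_subtopology compact_space_def)
  moreover have "openin PR B" if "B \<in> {B. \<exists>k. P B k}" for B
  proof -
    from that obtain k U C where B: "B = U \<times> {\<sigma> \<in> \<Gamma>hat. \<sigma> k = C}" "openin (top_of_set HH) U"
      by (auto simp: P_def)
    then show ?thesis using openin_level[of "\<lambda>X. X = C" k] by (simp add: openin_prod_Times_iff)
  qed
  moreover have "K \<times> \<Gamma>hat \<subseteq> \<Union> {B. \<exists>k. P B k}"
  proof clarify
    fix z \<tau> assume z: "z \<in> K" and \<tau>: "\<tau> \<in> \<Gamma>hat"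
    have zH: "z \<in> HH" using z UK(3) by blast
    have "G (sp z \<tau>) \<in> sol" using continuous_map_funspace[OF G] zH \<tau> by auto
    then obtain N where N: "openin ST N" "G (sp z \<tau>) \<in> N" "\<forall>p\<in>N. \<forall>q\<in>N. small p q" using loc by blast
    have opn: "openin PR {x \<in> topspace PR. (G \<circ> case_prod sp) x \<in> N}"
      by (rule openin_continuous_map_preimage[OF continuous_map_compose[OF continuous_map_sp G] N(1)])
    have mem: "(z, \<tau>) \<in> {x \<in> topspace PR. (G \<circ> case_prod sp) x \<in> N}" using N(2) zH \<tau> by simp
    obtain V W where VW: "openin (top_of_set HH) V" "openin PT W" "z \<in> V" "\<tau> \<in> W"
        "V \<times> W \<subseteq> {x \<in> topspace PR. (G \<circ> case_prod sp) x \<in> N}"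
      using openin_prod_topology_alt[THEN iffD1, OF opn, rule_format, OF mem] by blast
    obtain k where k: "\<forall>\<sigma>\<in>\<Gamma>hat. \<sigma> k = \<tau> k \<longrightarrow> \<sigma> \<in> W" using VW(2,4) openin_PT by blast
    let ?B = "V \<times> {\<sigma> \<in> \<Gamma>hat. \<sigma> k = \<tau> k}"
    have inN: "G (case_prod sp x) \<in> N" if "x \<in> ?B" for x
    proof -
      from that have "x \<in> V \<times> W" using k by blast
      from subsetD[OF VW(5) this] show "G (case_prod sp x) \<in> N" by simp
    qed
    have "\<forall>x\<in>?B. \<forall>y\<in>?B. small (G (case_prod sp x)) (G (case_prod sp y))"
    proof (intro ballI)
      fix x y assume xy: "x \<in> ?B" "y \<in> ?B"
      show "small (G (case_prod sp x)) (G (case_prod sp y))"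
        by (rule N(3)[rule_format, OF inN[OF xy(1)] inN[OF xy(2)]])
    qed
    then have "P ?B k"
      unfolding P_def by (intro exI[of _ V] exI[of _ "\<tau> k"] conjI refl VW(1))
    moreover have "(z, \<tau>) \<in> ?B" using VW(3) \<tau> by simp
    ultimately show "(z, \<tau>) \<in> \<Union> {B. \<exists>k. P B k}" by blast
  qed
  ultimately obtain \<F> where F: "finite \<F>" "\<F> \<subseteq> {B. \<exists>k. P B k}" "K \<times> \<Gamma>hat \<subseteq> \<Union> \<F>"
    unfolding compactin_def by meson
  have "\<forall>B\<in>\<F>. \<exists>k. P B k" using F(2) by blast
  then obtain \<kappa> where \<kappa>: "\<forall>B\<in>\<F>. P B (\<kappa> B)" using bchoice by metis
  define m where "m = Max (insert 0 (\<kappa> ` \<F>))"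
  have m: "\<kappa> B \<le> m" if "B \<in> \<F>" for B unfolding m_def using F(1) that by (intro Max_ge) auto
  have close: "small (G (sp z \<tau>)) (G (sp z \<tau>'))"
    if z: "z \<in> K" and \<tau>: "\<tau> \<in> \<Gamma>hat" "\<tau>' \<in> \<Gamma>hat" "\<tau> m = \<tau>' m" for z \<tau> \<tau>'
  proof -
    obtain B where B: "B \<in> \<F>" "(z, \<tau>) \<in> B" using F(3) z \<tau> by blast
    have PB: "P B (\<kappa> B)" using \<kappa> B(1) by blast
    have lev: "\<tau>' (\<kappa> B) = \<tau> (\<kappa> B)" using hat_level_eq_le[OF \<tau> m[OF B(1)]] by simp
    obtain V C where VC: "B = V \<times> {\<sigma> \<in> \<Gamma>hat. \<sigma> (\<kappa> B) = C}" "openin (top_of_set HH) V"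
        "\<forall>x\<in>B. \<forall>y\<in>B. small (G (case_prod sp x)) (G (case_prod sp y))"
      using PB[unfolded P_def] by (elim exE conjE) (rule that)
    define S where "S = {\<sigma> \<in> \<Gamma>hat. \<sigma> (\<kappa> B) = C}"
    have BS: "B = V \<times> S" unfolding S_def by (rule VC(1))
    have "z \<in> V" "\<tau> \<in> S" using B(2) unfolding BS by auto
    then have "\<tau>' \<in> S" using lev \<tau>(2) by (simp add: S_def)
    then have zB: "(z, \<tau>') \<in> B" using \<open>z \<in> V\<close> unfolding BS by simp
    have "small (G (case_prod sp (z, \<tau>))) (G (case_prod sp (z, \<tau>')))"
      by (rule VC(3)[rule_format, OF B(2) zB])
    then show ?thesis by simp
  qed
  have "small (G (sp z ee)) (G (sp (act s z) ee))" if z: "z \<in> HH" and s: "s \<in> core m" for z s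
  proof -
    obtain g where g: "g \<in> \<Gamma>" "act g z \<in> U" using UK(4) z by blast
    define k where "k = act g z"
    have k: "k \<in> K" "k \<in> HH" "z = act (psl_inv g) k" using g z UK(1) by (auto simp: k_def)
    have s\<Gamma>: "s \<in> \<Gamma>" using s by simp
    have g': "psl_inv g \<in> \<Gamma>" "s \<cdot> psl_inv g \<in> \<Gamma>" using g s\<Gamma> by auto
    have "act s z = act (s \<cdot> psl_inv g) k" unfolding k(3) using s\<Gamma> g k(2) by (simp add: act_mult)
    then have e1: "sp (act s z) ee = sp k (emb (s \<cdot> psl_inv g))" using sp_emb[OF k(2) g'(2)] by simp
    have e2: "sp z ee = sp k (emb (psl_inv g))" using sp_emb[OF k(2) g'(1)] k(3) by simp
    have "s \<cdot> psl_inv g \<in> emb (psl_inv g) m"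
      using emb_mem_iff[OF g'(1)] g' s g(1) by (simp add: PSL.m_assoc)
    then have "emb (psl_inv g) m = emb (s \<cdot> psl_inv g) m"
      using hat_level_eqI[OF emb_hat[OF g'(1)] emb_hat[OF g'(2)] _ emb_mem[OF g'(2)]] by blast
    then show ?thesis unfolding e1 e2 by (rule close[OF k(1) emb_hat[OF g'(1)] emb_hat[OF g'(2)]])
  qed
  then show ?thesis unfolding small_def by blast
qed

text \<open>For \<open>s\<close> deep in \<open>\<Gamma>\<close>, uniform continuity says that \<open>A s A\<^sup>-\<^sup>1\<close> moves every point of \<open>HH\<close> by
  little modulo \<open>\<Gamma>\<close>. The element of \<open>\<Gamma>\<close> that corrects it is locally constant, hence constant, and
  the corrected isometry has bounded displacement, hence is trivial.\<close>

lemma rigidity: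
  assumes G: "continuous_map ST ST G" and A: "A \<in> carrier PSL2R"
    and GA: "\<And>z. z \<in> HH \<Longrightarrow> G (sp z ee) = sp (act A z) ee"
  shows "\<exists>m. conj_core A m 0"
proof -
  obtain e0 where e0: "0 < e0" "\<forall>z\<in>HH. \<forall>\<gamma>\<in>\<Gamma>. hyp (act \<gamma> z) z < e0 \<longrightarrow> \<gamma> = \<one>\<^bsub>PSL2R\<^esub>"
    using displacement_bound by blast
  \<comment> \<open>By \<open>hyp_triangle\<close>, two elements of \<open>\<Gamma>\<close> that bring a point within \<open>e\<close> of a common point differ
    by one of displacement less than \<open>e0\<close>.\<close>
  define e where "e = min 1 (e0 / 109)"
  have e: "0 < e" "e \<le> 1" "108 * e < e0" using e0(1) by (auto simp: e_def min_def)
  obtain m where m: "\<forall>z\<in>HH. \<forall>s\<in>core m. \<exists>x\<in>G (sp z ee) 0. \<exists>y\<in>G (sp (act s z) ee) 0. hyp x y < e"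
    using uniformly_close_levels[OF G e(1,2)] by blast
  have "A \<cdot> s \<cdot> psl_inv A \<in> \<Gamma>" if s: "s \<in> core m" for s
  proof -
    have s\<Gamma>: "s \<in> \<Gamma>" using s by simp
    define h where "h = A \<cdot> s \<cdot> psl_inv A"
    have h: "h \<in> carrier PSL2R" using A s\<Gamma> by (simp add: h_def)
    have lev0: "sp x ee 0 = orb 0 x" if "x \<in> HH" for x
      using sp_level[OF that ee_hat emb_mem[of "\<one>\<^bsub>PSL2R\<^esub>" 0]] that by simp
    have near: "\<exists>\<gamma>\<in>\<Gamma>. hyp (act (\<gamma> \<cdot> h) w) w < e" if w: "w \<in> HH" for w
    proof -
      define z where "z = act (psl_inv A) w"
      have z: "z \<in> HH" "act A z = w" using A w by (auto simp: z_def)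
      have "act A (act s z) = act h w" using A s\<Gamma> w by (simp add: h_def z_def act_mult)
      then have Gs: "G (sp (act s z) ee) 0 = orb 0 (act h w)" "G (sp z ee) 0 = orb 0 w"
        using GA[of "act s z"] GA[of z] lev0 s\<Gamma> z w h by auto
      obtain x y where xy: "x \<in> orb 0 w" "y \<in> orb 0 (act h w)" "hyp x y < e"
        using m z(1) s unfolding Gs[symmetric] by blast
      obtain a b where ab: "a \<in> \<Gamma>" "x = act a w" "b \<in> \<Gamma>" "y = act b (act h w)"
        using xy by (auto simp: PSL2R_orbit_eq)
      have "hyp (act (psl_inv a \<cdot> b \<cdot> h) w) w = hyp (act a (act (psl_inv a \<cdot> b \<cdot> h) w)) (act a w)"
        using hyp_act ab h w by simp
      also have "act a (act (psl_inv a \<cdot> b \<cdot> h) w) = y"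
        using ab h w by (simp add: act_mult)
      finally have "hyp (act (psl_inv a \<cdot> b \<cdot> h) w) w < e" using xy(3) ab(2) by (simp add: hyp_commute)
      then show ?thesis using ab by (intro bexI[of _ "psl_inv a \<cdot> b"]) auto
    qed
    have "\<exists>\<gamma>\<in>\<Gamma>. HH \<subseteq> {w \<in> HH. hyp (act (\<gamma> \<cdot> h) w) w < e}"
    proof (rule connected_HH_selects)
      fix g assume g: "g \<in> \<Gamma>"
      have "continuous_on HH (\<lambda>w. hyp (act (g \<cdot> h) w) w)"
        by (rule continuous_on_hyp) (use g h continuous_on_act[of "g \<cdot> h" HH] in auto)
      from open_preimage_HH[OF this, of "{..<e}"] show "open {w \<in> HH. hyp (act (g \<cdot> h) w) w < e}" by simp
    next
      fix a b w assume ab: "a \<in> \<Gamma>" "b \<in> \<Gamma>" "w \<in> HH"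
        "w \<in> {w \<in> HH. hyp (act (a \<cdot> h) w) w < e}" "w \<in> {w \<in> HH. hyp (act (b \<cdot> h) w) w < e}"
      define y where "y = act (b \<cdot> h) w"
      have y: "y \<in> HH" using ab h by (simp add: y_def)
      have "act (a \<cdot> psl_inv b) y = act (a \<cdot> h) w" using ab(1-3) h by (simp add: y_def act_mult)
      moreover have "hyp (act (a \<cdot> h) w) y \<le> 108 * e"
        by (rule hyp_triangle[of _ _ w]) (use ab h e y in \<open>auto simp: y_def\<close>)
      ultimately have "hyp (act (a \<cdot> psl_inv b) y) y < e0" using e(3) by simp
      then have "a \<cdot> psl_inv b = \<one>\<^bsub>PSL2R\<^esub>" using e0(2) y ab(1,2) by blast
      then show "a = b" using ab(1,2) by (metis PSL.inv_closed PSL.inv_equality PSL.inv_inv sub_carrier)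
    qed (use near in auto)
    then obtain g where g: "g \<in> \<Gamma>" "\<And>w. w \<in> HH \<Longrightarrow> hyp (act (g \<cdot> h) w) w < e" by blast
    have "g \<cdot> h = \<one>\<^bsub>PSL2R\<^esub>"
      by (rule bounded_displacement_trivial[where B = e]) (use g h in \<open>auto simp: less_imp_le\<close>)
    then have "h = psl_inv g" using g(1) h by (metis PSL.inv_equality PSL.inv_inv PSL.inv_closed sub_carrier)
    then show ?thesis using g(1) by (simp add: h_def)
  qed
  then show ?thesis unfolding conj_core_def by (intro exI[of _ m]) auto
qed

subsection \<open>Decomposition of automorphisms\<close>

text \<open>The leaf of the points \<open>[z, 1]\<close> is dense, since it contains \<open>[z, \<gamma>]\<close> for all \<open>\<gamma>\<close> in the
  dense subgroup \<open>\<Gamma>\<close> of the completion.\<close>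

lemma eq_on_base_leaf:
  assumes F: "continuous_map ST ST F" and G: "continuous_map ST ST G"
    and eq: "\<And>z. z \<in> HH \<Longrightarrow> F (sp z ee) = G (sp z ee)" and p: "p \<in> sol"
  shows "F p = G p"
proof -
  obtain z \<tau> where z: "z \<in> HH" "\<tau> \<in> \<Gamma>hat" "p = sp z \<tau>" using sp_cases[OF p] .
  have "(F \<circ> sp z) \<tau> = (G \<circ> sp z) \<tau>"
  proof (rule forall_in_closure_of_eq[where X = PT and S = "emb ` \<Gamma>", OF _ Hausdorff_ST])
    have "\<exists>x\<in>\<Gamma>. x \<in> \<tau> k" for k
    proof -
      obtain x where x: "x \<in> \<tau> k" using hat_ex[OF z(2)] by blast
      show ?thesis by (rule bexI[of "\<lambda>x. x \<in> \<tau> k", OF x hat_mem(1)[OF z(2) x]])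
    qed
    then have "\<tau> \<in> profinite_closure \<Delta> \<Gamma>" using z(2) by (simp add: closure_iff)
    then show "\<tau> \<in> PT closure_of emb ` \<Gamma>" by (simp add: profinite_closure_def)
    show "continuous_map PT ST (F \<circ> sp z)" "continuous_map PT ST (G \<circ> sp z)"
      by (rule continuous_map_compose[OF continuous_transversal[OF z(1)]], fact)+
    fix \<sigma> assume "\<sigma> \<in> emb ` \<Gamma>"
    then obtain g where g: "g \<in> \<Gamma>" "\<sigma> = emb g" by blast
    show "(F \<circ> sp z) \<sigma> = (G \<circ> sp z) \<sigma>"
      unfolding o_def g(2) sp_emb[OF z(1) g(1)] by (rule eq) (use g z(1) in simp)
  qed
  then show ?thesis using z(3) by simp
qed

text \<open>Density of \<open>\<Gamma>\<close> in the completion, in multiplicative form.\<close>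

lemma hat_split:
  assumes \<sigma>: "\<sigma> \<in> \<Gamma>hat"
  shows "\<exists>s\<in>\<Gamma>. \<exists>\<tau>\<in>\<Gamma>hat. s \<in> \<sigma> m \<and> \<sigma> = emb s \<star> \<tau> \<and> \<tau> m = core m"
proof -
  obtain s where s: "s \<in> \<sigma> m" using hat_ex[OF \<sigma>] by blast
  have s\<Gamma>: "s \<in> \<Gamma>" using hat_mem(1)[OF \<sigma> s] .
  define \<tau> where "\<tau> = emb (psl_inv s) \<star> \<sigma>"
  have \<tau>: "\<tau> \<in> \<Gamma>hat" using \<sigma> s\<Gamma> by (simp add: \<tau>_def)
  have "psl_inv s \<cdot> s \<in> \<tau> m"
    unfolding \<tau>_def by (rule pmult_mem[OF _ \<sigma> emb_mem s]) (use s\<Gamma> in auto)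
  then have "\<tau> m = core m" using hat_mem(2)[OF \<tau>, of "\<one>\<^bsub>PSL2R\<^esub>" m] s\<Gamma> by simp
  moreover have "\<sigma> = emb s \<star> \<tau>"
    using \<sigma> s\<Gamma> by (simp add: \<tau>_def pmult_assoc[symmetric] emb_mult[symmetric] one_pmult)
  ultimately show ?thesis using s s\<Gamma> \<tau> by blast
qed

lemma hat_act_Comm_act_swap:
  assumes \<sigma>: "\<sigma> \<in> \<Gamma>hat" and x: "x \<in> comm"
  shows "\<exists>a\<in>comm. \<exists>\<tau>\<in>\<Gamma>hat. \<forall>p\<in>sol. hat_act \<Gamma> \<sigma> (Comm_act \<Gamma> x p) = Comm_act \<Gamma> a (hat_act \<Gamma> \<tau> p)"
proof -
  obtain m where m: "\<forall>\<tau>\<in>\<Gamma>hat. \<tau> m = core m \<longrightarrow> (\<exists>\<tau>'\<in>\<Gamma>hat. \<tau>' 0 = core 0 \<and>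
    (\<forall>p\<in>sol. hat_act \<Gamma> \<tau> (Comm_act \<Gamma> x p) = Comm_act \<Gamma> x (hat_act \<Gamma> \<tau>' p)))"
    using hat_act_Comm_act[OF x, of 0] by blast
  obtain s \<tau> where s: "s \<in> \<Gamma>" "\<tau> \<in> \<Gamma>hat" "\<sigma> = emb s \<star> \<tau>" "\<tau> m = core m"
    using hat_split[OF \<sigma>, of m] by blast
  obtain \<tau>' where t: "\<tau>' \<in> \<Gamma>hat"
    "\<forall>p\<in>sol. hat_act \<Gamma> \<tau> (Comm_act \<Gamma> x p) = Comm_act \<Gamma> x (hat_act \<Gamma> \<tau>' p)"
    using m s(2,4) by blast
  have "hat_act \<Gamma> \<sigma> (Comm_act \<Gamma> x p) = Comm_act \<Gamma> (s \<cdot> x) (hat_act \<Gamma> \<tau>' p)" if p: "p \<in> sol" for p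
    using s x t p by (simp add: hat_act_mult Comm_act_mult Comm_act_sub)
  then show ?thesis using s(1) x t(1) by (intro bexI[of _ "s \<cdot> x"] bexI[of _ \<tau>']) auto
qed

text \<open>The automorphism maps the leaf through the base point to a leaf. After correction by an
  element of \<open>\<Gamma>hat\<close> it preserves the base leaf, on which it is given by an automorphism of \<open>HH\<close>,
  and rigidity puts the latter into the commensurator.\<close>

lemma Aut_solenoid_decompose:
  assumes F: "F \<in> carrier (Aut_solenoid \<Gamma>)"
  shows "\<exists>a\<in>comm. \<exists>\<tau>\<in>\<Gamma>hat. \<forall>p\<in>sol. F p = Comm_act \<Gamma> a (hat_act \<Gamma> \<tau> p)"
proof -
  have Fb: "bij_betw F sol sol" and Fh: "sol_holomorphic \<Gamma> F"
    using F by (auto simp: Aut_solenoid_def Bij_def)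
  have Fc: "continuous_map ST ST F" using Fh by (simp add: sol_holomorphic_def)
  have "homeomorphic_map ST ST F"
    by (rule continuous_imp_homeomorphic_map[OF Fc compact_ST Hausdorff_ST])
      (use Fb in \<open>auto simp: bij_betw_def\<close>)
  then obtain F' where F': "homeomorphic_maps ST ST F F'" unfolding homeomorphic_map_maps by blast
  have F'c: "continuous_map ST ST F'" and FF': "\<And>p. p \<in> sol \<Longrightarrow> F' (F p) = p" "\<And>p. p \<in> sol \<Longrightarrow> F (F' p) = p"
    using F' by (auto simp: homeomorphic_maps_def)
  have Fs: "F p \<in> sol" "F' p \<in> sol" if "p \<in> sol" for p
    using continuous_map_funspace[OF Fc] continuous_map_funspace[OF F'c] that by auto
  have "continuous_map (top_of_set HH) ST (F \<circ> (\<lambda>z. sp z ee))"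
    by (rule continuous_map_compose[OF continuous_leaf[OF ee_hat] Fc])
  then obtain \<alpha> \<sigma> where \<alpha>: "continuous_on HH \<alpha>" "\<alpha> ` HH \<subseteq> HH" and \<sigma>: "\<sigma> \<in> \<Gamma>hat"
      and F\<alpha>: "\<And>z. z \<in> HH \<Longrightarrow> F (sp z ee) = sp (\<alpha> z) \<sigma>"
    using lift_to_HH[of "F \<circ> (\<lambda>z. sp z ee)"] by auto
  have \<alpha>H: "\<alpha> z \<in> HH" if "z \<in> HH" for z using \<alpha>(2) that by blast
  have \<alpha>hol: "\<alpha> holomorphic_on HH" by (rule sol_holomorphic_leaf[OF Fh \<alpha> \<sigma> F\<alpha>])
  \<comment> \<open>The correction of \<open>F\<close> that preserves the base leaf.\<close>
  define G where "G = hat_act \<Gamma> (hinv \<sigma>) \<circ> F"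
  define G' where "G' = F' \<circ> hat_act \<Gamma> \<sigma>"
  have Gc: "continuous_map ST ST G" "continuous_map ST ST G'"
    unfolding G_def G'_def
    by (rule continuous_map_compose[OF Fc continuous_map_hat_act],
      use \<sigma> in simp, rule continuous_map_compose[OF continuous_map_hat_act[OF \<sigma>] F'c])
  have GG': "G' (G p) = p" "G (G' p) = p" if "p \<in> sol" for p
    using that \<sigma> Fs FF' by (auto simp: G_def G'_def)
  have G\<alpha>: "G (sp z ee) = sp (\<alpha> z) ee" if "z \<in> HH" for z
    using F\<alpha>[OF that] hat_act_sp[OF hinv_hat[OF \<sigma>] \<alpha>H[OF that] \<sigma>] \<sigma> by (simp add: G_def hinv_pmult)
  have "continuous_map (top_of_set HH) ST (G' \<circ> (\<lambda>z. sp z ee))"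
    by (rule continuous_map_compose[OF continuous_leaf[OF ee_hat] Gc(2)])
  then obtain \<beta>0 \<rho> where \<beta>0: "continuous_on HH \<beta>0" "\<beta>0 ` HH \<subseteq> HH" and \<rho>: "\<rho> \<in> \<Gamma>hat"
      and G\<beta>0: "\<And>z. z \<in> HH \<Longrightarrow> G' (sp z ee) = sp (\<beta>0 z) \<rho>"
    using lift_to_HH[of "G' \<circ> (\<lambda>z. sp z ee)"] by auto
  have \<beta>0H: "\<beta>0 z \<in> HH" if "z \<in> HH" for z using \<beta>0(2) that by blast
  have "sp (\<beta>0 (\<alpha> \<i>)) \<rho> = sp \<i> ee"
    using G\<beta>0[OF \<alpha>H[OF ii_HH]] G\<alpha>[OF ii_HH] GG'(1)[OF sp_sol[OF ii_HH ee_hat]] by simp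
  then obtain g where g: "g \<in> \<Gamma>" "\<rho> = ee \<star> emb g"
    using sp_eqD[OF \<beta>0H[OF \<alpha>H[OF ii_HH]] ii_HH \<rho> ee_hat] by blast
  have \<rho>g: "\<rho> = emb g" using g by (simp add: one_pmult)
  \<comment> \<open>The lift \<open>\<beta>0\<close> of the inverse starts on the base leaf up to an element \<open>g\<close> of \<open>\<Gamma>\<close>, which is
    absorbed into the first coordinate.\<close>
  define \<beta> where "\<beta> z = act g (\<beta>0 z)" for z
  have \<beta>H: "\<beta> z \<in> HH" if "z \<in> HH" for z using \<beta>0H[OF that] g(1) by (simp add: \<beta>_def)
  have G\<beta>: "G' (sp z ee) = sp (\<beta> z) ee" if "z \<in> HH" for z
    using G\<beta>0[OF that] sp_emb[OF \<beta>0H[OF that] g(1)] by (simp add: \<rho>g \<beta>_def)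
  have \<beta>c: "continuous_on HH \<beta>"
    using continuous_on_compose[OF \<beta>0(1) continuous_on_act[OF sub_carrier[OF g(1)] \<beta>0(2)]]
    by (simp add: \<beta>_def[abs_def] o_def)
  \<comment> \<open>Both composites of \<open>\<alpha>\<close> and \<open>\<beta>\<close> are given by elements of \<open>\<Gamma>\<close>, so \<open>\<alpha>\<close> is a bijection.\<close>
  have deck: "\<exists>\<gamma>\<in>\<Gamma>. w = act \<gamma> z" if "z \<in> HH" "w \<in> HH" "sp z ee = sp w ee" for z w
    using sp_eqD[OF that(1,2) ee_hat ee_hat that(3)] by blast
  have "\<exists>\<gamma>\<in>\<Gamma>. \<alpha> (\<beta> z) = act \<gamma> z" if z: "z \<in> HH" for z
    by (rule deck) (use GG'(2)[of "sp z ee"] G\<beta>[OF z] G\<alpha>[OF \<beta>H[OF z]] z \<alpha>H \<beta>H in auto)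
  moreover have "continuous_on HH (\<lambda>z. \<alpha> (\<beta> z))"
    by (rule continuous_on_compose2[OF \<alpha>(1) \<beta>c]) (use \<beta>H in blast)
  ultimately obtain g1 where g1: "g1 \<in> \<Gamma>" "\<forall>z\<in>HH. \<alpha> (\<beta> z) = act g1 z"
    using deck_constant[of "\<lambda>z. \<alpha> (\<beta> z)"] by blast
  have "\<exists>\<gamma>\<in>\<Gamma>. \<beta> (\<alpha> z) = act \<gamma> z" if z: "z \<in> HH" for z
    by (rule deck) (use GG'(1)[of "sp z ee"] G\<alpha>[OF z] G\<beta>[OF \<alpha>H[OF z]] z \<alpha>H \<beta>H in auto)
  moreover have "continuous_on HH (\<lambda>z. \<beta> (\<alpha> z))"
    by (rule continuous_on_compose2[OF \<beta>c \<alpha>(1)]) (use \<alpha>H in blast)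
  ultimately obtain g2 where g2: "g2 \<in> \<Gamma>" "\<forall>z\<in>HH. \<beta> (\<alpha> z) = act g2 z"
    using deck_constant[of "\<lambda>z. \<beta> (\<alpha> z)"] by blast
  have "bij_betw \<alpha> HH HH"
    unfolding bij_betw_def
  proof
    show "inj_on \<alpha> HH"
    proof (rule inj_onI)
      fix x y assume xy: "x \<in> HH" "y \<in> HH" "\<alpha> x = \<alpha> y"
      then have "act g2 x = act g2 y" using g2(2) by metis
      then have "act (psl_inv g2) (act g2 x) = act (psl_inv g2) (act g2 y)" by simp
      then show "x = y" using g2(1) xy by simp
    qed
    show "\<alpha> ` HH = HH"
    proof (intro equalityI \<alpha>(2) subsetI)
      fix w assume w: "w \<in> HH"
      define z where "z = \<beta> (act (psl_inv g1) w)"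
      have "z \<in> HH" unfolding z_def by (rule \<beta>H) (use g1(1) w in simp)
      moreover have "\<alpha> z = w" using g1 w by (simp add: z_def)
      ultimately show "w \<in> \<alpha> ` HH" by blast
    qed
  qed
  then obtain A where A: "A \<in> carrier PSL2R" "\<forall>z\<in>HH. \<alpha> z = act A z"
    using automorphism_HH[OF \<alpha>hol] by blast
  have GA: "G (sp z ee) = sp (act A z) ee" if "z \<in> HH" for z using G\<alpha>[OF that] A(2) that by simp
  have G'A: "G' (sp z ee) = sp (act (psl_inv A) z) ee" if z: "z \<in> HH" for z
  proof -
    have w: "act (psl_inv A) z \<in> HH" using A(1) z by simp
    have "G (sp (act (psl_inv A) z) ee) = sp z ee" using GA[OF w] A(1) z by simp
    then show ?thesis using GG'(1)[OF sp_sol[OF w ee_hat]] by simp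
  qed
  have "\<exists>m. conj_core A m 0" by (rule rigidity[OF Gc(1) A(1) GA])
  moreover have "\<exists>m. conj_core (psl_inv A) m 0" by (rule rigidity[OF Gc(2) _ G'A]) (use A(1) in simp)
  ultimately have Ac: "A \<in> comm" using commI A(1) by blast
  have GAc: "G p = Comm_act \<Gamma> A p" if "p \<in> sol" for p
    by (rule eq_on_base_leaf[OF Gc(1) continuous_map_Comm_act[OF Ac] _ that])
      (simp add: GA Comm_act_base Ac)
  have "F p = hat_act \<Gamma> \<sigma> (Comm_act \<Gamma> A p)" if p: "p \<in> sol" for p
    using GAc[OF p] hat_act_inv(1)[OF \<sigma> Fs(1)[OF p]] by (simp add: G_def)
  then show ?thesis using hat_act_Comm_act_swap[OF \<sigma> Ac] by simp
qed

definition sol_aut :: "(real^2^2) set \<Rightarrow> (nat \<Rightarrow> (real^2^2) set set) \<Rightarrow> solenoid_point \<Rightarrow> solenoid_point" where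
  "sol_aut a \<tau> = (\<lambda>p\<in>sol. Comm_act \<Gamma> a (hat_act \<Gamma> \<tau> p))"

lemma sol_aut_in_Aut:
  assumes a: "a \<in> comm" and \<tau>: "\<tau> \<in> \<Gamma>hat"
  shows "sol_aut a \<tau> \<in> carrier (Aut_solenoid \<Gamma>)"
proof -
  let ?F = "\<lambda>p. Comm_act \<Gamma> a (hat_act \<Gamma> \<tau> p)"
  have "bij_betw (sol_aut a \<tau>) sol sol"
    by (rule bij_betwI[where g = "\<lambda>p. hat_act \<Gamma> (hinv \<tau>) (Comm_act \<Gamma> (psl_inv a) p)"])
      (use a \<tau> in \<open>auto simp: sol_aut_def\<close>)
  moreover have "sol_holomorphic \<Gamma> (sol_aut a \<tau>)"
  proof (rule sol_holomorphic_affine)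
    have "continuous_map ST ST (Comm_act \<Gamma> a \<circ> hat_act \<Gamma> \<tau>)"
      by (rule continuous_map_compose[OF continuous_map_hat_act[OF \<tau>] continuous_map_Comm_act[OF a]])
    then show "continuous_map ST ST (sol_aut a \<tau>)"
      by (rule continuous_map_eq) (simp add: sol_aut_def)
    fix \<sigma> assume \<sigma>: "\<sigma> \<in> \<Gamma>hat"
    have "sol_aut a \<tau> (sp z \<sigma>) = Comm_act \<Gamma> a (sp z (\<tau> \<star> \<sigma>))" if "z \<in> HH" for z
      using that \<sigma> \<tau> by (simp add: sol_aut_def hat_act_sp)
    then show "\<exists>\<beta>\<in>carrier PSL2R. \<exists>\<rho>\<in>\<Gamma>hat. \<forall>z\<in>HH. sol_aut a \<tau> (sp z \<sigma>) = sp (act \<beta> z) \<rho>"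
      using Comm_act_affine[OF a pmult_closed[OF \<tau> \<sigma>]] by simp
  qed
  ultimately show ?thesis by (simp add: Aut_solenoid_def Bij_def sol_aut_def)
qed

lemma Aut_solenoid_eq: "carrier (Aut_solenoid \<Gamma>) = {sol_aut a \<tau> | a \<tau>. a \<in> comm \<and> \<tau> \<in> \<Gamma>hat}"
proof (intro equalityI subsetI)
  fix F assume F: "F \<in> carrier (Aut_solenoid \<Gamma>)"
  then have "F \<in> extensional sol" by (simp add: Aut_solenoid_def Bij_def)
  moreover obtain a \<tau> where a: "a \<in> comm" "\<tau> \<in> \<Gamma>hat" "\<forall>p\<in>sol. F p = Comm_act \<Gamma> a (hat_act \<Gamma> \<tau> p)"
    using Aut_solenoid_decompose[OF F] by blast
  ultimately have "F = sol_aut a \<tau>" by (intro extensionalityI[of F sol]) (auto simp: sol_aut_def)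
  then show "F \<in> {sol_aut a \<tau> | a \<tau>. a \<in> comm \<and> \<tau> \<in> \<Gamma>hat}" using a by blast
qed (use sol_aut_in_Aut in auto)

end

section \<open>The Belyaev completion\<close>

text \<open>Basic open sets prescribe finitely many values.\<close>

lemma in_Symm_closure_iff:
  assumes "A \<subseteq> Bij S"
  shows "f \<in> Symm_topology S closure_of A \<longleftrightarrow>
    f \<in> Bij S \<and> (\<forall>X. finite X \<and> X \<subseteq> S \<longrightarrow> (\<exists>g\<in>A. \<forall>x\<in>X. g x = f x))"
proof -
  let ?P = "product_topology (\<lambda>_. discrete_topology S) S"
  have Bij: "g \<in> (\<Pi>\<^sub>E x\<in>S. S)" if "g \<in> Bij S" for g
    unfolding PiE_def
    using Bij_imp_funcset[OF that] Bij_imp_extensional[OF that] by (rule IntI)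
  have top: "topspace (Symm_topology S) = Bij S"
    using Bij by (auto simp: Symm_topology_def BijGroup_def)
  show ?thesis
  proof
    assume *: "f \<in> Symm_topology S closure_of A"
    then have f: "f \<in> Bij S" by (simp add: in_closure_of top)
    have "\<exists>g\<in>A. \<forall>x\<in>X. g x = f x" if X: "finite X" "X \<subseteq> S" for X
    proof -
      let ?U = "\<Pi>\<^sub>E x\<in>S. if x \<in> X then {f x} else S"
      have fS: "f x \<in> S" if "x \<in> S" for x using Bij_imp_funcset[OF f] that by auto
      have "openin ?P ?U"
        by (rule product_topology_basis) (use X fS in \<open>auto intro: finite_subset[of _ X]\<close>)
      then have "openin (Symm_topology S) (?U \<inter> Bij S)"
        unfolding Symm_topology_def openin_subtopology by (auto simp: BijGroup_def)
      moreover have "f \<in> ?U \<inter> Bij S"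
        using f fS Bij_imp_extensional[OF f] by (auto simp: PiE_def extensional_def)
      ultimately obtain g where g: "g \<in> A" "g \<in> ?U" using * unfolding in_closure_of by blast
      have "g x = f x" if "x \<in> X" for x using PiE_mem[OF g(2), of x] that X(2) by auto
      then show ?thesis using g(1) by blast
    qed
    then show "f \<in> Bij S \<and> (\<forall>X. finite X \<and> X \<subseteq> S \<longrightarrow> (\<exists>g\<in>A. \<forall>x\<in>X. g x = f x))" using f by blast
  next
    assume *: "f \<in> Bij S \<and> (\<forall>X. finite X \<and> X \<subseteq> S \<longrightarrow> (\<exists>g\<in>A. \<forall>x\<in>X. g x = f x))"
    show "f \<in> Symm_topology S closure_of A"
      unfolding in_closure_of top
    proof (intro conjI allI impI)
      show "f \<in> Bij S" using * by blast
      fix T assume T: "f \<in> T \<and> openin (Symm_topology S) T"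
      then obtain V where V: "openin ?P V" "T = V \<inter> Bij S"
        by (auto simp: Symm_topology_def openin_subtopology BijGroup_def)
      have "f \<in> V" using T V(2) by blast
      from openin_product_topology_alt[THEN iffD1, OF V(1), rule_format, OF this]
      obtain W where W: "finite {i \<in> S. W i \<noteq> topspace (discrete_topology S)}" "f \<in> Pi\<^sub>E S W" "Pi\<^sub>E S W \<subseteq> V"
        by blast
      define X where "X = {i \<in> S. W i \<noteq> S}"
      have "finite X" "X \<subseteq> S" using W(1) by (auto simp: X_def)
      then obtain g where g: "g \<in> A" "\<forall>x\<in>X. g x = f x" using * by blast
      have gB: "g \<in> Bij S" using g(1) assms by blast
      have "g x \<in> W x" if x: "x \<in> S" for x
      proof (cases "x \<in> X")
        case True
        then show ?thesis using g(2) PiE_mem[OF W(2) x] by simp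
      next
        case False
        then show ?thesis using x Bij_imp_funcset[OF gB] by (auto simp: X_def)
      qed
      then have "g \<in> Pi\<^sub>E S W" using Bij_imp_extensional[OF gB] by (auto simp: PiE_def)
      then show "\<exists>y. y \<in> A \<and> y \<in> T" using g(1) gB W(3) V(2) by blast
    qed
  qed
qed

context fuchsian
begin

abbreviation psl_lcos (infixr "\<rhd>" 75) where "x \<rhd> K \<equiv> x <#\<^bsub>PSL2R\<^esub> K"
abbreviation "BB \<equiv> Belyaev_cosets \<Gamma>"
abbreviation "BS \<equiv> Belyaev_star \<Gamma>"

lemma lcos_mult: "a \<in> carrier PSL2R \<Longrightarrow> x \<in> carrier PSL2R \<Longrightarrow> K \<subseteq> carrier PSL2R \<Longrightarrow> a \<rhd> x \<rhd> K = (a \<cdot> x) \<rhd> K"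
  using PSL.lcos_m_assoc by simp

lemma BB_cases:
  assumes "b \<in> BB"
  obtains x K where "b = x \<rhd> K" "x \<in> comm" "subgroup K PSL2R" "K \<subseteq> comm" "commensurable PSL2R K \<Gamma>"
  using assms unfolding Belyaev_cosets_def Comm_eq by blast

lemma BB_carrier: "b \<in> BB \<Longrightarrow> b \<subseteq> carrier PSL2R"
  by (erule BB_cases) (auto simp: l_coset_def dest: subgroup.mem_carrier)

lemma lcos_BB [simp]:
  assumes "a \<in> comm" "b \<in> BB"
  shows "a \<rhd> b \<in> BB"
proof -
  obtain x K where b: "b = x \<rhd> K" "x \<in> comm" "subgroup K PSL2R" "K \<subseteq> comm" "commensurable PSL2R K \<Gamma>"
    using BB_cases[OF assms(2)] .
  have "a \<rhd> b = (a \<cdot> x) \<rhd> K" unfolding b(1) by (rule lcos_mult) (use assms b subgroup.subset in auto)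
  moreover have "a \<cdot> x \<in> comm" using assms(1) b(2) by simp
  ultimately show ?thesis using b(3-5) unfolding Belyaev_cosets_def Comm_eq by blast
qed

lemma lcos_inv:
  assumes "a \<in> carrier PSL2R" "b \<subseteq> carrier PSL2R"
  shows "psl_inv a \<rhd> a \<rhd> b = b" "a \<rhd> psl_inv a \<rhd> b = b"
  using assms by (simp_all add: lcos_mult PSL.lcos_mult_one)

definition stab :: "nat \<Rightarrow> (real^2^2) set set \<Rightarrow> bool" where
  "stab m b \<longleftrightarrow> (\<forall>g\<in>core m. g \<rhd> b = b)"

lemma stab_mono: "stab m b \<Longrightarrow> m \<le> n \<Longrightarrow> stab n b"
  unfolding stab_def using core_antimono by blast

text \<open>For \<open>b = x K\<close> some \<open>core l\<close> is contained in \<open>K\<close>, and conjugation by the inverse of \<open>x\<close> maps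
  a smaller core into it.\<close>

lemma ex_stab:
  assumes "b \<in> BB"
  shows "\<exists>m. stab m b"
proof -
  obtain x K where b: "b = x \<rhd> K" "x \<in> comm" "subgroup K PSL2R" "K \<subseteq> comm" "commensurable PSL2R K \<Gamma>"
    using BB_cases[OF assms] .
  have KC: "K \<subseteq> carrier PSL2R" by (rule subgroup.subset[OF b(3)])
  have "subgroup (K \<inter> \<Gamma>) PSL2R" by (rule PSL.subgroups_Inter_pair[OF b(3) sub_PSL])
  moreover have "finite_index PSL2R \<Gamma> (K \<inter> \<Gamma>)" using b(5) by (simp add: commensurable_def)
  ultimately obtain l where l: "core l \<subseteq> K" using finite_index_imp_core[of "K \<inter> \<Gamma>"] by blast
  obtain m where m: "conj_core (psl_inv x) m l" using comm_conj_core[OF comm_inv[OF b(2)]] by blast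
  have "g \<rhd> b = b" if g: "g \<in> core m" for g
  proof -
    have gc: "g \<in> carrier PSL2R" using g by simp
    define h where "h = psl_inv x \<cdot> g \<cdot> x"
    have "h \<in> core l" using m g b(2) unfolding conj_core_def h_def by auto
    then have h: "h \<in> K" "h \<in> carrier PSL2R" using l KC by auto
    have "g \<cdot> x = x \<cdot> h" using gc b(2) by (simp add: h_def PSL.m_assoc PSL.r_inv_cancel)
    then have "g \<rhd> b = x \<rhd> h \<rhd> K" unfolding b(1) using gc b(2) h(2) KC by (simp add: lcos_mult)
    also have "h \<rhd> K = K" by (rule PSL.coset_join3[OF h(2) b(3) h(1)])
    finally show ?thesis using b(1) by simp
  qed
  then show ?thesis unfolding stab_def by blast
qed

lemma BS_iff: "b \<in> BS \<longleftrightarrow> (\<exists>x n. x \<in> comm \<and> b = x \<rhd> core n)"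
  unfolding Belyaev_star_def Comm_eq by blast

lemma core_carrier: "core n \<subseteq> carrier PSL2R"
  by (rule subgroup.subset[OF core_subgroup])

lemma BS_BB: "BS \<subseteq> BB"
proof
  fix b assume "b \<in> BS"
  then obtain x n where b: "x \<in> comm" "b = x \<rhd> core n" unfolding BS_iff by blast
  have "finite_index PSL2R (core n) (core n)"
    by (rule finite_indexI[where f = "\<lambda>_. ()", OF core_subgroup core_subgroup order.refl]) auto
  moreover have "core n \<inter> \<Gamma> = core n" using core_subset by blast
  ultimately have "commensurable PSL2R (core n) \<Gamma>"
    using finite_index_core by (simp add: commensurable_def)
  moreover have "core n \<subseteq> comm" by auto
  ultimately show "b \<in> BB" unfolding Belyaev_cosets_def Comm_eq using b core_subgroup[of n] by blast
qed

lemma core_BS: "core n \<in> BS"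
  unfolding BS_iff
  using PSL.lcos_mult_one[OF core_carrier] sub_comm[OF sub_closed(1)] by (intro exI[of _ "\<one>\<^bsub>PSL2R\<^esub>"] exI[of _ n]) simp

lemma core_BB: "core n \<in> BB"
  using core_BS BS_BB by blast

subsection \<open>The profinite completion acts on the cosets\<close>

text \<open>The left translate of \<open>b\<close> by \<open>\<tau>\<close>, computed from any element of a level of \<open>\<tau>\<close> at which the
  core stabilises \<open>b\<close>.\<close>

definition hat_lcos :: "(nat \<Rightarrow> (real^2^2) set set) \<Rightarrow> (real^2^2) set set \<Rightarrow> (real^2^2) set set" where
  "hat_lcos \<tau> b = (SOME g. g \<in> \<tau> (SOME m. stab m b)) \<rhd> b"

lemma stab_level:
  assumes \<tau>: "\<tau> \<in> \<Gamma>hat" and b: "b \<in> BB" "stab m b" and g: "g \<in> \<tau> m" "h \<in> \<tau> m"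
  shows "g \<rhd> b = h \<rhd> b"
proof -
  have G: "g \<in> \<Gamma>" "h \<in> \<Gamma>" using hat_mem(1)[OF \<tau>] g by auto
  have "h \<cdot> psl_inv g \<in> core m" using hat_mem_iff[OF \<tau> g(1)] g(2) by blast
  then have k: "psl_inv g \<cdot> (h \<cdot> psl_inv g) \<cdot> g \<in> core m" by (rule core_conj'[OF G(1)])
  have "h = g \<cdot> (psl_inv g \<cdot> (h \<cdot> psl_inv g) \<cdot> g)" using G by (simp add: PSL.m_assoc PSL.r_inv_cancel)
  then have "h \<rhd> b = (g \<cdot> (psl_inv g \<cdot> (h \<cdot> psl_inv g) \<cdot> g)) \<rhd> b" by simp
  also have "\<dots> = g \<rhd> (psl_inv g \<cdot> (h \<cdot> psl_inv g) \<cdot> g) \<rhd> b"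
    by (rule lcos_mult[symmetric]) (use G BB_carrier[OF b(1)] in auto)
  also have "\<dots> = g \<rhd> b" using b(2) k unfolding stab_def by simp
  finally show ?thesis by simp
qed

lemma hat_lcos_eq:
  assumes \<tau>: "\<tau> \<in> \<Gamma>hat" and b: "b \<in> BB" "stab m b" and g: "g \<in> \<tau> m"
  shows "hat_lcos \<tau> b = g \<rhd> b"
proof -
  define m0 where "m0 = (SOME m. stab m b)"
  have m0: "stab m0 b" unfolding m0_def using b(2) by (rule someI)
  define g0 where "g0 = (SOME g. g \<in> \<tau> m0)"
  have g0: "g0 \<in> \<tau> m0" unfolding g0_def using hat_ex[OF \<tau>] by (rule someI_ex)
  obtain h where h: "h \<in> \<tau> (max m m0)" using hat_ex[OF \<tau>] by blast
  have hm: "h \<in> \<tau> m" "h \<in> \<tau> m0"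
    using hat_nested[OF \<tau> _ h, of m] hat_nested[OF \<tau> _ h, of m0] by auto
  have "hat_lcos \<tau> b = g0 \<rhd> b" by (simp add: hat_lcos_def m0_def g0_def)
  also have "\<dots> = h \<rhd> b" by (rule stab_level[OF \<tau> b(1) m0 g0 hm(2)])
  also have "\<dots> = g \<rhd> b" by (rule stab_level[OF \<tau> b hm(1) g])
  finally show ?thesis .
qed

lemma hat_lcos_finite:
  assumes \<tau>: "\<tau> \<in> \<Gamma>hat" and X: "finite X" "X \<subseteq> BB"
  shows "\<exists>m. \<exists>g\<in>\<tau> m. g \<in> \<Gamma> \<and> (\<forall>b\<in>X. stab m b \<and> hat_lcos \<tau> b = g \<rhd> b)"
proof -
  have "\<forall>b\<in>X. \<exists>m. stab m b" using ex_stab X(2) by blast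
  then have "\<exists>\<mu>. \<forall>b\<in>X. stab (\<mu> b) b" by (rule bchoice)
  then obtain \<mu> where \<mu>: "\<forall>b\<in>X. stab (\<mu> b) b" by blast
  define m where "m = Max (insert 0 (\<mu> ` X))"
  have st: "stab m b" if "b \<in> X" for b
    by (rule stab_mono[of "\<mu> b"]) (use \<mu> that X(1) in \<open>auto simp: m_def\<close>)
  obtain g where g: "g \<in> \<tau> m" using hat_ex[OF \<tau>] by blast
  have "hat_lcos \<tau> b = g \<rhd> b" if "b \<in> X" for b
    by (rule hat_lcos_eq[OF \<tau> _ st[OF that] g]) (use that X(2) in blast)
  then show ?thesis using g st hat_mem(1)[OF \<tau> g] by blast
qed

definition star_perm :: "(real^2^2) set \<Rightarrow> (nat \<Rightarrow> (real^2^2) set set) \<Rightarrow> (real^2^2) set set \<Rightarrow> (real^2^2) set set" where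
  "star_perm a \<tau> b = a \<rhd> hat_lcos \<tau> b"

lemma left_mult_Bij: "a \<in> comm \<Longrightarrow> (\<lambda>b\<in>BB. a \<rhd> b) \<in> Bij BB"
  unfolding Bij_def
  by (auto intro!: bij_betwI[where g = "\<lambda>b. psl_inv a \<rhd> b"] simp: lcos_inv BB_carrier)

text \<open>For surjectivity let \<open>g\<close> be in a level of \<open>\<tau>\<close> whose core stabilises \<open>d = a\<^sup>-\<^sup>1 c\<close>. Since the
  core is normal it stabilises \<open>g\<^sup>-\<^sup>1 d\<close> too, so \<open>\<tau>\<close> moves \<open>g\<^sup>-\<^sup>1 d\<close> by \<open>g\<close>, that is, to \<open>d\<close>.\<close>

lemma star_perm_Bij:
  assumes a: "a \<in> comm" and \<tau>: "\<tau> \<in> \<Gamma>hat"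
  shows "(\<lambda>b\<in>BB. star_perm a \<tau> b) \<in> Bij BB"
proof -
  have cl: "star_perm a \<tau> b \<in> BB" if b: "b \<in> BB" for b
  proof -
    obtain m g where "g \<in> \<Gamma>" "hat_lcos \<tau> b = g \<rhd> b" using hat_lcos_finite[OF \<tau>, of "{b}"] b by auto
    then show ?thesis using a b by (simp add: star_perm_def)
  qed
  have "inj_on (star_perm a \<tau>) BB"
  proof (rule inj_onI)
    fix b c assume bc: "b \<in> BB" "c \<in> BB" "star_perm a \<tau> b = star_perm a \<tau> c"
    obtain m g where g: "g \<in> \<Gamma>" "hat_lcos \<tau> b = g \<rhd> b" "hat_lcos \<tau> c = g \<rhd> c"
      using hat_lcos_finite[OF \<tau>, of "{b, c}"] bc by auto
    have ac: "a \<in> carrier PSL2R" "g \<in> carrier PSL2R" using a g by auto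
    have "psl_inv g \<rhd> psl_inv a \<rhd> a \<rhd> g \<rhd> b = psl_inv g \<rhd> psl_inv a \<rhd> a \<rhd> g \<rhd> c"
      using bc(3) unfolding star_perm_def g by simp
    then show "b = c"
      using lcos_inv(1)[OF ac(1) BB_carrier[OF lcos_BB[OF sub_comm[OF g(1)] bc(1)]]]
        lcos_inv(1)[OF ac(1) BB_carrier[OF lcos_BB[OF sub_comm[OF g(1)] bc(2)]]]
        lcos_inv(1)[OF ac(2) BB_carrier[OF bc(1)]] lcos_inv(1)[OF ac(2) BB_carrier[OF bc(2)]] by simp
  qed
  moreover have "star_perm a \<tau> ` BB = BB"
  proof (intro equalityI subsetI)
    fix c assume c: "c \<in> BB"
    define d where "d = psl_inv a \<rhd> c"
    have d: "d \<in> BB" using a c by (simp add: d_def)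
    obtain m where m: "stab m d" using ex_stab[OF d] by blast
    obtain g where g: "g \<in> \<tau> m" using hat_ex[OF \<tau>] by blast
    have g\<Gamma>: "g \<in> \<Gamma>" using hat_mem(1)[OF \<tau> g] .
    define b where "b = psl_inv g \<rhd> d"
    have b: "b \<in> BB" using d g\<Gamma> by (simp add: b_def)
    have dc: "d \<subseteq> carrier PSL2R" by (rule BB_carrier[OF d])
    have "stab m b" unfolding stab_def
    proof
      fix h assume h: "h \<in> core m"
      have k: "g \<cdot> h \<cdot> psl_inv g \<in> core m" by (rule core_conj[OF g\<Gamma> h])
      have "h \<rhd> b = (psl_inv g \<cdot> (g \<cdot> h \<cdot> psl_inv g)) \<rhd> d"
        unfolding b_def using h g\<Gamma> dc by (simp add: lcos_mult PSL.m_assoc PSL.l_inv_cancel)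
      also have "\<dots> = psl_inv g \<rhd> (g \<cdot> h \<cdot> psl_inv g) \<rhd> d"
        by (rule lcos_mult[symmetric]) (use g\<Gamma> h dc in auto)
      also have "\<dots> = b" using m k unfolding stab_def b_def by simp
      finally show "h \<rhd> b = b" .
    qed
    then have "hat_lcos \<tau> b = g \<rhd> b" by (rule hat_lcos_eq[OF \<tau> b _ g])
    also have "\<dots> = d" unfolding b_def by (rule lcos_inv(2)) (use g\<Gamma> dc in auto)
    finally have "star_perm a \<tau> b = c"
      using lcos_inv(2)[OF comm_PSL[OF a] BB_carrier[OF c]] by (simp add: star_perm_def d_def)
    then show "c \<in> star_perm a \<tau> ` BB" using b by blast
  qed (use cl in auto)
  ultimately show ?thesis by (simp add: Bij_def bij_betw_def inj_on_def)
qed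

text \<open>A limit of left multiplications is determined by its values on the cosets \<open>core n\<close>, and
  these record an element of the commensurator together with a coherent sequence in \<open>\<Gamma>\<close>.\<close>

lemma Belyaev_completion_eq:
  "Belyaev_completion \<Gamma> = {\<lambda>b\<in>BB. star_perm a \<tau> b | a \<tau>. a \<in> comm \<and> \<tau> \<in> \<Gamma>hat}"
proof -
  let ?L = "(\<lambda>x. \<lambda>b\<in>BB. x \<rhd> b) ` comm"
  have cl: "f \<in> Belyaev_completion \<Gamma> \<longleftrightarrow>
      f \<in> Bij BB \<and> (\<forall>X. finite X \<and> X \<subseteq> BB \<longrightarrow> (\<exists>g\<in>?L. \<forall>b\<in>X. g b = f b))" for f
    unfolding Belyaev_completion_def Comm_eq
    by (rule in_Symm_closure_iff) (use left_mult_Bij in blast)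
  show ?thesis
  proof (intro equalityI subsetI)
    fix f assume "f \<in> {\<lambda>b\<in>BB. star_perm a \<tau> b | a \<tau>. a \<in> comm \<and> \<tau> \<in> \<Gamma>hat}"
    then obtain a \<tau> where f: "f = (\<lambda>b\<in>BB. star_perm a \<tau> b)" "a \<in> comm" "\<tau> \<in> \<Gamma>hat" by blast
    have "\<exists>g\<in>?L. \<forall>b\<in>X. g b = f b" if X: "finite X" "X \<subseteq> BB" for X
    proof -
      obtain m g where g: "g \<in> \<Gamma>" "\<forall>b\<in>X. hat_lcos \<tau> b = g \<rhd> b" using hat_lcos_finite[OF f(3) X] by blast
      have "(\<lambda>b\<in>BB. (a \<cdot> g) \<rhd> b) b = f b" if "b \<in> X" for b
      proof -
        have b: "b \<in> BB" using that X(2) by blast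
        have "f b = a \<rhd> g \<rhd> b" using b g(2) that by (simp add: f(1) star_perm_def)
        also have "\<dots> = (a \<cdot> g) \<rhd> b" by (rule lcos_mult) (use f(2) g(1) BB_carrier[OF b] in auto)
        finally show ?thesis using b by simp
      qed
      moreover have "a \<cdot> g \<in> comm" using f(2) g(1) by simp
      ultimately show ?thesis by blast
    qed
    then show "f \<in> Belyaev_completion \<Gamma>" unfolding cl using star_perm_Bij[OF f(2,3)] f(1) by blast
  next
    fix f assume f: "f \<in> Belyaev_completion \<Gamma>"
    have appr: "\<exists>c\<in>comm. \<forall>b\<in>X. c \<rhd> b = f b" if X: "finite X" "X \<subseteq> BB" for X
    proof -
      have "\<exists>g\<in>?L. \<forall>b\<in>X. g b = f b" using f X unfolding cl by blast
      then obtain c where c: "c \<in> comm" "\<forall>b\<in>X. (\<lambda>b\<in>BB. c \<rhd> b) b = f b" by blast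
      have "c \<rhd> b = f b" if "b \<in> X" for b
        using bspec[OF c(2) that] that X(2) by (simp add: subset_iff)
      then show ?thesis using c(1) by blast
    qed
    have coset: "psl_inv y \<cdot> x \<in> core n"
      if "x \<in> comm" "y \<in> comm" "x \<rhd> core n = y \<rhd> core n" for x y n
    proof -
      have "x \<cdot> \<one>\<^bsub>PSL2R\<^esub> \<in> x \<rhd> core n" unfolding l_coset_def using core_closed(1)[of n] by blast
      then have "x \<in> y \<rhd> core n" using that by simp
      then obtain h where h: "h \<in> core n" "x = y \<cdot> h" by (auto simp: l_coset_def)
      then show ?thesis using that(2) by (simp add: PSL.l_inv_cancel)
    qed
    have "\<exists>c. c \<in> comm \<and> f (core n) = c \<rhd> core n" for n
      using appr[of "{core n}"] core_BB[of n] by auto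
    then have "\<exists>a. \<forall>n. a n \<in> comm \<and> f (core n) = a n \<rhd> core n" by (intro choice allI)
    then obtain a where a: "\<And>n. a n \<in> comm" "\<And>n. f (core n) = a n \<rhd> core n" by blast
    \<comment> \<open>A left multiplication that agrees with \<open>f\<close> on two of the cosets at once compares \<open>a m\<close> with
      \<open>a n\<close>.\<close>
    have down: "psl_inv (a m) \<cdot> a n \<in> core m" if mn: "m \<le> n" for m n
    proof -
      obtain c where c: "c \<in> comm" "c \<rhd> core m = f (core m)" "c \<rhd> core n = f (core n)"
        using appr[of "{core m, core n}"] core_BB by auto
      have 1: "psl_inv (a m) \<cdot> c \<in> core m" using coset[OF c(1) a(1)] c(2) a(2) by simp
      have "psl_inv c \<cdot> a n \<in> core n" using coset[OF a(1) c(1)] c(3) a(2) by simp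
      then have 2: "psl_inv c \<cdot> a n \<in> core m" using core_antimono[OF mn] by blast
      have "psl_inv (a m) \<cdot> a n = (psl_inv (a m) \<cdot> c) \<cdot> (psl_inv c \<cdot> a n)"
        using a(1) c(1) by (simp add: PSL.m_assoc PSL.r_inv_cancel)
      then show ?thesis using core_closed(3)[OF 1 2] by simp
    qed
    \<comment> \<open>All \<open>a n\<close> agree modulo \<open>core 0 = \<Gamma>\<close>, so \<open>t n\<close> is in \<open>\<Gamma>\<close>.\<close>
    define t where "t n = psl_inv (a 0) \<cdot> a n" for n
    have t: "t n \<in> \<Gamma>" for n using down[of 0 n] by (simp add: t_def)
    define \<tau> where "\<tau> = (\<lambda>n. core n #>\<^bsub>PSL2R\<^esub> t n)"
    have \<tau>: "\<tau> \<in> \<Gamma>hat"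
      unfolding \<tau>_def
    proof (rule hat_of_seq[OF t])
      fix m n :: nat assume mn: "m \<le> n"
      have "psl_inv (t m) \<cdot> t n = psl_inv (a m) \<cdot> a n"
        using a(1) by (simp add: t_def PSL.inv_mult_group PSL.m_assoc PSL.r_inv_cancel)
      then have "psl_inv (t m) \<cdot> t n \<in> core m" using down[OF mn] by simp
      from core_conj[OF t[of m] this] show "t n \<cdot> psl_inv (t m) \<in> core m"
        using t by (simp add: PSL.m_assoc PSL.r_inv_cancel)
    qed
    have "f b = star_perm (a 0) \<tau> b" if b: "b \<in> BB" for b
    proof -
      obtain m where m: "stab m b" using ex_stab[OF b] by blast
      obtain c where c: "c \<in> comm" "c \<rhd> core m = f (core m)" "c \<rhd> b = f b"
        using appr[of "{core m, b}"] core_BB b by auto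
      define h where "h = psl_inv (a m) \<cdot> c"
      have h: "h \<in> core m" using coset[OF c(1) a(1)] c(2) a(2) by (simp add: h_def)
      have "c = a m \<cdot> h" using c(1) a(1) by (simp add: h_def PSL.r_inv_cancel)
      then have "f b = a m \<rhd> h \<rhd> b"
        unfolding c(3)[symmetric] using a(1)[of m] h BB_carrier[OF b] by (simp add: lcos_mult)
      also have "h \<rhd> b = b" using m h unfolding stab_def by simp
      also have "a m = a 0 \<cdot> t m" using a(1) by (simp add: t_def PSL.r_inv_cancel)
      also have "(a 0 \<cdot> t m) \<rhd> b = a 0 \<rhd> t m \<rhd> b"
        by (rule lcos_mult[symmetric]) (use a(1) t BB_carrier[OF b] in auto)
      also have "t m \<rhd> b = hat_lcos \<tau> b"
        by (rule hat_lcos_eq[OF \<tau> b m, symmetric]) (use t in \<open>simp add: \<tau>_def\<close>)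
      finally show ?thesis by (simp add: star_perm_def)
    qed
    moreover have "f \<in> extensional BB" using f unfolding cl Bij_def by blast
    ultimately have "f = (\<lambda>b\<in>BB. star_perm (a 0) \<tau> b)" by (intro extensionalityI[of f BB]) auto
    then show "f \<in> {\<lambda>b\<in>BB. star_perm a \<tau> b | a \<tau>. a \<in> comm \<and> \<tau> \<in> \<Gamma>hat}" using a(1) \<tau> by blast
  qed
qed

lemma completion_on_star_eq:
  "completion_on_star \<Gamma> = {\<lambda>b\<in>BS. star_perm a \<tau> b | a \<tau>. a \<in> comm \<and> \<tau> \<in> \<Gamma>hat}"
proof -
  have res: "restrict (\<lambda>b\<in>BB. star_perm a \<tau> b) BS = (\<lambda>b\<in>BS. star_perm a \<tau> b)" for a \<tau>
  proof
    fix b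
    show "restrict (\<lambda>b\<in>BB. star_perm a \<tau> b) BS b = (\<lambda>b\<in>BS. star_perm a \<tau> b) b"
      using BS_BB by (cases "b \<in> BS") auto
  qed
  show ?thesis
    unfolding completion_on_star_def Belyaev_completion_eq
  proof (intro equalityI subsetI)
    fix f assume "f \<in> (\<lambda>f. restrict f BS) ` {\<lambda>b\<in>BB. star_perm a \<tau> b | a \<tau>. a \<in> comm \<and> \<tau> \<in> \<Gamma>hat}"
    then obtain a \<tau> where "f = restrict (\<lambda>b\<in>BB. star_perm a \<tau> b) BS" "a \<in> comm" "\<tau> \<in> \<Gamma>hat" by blast
    then show "f \<in> {\<lambda>b\<in>BS. star_perm a \<tau> b | a \<tau>. a \<in> comm \<and> \<tau> \<in> \<Gamma>hat}" unfolding res by blast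
  next
    fix f assume "f \<in> {\<lambda>b\<in>BS. star_perm a \<tau> b | a \<tau>. a \<in> comm \<and> \<tau> \<in> \<Gamma>hat}"
    then obtain a \<tau> where f: "f = (\<lambda>b\<in>BS. star_perm a \<tau> b)" "a \<in> comm" "\<tau> \<in> \<Gamma>hat" by blast
    have "f = restrict (\<lambda>b\<in>BB. star_perm a \<tau> b) BS" unfolding res by (rule f(1))
    then show "f \<in> (\<lambda>f. restrict f BS) ` {\<lambda>b\<in>BB. star_perm a \<tau> b | a \<tau>. a \<in> comm \<and> \<tau> \<in> \<Gamma>hat}"
      by (rule image_eqI[where f = "\<lambda>f. restrict f BS"]) (use f(2,3) in blast)
  qed
qed

subsection \<open>The permutation representation of the automorphism group\<close>

definition aut_coset :: "(real^2^2) set \<Rightarrow> nat \<Rightarrow> (solenoid_point \<Rightarrow> solenoid_point) set" where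
  "aut_coset x n = sol_aut x ` hat \<Gamma> (core n)"

lemma hat_core: "\<tau> \<in> hat \<Gamma> (core n) \<longleftrightarrow> \<tau> \<in> \<Gamma>hat \<and> \<tau> n = core n"
  by (simp add: closure_core)

lemma Bij_sol_aut: "a \<in> comm \<Longrightarrow> \<tau> \<in> \<Gamma>hat \<Longrightarrow> sol_aut a \<tau> \<in> Bij sol"
  using sol_aut_in_Aut by (simp add: Aut_solenoid_def)

lemma Comm_act_eq_sol_aut: "a \<in> comm \<Longrightarrow> Comm_act \<Gamma> a = sol_aut a ee"
proof
  fix p assume "a \<in> comm"
  then show "Comm_act \<Gamma> a p = sol_aut a ee p"
    by (cases "p \<in> sol") (simp add: sol_aut_def hat_act_one, simp add: sol_aut_def Comm_act_def)
qed

lemma hat_act_eq_sol_aut: "\<tau> \<in> \<Gamma>hat \<Longrightarrow> hat_act \<Gamma> \<tau> = sol_aut \<one>\<^bsub>PSL2R\<^esub> \<tau>"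
proof
  fix p assume "\<tau> \<in> \<Gamma>hat"
  then show "hat_act \<Gamma> \<tau> p = sol_aut \<one>\<^bsub>PSL2R\<^esub> \<tau> p"
    by (cases "p \<in> sol") (simp add: sol_aut_def Comm_act_one, simp add: sol_aut_def hat_act_def)
qed

lemma Aut_mult:
  assumes "F \<in> Bij sol" "G \<in> Bij sol"
  shows "F \<otimes>\<^bsub>Aut_solenoid \<Gamma>\<^esub> G = (\<lambda>p\<in>sol. F (G p))"
  using assms by (simp add: Aut_solenoid_def BijGroup_def compose_def)

lemma aut_coset_eq:
  assumes x: "x \<in> comm"
  shows "Comm_act \<Gamma> x <#\<^bsub>Aut_solenoid \<Gamma>\<^esub> (hat_act \<Gamma> ` hat \<Gamma> (core n)) = aut_coset x n"
proof -
  have "Comm_act \<Gamma> x \<otimes>\<^bsub>Aut_solenoid \<Gamma>\<^esub> hat_act \<Gamma> \<tau> = sol_aut x \<tau>" if "\<tau> \<in> hat \<Gamma> (core n)" for \<tau>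
  proof -
    have \<tau>: "\<tau> \<in> \<Gamma>hat" using that hat_core by blast
    have "Comm_act \<Gamma> x \<in> Bij sol" "hat_act \<Gamma> \<tau> \<in> Bij sol"
      using Bij_sol_aut[OF x ee_hat] Bij_sol_aut[OF sub_comm[OF sub_closed(1)] \<tau>]
        Comm_act_eq_sol_aut[OF x] hat_act_eq_sol_aut[OF \<tau>] by simp_all
    then show ?thesis by (simp add: Aut_mult sol_aut_def)
  qed
  then show ?thesis unfolding aut_coset_def l_coset_def by auto
qed

text \<open>If \<open>u\<close> acts as \<open>x\<close> times an element \<open>\<tau>\<close> of the completion, then \<open>x\<^sup>-\<^sup>1 u\<close> acts on the base
  leaf through elements of \<open>\<Gamma>\<close>, hence by \<open>deck_constant\<close> through a single one. That element is
  \<open>x\<^sup>-\<^sup>1 u\<close> by faithfulness, and its image in the completion is \<open>\<tau>\<close>.\<close>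

lemma sol_aut_in_coset_iff:
  assumes u: "u \<in> comm" and x: "x \<in> comm"
  shows "sol_aut u ee \<in> aut_coset x n \<longleftrightarrow> u \<in> x \<rhd> core n"
proof
  assume "sol_aut u ee \<in> aut_coset x n"
  then obtain \<tau> where \<tau>: "\<tau> \<in> \<Gamma>hat" "\<tau> n = core n" "sol_aut u ee = sol_aut x \<tau>"
    unfolding aut_coset_def hat_core[abs_def] by (auto simp: hat_core)
  define v where "v = psl_inv x \<cdot> u"
  have v: "v \<in> comm" using u x by (simp add: v_def)
  have vz: "sp (act v z) ee = sp z \<tau>" if z: "z \<in> HH" for z
  proof -
    have "Comm_act \<Gamma> u (sp z ee) = Comm_act \<Gamma> x (hat_act \<Gamma> \<tau> (sp z ee))"
      using fun_cong[OF \<tau>(3), of "sp z ee"] z by (simp add: sol_aut_def hat_act_one)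
    also have "hat_act \<Gamma> \<tau> (sp z ee) = sp z \<tau>" using hat_act_sp[OF \<tau>(1) z ee_hat] \<tau>(1) by (simp add: one_pmult)
    finally have "Comm_act \<Gamma> (psl_inv x) (Comm_act \<Gamma> u (sp z ee)) = sp z \<tau>" using x z \<tau>(1) by simp
    then have "Comm_act \<Gamma> v (sp z ee) = sp z \<tau>" using u x z by (simp add: v_def Comm_act_mult)
    then show ?thesis using Comm_act_base[OF v z] by simp
  qed
  have "\<exists>\<gamma>\<in>\<Gamma>. act v z = act \<gamma> z" if z: "z \<in> HH" for z
    using sp_eqD[OF z _ \<tau>(1) ee_hat vz[OF z, symmetric]] v z by auto
  moreover have "continuous_on HH (act v)" using continuous_on_act v by simp
  ultimately obtain g where g: "g \<in> \<Gamma>" "\<forall>z\<in>HH. act v z = act g z"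
    using deck_constant[of "act v"] by blast
  have vg: "v = g" by (rule act_faithful) (use v g in auto)
  have "sp \<i> \<tau> = sp \<i> (emb g)" using vz[OF ii_HH] vg sp_emb[OF ii_HH g(1)] by simp
  then have "\<tau> = emb g" using sp_inj[OF ii_HH \<tau>(1)] g(1) by simp
  then have "g \<in> core n" using emb_mem[OF g(1), of n] \<tau>(2) by simp
  moreover have "u = x \<cdot> g" using u x by (simp add: vg[symmetric] v_def PSL.r_inv_cancel)
  ultimately show "u \<in> x \<rhd> core n" by (auto simp: l_coset_def)
next
  assume "u \<in> x \<rhd> core n"
  then obtain h where h: "h \<in> core n" "u = x \<cdot> h" by (auto simp: l_coset_def)
  have h\<Gamma>: "h \<in> \<Gamma>" using h(1) by simp
  have "sol_aut u ee p = sol_aut x (emb h) p" for p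
    using x h\<Gamma> by (simp add: sol_aut_def h(2) hat_act_one Comm_act_mult Comm_act_sub)
  then have "sol_aut u ee = sol_aut x (emb h)" by blast
  moreover have "emb h \<in> hat \<Gamma> (core n)"
    using h(1) h\<Gamma> PSL.coset_join2[OF _ core_subgroup h(1)] by (simp add: hat_core emb_level)
  ultimately show "sol_aut u ee \<in> aut_coset x n" by (simp add: aut_coset_def)
qed

lemma lcos_core_comm: "x \<in> comm \<Longrightarrow> x \<rhd> core n \<subseteq> comm"
  by (auto simp: l_coset_def)

lemma aut_coset_inj:
  assumes "x \<in> comm" "y \<in> comm" "aut_coset x n = aut_coset y k"
  shows "x \<rhd> core n = y \<rhd> core k"
  using sol_aut_in_coset_iff[of _ x n] sol_aut_in_coset_iff[of _ y k] lcos_core_comm[of x n] lcos_core_comm[of y k] assms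
  by blast

text \<open>A coset \<open>x \<Gamma>\<^sub>n\<close> can be written with different indices \<open>n\<close> only if the corresponding groups
  coincide as sets, and then their closures coincide as well.\<close>

lemma aut_coset_cong:
  assumes x: "x \<in> comm" and y: "y \<in> comm" and eq: "x \<rhd> core n = y \<rhd> core k"
  shows "aut_coset x n \<subseteq> aut_coset y k"
proof -
  have "x \<cdot> \<one>\<^bsub>PSL2R\<^esub> \<in> x \<rhd> core n" unfolding l_coset_def using core_closed(1)[of n] by blast
  then have "x \<in> y \<rhd> core k" using eq x by simp
  then obtain h where h: "h \<in> core k" "x = y \<cdot> h" by (auto simp: l_coset_def)
  have h\<Gamma>: "h \<in> \<Gamma>" using h(1) by simp
  have "y \<rhd> h \<rhd> core n = y \<rhd> core k" using eq y h\<Gamma> core_carrier by (simp add: h(2) lcos_mult)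
  then have "psl_inv y \<rhd> y \<rhd> h \<rhd> core n = psl_inv y \<rhd> y \<rhd> core k" by simp
  then have "h \<rhd> core n = core k"
    using lcos_inv(1)[OF comm_PSL[OF y] core_carrier[of k]]
      lcos_inv(1)[OF comm_PSL[OF y] BB_carrier[OF lcos_BB[OF sub_comm[OF h\<Gamma>] core_BB[of n]]]] by simp
  then have "core n = psl_inv h \<rhd> core k"
    using lcos_inv(1)[OF sub_carrier[OF h\<Gamma>] core_carrier[of n]] by simp
  also have "\<dots> = core k" by (rule PSL.coset_join3[OF _ core_subgroup]) (use h h\<Gamma> in auto)
  finally have nk: "core n = core k" .
  show ?thesis
  proof
    fix F assume "F \<in> aut_coset x n"
    then obtain \<sigma> where \<sigma>: "\<sigma> \<in> hat \<Gamma> (core k)" "F = sol_aut x \<sigma>" by (auto simp: aut_coset_def nk)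
    have \<sigma>h: "\<sigma> \<in> \<Gamma>hat" "\<sigma> k = core k" using \<sigma>(1) hat_core by auto
    have "sol_aut x \<sigma> p = sol_aut y (emb h \<star> \<sigma>) p" for p
      using y h\<Gamma> \<sigma>h by (simp add: sol_aut_def h(2) hat_act_mult Comm_act_mult Comm_act_sub)
    then have "F = sol_aut y (emb h \<star> \<sigma>)" using \<sigma>(2) by blast
    moreover have "emb h \<star> \<sigma> \<in> hat \<Gamma> (core k)"
    proof -
      have 1: "\<one>\<^bsub>PSL2R\<^esub> \<in> \<sigma> k" using \<sigma>h(2) by simp
      have "(emb h \<star> \<sigma>) k = core k #>\<^bsub>PSL2R\<^esub> (h \<cdot> \<one>\<^bsub>PSL2R\<^esub>)"
        by (rule pmult_level[OF emb_hat[OF h\<Gamma>] \<sigma>h(1) emb_mem[OF h\<Gamma>] 1])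
      then show ?thesis using h\<Gamma> \<sigma>h(1) PSL.coset_join2[OF _ core_subgroup h(1)] by (simp add: hat_core)
    qed
    ultimately show "F \<in> aut_coset y k" by (simp add: aut_coset_def)
  qed
qed

lemma star_coset_map_eq:
  assumes x: "x \<in> comm"
  shows "star_coset_map \<Gamma> (x \<rhd> core n) = aut_coset x n"
  unfolding star_coset_map_def Comm_eq
proof (rule the_equality)
  show "\<exists>y k. y \<in> comm \<and> x \<rhd> core n = y \<rhd> core k \<and>
      aut_coset x n = Comm_act \<Gamma> y <#\<^bsub>Aut_solenoid \<Gamma>\<^esub> (hat_act \<Gamma> ` hat \<Gamma> (core k))"
    using x aut_coset_eq[OF x, of n] by (intro exI[of _ x] exI[of _ n]) simp
  fix c assume "\<exists>y k. y \<in> comm \<and> x \<rhd> core n = y \<rhd> core k \<and>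
      c = Comm_act \<Gamma> y <#\<^bsub>Aut_solenoid \<Gamma>\<^esub> (hat_act \<Gamma> ` hat \<Gamma> (core k))"
  then obtain y k where y: "y \<in> comm" "x \<rhd> core n = y \<rhd> core k"
      "c = Comm_act \<Gamma> y <#\<^bsub>Aut_solenoid \<Gamma>\<^esub> (hat_act \<Gamma> ` hat \<Gamma> (core k))" by blast
  have "c = aut_coset y k" using y(3) aut_coset_eq[OF y(1)] by simp
  then show "c = aut_coset x n"
    using aut_coset_cong[OF x y(1,2)] aut_coset_cong[OF y(1) x y(2)[symmetric]] by simp
qed

lemma inj_star_coset_map: "inj_on (star_coset_map \<Gamma>) BS"
proof (rule inj_onI)
  fix b c assume bc: "b \<in> BS" "c \<in> BS" "star_coset_map \<Gamma> b = star_coset_map \<Gamma> c"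
  obtain x n where b: "x \<in> comm" "b = x \<rhd> core n" using bc(1) BS_iff by blast
  obtain y k where c: "y \<in> comm" "c = y \<rhd> core k" using bc(2) BS_iff by blast
  show "b = c" using aut_coset_inj[OF b(1) c(1)] bc(3) b c by (simp add: star_coset_map_eq)
qed

text \<open>Split \<open>\<tau>\<close> as \<open>g \<rho>\<close> with \<open>\<rho>\<close> so near \<open>1\<close> that it passes across \<open>x\<close> into the closure of
  \<open>core n\<close>, where it is absorbed by the coset.\<close>

lemma sol_aut_mult_coset:
  assumes a: "a \<in> comm" and \<tau>: "\<tau> \<in> \<Gamma>hat" and x: "x \<in> comm"
  shows "\<exists>m. \<forall>k\<ge>m. \<forall>g\<in>\<tau> k. sol_aut a \<tau> <#\<^bsub>Aut_solenoid \<Gamma>\<^esub> aut_coset x n = aut_coset (a \<cdot> g \<cdot> x) n"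
proof -
  obtain m where m: "\<forall>\<tau>\<in>\<Gamma>hat. \<tau> m = core m \<longrightarrow> (\<exists>\<tau>'\<in>\<Gamma>hat. \<tau>' n = core n \<and>
    (\<forall>p\<in>sol. hat_act \<Gamma> \<tau> (Comm_act \<Gamma> x p) = Comm_act \<Gamma> x (hat_act \<Gamma> \<tau>' p)))"
    using hat_act_Comm_act[OF x, of n] by blast
  have "sol_aut a \<tau> <#\<^bsub>Aut_solenoid \<Gamma>\<^esub> aut_coset x n = aut_coset (a \<cdot> g \<cdot> x) n"
    if k: "m \<le> k" and g: "g \<in> \<tau> k" for k g
  proof -
    have g\<Gamma>: "g \<in> \<Gamma>" using hat_mem(1)[OF \<tau> g] .
    define \<rho> where "\<rho> = emb (psl_inv g) \<star> \<tau>"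
    have \<rho>: "\<rho> \<in> \<Gamma>hat" using \<tau> g\<Gamma> by (simp add: \<rho>_def)
    have "psl_inv g \<cdot> g \<in> \<rho> k"
      unfolding \<rho>_def by (rule pmult_mem[OF _ \<tau> emb_mem g]) (use g\<Gamma> in auto)
    then have "\<one>\<^bsub>PSL2R\<^esub> \<in> \<rho> m" using hat_nested[OF \<rho> k] g\<Gamma> by simp
    then have "\<rho> m = core m" using hat_mem(2)[OF \<rho>] by (metis core_coset_one)
    then obtain \<rho>' where \<rho>': "\<rho>' \<in> \<Gamma>hat" "\<rho>' n = core n"
        "\<forall>p\<in>sol. hat_act \<Gamma> \<rho> (Comm_act \<Gamma> x p) = Comm_act \<Gamma> x (hat_act \<Gamma> \<rho>' p)"
      using m \<rho> by blast
    have \<tau>eq: "\<tau> = emb g \<star> \<rho>"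
      using \<tau> g\<Gamma> by (simp add: \<rho>_def pmult_assoc[symmetric] emb_mult[symmetric] one_pmult)
    have agx: "a \<cdot> g \<cdot> x \<in> comm" using a g\<Gamma> x by simp
    have comp: "sol_aut a \<tau> \<otimes>\<^bsub>Aut_solenoid \<Gamma>\<^esub> sol_aut x \<sigma> = sol_aut (a \<cdot> g \<cdot> x) (\<rho>' \<star> \<sigma>)"
      if \<sigma>: "\<sigma> \<in> \<Gamma>hat" for \<sigma>
    proof -
      have "Comm_act \<Gamma> a (hat_act \<Gamma> \<tau> (Comm_act \<Gamma> x (hat_act \<Gamma> \<sigma> p))) =
          Comm_act \<Gamma> (a \<cdot> g \<cdot> x) (hat_act \<Gamma> (\<rho>' \<star> \<sigma>) p)" if p: "p \<in> sol" for p
        using a g\<Gamma> x \<rho> \<rho>' \<sigma> p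
        by (simp add: \<tau>eq hat_act_mult Comm_act_mult Comm_act_sub)
      then show ?thesis
        unfolding Aut_mult[OF Bij_sol_aut[OF a \<tau>] Bij_sol_aut[OF x \<sigma>]]
        using x \<sigma> by (auto simp: sol_aut_def restrict_def)
    qed
    have prod: "\<rho>1 \<star> \<sigma> \<in> hat \<Gamma> (core n)" if "\<rho>1 \<in> hat \<Gamma> (core n)" "\<sigma> \<in> hat \<Gamma> (core n)" for \<rho>1 \<sigma>
    proof -
      have h: "\<rho>1 \<in> \<Gamma>hat" "\<sigma> \<in> \<Gamma>hat" "\<one>\<^bsub>PSL2R\<^esub> \<in> \<rho>1 n" "\<one>\<^bsub>PSL2R\<^esub> \<in> \<sigma> n" using that hat_core by auto
      have "(\<rho>1 \<star> \<sigma>) n = core n #>\<^bsub>PSL2R\<^esub> (\<one>\<^bsub>PSL2R\<^esub> \<cdot> \<one>\<^bsub>PSL2R\<^esub>)" by (rule pmult_level[OF h])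
      then show ?thesis using h(1,2) by (simp add: hat_core)
    qed
    have \<rho>'c: "\<rho>' \<in> hat \<Gamma> (core n)" using \<rho>' hat_core by blast
    have "hinv \<rho>' \<in> hat \<Gamma> (core n)"
    proof -
      have "psl_inv \<one>\<^bsub>PSL2R\<^esub> \<in> hinv \<rho>' n" by (rule hinv_mem[OF \<rho>'(1)]) (simp add: \<rho>'(2))
      then show ?thesis using hat_mem(2)[OF hinv_hat[OF \<rho>'(1)], of "\<one>\<^bsub>PSL2R\<^esub>" n] \<rho>'(1) by (simp add: hat_core)
    qed
    note \<rho>'i = this
    show ?thesis
    proof (intro equalityI subsetI)
      fix F assume "F \<in> sol_aut a \<tau> <#\<^bsub>Aut_solenoid \<Gamma>\<^esub> aut_coset x n"
      then obtain \<sigma> where \<sigma>: "\<sigma> \<in> hat \<Gamma> (core n)" "F = sol_aut a \<tau> \<otimes>\<^bsub>Aut_solenoid \<Gamma>\<^esub> sol_aut x \<sigma>"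
        by (auto simp: l_coset_def aut_coset_def)
      have "F = sol_aut (a \<cdot> g \<cdot> x) (\<rho>' \<star> \<sigma>)" using \<sigma> comp hat_core by blast
      then show "F \<in> aut_coset (a \<cdot> g \<cdot> x) n"
        unfolding aut_coset_def using prod[OF \<rho>'c \<sigma>(1)] by blast
    next
      fix F assume "F \<in> aut_coset (a \<cdot> g \<cdot> x) n"
      then obtain \<sigma> where \<sigma>: "\<sigma> \<in> hat \<Gamma> (core n)" "F = sol_aut (a \<cdot> g \<cdot> x) \<sigma>"
        by (auto simp: aut_coset_def)
      have \<sigma>h: "\<sigma> \<in> \<Gamma>hat" using \<sigma>(1) hat_core by blast
      define \<sigma>' where "\<sigma>' = hinv \<rho>' \<star> \<sigma>"
      have \<sigma>': "\<sigma>' \<in> hat \<Gamma> (core n)" unfolding \<sigma>'_def by (rule prod[OF \<rho>'i \<sigma>(1)])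
      have \<sigma>'h: "\<sigma>' \<in> \<Gamma>hat" using \<sigma>' hat_core by blast
      have "\<rho>' \<star> \<sigma>' = \<sigma>"
        using \<rho>'(1) \<sigma>h by (simp add: \<sigma>'_def pmult_assoc[symmetric] hinv_pmult one_pmult)
      then have "F = sol_aut a \<tau> \<otimes>\<^bsub>Aut_solenoid \<Gamma>\<^esub> sol_aut x \<sigma>'" using comp[OF \<sigma>'h] \<sigma>(2) by simp
      then show "F \<in> sol_aut a \<tau> <#\<^bsub>Aut_solenoid \<Gamma>\<^esub> aut_coset x n"
        using \<sigma>' by (auto simp: l_coset_def aut_coset_def)
    qed
  qed
  then show ?thesis by blast
qed

lemma j_rep_sol_aut:
  assumes a: "a \<in> comm" and \<tau>: "\<tau> \<in> \<Gamma>hat"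
  shows "j_rep \<Gamma> (sol_aut a \<tau>) = (\<lambda>b\<in>BS. star_perm a \<tau> b)"
  unfolding j_rep_def
proof (rule restrict_ext)
  fix b assume b: "b \<in> BS"
  then obtain x n where x: "x \<in> comm" "b = x \<rhd> core n" unfolding BS_iff by blast
  have bB: "b \<in> BB" using b BS_BB by blast
  obtain m1 where m1: "\<forall>k\<ge>m1. \<forall>g\<in>\<tau> k. sol_aut a \<tau> <#\<^bsub>Aut_solenoid \<Gamma>\<^esub> aut_coset x n = aut_coset (a \<cdot> g \<cdot> x) n"
    using sol_aut_mult_coset[OF a \<tau> x(1)] by blast
  obtain m2 where m2: "stab m2 b" using ex_stab[OF bB] by blast
  obtain g where g: "g \<in> \<tau> (max m1 m2)" using hat_ex[OF \<tau>] by blast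
  have g\<Gamma>: "g \<in> \<Gamma>" using hat_mem(1)[OF \<tau> g] .
  have agx: "a \<cdot> g \<cdot> x \<in> comm" using a g\<Gamma> x by simp
  have "sol_aut a \<tau> <#\<^bsub>Aut_solenoid \<Gamma>\<^esub> star_coset_map \<Gamma> b = star_coset_map \<Gamma> ((a \<cdot> g \<cdot> x) \<rhd> core n)"
    unfolding x(2) star_coset_map_eq[OF x(1)] star_coset_map_eq[OF agx]
    by (rule m1[rule_format, OF _ g]) simp
  moreover have "(a \<cdot> g \<cdot> x) \<rhd> core n \<in> BS" unfolding BS_iff using agx by blast
  ultimately have "inv_into BS (star_coset_map \<Gamma>) (sol_aut a \<tau> <#\<^bsub>Aut_solenoid \<Gamma>\<^esub> star_coset_map \<Gamma> b) =
      (a \<cdot> g \<cdot> x) \<rhd> core n"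
    using inv_into_f_f[OF inj_star_coset_map] by simp
  also have "\<dots> = a \<rhd> g \<rhd> b"
    unfolding x(2) using a g\<Gamma> x(1) core_carrier by (simp add: lcos_mult PSL.m_assoc)
  also have "g \<rhd> b = hat_lcos \<tau> b"
    by (rule hat_lcos_eq[OF \<tau> bB stab_mono[OF m2] g, symmetric]) simp
  finally show "inv_into BS (star_coset_map \<Gamma>) (sol_aut a \<tau> <#\<^bsub>Aut_solenoid \<Gamma>\<^esub> star_coset_map \<Gamma> b) = star_perm a \<tau> b"
    by (simp add: star_perm_def)
qed

theorem completion_eq_Aut: "completion_on_star \<Gamma> = j_rep \<Gamma> ` carrier (Aut_solenoid \<Gamma>)"
  unfolding completion_on_star_eq
proof (intro equalityI subsetI)
  fix f assume "f \<in> {\<lambda>b\<in>BS. star_perm a \<tau> b | a \<tau>. a \<in> comm \<and> \<tau> \<in> \<Gamma>hat}"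
  then obtain a \<tau> where f: "f = (\<lambda>b\<in>BS. star_perm a \<tau> b)" "a \<in> comm" "\<tau> \<in> \<Gamma>hat" by blast
  then have "f = j_rep \<Gamma> (sol_aut a \<tau>)" using j_rep_sol_aut[OF f(2,3)] by simp
  then show "f \<in> j_rep \<Gamma> ` carrier (Aut_solenoid \<Gamma>)" using sol_aut_in_Aut[OF f(2,3)] by (rule image_eqI)
next
  fix f assume "f \<in> j_rep \<Gamma> ` carrier (Aut_solenoid \<Gamma>)"
  then obtain F where F: "f = j_rep \<Gamma> F" "F \<in> carrier (Aut_solenoid \<Gamma>)" by blast
  then obtain a \<tau> where "F = sol_aut a \<tau>" and a: "a \<in> comm" "\<tau> \<in> \<Gamma>hat" unfolding Aut_solenoid_eq by blast
  then have "f = (\<lambda>b\<in>BS. star_perm a \<tau> b)" using j_rep_sol_aut[OF a] F(1) by simp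
  then show "f \<in> {\<lambda>b\<in>BS. star_perm a \<tau> b | a \<tau>. a \<in> comm \<and> \<tau> \<in> \<Gamma>hat}" using a by blast
qed

end

theorem theorem7:
  fixes C :: "'c topology" and A :: "'c atlas" and g :: nat
    and \<Gamma> :: "(real^2^2) set set"
  assumes "riemann_surface C A" and "compact_space C"
    and "has_genus C g" and "2 \<le> g"
    and "fuchsian_surface_group \<Gamma>"
    and "uniformises \<Gamma> C A"
  shows "completion_on_star \<Gamma> = j_rep \<Gamma> ` carrier (Aut_solenoid \<Gamma>)"
proof -
  interpret fuchsian \<Gamma> by unfold_locales fact
  show ?thesis by (rule completion_eq_Aut)
qed

end
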